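(* Let $k$ be a commutative unital ring, $\mathcal{H}$ a Hopf algebra over $k$ with bijective antipode $S$, and $C$ a left $\mathcal{H}$-comodule coalgebra. Let $\mathsf{C}^{\bullet}(C>\!\blacktriangleleft\mathcal{H})$ be the cocyclic module of the crossed coproduct coalgebra $C>\!\blacktriangleleft\mathcal{H}$ and $\Delta(C\natural\mathcal{H})$ the diagonal cocyclic module of $C\natural\mathcal{H}$. Then there is an isomorphism of cocyclic modules $$\Delta(C\natural\mathcal{H})\cong\mathsf{C}^{\bullet}(C>\!\blacktriangleleft\mathcal{H}).$$
   Context: All tensor products are over $k$. Sweedler notation (summation understood): $\Delta(h)=h^{(0)}\otimes h^{(1)}$ for coproducts, with counit $\epsilon$; a left $\mathcal{H}$-coaction $\rho:M\to\mathcal{H}\otimes M$ is written $\rho(m)=m^{(\bar 1)}\otimes m^{(\bar 0)}$. Put $h\cdot(g_0,\dots,g_p)=(h^{(0)}g_0,\dots,h^{(p)}g_p)$. A coalgebra $C$ is a left $\mathcal{H}$-comodule coalgebra if it is a left $\mathcal{H}$-comodule and, for all $a\in C$, $a^{(0)(\bar 1)}a^{(1)(\bar 1)}\otimes a^{(0)(\bar 0)}\otimes a^{(1)(\bar 0)}=a^{(\bar 1)}\otimes a^{(\bar 0)(0)}\otimes a^{(\bar 0)(1)}$ and $a^{(\bar 1)}\epsilon(a^{(\bar 0)})=\epsilon(a)1_{\mathcal{H}}$. The crossed coproduct coalgebra $C>\!\blacktriangleleft\mathcal{H}$ is $C\otimes\mathcal{H}$ with $\Delta(a\otimes g)=(a^{(0)}\otimes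 a^{(1)(\bar 1)}g^{(0)})\otimes(a^{(1)(\bar 0)}\otimes g^{(1)})$ and $\epsilon(a\otimes g)=\epsilon(a)\epsilon(g)$. The cocyclic module $\mathsf{C}^\bullet(D)$ of a coalgebra $D$ is $\mathsf{C}^n(D)=D^{\otimes(n+1)}$ with $\partial^i(x_0,\dots,x_n)=(x_0,\dots,x_i^{(0)},x_i^{(1)},\dots,x_n)$ ($0\le i\le n$), $\partial^{n+1}(x_0,\dots,x_n)=(x_0^{(1)},x_1,\dots,x_n,x_0^{(0)})$, $\sigma^i(x_0,\dots,x_n)=\epsilon(x_{i+1})(x_0,\dots,x_i,x_{i+2},\dots,x_n)$ ($0\le i\le n-1$), $\tau(x_0,\dots,x_n)=(x_1,\dots,x_n,x_0)$. $C\natural\mathcal{H}$ is given by $(C\natural\mathcal{H})_{p,q}=\mathcal{H}^{\otimes(p+1)}\otimes C^{\otimes(q+1)}$ with the following operators on $(g_0,\dots,g_p\mid a_0,\dots,a_q)$: $\tau=(S^{-1}(a_0^{(\bar 1)})\cdot(g_0,\dots,g_p)\mid a_1,\dots,a_q,a_0^{(\bar 0)})$; $\sigma^i=\epsilon(a_{i+1})(g_0,\dots,g_p\mid a_0,\dots,a_i,a_{i+2},\dots,a_q)$, $0\le i<q$; $\partial^i=(g_0,\dots,g_p\mid a_0,\dots,a_i^{(0)},a_i^{(1)},\dots,a_q)$, $0\le i\le q$; $\partial^{q+1}=(S^{-1}(a_0^{(0)(\bar 1)})\cdot(g_0,\dots,g_p)\mid a_0^{(1)},a_1,\dots,a_q,a_0^{(0)(\bar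 0)})$; $\bar\tau=(g_1,\dots,g_p,(a_0^{(\bar 1)}\cdots a_q^{(\bar 1)})g_0\mid a_0^{(\bar 0)},\dots,a_q^{(\bar 0)})$; $\bar\sigma^i=\epsilon(g_{i+1})(g_0,\dots,g_i,g_{i+2},\dots,g_p\mid a_0,\dots,a_q)$, $0\le i<p$; $\bar\partial^i=(g_0,\dots,g_i^{(0)},g_i^{(1)},\dots,g_p\mid a_0,\dots,a_q)$, $0\le i\le p$; $\bar\partial^{p+1}=(g_0^{(1)},g_1,\dots,g_p,(a_0^{(\bar 1)}\cdots a_q^{(\bar 1)})g_0^{(0)}\mid a_0^{(\bar 0)},\dots,a_q^{(\bar 0)})$. Its diagonal is $\Delta(C\natural\mathcal{H})_n=\mathcal{H}^{\otimes(n+1)}\otimes C^{\otimes(n+1)}$ with operators $\bar\partial^i\partial^i$, $\bar\sigma^i\sigma^i$, $\bar\tau\tau$; this is a cocyclic module. An isomorphism of cocyclic modules is a degreewise $k$-linear isomorphism commuting with all coface, codegeneracy and cyclic operators. *)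

theory Defs
  imports "HOL-Algebra.Module" "HOL-Algebra.AbelCoset"
begin

section \<open>Modules given by generators and relations\<close>

definition linear_maps ::
    "('k, 'r) ring_scheme \<Rightarrow> ('k, 'a, 'm) module_scheme \<Rightarrow> ('k, 'b, 'n) module_scheme \<Rightarrow> ('a \<Rightarrow> 'b) set"
  where "linear_maps R M N =
    {f \<in> carrier M \<rightarrow> carrier N.
      (\<forall>x\<in>carrier M. \<forall>y\<in>carrier M. f (x \<oplus>\<^bsub>M\<^esub> y) = f x \<oplus>\<^bsub>N\<^esub> f y) \<and>
      (\<forall>r\<in>carrier R. \<forall>x\<in>carrier M. f (r \<odot>\<^bsub>M\<^esub> x) = r \<odot>\<^bsub>N\<^esub> f x)}"

definition scalar_module :: "('k, 'r) ring_scheme \<Rightarrow> ('k, 'k) module"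
  where "scalar_module R =
    \<lparr>carrier = carrier R, mult = mult R, one = \<one>\<^bsub>R\<^esub>, zero = \<zero>\<^bsub>R\<^esub>, add = add R, smult = mult R\<rparr>"

text \<open>The record type of modules extends that of rings; the fields \<open>mult\<close> and \<open>one\<close> play no role
  in a module and are left unspecified in the constructions below.\<close>

definition free_module :: "('k, 'r) ring_scheme \<Rightarrow> 'b set \<Rightarrow> ('k, 'b \<Rightarrow> 'k) module"
  where "free_module R B =
    \<lparr>carrier = {F. (\<forall>b. F b \<in> carrier R) \<and> finite {b. F b \<noteq> \<zero>\<^bsub>R\<^esub>} \<and> {b. F b \<noteq> \<zero>\<^bsub>R\<^esub>} \<subseteq> B},
     mult = undefined, one = undefined,
     zero = (\<lambda>_. \<zero>\<^bsub>R\<^esub>),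
     add = (\<lambda>F G b. F b \<oplus>\<^bsub>R\<^esub> G b),
     smult = (\<lambda>r F b. r \<otimes>\<^bsub>R\<^esub> F b)\<rparr>"

definition basis_vec :: "('k, 'r) ring_scheme \<Rightarrow> 'b \<Rightarrow> 'b \<Rightarrow> 'k"
  where "basis_vec R b = (\<lambda>b'. if b' = b then \<one>\<^bsub>R\<^esub> else \<zero>\<^bsub>R\<^esub>)"

definition submodule_span :: "('k, 'r) ring_scheme \<Rightarrow> ('k, 'a) module \<Rightarrow> 'a set \<Rightarrow> 'a set"
  where "submodule_span R M Q = \<Inter>{K. submodule K R M \<and> Q \<subseteq> K}"

definition quotient_module :: "('k, 'a) module \<Rightarrow> 'a set \<Rightarrow> ('k, 'a set) module"
  where "quotient_module M K =
    \<lparr>carrier = a_rcosets\<^bsub>M\<^esub> K,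
     mult = undefined, one = undefined,
     zero = K,
     add = set_add M,
     smult = (\<lambda>r X. \<Union>x\<in>X. K +>\<^bsub>M\<^esub> (r \<odot>\<^bsub>M\<^esub> x))\<rparr>"

definition presented_module :: "('k, 'r) ring_scheme \<Rightarrow> 'b set \<Rightarrow> ('b \<Rightarrow> 'k) set \<Rightarrow> ('k, ('b \<Rightarrow> 'k) set) module"
  where "presented_module R B Q =
    quotient_module (free_module R B) (submodule_span R (free_module R B) Q)"

definition generator :: "('k, 'r) ring_scheme \<Rightarrow> 'b set \<Rightarrow> ('b \<Rightarrow> 'k) set \<Rightarrow> 'b \<Rightarrow> ('b \<Rightarrow> 'k) set"
  where "generator R B Q b =
    submodule_span R (free_module R B) Q +>\<^bsub>free_module R B\<^esub> basis_vec R b"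

text \<open>The \<open>R\<close>-linear extension of a map \<open>f\<close> on generators to a map from a presented module to \<open>N\<close>.
  An element of the presented module is a coset of formal combinations of generators; one of them
  is evaluated. If \<open>f\<close> respects the relations, the result does not depend on the representative.
  Sweedler notation is rendered by \<open>lin_ext\<close>: an expression \<open>f(h\<^sup>(\<^sup>0\<^sup>), h\<^sup>(\<^sup>1\<^sup>))\<close>
  (summation understood) with values in \<open>N\<close> is \<open>lin_ext R N (\<lambda>(u, v). f u v) (comult H h)\<close>.\<close>

definition lin_ext ::
    "('k, 'r) ring_scheme \<Rightarrow> ('k, 'n, 'm) module_scheme \<Rightarrow> ('b \<Rightarrow> 'n) \<Rightarrow> ('b \<Rightarrow> 'k) set \<Rightarrow> 'n"
  where "lin_ext R N f X =
    (let F = (SOME F. F \<in> X) in \<Oplus>\<^bsub>N\<^esub>b\<in>{b. F b \<noteq> \<zero>\<^bsub>R\<^esub>}. F b \<odot>\<^bsub>N\<^esub> f b)"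


section \<open>Tensor products\<close>

text \<open>The relations making the generator \<open>s u\<close> linear in \<open>u \<in> M\<close>; here \<open>s\<close> inserts \<open>u\<close> in one
  tensor factor, all others being fixed.\<close>

definition slot_relations ::
    "('k, 'r) ring_scheme \<Rightarrow> 'b set \<Rightarrow> ('k, 'a, 'm) module_scheme \<Rightarrow> ('a \<Rightarrow> 'b) \<Rightarrow> ('b \<Rightarrow> 'k) set"
  where "slot_relations R B M s =
    {basis_vec R (s (u \<oplus>\<^bsub>M\<^esub> v)) \<ominus>\<^bsub>free_module R B\<^esub> (basis_vec R (s u) \<oplus>\<^bsub>free_module R B\<^esub> basis_vec R (s v)) | u v.
       u \<in> carrier M \<and> v \<in> carrier M} \<union>
    {basis_vec R (s (r \<odot>\<^bsub>M\<^esub> u)) \<ominus>\<^bsub>free_module R B\<^esub> (r \<odot>\<^bsub>free_module R B\<^esub> basis_vec R (s u)) | r u.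
       r \<in> carrier R \<and> u \<in> carrier M}"

text \<open>The binary tensor product \<open>M \<otimes> N\<close>.\<close>

definition tensor_relations ::
    "('k, 'r) ring_scheme \<Rightarrow> ('k, 'a, 'm) module_scheme \<Rightarrow> ('k, 'b, 'n) module_scheme \<Rightarrow> ('a \<times> 'b \<Rightarrow> 'k) set"
  where "tensor_relations R M N =
    (\<Union>y\<in>carrier N. slot_relations R (carrier M \<times> carrier N) M (\<lambda>u. (u, y))) \<union>
    (\<Union>x\<in>carrier M. slot_relations R (carrier M \<times> carrier N) N (\<lambda>v. (x, v)))"

definition tensor ::
    "('k, 'r) ring_scheme \<Rightarrow> ('k, 'a, 'm) module_scheme \<Rightarrow> ('k, 'b, 'n) module_scheme \<Rightarrow> ('k, ('a \<times> 'b \<Rightarrow> 'k) set) module"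
  where "tensor R M N = presented_module R (carrier M \<times> carrier N) (tensor_relations R M N)"

definition pure ::
    "('k, 'r) ring_scheme \<Rightarrow> ('k, 'a, 'm) module_scheme \<Rightarrow> ('k, 'b, 'n) module_scheme \<Rightarrow> 'a \<Rightarrow> 'b \<Rightarrow> ('a \<times> 'b \<Rightarrow> 'k) set"
  where "pure R M N x y = generator R (carrier M \<times> carrier N) (tensor_relations R M N) (x, y)"

text \<open>The tensor power \<open>M\<^sup>\<otimes>\<^sup>n\<close>, generated by lists of length \<open>n\<close>.\<close>

definition tuples :: "('k, 'a, 'm) module_scheme \<Rightarrow> nat \<Rightarrow> 'a list set"
  where "tuples M n = {xs. length xs = n \<and> set xs \<subseteq> carrier M}"

definition power_relations ::
    "('k, 'r) ring_scheme \<Rightarrow> ('k, 'a, 'm) module_scheme \<Rightarrow> nat \<Rightarrow> ('a list \<Rightarrow> 'k) set"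
  where "power_relations R M n =
    (\<Union>xs\<in>tuples M n. \<Union>i<n. slot_relations R (tuples M n) M (\<lambda>u. xs[i := u]))"

definition tensor_power ::
    "('k, 'r) ring_scheme \<Rightarrow> ('k, 'a, 'm) module_scheme \<Rightarrow> nat \<Rightarrow> ('k, ('a list \<Rightarrow> 'k) set) module"
  where "tensor_power R M n = presented_module R (tuples M n) (power_relations R M n)"

definition pure_power ::
    "('k, 'r) ring_scheme \<Rightarrow> ('k, 'a, 'm) module_scheme \<Rightarrow> 'a list \<Rightarrow> ('a list \<Rightarrow> 'k) set"
  where "pure_power R M xs =
    generator R (tuples M (length xs)) (power_relations R M (length xs)) xs"

text \<open>The tensor product \<open>M\<^sup>\<otimes>\<^sup>p \<otimes> N\<^sup>\<otimes>\<^sup>q\<close> of \<open>p + q\<close> modules; the generator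
  \<open>(xs, ys)\<close> is written \<open>(x\<^sub>0, \<dots> | y\<^sub>0, \<dots>)\<close> informally.\<close>

definition mixed_relations ::
    "('k, 'r) ring_scheme \<Rightarrow> ('k, 'a, 'm) module_scheme \<Rightarrow> ('k, 'b, 'n) module_scheme \<Rightarrow> nat \<Rightarrow> nat
      \<Rightarrow> ('a list \<times> 'b list \<Rightarrow> 'k) set"
  where "mixed_relations R M N p q =
    (\<Union>xs\<in>tuples M p. \<Union>ys\<in>tuples N q.
      (\<Union>i<p. slot_relations R (tuples M p \<times> tuples N q) M (\<lambda>u. (xs[i := u], ys))) \<union>
      (\<Union>j<q. slot_relations R (tuples M p \<times> tuples N q) N (\<lambda>v. (xs, ys[j := v]))))"

definition mixed_tensor ::
    "('k, 'r) ring_scheme \<Rightarrow> ('k, 'a, 'm) module_scheme \<Rightarrow> ('k, 'b, 'n) module_scheme \<Rightarrow> nat \<Rightarrow> nat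
      \<Rightarrow> ('k, ('a list \<times> 'b list \<Rightarrow> 'k) set) module"
  where "mixed_tensor R M N p q =
    presented_module R (tuples M p \<times> tuples N q) (mixed_relations R M N p q)"

definition pure_mixed ::
    "('k, 'r) ring_scheme \<Rightarrow> ('k, 'a, 'm) module_scheme \<Rightarrow> ('k, 'b, 'n) module_scheme \<Rightarrow> 'a list \<Rightarrow> 'b list
      \<Rightarrow> ('a list \<times> 'b list \<Rightarrow> 'k) set"
  where "pure_mixed R M N xs ys =
    generator R (tuples M (length xs) \<times> tuples N (length ys))
      (mixed_relations R M N (length xs) (length ys)) (xs, ys)"


section \<open>Coalgebras, Hopf algebras and comodule coalgebras\<close>

record ('k, 'a) coalgebra = "('k, 'a) module" +
  comult :: "'a \<Rightarrow> ('a \<times> 'a \<Rightarrow> 'k) set"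
  counit :: "'a \<Rightarrow> 'k"

record ('k, 'a) hopf_algebra = "('k, 'a) coalgebra" +
  antipode :: "'a \<Rightarrow> 'a"

record ('k, 'a, 'h) comodule_coalgebra = "('k, 'a) coalgebra" +
  coact :: "'a \<Rightarrow> ('h \<times> 'a \<Rightarrow> 'k) set"

text \<open>The triple tensor products in the axioms below are taken in unbracketed form.\<close>

locale coalgebra = module R C for R (structure) and C (structure) +
  assumes comult_linear: "comult C \<in> linear_maps R C (tensor R C C)"
    and counit_linear: "counit C \<in> linear_maps R C (scalar_module R)"
    and coassoc: "a \<in> carrier C \<Longrightarrow>
      lin_ext R (tensor_power R C 3)
        (\<lambda>(x, y). lin_ext R (tensor_power R C 3) (\<lambda>(u, v). pure_power R C [u, v, y]) (comult C x)) (comult C a) =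
      lin_ext R (tensor_power R C 3)
        (\<lambda>(x, y). lin_ext R (tensor_power R C 3) (\<lambda>(u, v). pure_power R C [x, u, v]) (comult C y)) (comult C a)"
    and counit_left: "a \<in> carrier C \<Longrightarrow> lin_ext R C (\<lambda>(x, y). counit C x \<odot>\<^bsub>C\<^esub> y) (comult C a) = a"
    and counit_right: "a \<in> carrier C \<Longrightarrow> lin_ext R C (\<lambda>(x, y). counit C y \<odot>\<^bsub>C\<^esub> x) (comult C a) = a"

text \<open>Unital associative algebras; the locale \<^locale>\<open>algebra\<close> would require commutativity.\<close>

locale assoc_algebra = module R A + A?: ring A for R (structure) and A (structure) +
  assumes smult_mult_left: "\<lbrakk>r \<in> carrier R; x \<in> carrier A; y \<in> carrier A\<rbrakk> \<Longrightarrow>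
      (r \<odot>\<^bsub>A\<^esub> x) \<otimes>\<^bsub>A\<^esub> y = r \<odot>\<^bsub>A\<^esub> (x \<otimes>\<^bsub>A\<^esub> y)"
    and smult_mult_right: "\<lbrakk>r \<in> carrier R; x \<in> carrier A; y \<in> carrier A\<rbrakk> \<Longrightarrow>
      x \<otimes>\<^bsub>A\<^esub> (r \<odot>\<^bsub>A\<^esub> y) = r \<odot>\<^bsub>A\<^esub> (x \<otimes>\<^bsub>A\<^esub> y)"

locale hopf_algebra = coalgebra R H + assoc_algebra R H for R (structure) and H (structure) +
  assumes comult_mult: "\<lbrakk>g \<in> carrier H; h \<in> carrier H\<rbrakk> \<Longrightarrow>
      comult H (g \<otimes>\<^bsub>H\<^esub> h) =
      lin_ext R (tensor R H H)
        (\<lambda>(g0, g1). lin_ext R (tensor R H H)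
          (\<lambda>(h0, h1). pure R H H (g0 \<otimes>\<^bsub>H\<^esub> h0) (g1 \<otimes>\<^bsub>H\<^esub> h1)) (comult H h)) (comult H g)"
    and comult_one: "comult H \<one>\<^bsub>H\<^esub> = pure R H H \<one>\<^bsub>H\<^esub> \<one>\<^bsub>H\<^esub>"
    and counit_mult: "\<lbrakk>g \<in> carrier H; h \<in> carrier H\<rbrakk> \<Longrightarrow>
      counit H (g \<otimes>\<^bsub>H\<^esub> h) = counit H g \<otimes>\<^bsub>R\<^esub> counit H h"
    and counit_one: "counit H \<one>\<^bsub>H\<^esub> = \<one>\<^bsub>R\<^esub>"
    and antipode_linear: "antipode H \<in> linear_maps R H H"
    and antipode_left: "h \<in> carrier H \<Longrightarrow>
      lin_ext R H (\<lambda>(h0, h1). antipode H h0 \<otimes>\<^bsub>H\<^esub> h1) (comult H h) = counit H h \<odot>\<^bsub>H\<^esub> \<one>\<^bsub>H\<^esub>"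
    and antipode_right: "h \<in> carrier H \<Longrightarrow>
      lin_ext R H (\<lambda>(h0, h1). h0 \<otimes>\<^bsub>H\<^esub> antipode H h1) (comult H h) = counit H h \<odot>\<^bsub>H\<^esub> \<one>\<^bsub>H\<^esub>"

definition antipode_inv :: "('k, 'h, 'z) hopf_algebra_scheme \<Rightarrow> 'h \<Rightarrow> 'h"
  where "antipode_inv H = inv_into (carrier H) (antipode H)"

locale comodule_coalgebra = H: hopf_algebra R H + coalgebra R C
    for R (structure) and H (structure) and C (structure) +
  assumes coact_linear: "coact C \<in> linear_maps R C (tensor R H C)"
    and coact_coassoc: "a \<in> carrier C \<Longrightarrow>
      lin_ext R (mixed_tensor R H C 2 1)
        (\<lambda>(h, c). lin_ext R (mixed_tensor R H C 2 1)
          (\<lambda>(h0, h1). pure_mixed R H C [h0, h1] [c]) (comult H h)) (coact C a) =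
      lin_ext R (mixed_tensor R H C 2 1)
        (\<lambda>(h, c). lin_ext R (mixed_tensor R H C 2 1)
          (\<lambda>(h', c'). pure_mixed R H C [h, h'] [c']) (coact C c)) (coact C a)"
    and coact_counit: "a \<in> carrier C \<Longrightarrow>
      lin_ext R C (\<lambda>(h, c). counit H h \<odot>\<^bsub>C\<^esub> c) (coact C a) = a"
    and coact_comult: "a \<in> carrier C \<Longrightarrow>
      lin_ext R (mixed_tensor R H C 1 2)
        (\<lambda>(a0, a1). lin_ext R (mixed_tensor R H C 1 2)
          (\<lambda>(h, b). lin_ext R (mixed_tensor R H C 1 2)
            (\<lambda>(h', b'). pure_mixed R H C [h \<otimes>\<^bsub>H\<^esub> h'] [b, b']) (coact C a1)) (coact C a0)) (comult C a) =
      lin_ext R (mixed_tensor R H C 1 2)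
        (\<lambda>(h, c). lin_ext R (mixed_tensor R H C 1 2)
          (\<lambda>(c0, c1). pure_mixed R H C [h] [c0, c1]) (comult C c)) (coact C a)"
    and counit_coact: "a \<in> carrier C \<Longrightarrow>
      lin_ext R H (\<lambda>(h, c). counit C c \<odot>\<^bsub>H\<^esub> h) (coact C a) = counit C a \<odot>\<^bsub>H\<^esub> \<one>\<^bsub>H\<^esub>"

definition crossed_coproduct ::
    "('k, 'r) ring_scheme \<Rightarrow> ('k, 'h, 'z) hopf_algebra_scheme \<Rightarrow> ('k, 'c, 'h, 'y) comodule_coalgebra_scheme
      \<Rightarrow> ('k, ('c \<times> 'h \<Rightarrow> 'k) set) coalgebra"
  where "crossed_coproduct R H C =
    (let D = tensor R C H; DD = tensor R D D in
     \<lparr>carrier = carrier D, mult = mult D, one = one D, zero = zero D, add = add D, smult = smult D,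
      comult = lin_ext R DD
        (\<lambda>(a, g). lin_ext R DD
          (\<lambda>(a0, a1). lin_ext R DD
            (\<lambda>(h, b). lin_ext R DD
              (\<lambda>(g0, g1). pure R D D (pure R C H a0 (h \<otimes>\<^bsub>H\<^esub> g0)) (pure R C H b g1))
              (comult H g))
            (coact C a1))
          (comult C a)),
      counit = lin_ext R (scalar_module R) (\<lambda>(a, g). counit C a \<otimes>\<^bsub>R\<^esub> counit H g)\<rparr>)"


section \<open>Cocyclic modules\<close>

text \<open>\<open>coface X n i : obj X n \<rightarrow> obj X (n + 1)\<close> for \<open>0 \<le> i \<le> n + 1\<close>,
  \<open>codegen X n i : obj X (n + 1) \<rightarrow> obj X n\<close> for \<open>0 \<le> i \<le> n\<close> (so indexed by the degree of
  the target), and \<open>cyc X n : obj X n \<rightarrow> obj X n\<close>. The record only carries the data; the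
  cocyclic identities are not part of it, and isomorphisms do not refer to them.\<close>

record ('k, 'a) cocyclic =
  obj :: "nat \<Rightarrow> ('k, 'a) module"
  coface :: "nat \<Rightarrow> nat \<Rightarrow> 'a \<Rightarrow> 'a"
  codegen :: "nat \<Rightarrow> nat \<Rightarrow> 'a \<Rightarrow> 'a"
  cyc :: "nat \<Rightarrow> 'a \<Rightarrow> 'a"

definition cocyclic_iso ::
    "('k, 'r) ring_scheme \<Rightarrow> ('k, 'a) cocyclic \<Rightarrow> ('k, 'b) cocyclic \<Rightarrow> (nat \<Rightarrow> 'a \<Rightarrow> 'b) \<Rightarrow> bool"
  where "cocyclic_iso R X Y \<phi> \<longleftrightarrow>
    (\<forall>n. \<phi> n \<in> linear_maps R (obj X n) (obj Y n) \<and>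
         bij_betw (\<phi> n) (carrier (obj X n)) (carrier (obj Y n))) \<and>
    (\<forall>n. \<forall>i\<le>Suc n. \<forall>x\<in>carrier (obj X n). \<phi> (Suc n) (coface X n i x) = coface Y n i (\<phi> n x)) \<and>
    (\<forall>n. \<forall>i\<le>n. \<forall>x\<in>carrier (obj X (Suc n)). \<phi> n (codegen X n i x) = codegen Y n i (\<phi> (Suc n) x)) \<and>
    (\<forall>n. \<forall>x\<in>carrier (obj X n). \<phi> n (cyc X n x) = cyc Y n (\<phi> n x))"

definition coalgebra_cocyclic ::
    "('k, 'r) ring_scheme \<Rightarrow> ('k, 'a, 'm) coalgebra_scheme \<Rightarrow> ('k, ('a list \<Rightarrow> 'k) set) cocyclic"
  where "coalgebra_cocyclic R D =
    \<lparr>obj = (\<lambda>n. tensor_power R D (n + 1)),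
     coface = (\<lambda>n i. lin_ext R (tensor_power R D (n + 2))
       (\<lambda>xs. lin_ext R (tensor_power R D (n + 2))
         (\<lambda>(u, v). pure_power R D
            (if i \<le> n then take i xs @ [u, v] @ drop (i + 1) xs else v # tl xs @ [u]))
         (comult D (if i \<le> n then xs ! i else hd xs)))),
     codegen = (\<lambda>n i. lin_ext R (tensor_power R D (n + 1))
       (\<lambda>xs. counit D (xs ! (i + 1)) \<odot>\<^bsub>tensor_power R D (n + 1)\<^esub>
              pure_power R D (take (i + 1) xs @ drop (i + 2) xs))),
     cyc = (\<lambda>n. lin_ext R (tensor_power R D (n + 1)) (\<lambda>xs. pure_power R D (rotate1 xs)))\<rparr>"


section \<open>The bigraded module of a comodule coalgebra and its diagonal\<close>

text \<open>The operators \<open>h\<dots>\<close> change the second degree \<open>q\<close>, the operators \<open>v\<dots>\<close> (written with a bar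
  informally) the first degree \<open>p\<close>. Codegeneracies are again indexed by the target bidegree:
  \<open>hcodegen X p q i\<close> starts in bidegree \<open>(p, q + 1)\<close> and \<open>vcodegen X p q i\<close> in \<open>(p + 1, q)\<close>.\<close>

record ('k, 'a) bicocyclic =
  bobj :: "nat \<Rightarrow> nat \<Rightarrow> ('k, 'a) module"
  hcoface :: "nat \<Rightarrow> nat \<Rightarrow> nat \<Rightarrow> 'a \<Rightarrow> 'a"
  hcodegen :: "nat \<Rightarrow> nat \<Rightarrow> nat \<Rightarrow> 'a \<Rightarrow> 'a"
  hcyc :: "nat \<Rightarrow> nat \<Rightarrow> 'a \<Rightarrow> 'a"
  vcoface :: "nat \<Rightarrow> nat \<Rightarrow> nat \<Rightarrow> 'a \<Rightarrow> 'a"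
  vcodegen :: "nat \<Rightarrow> nat \<Rightarrow> nat \<Rightarrow> 'a \<Rightarrow> 'a"
  vcyc :: "nat \<Rightarrow> nat \<Rightarrow> 'a \<Rightarrow> 'a"

definition diagonal :: "('k, 'a) bicocyclic \<Rightarrow> ('k, 'a) cocyclic"
  where "diagonal X =
    \<lparr>obj = (\<lambda>n. bobj X n n),
     coface = (\<lambda>n i. vcoface X n (n + 1) i \<circ> hcoface X n n i),
     codegen = (\<lambda>n i. vcodegen X n n i \<circ> hcodegen X (n + 1) n i),
     cyc = (\<lambda>n. vcyc X n n \<circ> hcyc X n n)\<rparr>"

text \<open>\<open>h\<^sup>(\<^sup>0\<^sup>) \<otimes> \<dots> \<otimes> h\<^sup>(\<^sup>p\<^sup>)\<close>\<close>

primrec iter_comult ::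
    "('k, 'r) ring_scheme \<Rightarrow> ('k, 'h, 'z) coalgebra_scheme \<Rightarrow> nat \<Rightarrow> 'h \<Rightarrow> ('h list \<Rightarrow> 'k) set"
  where
    "iter_comult R H 0 h = pure_power R H [h]"
  | "iter_comult R H (Suc p) h = lin_ext R (tensor_power R H (p + 2))
      (\<lambda>(h0, h1). lin_ext R (tensor_power R H (p + 2)) (\<lambda>hs. pure_power R H (h0 # hs)) (iter_comult R H p h1))
      (comult H h)"

text \<open>\<open>h \<cdot> (g\<^sub>0, \<dots>, g\<^sub>p)\<close>, for a nonempty list\<close>

definition diag_act ::
    "('k, 'r) ring_scheme \<Rightarrow> ('k, 'h, 'z) coalgebra_scheme \<Rightarrow> 'h \<Rightarrow> 'h list \<Rightarrow> ('h list \<Rightarrow> 'k) set"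
  where "diag_act R H h gs =
    lin_ext R (tensor_power R H (length gs)) (\<lambda>hs. pure_power R H (map2 (mult H) hs gs))
      (iter_comult R H (length gs - 1) h)"

text \<open>The factorwise coaction
  \<open>a\<^sub>0\<^sup>(\<^sup>1\<^sup>) \<otimes> \<dots> \<otimes> a\<^sub>q\<^sup>(\<^sup>1\<^sup>) \<otimes> a\<^sub>0\<^sup>(\<^sup>0\<^sup>) \<otimes> \<dots> \<otimes> a\<^sub>q\<^sup>(\<^sup>0\<^sup>)\<close>
  (coaction indices, usually barred) of a tuple, with the tensor factors sorted.\<close>

primrec coact_tuple ::
    "('k, 'r) ring_scheme \<Rightarrow> ('k, 'h, 'z) hopf_algebra_scheme \<Rightarrow> ('k, 'c, 'h, 'y) comodule_coalgebra_scheme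
      \<Rightarrow> 'c list \<Rightarrow> ('h list \<times> 'c list \<Rightarrow> 'k) set"
  where
    "coact_tuple R H C [] = pure_mixed R H C [] []"
  | "coact_tuple R H C (a # as) =
      (let T = mixed_tensor R H C (length as + 1) (length as + 1) in
       lin_ext R T
         (\<lambda>(h, b). lin_ext R T (\<lambda>(hs, bs). pure_mixed R H C (h # hs) (b # bs)) (coact_tuple R H C as))
         (coact C a))"

definition list_mult :: "('h, 'z) monoid_scheme \<Rightarrow> 'h list \<Rightarrow> 'h"
  where "list_mult H hs = foldr (mult H) hs \<one>\<^bsub>H\<^esub>"

definition natural_bicocyclic ::
    "('k, 'r) ring_scheme \<Rightarrow> ('k, 'h, 'z) hopf_algebra_scheme \<Rightarrow> ('k, 'c, 'h, 'y) comodule_coalgebra_scheme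
      \<Rightarrow> ('k, ('h list \<times> 'c list \<Rightarrow> 'k) set) bicocyclic"
  where "natural_bicocyclic R H C =
    (let T = (\<lambda>p q. mixed_tensor R H C (p + 1) (q + 1)) in
     \<lparr>bobj = T,
      hcoface = (\<lambda>p q i. lin_ext R (T p (q + 1))
        (\<lambda>(gs, as).
          if i \<le> q then
            lin_ext R (T p (q + 1))
              (\<lambda>(u, v). pure_mixed R H C gs (take i as @ [u, v] @ drop (i + 1) as))
              (comult C (as ! i))
          else
            lin_ext R (T p (q + 1))
              (\<lambda>(u, v). lin_ext R (T p (q + 1))
                (\<lambda>(h, b). lin_ext R (T p (q + 1))
                  (\<lambda>gs'. pure_mixed R H C gs' (v # tl as @ [b]))
                  (diag_act R H (antipode_inv H h) gs))
                (coact C u))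
              (comult C (hd as)))),
      hcodegen = (\<lambda>p q i. lin_ext R (T p q)
        (\<lambda>(gs, as). counit C (as ! (i + 1)) \<odot>\<^bsub>T p q\<^esub>
           pure_mixed R H C gs (take (i + 1) as @ drop (i + 2) as))),
      hcyc = (\<lambda>p q. lin_ext R (T p q)
        (\<lambda>(gs, as). lin_ext R (T p q)
          (\<lambda>(h, b). lin_ext R (T p q)
            (\<lambda>gs'. pure_mixed R H C gs' (tl as @ [b]))
            (diag_act R H (antipode_inv H h) gs))
          (coact C (hd as)))),
      vcoface = (\<lambda>p q i. lin_ext R (T (p + 1) q)
        (\<lambda>(gs, as).
          if i \<le> p then
            lin_ext R (T (p + 1) q)
              (\<lambda>(u, v). pure_mixed R H C (take i gs @ [u, v] @ drop (i + 1) gs) as)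
              (comult H (gs ! i))
          else
            lin_ext R (T (p + 1) q)
              (\<lambda>(u, v). lin_ext R (T (p + 1) q)
                (\<lambda>(hs, bs). pure_mixed R H C (v # tl gs @ [list_mult H hs \<otimes>\<^bsub>H\<^esub> u]) bs)
                (coact_tuple R H C as))
              (comult H (hd gs)))),
      vcodegen = (\<lambda>p q i. lin_ext R (T p q)
        (\<lambda>(gs, as). counit H (gs ! (i + 1)) \<odot>\<^bsub>T p q\<^esub>
           pure_mixed R H C (take (i + 1) gs @ drop (i + 2) gs) as)),
      vcyc = (\<lambda>p q. lin_ext R (T p q)
        (\<lambda>(gs, as). lin_ext R (T p q)
          (\<lambda>(hs, bs). pure_mixed R H C (tl gs @ [list_mult H hs \<otimes>\<^bsub>H\<^esub> hd gs]) bs)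
          (coact_tuple R H C as)))\<rparr>)"

end

theory Submission
  imports Defs
begin

text \<open>Both sides of every identity below are evaluated on multilinear maps with values in an
  arbitrary module; by the universal property this is the same as comparing elements of tensor
  products, and it makes Sweedler calculations possible without naming tensors of varying length.

  Writing \<open>h \<otimes> c\<close> for a coaction, the isomorphism multiplies each \<open>g\<^sub>i\<close> from the left by one
  piece of the coaction of every \<open>a\<^sub>j\<close> with \<open>j > i\<close>, and pairs the result with what remains of
  \<open>a\<^sub>i\<close>. Its inverse undoes these multiplications with \<open>S\<^sup>-\<^sup>1\<close>. For the cyclic operators, the
  pieces of \<open>a\<^sub>0\<close> that the isomorphism produces after \<open>\<tau>\<close> act diagonally on \<open>(g\<^sub>0, \<dots>, g\<^sub>n)\<close>, as
  does the element \<open>S\<^sup>-\<^sup>1(a\<^sub>0)\<close> inserted by \<open>\<tau>\<close>; the two cancel because \<open>h\<^sup>(\<^sup>1\<^sup>) S\<^sup>-\<^sup>1(h\<^sup>(\<^sup>0\<^sup>)) =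
  \<epsilon>(h)\<close>. Cofaces reduce to the comodule coalgebra axiom, and the last coface is the first one
  followed by the cyclic operator.\<close>

section \<open>Linear maps\<close>

text \<open>Why this map: splitting \<open>a \<otimes> g\<close> in the crossed coproduct puts the
  coaction leg of the second copy of a onto the first copy of g. After a coface at i that second
  copy stands at place i+1, so multiplying by the legs of all later entries reproduces exactly this
  factor. At places before i both copies act together, and the comodule coalgebra axiom fuses their
  legs into the leg of the unsplit entry. One device carries the induction: C^n is itself an
  H-comodule by the product of the legs, so a whole tail is coacted at once, with a single leg in H,
  and the laws of one coaction extend to tuples. S^-1 rather than S occurs because the leg split off
  first is the left one; when a later coaction supplies the other leg, the products formed are h^(1)
  S^-1(h^(0)) and S^-1(h^(1)) h^(0). These need S to reverse products, which is not an axiom and has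
  to be derived. The obstacle is that every Sweedler expression hides a choice of representative
  that is not linear in the element. Hence membership in carriers, lengths of tuples and linearity
  in each slot accompany every equation.\<close>

lemma linI:
  assumes "\<And>x. x \<in> carrier M \<Longrightarrow> f x \<in> carrier N"
    and "\<And>x y. x \<in> carrier M \<Longrightarrow> y \<in> carrier M \<Longrightarrow> f (x \<oplus>\<^bsub>M\<^esub> y) = f x \<oplus>\<^bsub>N\<^esub> f y"
    and "\<And>r x. r \<in> carrier R \<Longrightarrow> x \<in> carrier M \<Longrightarrow> f (r \<odot>\<^bsub>M\<^esub> x) = r \<odot>\<^bsub>N\<^esub> f x"
  shows "f \<in> linear_maps R M N"
  using assms by (auto simp: linear_maps_def)

lemma lin_closed: "f \<in> linear_maps R M N \<Longrightarrow> x \<in> carrier M \<Longrightarrow> f x \<in> carrier N"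
  and lin_add: "f \<in> linear_maps R M N \<Longrightarrow> x \<in> carrier M \<Longrightarrow> y \<in> carrier M \<Longrightarrow>
    f (x \<oplus>\<^bsub>M\<^esub> y) = f x \<oplus>\<^bsub>N\<^esub> f y"
  and lin_smult: "f \<in> linear_maps R M N \<Longrightarrow> r \<in> carrier R \<Longrightarrow> x \<in> carrier M \<Longrightarrow>
    f (r \<odot>\<^bsub>M\<^esub> x) = r \<odot>\<^bsub>N\<^esub> f x"
  by (auto simp: linear_maps_def)

text \<open>Membership in \<open>linear_maps\<close> constrains a function only on the carrier, so
  an expression involving choices may be exchanged for one that agrees with it there. That
  \<open>M\<close> is a module keeps sums and multiples inside the carrier.\<close>

lemma lin_cong:
  assumes "module R M" "\<And>x. x \<in> carrier M \<Longrightarrow> f x = g x"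
  shows "f \<in> linear_maps R M N \<longleftrightarrow> g \<in> linear_maps R M N"
proof -
  interpret module R M by fact
  show ?thesis using assms(2) by (auto simp: linear_maps_def Pi_iff)
qed

lemma lin_comp:
  "f \<in> linear_maps R M N \<Longrightarrow> g \<in> linear_maps R L M \<Longrightarrow> (\<lambda>x. f (g x)) \<in> linear_maps R L N"
  by (auto simp: linear_maps_def Pi_iff)

lemma lin_zero:
  assumes "module R M" "module R N" "f \<in> linear_maps R M N"
  shows "f \<zero>\<^bsub>M\<^esub> = \<zero>\<^bsub>N\<^esub>"
proof -
  interpret M: module R M by fact
  interpret N: module R N by fact
  have "f (\<zero>\<^bsub>R\<^esub> \<odot>\<^bsub>M\<^esub> \<zero>\<^bsub>M\<^esub>) = \<zero>\<^bsub>R\<^esub> \<odot>\<^bsub>N\<^esub> f \<zero>\<^bsub>M\<^esub>"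
    by (rule lin_smult[OF assms(3)]) auto
  then show ?thesis using lin_closed[OF assms(3), of "\<zero>\<^bsub>M\<^esub>"] by simp
qed

lemma lin_minus:
  assumes "module R M" "module R N" "f \<in> linear_maps R M N" "x \<in> carrier M" "y \<in> carrier M"
  shows "f (x \<ominus>\<^bsub>M\<^esub> y) = f x \<ominus>\<^bsub>N\<^esub> f y"
proof -
  interpret M: module R M by fact
  interpret N: module R N by fact
  have "f y \<oplus>\<^bsub>N\<^esub> f (\<ominus>\<^bsub>M\<^esub> y) = \<zero>\<^bsub>N\<^esub>"
    using lin_add[OF assms(3,5), of "\<ominus>\<^bsub>M\<^esub> y"] assms(5) lin_zero[OF assms(1-3)]
    by (simp add: M.r_neg)
  then have "f (\<ominus>\<^bsub>M\<^esub> y) = \<ominus>\<^bsub>N\<^esub> f y"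
    using assms lin_closed[OF assms(3)] by (metis M.add.inv_closed N.add.inv_unique' N.a_comm
        N.minus_equality)
  then show ?thesis using lin_add[OF assms(3,4), of "\<ominus>\<^bsub>M\<^esub> y"] assms
    by (simp add: a_minus_def)
qed

text \<open>Rests on commutativity of the ground ring: the fixed scalar has to be moved past the
  varying one.\<close>

lemma lin_smult_const:
  assumes "module R N" "r \<in> carrier R" "f \<in> linear_maps R M N"
  shows "(\<lambda>x. r \<odot>\<^bsub>N\<^esub> f x) \<in> linear_maps R M N"
proof -
  interpret module R N by fact
  show ?thesis using assms lin_closed[OF assms(3)] lin_add[OF assms(3)] lin_smult[OF assms(3)]
    by (intro linI) (auto simp: smult_r_distr smult_assoc1[symmetric] R.m_comm)
qed

lemma lin_smult_left:
  assumes "module R N" "f \<in> linear_maps R M (scalar_module R)" "y \<in> carrier N"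
  shows "(\<lambda>x. f x \<odot>\<^bsub>N\<^esub> y) \<in> linear_maps R M N"
proof -
  interpret module R N by fact
  show ?thesis using assms(3) lin_closed[OF assms(2)] lin_add[OF assms(2)] lin_smult[OF assms(2)]
    by (intro linI) (auto simp: smult_l_distr smult_assoc1 scalar_module_def)
qed

lemma scalar_module_sel [simp]:
  "carrier (scalar_module R) = carrier R" "zero (scalar_module R) = zero R"
  "add (scalar_module R) = add R" "smult (scalar_module R) = mult R"
  by (simp_all add: scalar_module_def)

lemma scalar_module:
  assumes "cring R" shows "module R (scalar_module R)"
proof -
  interpret cring R by fact
  show ?thesis
  proof (rule moduleI[OF assms])
    show "abelian_group (scalar_module R)"
    proof (rule abelian_groupI)
      fix x assume x: "x \<in> carrier (scalar_module R)"
      then show "\<exists>y\<in>carrier (scalar_module R). y \<oplus>\<^bsub>scalar_module R\<^esub> x = \<zero>\<^bsub>scalar_module R\<^esub>"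
        by (intro bexI[of _ "\<ominus>\<^bsub>R\<^esub> x"]) (simp_all add: l_neg)
    qed (auto simp: a_assoc intro: a_comm)
  qed (simp_all add: l_distr r_distr m_assoc)
qed

section \<open>Formal linear combinations\<close>

text \<open>A list of pairs \<open>(r, x)\<close> stands for the formal combination of the \<open>x\<close> with coefficients
  \<open>r\<close>. Unlike elements of a presented module, such lists form a monad without any linearity
  conditions: sums over them commute with each other and with linear maps for arbitrary
  summands.\<close>

primrec ev :: "('k, 'n, 'm) module_scheme \<Rightarrow> ('k \<times> 'b) list \<Rightarrow> ('b \<Rightarrow> 'n) \<Rightarrow> 'n" where
  "ev N [] f = \<zero>\<^bsub>N\<^esub>"
| "ev N (p # L) f = (fst p \<odot>\<^bsub>N\<^esub> f (snd p)) \<oplus>\<^bsub>N\<^esub> ev N L f"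

definition combs :: "('k, 'r) ring_scheme \<Rightarrow> 'b set \<Rightarrow> ('k \<times> 'b) list set" where
  "combs R B = lists (carrier R \<times> B)"

lemma ev_closed:
  assumes "module R N" "L \<in> combs R B" "\<And>x. x \<in> B \<Longrightarrow> f x \<in> carrier N"
  shows "ev N L f \<in> carrier N"
proof -
  interpret module R N by fact
  show ?thesis using assms(2,3) by (induction L) (auto simp: combs_def)
qed

lemma ev_cong:
  assumes "L \<in> combs R B" "\<And>x. x \<in> B \<Longrightarrow> f x = g x"
  shows "ev N L f = ev N L g"
  using assms by (induction L) (auto simp: combs_def)

lemma ev_zero:
  assumes "module R N" "L \<in> combs R B" shows "ev N L (\<lambda>x. \<zero>\<^bsub>N\<^esub>) = \<zero>\<^bsub>N\<^esub>"
proof -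
  interpret module R N by fact
  show ?thesis using assms(2) by (induction L) (auto simp: combs_def)
qed

lemma ev_add:
  assumes "module R N" "L \<in> combs R B" "\<And>x. x \<in> B \<Longrightarrow> f x \<in> carrier N" "\<And>x. x \<in> B \<Longrightarrow> g x \<in> carrier N"
  shows "ev N L (\<lambda>x. f x \<oplus>\<^bsub>N\<^esub> g x) = ev N L f \<oplus>\<^bsub>N\<^esub> ev N L g"
proof -
  interpret module R N by fact
  show ?thesis using assms(2-4)
  proof (induction L)
    case (Cons p L)
    obtain r x where p: "p = (r, x)" by fastforce
    have rx: "r \<in> carrier R" "x \<in> B" "L \<in> combs R B" using Cons.prems p by (auto simp: combs_def)
    have c: "ev N L f \<in> carrier N" "ev N L g \<in> carrier N" "f x \<in> carrier N" "g x \<in> carrier N"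
      using rx Cons.prems by (auto intro!: ev_closed[OF assms(1)])
    have "ev N L (\<lambda>x. f x \<oplus>\<^bsub>N\<^esub> g x) = ev N L f \<oplus>\<^bsub>N\<^esub> ev N L g"
      using Cons.IH rx Cons.prems by blast
    then show ?case using c rx by (simp add: p smult_r_distr M.a_ac)
  qed auto
qed

lemma ev_smult:
  assumes "module R N" "L \<in> combs R B" "\<And>x. x \<in> B \<Longrightarrow> f x \<in> carrier N" "s \<in> carrier R"
  shows "ev N L (\<lambda>x. s \<odot>\<^bsub>N\<^esub> f x) = s \<odot>\<^bsub>N\<^esub> ev N L f"
proof -
  interpret module R N by fact
  show ?thesis using assms(2-4)
  proof (induction L)
    case (Cons p L)
    obtain r x where p: "p = (r, x)" by fastforce
    have rx: "r \<in> carrier R" "x \<in> B" "L \<in> combs R B" using Cons.prems p by (auto simp: combs_def)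
    have c: "ev N L f \<in> carrier N" "f x \<in> carrier N"
      using rx Cons.prems by (auto intro!: ev_closed[OF assms(1)])
    show ?case using c rx Cons.IH Cons.prems
      by (simp add: p smult_r_distr smult_assoc1[symmetric] R.m_comm)
  qed auto
qed

text \<open>The combination \<open>L\<close> is held fixed. Linearity in the element that
  \<open>L\<close> represents is a different matter: the lists chosen by \<open>rep\<close> do not
  add, and that kind of linearity comes only from the universal property, in
  \<open>sw_arg_lin\<close>.\<close>

lemma ev_lin_param:
  assumes "module R N" "L \<in> combs R B" "\<And>x. x \<in> B \<Longrightarrow> (\<lambda>u. f u x) \<in> linear_maps R M N"
  shows "(\<lambda>u. ev N L (f u)) \<in> linear_maps R M N"
proof (rule linI)
  note l = assms(3)
  show "ev N L (f u) \<in> carrier N" if "u \<in> carrier M" for u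
    using that lin_closed[OF l] by (intro ev_closed[OF assms(1,2)])
  show "ev N L (f (u \<oplus>\<^bsub>M\<^esub> v)) = ev N L (f u) \<oplus>\<^bsub>N\<^esub> ev N L (f v)" if "u \<in> carrier M"
      "v \<in> carrier M" for u v
    using that l lin_closed[OF l]
    by (subst ev_add[OF assms(1,2), symmetric]) (auto intro!: ev_cong[OF assms(2)] lin_add[OF l])
  show "ev N L (f (r \<odot>\<^bsub>M\<^esub> u)) = r \<odot>\<^bsub>N\<^esub> ev N L (f u)" if "r \<in> carrier R" "u \<in> carrier M" for r u
    using that l lin_closed[OF l]
    by (subst ev_smult[OF assms(1,2), symmetric]) (auto intro!: ev_cong[OF assms(2)] lin_smult[OF
        l])
qed

lemma ev_map:
  assumes "module R M" "module R N" "T \<in> linear_maps R M N" "L \<in> combs R B"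
    "\<And>x. x \<in> B \<Longrightarrow> f x \<in> carrier M"
  shows "T (ev M L f) = ev N L (\<lambda>x. T (f x))"
proof -
  interpret M: module R M by fact
  interpret N: module R N by fact
  show ?thesis using assms(4,5)
  proof (induction L)
    case Nil then show ?case using lin_zero[OF assms(1-3)] by simp
  next
    case (Cons p L)
    obtain r x where p: "p = (r, x)" by fastforce
    have rx: "r \<in> carrier R" "x \<in> B" "L \<in> combs R B" using Cons.prems p by (auto simp: combs_def)
    have c: "ev M L f \<in> carrier M" "f x \<in> carrier M"
      using rx Cons.prems by (auto intro!: ev_closed[OF assms(1)])
    show ?case using c rx Cons.IH Cons.prems
      by (simp add: p lin_add[OF assms(3)] lin_smult[OF assms(3)])
  qed
qed

lemma ev_swap:
  assumes "module R N" "L \<in> combs R B" "L' \<in> combs R B'"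
    "\<And>x y. x \<in> B \<Longrightarrow> y \<in> B' \<Longrightarrow> f x y \<in> carrier N"
  shows "ev N L (\<lambda>x. ev N L' (f x)) = ev N L' (\<lambda>y. ev N L (\<lambda>x. f x y))"
proof -
  interpret module R N by fact
  show ?thesis using assms(2)
  proof (induction L)
    case Nil then show ?case using ev_zero[OF assms(1,3)] by simp
  next
    case (Cons p L)
    obtain r x where p: "p = (r, x)" by fastforce
    have rx: "r \<in> carrier R" "x \<in> B" "L \<in> combs R B" using Cons.prems p by (auto simp: combs_def)
    have "ev N (p # L) (\<lambda>x. ev N L' (f x)) = r \<odot>\<^bsub>N\<^esub> ev N L' (f x) \<oplus>\<^bsub>N\<^esub> ev N L' (\<lambda>y. ev N L
        (\<lambda>x. f x y))"
      using Cons.IH rx by (simp add: p)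
    also have "\<dots> = ev N L' (\<lambda>y. r \<odot>\<^bsub>N\<^esub> f x y \<oplus>\<^bsub>N\<^esub> ev N L (\<lambda>x. f x y))"
      using rx assms(4)
      by (simp add: ev_add[OF assms(1,3)] ev_smult[OF assms(1,3)] ev_closed[OF assms(1) rx(3)])
    finally show ?case by (simp add: p)
  qed
qed

definition ret :: "('k, 'r) ring_scheme \<Rightarrow> 'b \<Rightarrow> ('k \<times> 'b) list" where
  "ret R x = [(\<one>\<^bsub>R\<^esub>, x)]"

definition bind :: "('k, 'r) ring_scheme \<Rightarrow> ('k \<times> 'b) list \<Rightarrow> ('b \<Rightarrow> ('k \<times> 'c) list) \<Rightarrow> ('k \<times> 'c) list"
    where
  "bind R L g = concat (map (\<lambda>(r, x). map (\<lambda>(s, y). (r \<otimes>\<^bsub>R\<^esub> s, y)) (g x)) L)"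

lemma ret_combs: "cring R \<Longrightarrow> x \<in> B \<Longrightarrow> ret R x \<in> combs R B"
  by (auto simp: ret_def combs_def cring_def ring.ring_simprules)

lemma bind_combs:
  assumes "cring R" "L \<in> combs R B" "\<And>x. x \<in> B \<Longrightarrow> g x \<in> combs R B'"
  shows "bind R L g \<in> combs R B'"
proof -
  interpret cring R by fact
  show ?thesis using assms(2,3) unfolding bind_def combs_def lists_eq_set by fastforce
qed

lemma ev_ret:
  assumes "module R N" "f x \<in> carrier N"
  shows "ev N (ret R x) f = f x"
proof -
  interpret module R N by fact
  show ?thesis using assms(2) by (simp add: ret_def)
qed

lemma ev_append:
  assumes "module R N" "L \<in> combs R B" "L' \<in> combs R B" "\<And>x. x \<in> B \<Longrightarrow> f x \<in> carrier N"
  shows "ev N (L @ L') f = ev N L f \<oplus>\<^bsub>N\<^esub> ev N L' f"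
proof -
  interpret module R N by fact
  show ?thesis using assms(2)
  proof (induction L)
    case Nil then show ?case using ev_closed[OF assms(1,3,4)] by simp
  next
    case (Cons p L)
    then have L: "L \<in> combs R B" by (simp add: combs_def)
    show ?case using Cons ev_closed[OF assms(1,3,4)] ev_closed[OF assms(1) L assms(4)] assms(4)
      by (auto simp: combs_def M.a_assoc)
  qed
qed

lemma ev_scale:
  assumes "module R N" "L \<in> combs R B" "\<And>x. x \<in> B \<Longrightarrow> f x \<in> carrier N" "r \<in> carrier R"
  shows "ev N (map (\<lambda>(s, y). (r \<otimes>\<^bsub>R\<^esub> s, y)) L) f = r \<odot>\<^bsub>N\<^esub> ev N L f"
proof -
  interpret module R N by fact
  show ?thesis using assms(2)
  proof (induction L)
    case Nil then show ?case using assms(4) by simp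
  next
    case (Cons p L)
    then have L: "L \<in> combs R B" by (simp add: combs_def)
    show ?case using Cons ev_closed[OF assms(1) L assms(3)] assms(3,4)
      by (auto simp: combs_def smult_r_distr smult_assoc1)
  qed
qed

text \<open>Evaluating a composed combination is a nested sum. This turns the list recursions that
  define \<open>coacts\<close>, \<open>act\<close>, \<open>Phi\<close> and \<open>Psi\<close> into
  recursions for their Sweedler sums.\<close>

lemma ev_bind:
  assumes "module R N" "L \<in> combs R B" "\<And>x. x \<in> B \<Longrightarrow> g x \<in> combs R B'"
     "\<And>x. x \<in> B' \<Longrightarrow> f x \<in> carrier N"
  shows "ev N (bind R L g) f = ev N L (\<lambda>x. ev N (g x) f)"
proof -
  interpret module R N by fact
  show ?thesis using assms(2)
  proof (induction L)
    case Nil then show ?case by (simp add: bind_def)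
  next
    case (Cons p L)
    obtain r x where p: "p = (r, x)" by fastforce
    have rx: "r \<in> carrier R" "x \<in> B" "L \<in> combs R B" using Cons.prems p by (auto simp: combs_def)
    have "bind R [p] g \<in> combs R B'" "bind R L g \<in> combs R B'"
      using rx by (auto intro!: bind_combs[OF _ _ assms(3)] R.cring_axioms simp: p) (auto simp:
          combs_def)
    moreover have "bind R (p # L) g = bind R [p] g @ bind R L g" by (simp add: bind_def)
    ultimately have "ev N (bind R (p # L) g) f = ev N (bind R [p] g) f \<oplus>\<^bsub>N\<^esub> ev N (bind R L g) f"
      using ev_append[OF assms(1) _ _ assms(4), where L = "bind R [p] g" and L' = "bind R L g"]
          by simp
    also have "ev N (bind R [p] g) f = r \<odot>\<^bsub>N\<^esub> ev N (g x) f"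
      using ev_scale[OF assms(1) assms(3)[OF rx(2)] assms(4) rx(1)] by (simp add: bind_def p)
    finally show ?case using Cons.IH rx by (simp add: p)
  qed
qed

section \<open>Presented modules\<close>

lemma free_module_carrier: "F \<in> carrier (free_module R B) \<longleftrightarrow>
    (\<forall>b. F b \<in> carrier R) \<and> finite {b. F b \<noteq> \<zero>\<^bsub>R\<^esub>} \<and> {b. F b \<noteq> \<zero>\<^bsub>R\<^esub>} \<subseteq> B"
  by (simp add: free_module_def)

lemma free_module_sel:
  "F \<oplus>\<^bsub>free_module R B\<^esub> G = (\<lambda>b. F b \<oplus>\<^bsub>R\<^esub> G b)"
  "r \<odot>\<^bsub>free_module R B\<^esub> F = (\<lambda>b. r \<otimes>\<^bsub>R\<^esub> F b)"
  "\<zero>\<^bsub>free_module R B\<^esub> = (\<lambda>b. \<zero>\<^bsub>R\<^esub>)"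
  by (simp_all add: free_module_def)

lemma free_module:
  fixes R (structure)
  assumes "cring R" shows "module R (free_module R B)"
proof -
  interpret cring R by fact
  have add: "F \<oplus>\<^bsub>free_module R B\<^esub> G \<in> carrier (free_module R B)"
    if "F \<in> carrier (free_module R B)" "G \<in> carrier (free_module R B)" for F G
  proof -
    have "{b. F b \<oplus> G b \<noteq> \<zero>} \<subseteq> {b. F b \<noteq> \<zero>} \<union> {b. G b \<noteq> \<zero>}" using that
      by (auto simp: free_module_carrier)
    then show ?thesis using that
      by (auto simp: free_module_carrier free_module_sel intro: finite_subset[where B="{b. F b \<noteq> \<zero>}
          \<union> {b. G b \<noteq> \<zero>}"])
  qed
  have smult: "r \<odot>\<^bsub>free_module R B\<^esub> G \<in> carrier (free_module R B)"
    if "r \<in> carrier R" "G \<in> carrier (free_module R B)" for r G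
  proof -
    have "{b. r \<otimes> G b \<noteq> \<zero>} \<subseteq> {b. G b \<noteq> \<zero>}" using that
      by (auto simp: free_module_carrier)
    then show ?thesis using that
      by (auto simp: free_module_carrier free_module_sel intro: finite_subset[where B="{b. G b \<noteq>
          \<zero>}"])
  qed
  show ?thesis
  proof (rule moduleI[OF assms _ smult])
    show "abelian_group (free_module R B)"
    proof (rule abelian_groupI)
      fix F assume F: "F \<in> carrier (free_module R B)"
      show "\<exists>G\<in>carrier (free_module R B). G \<oplus>\<^bsub>free_module R B\<^esub> F = \<zero>\<^bsub>free_module R B\<^esub>"
      proof (rule bexI)
        \<comment> \<open>The negative is formed as a scalar multiple, so that finiteness of its
          support is already known from \<open>smult\<close>.\<close>
        show "(\<ominus> \<one>) \<odot>\<^bsub>free_module R B\<^esub> F \<in> carrier (free_module R B)"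
          using F by (intro smult) auto
        show "(\<ominus> \<one>) \<odot>\<^bsub>free_module R B\<^esub> F \<oplus>\<^bsub>free_module R B\<^esub> F = \<zero>\<^bsub>free_module R B\<^esub>"
          using F by (auto simp: free_module_sel free_module_carrier l_minus l_neg)
      qed
    next
      show "\<zero>\<^bsub>free_module R B\<^esub> \<in> carrier (free_module R B)"
        by (simp add: free_module_carrier free_module_sel)
    qed (use add in \<open>auto simp: free_module_carrier free_module_sel a_ac\<close>)
  qed (auto simp: free_module_carrier free_module_sel l_distr r_distr m_assoc)
qed

lemma basis_vec_carrier: "cring R \<Longrightarrow> b \<in> B \<Longrightarrow> basis_vec R b \<in> carrier (free_module R B)"
  by (auto simp: free_module_carrier basis_vec_def cring_def ring.ring_simprules
      intro: finite_subset[of _ "{b}"])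

text \<open>The sum inside \<open>lin_ext\<close> before a coset representative is chosen. It is
  linear for every \<open>f\<close> into a module, so well-definedness on a quotient becomes a
  question about its kernel.\<close>

definition free_sum :: "('k, 'r) ring_scheme \<Rightarrow> ('k, 'n, 'm) module_scheme \<Rightarrow> ('b \<Rightarrow> 'n) \<Rightarrow> ('b \<Rightarrow> 'k) \<Rightarrow>
    'n" where
  "free_sum R N f F = (\<Oplus>\<^bsub>N\<^esub>b\<in>{b. F b \<noteq> \<zero>\<^bsub>R\<^esub>}. F b \<odot>\<^bsub>N\<^esub> f b)"

text \<open>Supports can shrink under addition and scaling; extending the index sets to a common
  finite superset makes the sums comparable term by term.\<close>

lemma free_sum_superset:
  assumes "module R N" "F \<in> carrier (free_module R B)" "f \<in> B \<rightarrow> carrier N"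
    "finite A" "{b. F b \<noteq> \<zero>\<^bsub>R\<^esub>} \<subseteq> A" "A \<subseteq> B"
  shows "free_sum R N f F = (\<Oplus>\<^bsub>N\<^esub>b\<in>A. F b \<odot>\<^bsub>N\<^esub> f b)"
proof -
  interpret module R N by fact
  show ?thesis unfolding free_sum_def
    by (rule M.add.finprod_mono_neutral_cong_left)
      (use assms in \<open>auto simp: free_module_carrier Pi_iff subset_iff\<close>)
qed

lemma free_sum_linear:
  fixes R (structure)
  assumes "module R N" "f \<in> B \<rightarrow> carrier N"
  shows "free_sum R N f \<in> linear_maps R (free_module R B) N"
proof -
  interpret module R N by fact
  interpret F: module R "free_module R B" by (rule free_module) (rule R.cring_axioms)
  show ?thesis
  proof (rule linI)
    fix F assume F: "F \<in> carrier (free_module R B)"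
    show "free_sum R N f F \<in> carrier N" unfolding free_sum_def
      by (rule M.finsum_closed) (use F assms in \<open>auto simp: free_module_carrier Pi_iff subset_iff\<close>)
    show "free_sum R N f (r \<odot>\<^bsub>free_module R B\<^esub> F) = r \<odot>\<^bsub>N\<^esub> free_sum R N f F" if r:
        "r \<in> carrier R" for r
    proof -
      let ?A = "{b. F b \<noteq> \<zero>\<^bsub>R\<^esub>}"
      have A: "finite ?A" "?A \<subseteq> B" "\<And>b. F b \<in> carrier R" using F by (auto simp: free_module_carrier)
      have "free_sum R N f (r \<odot>\<^bsub>free_module R B\<^esub> F) = (\<Oplus>\<^bsub>N\<^esub>b\<in>?A. (r \<otimes> F b) \<odot>\<^bsub>N\<^esub> f b)"
        using A r F by (subst free_sum_superset[OF assms(1) F.smult_closed[OF r F] assms(2), of ?A])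
            (auto simp: free_module_sel)
      also have "\<dots> = (\<Oplus>\<^bsub>N\<^esub>b\<in>?A. r \<odot>\<^bsub>N\<^esub> (F b \<odot>\<^bsub>N\<^esub> f b))"
        using A r assms(2) by (intro M.finsum_cong' refl) (auto simp: Pi_iff subset_iff
            smult_assoc1)
      also have "\<dots> = r \<odot>\<^bsub>N\<^esub> free_sum R N f F" unfolding free_sum_def
        using A r assms(2) by (subst finsum_smult_ldistr) (auto simp: Pi_iff subset_iff)
      finally show ?thesis .
    qed
    fix G assume G: "G \<in> carrier (free_module R B)"
    let ?A = "{b. F b \<noteq> \<zero>\<^bsub>R\<^esub>} \<union> {b. G b \<noteq> \<zero>\<^bsub>R\<^esub>}"
    have A: "finite ?A" "?A \<subseteq> B" "\<And>b. F b \<in> carrier R" "\<And>b. G b \<in> carrier R" using F G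
        by (auto simp: free_module_carrier)
    have "free_sum R N f (F \<oplus>\<^bsub>free_module R B\<^esub> G) = (\<Oplus>\<^bsub>N\<^esub>b\<in>?A. (F b \<oplus> G b) \<odot>\<^bsub>N\<^esub> f b)"
      using A by (subst free_sum_superset[OF assms(1) F.a_closed[OF F G] assms(2), of ?A]) (auto
          simp: free_module_sel)
    also have "\<dots> = (\<Oplus>\<^bsub>N\<^esub>b\<in>?A. F b \<odot>\<^bsub>N\<^esub> f b \<oplus>\<^bsub>N\<^esub> G b \<odot>\<^bsub>N\<^esub> f b)"
      using A assms(2) by (intro M.finsum_cong' refl) (auto simp: Pi_iff subset_iff smult_l_distr)
    also have "\<dots> = (\<Oplus>\<^bsub>N\<^esub>b\<in>?A. F b \<odot>\<^bsub>N\<^esub> f b) \<oplus>\<^bsub>N\<^esub> (\<Oplus>\<^bsub>N\<^esub>b\<in>?A. G b \<odot>\<^bsub>N\<^esub> f b)"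
      using A assms(2) by (intro M.finsum_addf) (auto simp: Pi_iff subset_iff)
    also have "\<dots> = free_sum R N f F \<oplus>\<^bsub>N\<^esub> free_sum R N f G"
      using A by (simp add: free_sum_superset[OF assms(1) F assms(2), of ?A] free_sum_superset[OF
          assms(1) G assms(2), of ?A])
    finally show "free_sum R N f (F \<oplus>\<^bsub>free_module R B\<^esub> G) = free_sum R N f F \<oplus>\<^bsub>N\<^esub> free_sum R N f G"
        .
  qed
qed

lemma free_sum_basis:
  assumes "module R N" "f \<in> B \<rightarrow> carrier N" "b \<in> B"
  shows "free_sum R N f (basis_vec R b) = f b"
proof -
  interpret module R N by fact
  have "free_sum R N f (basis_vec R b) = (\<Oplus>\<^bsub>N\<^esub>c\<in>{b}. basis_vec R b c \<odot>\<^bsub>N\<^esub> f c)"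
    by (rule free_sum_superset[OF assms(1) basis_vec_carrier[OF R.cring_axioms assms(3)] assms(2)])
      (use assms in \<open>auto simp: basis_vec_def split: if_splits\<close>)
  then show ?thesis using assms by (auto simp: basis_vec_def Pi_iff)
qed

lemma free_sum_basis_vec:
  assumes "cring R" "F \<in> carrier (free_module R B)"
  shows "free_sum R (free_module R B) (basis_vec R) F = F"
proof -
  interpret R: cring R by fact
  interpret F: module R "free_module R B" by (rule free_module) (rule R.cring_axioms)
  \<comment> \<open>Generalised to partial sums over any finite \<open>A\<close>, since the support
    of the fixed \<open>F\<close> offers nothing to induct on.\<close>
  have "(\<Oplus>\<^bsub>free_module R B\<^esub>b\<in>A. F b \<odot>\<^bsub>free_module R B\<^esub> basis_vec R b) = (\<lambda>c.
      if c \<in> A then F c else \<zero>\<^bsub>R\<^esub>)"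
    if "finite A" "A \<subseteq> B" for A using that
  proof (induction A)
    case empty then show ?case by (simp add: free_module_sel)
  next
    case (insert b A)
    have F: "\<And>b. F b \<in> carrier R" using assms by (auto simp: free_module_carrier)
    have "(\<Oplus>\<^bsub>free_module R B\<^esub>b\<in>insert b A. F b \<odot>\<^bsub>free_module R B\<^esub> basis_vec R b) =
      F b \<odot>\<^bsub>free_module R B\<^esub> basis_vec R b \<oplus>\<^bsub>free_module R B\<^esub> (\<lambda>c. if c \<in> A then F c else \<zero>\<^bsub>R\<^esub>)"
      using insert F
      by (subst F.M.finsum_insert) (auto intro!: F.smult_closed basis_vec_carrier[OF assms(1)])
    then show ?case using insert F by (auto simp: free_module_sel basis_vec_def)
  qed
  from this[of "{b. F b \<noteq> \<zero>\<^bsub>R\<^esub>}"] show ?thesis using assms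
    by (auto simp: free_sum_def free_module_carrier)
qed

text \<open>\<open>Q \<subseteq> carrier M\<close> makes the whole module one of the submodules
  intersected, and this bounds the intersection by the carrier.\<close>

lemma span_submodule:
  assumes "module R M" "Q \<subseteq> carrier M" shows "submodule (submodule_span R M Q) R M"
    and "Q \<subseteq> submodule_span R M Q"
proof -
  interpret module R M by fact
  show "submodule (submodule_span R M Q) R M"
  proof (rule submoduleI)
    show "submodule_span R M Q \<subseteq> carrier M"
      using carrier_is_submodule assms(2) by (auto simp: submodule_span_def)
    have "\<zero>\<^bsub>M\<^esub> \<in> K" if "submodule K R M" for K
      using subgroup.one_closed[OF submodule.axioms(1)[OF that]] by simp
    then show "\<zero>\<^bsub>M\<^esub> \<in> submodule_span R M Q" by (auto simp: submodule_span_def)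
  qed (simp_all add: submodule_span_def submoduleE)
  show "Q \<subseteq> submodule_span R M Q" by (auto simp: submodule_span_def)
qed

lemma span_least:
  "submodule K R M \<Longrightarrow> Q \<subseteq> K \<Longrightarrow> submodule_span R M Q \<subseteq> K"
  by (auto simp: submodule_span_def)

text \<open>Together with \<open>span_least\<close> this reduces vanishing on the span of the
  relations to vanishing on each relation.\<close>

lemma kernel_submodule:
  assumes "module R M" "module R N" "T \<in> linear_maps R M N"
  shows "submodule {x \<in> carrier M. T x = \<zero>\<^bsub>N\<^esub>} R M"
proof -
  interpret M: module R M by fact
  interpret N: module R N by fact
  have "T (\<ominus>\<^bsub>M\<^esub> x) = \<zero>\<^bsub>N\<^esub>" if "x \<in> carrier M" "T x = \<zero>\<^bsub>N\<^esub>" for x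
    using lin_minus[OF assms M.M.zero_closed that(1)] that lin_zero[OF assms]
    by (simp add: a_minus_def)
  then show ?thesis
    by (intro M.submoduleI) (auto simp: lin_zero[OF assms] lin_add[OF assms(3)] lin_smult[OF
        assms(3)])
qed

lemma quotient_sel:
  "carrier (quotient_module M K) = a_rcosets\<^bsub>M\<^esub> K"
  "zero (quotient_module M K) = K"
  "X \<oplus>\<^bsub>quotient_module M K\<^esub> Y = X <+>\<^bsub>M\<^esub> Y"
  by (simp_all add: quotient_module_def)

lemma submodule_abelian_subgroup:
  assumes "module R M" "submodule K R M" shows "abelian_subgroup K M"
proof -
  interpret module R M by fact
  show ?thesis using assms(2) by (intro abelian_subgroupI3 M.abelian_group_axioms)
      (simp add: additive_subgroup_def submodule_def)
qed

text \<open>Scaling in the quotient is a union over all members of a coset. Members differ by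
  elements of \<open>K\<close>, which scaling keeps in \<open>K\<close>, so the union is taken over
  equal cosets.\<close>

lemma quotient_smult:
  assumes "module R M" "submodule K R M" "r \<in> carrier R" "x \<in> carrier M"
  shows "r \<odot>\<^bsub>quotient_module M K\<^esub> (K +>\<^bsub>M\<^esub> x) = K +>\<^bsub>M\<^esub> (r \<odot>\<^bsub>M\<^esub> x)"
proof -
  interpret module R M by fact
  interpret K: abelian_subgroup K M by (rule submodule_abelian_subgroup[OF assms(1,2)])
  have 1: "K +>\<^bsub>M\<^esub> (r \<odot>\<^bsub>M\<^esub> y) = K +>\<^bsub>M\<^esub> (r \<odot>\<^bsub>M\<^esub> x)" if "y \<in> K +>\<^bsub>M\<^esub> x" for y
  proof -
    have "\<exists>k\<in>K. y = k \<oplus>\<^bsub>M\<^esub> x" using that by (simp add: a_r_coset_def')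
    then obtain k where k: "k \<in> K" "y = k \<oplus>\<^bsub>M\<^esub> x" by (elim bexE)
    then have "r \<odot>\<^bsub>M\<^esub> y = r \<odot>\<^bsub>M\<^esub> k \<oplus>\<^bsub>M\<^esub> r \<odot>\<^bsub>M\<^esub> x" using assms subsetD[OF K.a_subset k(1)] by
        (simp add: smult_r_distr)
    moreover have "r \<odot>\<^bsub>M\<^esub> k \<in> K" using k assms by (simp add: submodule.smult_closed)
    ultimately have "r \<odot>\<^bsub>M\<^esub> y \<in> K +>\<^bsub>M\<^esub> (r \<odot>\<^bsub>M\<^esub> x)" by (auto simp: a_r_coset_def')
    then show ?thesis by (intro K.a_repr_independence'[symmetric]) (use assms in auto)
  qed
  have "x \<in> K +>\<^bsub>M\<^esub> x" using assms by (simp add: K.a_rcos_self)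
  then have "(\<Union>y\<in>K +>\<^bsub>M\<^esub> x. K +>\<^bsub>M\<^esub> (r \<odot>\<^bsub>M\<^esub> y)) = K +>\<^bsub>M\<^esub> (r \<odot>\<^bsub>M\<^esub> x)"
    by (intro SUP_eq_const 1) auto
  then show ?thesis by (simp add: quotient_module_def)
qed

text \<open>Every coset is the image of an element of \<open>M\<close> and the projection respects
  the operations, so each module law is the image of the same law in \<open>M\<close>.\<close>

lemma quotient_module:
  assumes "module R M" "submodule K R M"
  shows "module R (quotient_module M K)"
    and "(\<lambda>x. K +>\<^bsub>M\<^esub> x) \<in> linear_maps R M (quotient_module M K)"
proof -
  interpret module R M by fact
  interpret K: abelian_subgroup K M by (rule submodule_abelian_subgroup[OF assms(1,2)])
  have lin: "(\<lambda>x. K +>\<^bsub>M\<^esub> x) \<in> linear_maps R M (quotient_module M K)"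
    by (rule linI) (auto simp: quotient_sel quotient_smult[OF assms] K.a_rcos_sum M.a_rcosetsI[OF
        K.a_subset])
  then show "(\<lambda>x. K +>\<^bsub>M\<^esub> x) \<in> linear_maps R M (quotient_module M K)" .
  have ex: "\<exists>x\<in>carrier M. X = K +>\<^bsub>M\<^esub> x" if "X \<in> carrier (quotient_module M K)" for X
    using that by (auto simp: quotient_sel A_RCOSETS_def')
  note l = lin_closed[OF lin] lin_add[OF lin, symmetric] lin_smult[OF lin, symmetric]
  let ?Q = "quotient_module M K"
  have z: "\<zero>\<^bsub>?Q\<^esub> = K +>\<^bsub>M\<^esub> \<zero>\<^bsub>M\<^esub>" using K.a_subset by (simp add: quotient_sel)
  have closed_rules: "X \<oplus>\<^bsub>?Q\<^esub> Y \<in> carrier ?Q" if "X \<in> carrier ?Q" "Y \<in> carrier ?Q" for X Y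
    using ex[OF that(1)] ex[OF that(2)] by (auto simp: l)
  have coact_combs: "X \<oplus>\<^bsub>?Q\<^esub> Y = Y \<oplus>\<^bsub>?Q\<^esub> X" if "X \<in> carrier ?Q" "Y \<in> carrier ?Q" for X Y
    using ex[OF that(1)] ex[OF that(2)] by (auto simp: l M.a_comm)
  have as: "X \<oplus>\<^bsub>?Q\<^esub> Y \<oplus>\<^bsub>?Q\<^esub> Z = X \<oplus>\<^bsub>?Q\<^esub> (Y \<oplus>\<^bsub>?Q\<^esub> Z)"
    if "X \<in> carrier ?Q" "Y \<in> carrier ?Q" "Z \<in> carrier ?Q" for X Y Z
    using ex[OF that(1)] ex[OF that(2)] ex[OF that(3)] by (auto simp: l M.a_assoc)
  have ze: "\<zero>\<^bsub>?Q\<^esub> \<oplus>\<^bsub>?Q\<^esub> X = X" if "X \<in> carrier ?Q" for X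
    using ex[OF that] by (auto simp: l z)
  have ne: "\<exists>Y\<in>carrier ?Q. Y \<oplus>\<^bsub>?Q\<^esub> X = \<zero>\<^bsub>?Q\<^esub>" if "X \<in> carrier ?Q" for X
  proof -
    obtain x where x: "x \<in> carrier M" "X = K +>\<^bsub>M\<^esub> x" using ex[OF \<open>X \<in> carrier ?Q\<close>] by blast
    then have "(K +>\<^bsub>M\<^esub> (\<ominus>\<^bsub>M\<^esub> x)) \<oplus>\<^bsub>?Q\<^esub> X = \<zero>\<^bsub>?Q\<^esub>" by (simp add: l z M.l_neg)
    then show ?thesis using l(1)[of "\<ominus>\<^bsub>M\<^esub> x"] x by auto
  qed
  have ab: "abelian_group ?Q"
    using abelian_groupI[of ?Q, OF closed_rules _ as coact_combs ze ne] l(1)[OF M.zero_closed] z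
        by simp
  show "module R (quotient_module M K)"
  proof (rule moduleI[OF R.cring_axioms ab])
    fix a x assume "a \<in> carrier R" "x \<in> carrier (quotient_module M K)"
    then show "a \<odot>\<^bsub>quotient_module M K\<^esub> x \<in> carrier (quotient_module M K)"
      using ex[of x] by (auto simp: l)
  next
    fix a b x assume "a \<in> carrier R" "b \<in> carrier R" "x \<in> carrier (quotient_module M K)"
    then show "(a \<oplus>\<^bsub>R\<^esub> b) \<odot>\<^bsub>quotient_module M K\<^esub> x = a \<odot>\<^bsub>quotient_module M K\<^esub> x \<oplus>\<^bsub>quotient_module M
        K\<^esub> b \<odot>\<^bsub>quotient_module M K\<^esub> x"
      using ex[of x] by (auto simp: l smult_l_distr)
  next
    fix a x y assume "a \<in> carrier R" "x \<in> carrier (quotient_module M K)"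
        "y \<in> carrier (quotient_module M K)"
    then show "a \<odot>\<^bsub>quotient_module M K\<^esub> (x \<oplus>\<^bsub>quotient_module M K\<^esub> y) = a \<odot>\<^bsub>quotient_module M K\<^esub> x
        \<oplus>\<^bsub>quotient_module M K\<^esub> a \<odot>\<^bsub>quotient_module M K\<^esub> y"
      using ex[of x] ex[of y] by (auto simp: l smult_r_distr)
  next
    fix a b x assume "a \<in> carrier R" "b \<in> carrier R" "x \<in> carrier (quotient_module M K)"
    then show "(a \<otimes>\<^bsub>R\<^esub> b) \<odot>\<^bsub>quotient_module M K\<^esub> x = a \<odot>\<^bsub>quotient_module M K\<^esub> (b \<odot>\<^bsub>quotient_module M
        K\<^esub> x)"
      using ex[of x] by (auto simp: l smult_assoc1)
  next
    fix x assume "x \<in> carrier (quotient_module M K)"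
    then show "\<one>\<^bsub>R\<^esub> \<odot>\<^bsub>quotient_module M K\<^esub> x = x" using ex[of x] by (auto simp: l)
  qed
qed

locale presentation = cring R for R :: "('k, 'r) ring_scheme" (structure) +
  fixes B :: "'b set" and Q :: "('b \<Rightarrow> 'k) set"
  assumes relations: "Q \<subseteq> carrier (free_module R B)"
begin

abbreviation "P \<equiv> presented_module R B Q"
abbreviation "K \<equiv> submodule_span R (free_module R B) Q"

lemma K: "submodule K R (free_module R B)" "Q \<subseteq> K"
  using span_submodule[OF free_module[OF cring_axioms] relations] by auto

lemma presented_module: "module R P"
  unfolding presented_module_def by (rule quotient_module[OF free_module[OF cring_axioms] K(1)])

lemma proj: "(\<lambda>x. K +>\<^bsub>free_module R B\<^esub> x) \<in> linear_maps R (free_module R B) P"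
  unfolding presented_module_def by (rule quotient_module[OF free_module[OF cring_axioms] K(1)])

lemma generator_closed: "b \<in> B \<Longrightarrow> generator R B Q b \<in> carrier P"
  unfolding generator_def by (rule lin_closed[OF proj]) (rule basis_vec_carrier[OF cring_axioms])

lemma K_coset: "x \<in> K \<Longrightarrow> K +>\<^bsub>free_module R B\<^esub> x = \<zero>\<^bsub>P\<^esub>"
proof -
  interpret F: module R "free_module R B" by (rule free_module[OF cring_axioms])
  interpret K: abelian_subgroup K "free_module R B" by
      (rule submodule_abelian_subgroup[OF free_module[OF cring_axioms] K(1)])
  show "x \<in> K \<Longrightarrow> K +>\<^bsub>free_module R B\<^esub> x = \<zero>\<^bsub>P\<^esub>"
    using K.a_rcos_const by (simp add: presented_module_def quotient_sel)
qed

text \<open>A slot relation is the difference of two formal sums and lies in \<open>K\<close>; the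
  two sums have the same coset, which is additivity or homogeneity of the generator in that
  slot.\<close>

lemma generator_linear:
  assumes "slot_relations R B M s \<subseteq> Q" "module R M" "\<And>u. u \<in> carrier M \<Longrightarrow> s u \<in> B"
  shows "(\<lambda>u. generator R B Q (s u)) \<in> linear_maps R M P"
proof -
  interpret M: module R M by fact
  interpret F: module R "free_module R B" by (rule free_module[OF cring_axioms])
  interpret P: module R P by (rule presented_module)
  note b = basis_vec_carrier[OF cring_axioms]
  have eq: "K +>\<^bsub>free_module R B\<^esub> x = K +>\<^bsub>free_module R B\<^esub> y" if "x \<ominus>\<^bsub>free_module R B\<^esub> y \<in> Q"
    "x \<in> carrier (free_module R B)" "y \<in> carrier (free_module R B)" for x y
  proof -
    have "K +>\<^bsub>free_module R B\<^esub> (x \<ominus>\<^bsub>free_module R B\<^esub> y) = \<zero>\<^bsub>P\<^esub>" using K_coset K(2) that by blast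
    then have "(K +>\<^bsub>free_module R B\<^esub> x) \<ominus>\<^bsub>P\<^esub> (K +>\<^bsub>free_module R B\<^esub> y) = \<zero>\<^bsub>P\<^esub>"
      using lin_minus[OF F.module_axioms P.module_axioms proj that(2,3)] by simp
    then show ?thesis
      using P.M.minus_equality[of "K +>\<^bsub>free_module R B\<^esub> x" "\<ominus>\<^bsub>P\<^esub> (K +>\<^bsub>free_module R B\<^esub> y)"]
          lin_closed[OF proj] that
      by (simp add: a_minus_def)
  qed
  show ?thesis
  proof (rule linI)
    fix u assume u: "u \<in> carrier M"
    then show "generator R B Q (s u) \<in> carrier P" using assms(3) generator_closed by blast
    { fix v assume v: "v \<in> carrier M"
      have "generator R B Q (s (u \<oplus>\<^bsub>M\<^esub> v)) = K +>\<^bsub>free_module R B\<^esub> (basis_vec R (s u) \<oplus>\<^bsub>free_module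
          R B\<^esub> basis_vec R (s v))"
        unfolding generator_def
      proof (rule eq)
        show "basis_vec R (s (u \<oplus>\<^bsub>M\<^esub> v)) \<ominus>\<^bsub>free_module R B\<^esub> (basis_vec R (s u) \<oplus>\<^bsub>free_module R B\<^esub>
            basis_vec R (s v)) \<in> Q"
          using assms(1) u v unfolding slot_relations_def by blast
      qed (use u v assms(3) in \<open>auto intro!: F.a_closed b\<close>)
      then show "generator R B Q (s (u \<oplus>\<^bsub>M\<^esub> v)) = generator R B Q (s u) \<oplus>\<^bsub>P\<^esub> generator R B Q (s v)"
        unfolding generator_def using u v assms by (simp add: lin_add[OF proj] b)
    }
    { fix r assume r: "r \<in> carrier R"
      have "generator R B Q (s (r \<odot>\<^bsub>M\<^esub> u)) = K +>\<^bsub>free_module R B\<^esub> (r \<odot>\<^bsub>free_module R B\<^esub> basis_vec R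
          (s u))"
        unfolding generator_def
      proof (rule eq)
        show "basis_vec R (s (r \<odot>\<^bsub>M\<^esub> u)) \<ominus>\<^bsub>free_module R B\<^esub> (r \<odot>\<^bsub>free_module R B\<^esub> basis_vec R (s u))
            \<in> Q"
          using assms(1) u r unfolding slot_relations_def by blast
      qed (use u r assms(3) in \<open>auto intro!: b\<close>)
      then show "generator R B Q (s (r \<odot>\<^bsub>M\<^esub> u)) = r \<odot>\<^bsub>P\<^esub> generator R B Q (s u)"
        unfolding generator_def using u r assms by (simp add: lin_smult[OF proj] b)
    }
  qed
qed

text \<open>Cosets are non-empty, so the choice made inside \<open>lin_ext\<close> does return a
  member, and that member determines the coset again.\<close>

lemma representative:
  assumes "X \<in> carrier P"
  shows "(SOME F. F \<in> X) \<in> carrier (free_module R B)" "X = K +>\<^bsub>free_module R B\<^esub> (SOME F. F \<in> X)"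
proof -
  interpret F: module R "free_module R B" by (rule free_module[OF cring_axioms])
  interpret K: abelian_subgroup K "free_module R B" by
      (rule submodule_abelian_subgroup[OF free_module[OF cring_axioms] K(1)])
  obtain x where x: "x \<in> carrier (free_module R B)" "X = K +>\<^bsub>free_module R B\<^esub> x"
    using assms by (auto simp: presented_module_def quotient_sel A_RCOSETS_def')
  then have "x \<in> X" by (simp add: K.a_rcos_self)
  then have s: "(SOME F. F \<in> X) \<in> X" by (rule someI[of "\<lambda>F. F \<in> X"])
  then show "(SOME F. F \<in> X) \<in> carrier (free_module R B)" using x K.a_elemrcos_carrier by blast
  show "X = K +>\<^bsub>free_module R B\<^esub> (SOME F. F \<in> X)" using s x K.a_repr_independence' by blast
qed

end

text \<open>The combination chosen by \<^const>\<open>lin_ext\<close>, as a list. It is neither unique nor linear in the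
  element; only its values under maps respecting the relations are.\<close>

definition rep :: "('k, 'r) ring_scheme \<Rightarrow> ('b \<Rightarrow> 'k) set \<Rightarrow> ('k \<times> 'b) list" where
  "rep R X = (let F = (SOME F. F \<in> X) in
     map (\<lambda>b. (F b, b)) (SOME bs. set bs = {b. F b \<noteq> \<zero>\<^bsub>R\<^esub>} \<and> distinct bs))"

context presentation begin

lemma rep_exhaust:
  assumes "X \<in> carrier P"
  obtains bs where "set bs = {b. (SOME F. F \<in> X) b \<noteq> \<zero>\<^bsub>R\<^esub>}" "distinct bs"
    "rep R X = map (\<lambda>b. ((SOME F. F \<in> X) b, b)) bs"
proof -
  define F where "F = (SOME F. F \<in> X)"
  have "finite {b. F b \<noteq> \<zero>\<^bsub>R\<^esub>}" using representative(1)[OF assms] by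
      (simp add: free_module_carrier F_def)
  then obtain bs where "set bs = {b. F b \<noteq> \<zero>\<^bsub>R\<^esub>} \<and> distinct bs" using finite_distinct_list by blast
  then have *: "set (SOME bs. set bs = {b. F b \<noteq> \<zero>\<^bsub>R\<^esub>} \<and> distinct bs) = {b. F b \<noteq> \<zero>\<^bsub>R\<^esub>} \<and>
    distinct (SOME bs. set bs = {b. F b \<noteq> \<zero>\<^bsub>R\<^esub>} \<and> distinct bs)" by (rule someI)
  show ?thesis by (rule that[of "SOME bs. set bs = {b. F b \<noteq> \<zero>\<^bsub>R\<^esub>} \<and> distinct bs"])
      (use * in \<open>auto simp: rep_def F_def[symmetric] Let_def\<close>)
qed

lemma rep_combs:
  assumes "X \<in> carrier P" shows "rep R X \<in> combs R B"
proof -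
  obtain bs where bs: "set bs = {b. (SOME F. F \<in> X) b \<noteq> \<zero>\<^bsub>R\<^esub>}" "distinct bs"
    "rep R X = map (\<lambda>b. ((SOME F. F \<in> X) b, b)) bs"
    by (rule rep_exhaust[OF assms])
  then show ?thesis using representative(1)[OF assms]
    by (auto simp: combs_def free_module_carrier)
qed

text \<open>Both sides evaluate the same chosen representative, once as a set-indexed sum and once
  along a list. The equation therefore covers any \<open>f\<close> into \<open>N\<close>, whether or
  not it respects the relations.\<close>

lemma ev_rep:
  assumes "module R N" "f \<in> B \<rightarrow> carrier N" "X \<in> carrier P"
  shows "lin_ext R N f X = ev N (rep R X) f"
proof -
  interpret N: module R N by fact
  define F where "F = (SOME F. F \<in> X)"
  obtain bs where bs: "set bs = {b. F b \<noteq> \<zero>\<^bsub>R\<^esub>}" "distinct bs" "rep R X = map (\<lambda>b. (F b, b)) bs"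
    using rep_exhaust[OF assms(3)] unfolding F_def[symmetric] by blast
  have F: "F \<in> carrier (free_module R B)" using representative[OF assms(3)] F_def by simp
  have "(\<Oplus>\<^bsub>N\<^esub>b\<in>set bs. F b \<odot>\<^bsub>N\<^esub> f b) = ev N (map (\<lambda>b. (F b, b)) bs) f"
    if "set bs \<subseteq> B" "distinct bs" for bs using that
  proof (induction bs)
    case (Cons b bs)
    then show ?case using assms(2) F
      by (auto simp: Pi_iff free_module_carrier subset_iff)
  qed simp
  then show ?thesis using bs F by (simp add: lin_ext_def F_def[symmetric] free_module_carrier flip:
      bs(1))
qed

text \<open>In the free module a finitely supported function is the combination of its basis
  vectors; projecting this identity shows that the generators span, with the coefficients stored in
  \<open>rep\<close>.\<close>

lemma rep_generator:
  assumes "X \<in> carrier P" shows "X = ev P (rep R X) (generator R B Q)"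
proof -
  define F where "F = (SOME F. F \<in> X)"
  interpret F: module R "free_module R B" by (rule free_module[OF cring_axioms])
  interpret P: module R P by (rule presented_module)
  have F: "F \<in> carrier (free_module R B)" "X = K +>\<^bsub>free_module R B\<^esub> F" using representative[OF
      assms] F_def by simp_all
  obtain bs where bs: "set bs = {b. F b \<noteq> \<zero>\<^bsub>R\<^esub>}" "distinct bs" "rep R X = map (\<lambda>b. (F b, b)) bs"
    using rep_exhaust[OF assms] unfolding F_def[symmetric] by blast
  have *: "(\<Oplus>\<^bsub>N\<^esub>b\<in>set bs. F b \<odot>\<^bsub>N\<^esub> f b) = ev N (map (\<lambda>b. (F b, b)) bs) f"
    if "set bs \<subseteq> B" "distinct bs" "module R N" "f \<in> B \<rightarrow> carrier N" for bs N f using that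
  proof (induction bs)
    case Nil
    then interpret N: module R N by blast
    show ?case by simp
  next
    case (Cons b bs)
    interpret N: module R N using Cons by blast
    show ?case using Cons F(1)
      by (auto simp: Pi_iff free_module_carrier subset_iff)
  qed
  have bv: "basis_vec R \<in> B \<rightarrow> carrier (free_module R B)" by
      (intro Pi_I basis_vec_carrier[OF cring_axioms])
  have "set bs \<subseteq> B" using F(1) bs(1) by (auto simp: free_module_carrier)
  then have e: "free_sum R (free_module R B) (basis_vec R) F = ev (free_module R B) (map
      (\<lambda>b. (F b, b)) bs) (basis_vec R)"
    unfolding free_sum_def bs(1)[symmetric] by (rule *[OF _ bs(2) F.module_axioms bv])
  then have "F = ev (free_module R B) (rep R X) (basis_vec R)"
    unfolding bs(3) free_sum_basis_vec[OF cring_axioms F(1)] .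
  then have "X = K +>\<^bsub>free_module R B\<^esub> (ev (free_module R B) (rep R X) (basis_vec R))" using F(2)
      by simp
  also have "\<dots> = ev P (rep R X) (\<lambda>b. K +>\<^bsub>free_module R B\<^esub> basis_vec R b)"
    by (rule ev_map[OF F.module_axioms P.module_axioms proj rep_combs[OF assms]])
        (rule basis_vec_carrier[OF cring_axioms])
  finally show ?thesis unfolding generator_def .
qed

text \<open>Existence half of the universal property: the kernel of \<open>free_sum\<close> is a
  submodule containing \<open>Q\<close>, hence contains \<open>K\<close>, and the representative
  picked by \<open>lin_ext\<close> differs from any other by an element of \<open>K\<close>.\<close>

lemma lin_ext_universal:
  assumes "module R N" "f \<in> B \<rightarrow> carrier N" "\<And>q. q \<in> Q \<Longrightarrow> free_sum R N f q = \<zero>\<^bsub>N\<^esub>"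
  shows "lin_ext R N f \<in> linear_maps R P N"
    and "\<And>b. b \<in> B \<Longrightarrow> lin_ext R N f (generator R B Q b) = f b"
proof -
  interpret N: module R N by fact
  interpret F: module R "free_module R B" by (rule free_module[OF cring_axioms])
  interpret P: module R P by (rule presented_module)
  interpret K: abelian_subgroup K "free_module R B" by
      (rule submodule_abelian_subgroup[OF free_module[OF cring_axioms] K(1)])
  note l = free_sum_linear[OF assms(1,2)]
  have ker: "free_sum R N f x = \<zero>\<^bsub>N\<^esub>" if "x \<in> K" for x
    using span_least[OF kernel_submodule[OF F.module_axioms assms(1) l], of Q] that assms(3)
        relations by blast
  have eq: "lin_ext R N f (K +>\<^bsub>free_module R B\<^esub> x) = free_sum R N f x" if x:
      "x \<in> carrier (free_module R B)" for x
  proof -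
    let ?X = "K +>\<^bsub>free_module R B\<^esub> x"
    have "x \<in> ?X" by (simp add: K.a_rcos_self x)
    then have "(SOME F. F \<in> ?X) \<in> ?X" by (rule someI[of "\<lambda>F. F \<in> ?X"])
    then obtain k where k: "k \<in> K" "(SOME F. F \<in> ?X) = k \<oplus>\<^bsub>free_module R B\<^esub> x"
        by (auto simp: a_r_coset_def')
    have "lin_ext R N f ?X = free_sum R N f (k \<oplus>\<^bsub>free_module R B\<^esub> x)" by
        (simp add: lin_ext_def free_sum_def k Let_def)
    also have "\<dots> = free_sum R N f x" using lin_add[OF l _ x, of k] k(1) K.a_subset ker lin_closed[OF
        l x] by auto
    finally show ?thesis .
  qed
  show "lin_ext R N f (generator R B Q b) = f b" if "b \<in> B" for b
    using that by (simp add: generator_def eq basis_vec_carrier[OF cring_axioms] free_sum_basis[OF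
        assms(1,2)])
  show "lin_ext R N f \<in> linear_maps R P N"
  proof (rule linI)
    have ex: "\<exists>x\<in>carrier (free_module R B). X = K +>\<^bsub>free_module R B\<^esub> x" if "X \<in> carrier P" for X
      using representative[OF that] by blast
    fix X assume X: "X \<in> carrier P"
    then obtain x where x: "x \<in> carrier (free_module R B)" "X = K +>\<^bsub>free_module R B\<^esub> x" using ex
        by blast
    show "lin_ext R N f X \<in> carrier N" using x eq lin_closed[OF l] by simp
    { fix r assume "r \<in> carrier R"
      then show "lin_ext R N f (r \<odot>\<^bsub>P\<^esub> X) = r \<odot>\<^bsub>N\<^esub> lin_ext R N f X"
        by (simp add: x eq lin_smult[OF proj, symmetric] lin_smult[OF l])
    }
    { fix Y assume Y: "Y \<in> carrier P"
      then obtain y where y: "y \<in> carrier (free_module R B)" "Y = K +>\<^bsub>free_module R B\<^esub> y" using ex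
          by blast
      show "lin_ext R N f (X \<oplus>\<^bsub>P\<^esub> Y) = lin_ext R N f X \<oplus>\<^bsub>N\<^esub> lin_ext R N f Y"
        by (simp add: x y eq lin_add[OF proj, symmetric] lin_add[OF l])
    }
  qed
qed

text \<open>Reduces the vanishing hypothesis of \<open>lin_ext_universal\<close> to linearity of
  \<open>f\<close> in one slot: under a map linear there, the terms of a relation cancel.\<close>

lemma free_sum_slot:
  assumes "module R N" "f \<in> B \<rightarrow> carrier N" "module R M" "\<And>u. u \<in> carrier M \<Longrightarrow> s u \<in> B"
    "(\<lambda>u. f (s u)) \<in> linear_maps R M N" "q \<in> slot_relations R B M s"
  shows "free_sum R N f q = \<zero>\<^bsub>N\<^esub>"
proof -
  interpret N: module R N by fact
  interpret M: module R M by fact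
  interpret F: module R "free_module R B" by (rule free_module[OF cring_axioms])
  note b = basis_vec_carrier[OF cring_axioms] and l = free_sum_linear[OF assms(1,2)]
  note m = lin_minus[OF F.module_axioms assms(1) l]
  have f: "f (s u) \<in> carrier N" if "u \<in> carrier M" for u using that assms by auto
  have z: "x \<ominus>\<^bsub>N\<^esub> x = \<zero>\<^bsub>N\<^esub>" if "x \<in> carrier N" for x using that by (simp add: a_minus_def N.M.r_neg)
  show ?thesis using assms(6) unfolding slot_relations_def
    by (auto simp: z m b assms(4) lin_add[OF l] lin_smult[OF l] free_sum_basis[OF assms(1,2)] f
        lin_add[OF assms(5)] lin_smult[OF assms(5)])
qed

end

lemma slot_relations_closed:
  assumes "cring R" "module R M" "\<And>u. u \<in> carrier M \<Longrightarrow> s u \<in> B"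
  shows "slot_relations R B M s \<subseteq> carrier (free_module R B)"
proof -
  interpret M: module R M by fact
  interpret F: module R "free_module R B" by (rule free_module[OF assms(1)])
  show ?thesis unfolding slot_relations_def using assms(3)
    by (auto intro!: F.M.minus_closed F.M.a_closed F.smult_closed basis_vec_carrier[OF assms(1)])
qed

section \<open>Multilinear maps and tensor products\<close>

lemma tuples_Nil [simp]: "[] \<in> tuples M n \<longleftrightarrow> n = 0"
  and tuples_Cons [simp]: "x # xs \<in> tuples M n \<longleftrightarrow> x \<in> carrier M \<and> (\<exists>m. n = Suc m \<and> xs \<in> tuples M m)"
  by (auto simp: tuples_def)

lemma tuples_0: "tuples M 0 = {[]}"
  by (auto simp: tuples_def)

lemma tuples_length: "xs \<in> tuples M n \<Longrightarrow> length xs = n"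
  by (simp add: tuples_def)

lemma tuples_Suc_iff: "xs \<in> tuples M (Suc n) \<longleftrightarrow> (\<exists>y ys. xs = y # ys \<and> y \<in> carrier M \<and> ys \<in> tuples M
    n)"
  by (cases xs) auto

lemma tuples_update: "xs \<in> tuples M n \<Longrightarrow> u \<in> carrier M \<Longrightarrow> xs[i := u] \<in> tuples M n"
  using set_update_subset_insert[of xs i u] by (auto simp: tuples_def)

text \<open>Multilinearity by recursion on the head, to match the recursions on lists used later.
  \<open>multi_slot\<close> and \<open>multiI\<close> translate to and from the slotwise form in
  which the relations of a tensor power are given.\<close>

primrec multi :: "('k, 'r) ring_scheme \<Rightarrow> ('k, 'a, 'm) module_scheme \<Rightarrow> ('k, 'n, 'p) module_scheme \<Rightarrow>
    nat
    \<Rightarrow> ('a list \<Rightarrow> 'n) \<Rightarrow> bool" where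
  "multi R M N 0 f \<longleftrightarrow> f [] \<in> carrier N"
| "multi R M N (Suc n) f \<longleftrightarrow> (\<forall>x\<in>carrier M. multi R M N n (\<lambda>xs. f (x # xs))) \<and>
     (\<forall>xs\<in>tuples M n. (\<lambda>x. f (x # xs)) \<in> linear_maps R M N)"

lemma multi_closed: "multi R M N n f \<Longrightarrow> xs \<in> tuples M n \<Longrightarrow> f xs \<in> carrier N"
  by (induction n arbitrary: f xs) (auto simp: tuples_0 tuples_Suc_iff)

lemma multi_cong:
  assumes "module R M" "\<And>xs. xs \<in> tuples M n \<Longrightarrow> f xs = g xs" "multi R M N n f"
  shows "multi R M N n g"
  using assms(2,3)
proof (induction n arbitrary: f g)
  case (Suc n)
  have "multi R M N n (\<lambda>xs. g (x # xs))" if "x \<in> carrier M" for x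
    by (rule Suc.IH[of "\<lambda>xs. f (x # xs)"]) (use that Suc.prems in auto)
  moreover have "(\<lambda>x. g (x # xs)) \<in> linear_maps R M N" if "xs \<in> tuples M n" for xs
    using Suc.prems that lin_cong[OF assms(1), of "\<lambda>x. f (x # xs)" "\<lambda>x. g (x # xs)"] by auto
  ultimately show ?case by simp
qed simp

lemma multi_slot:
  "multi R M N n f \<Longrightarrow> xs \<in> tuples M n \<Longrightarrow> i < n \<Longrightarrow> (\<lambda>u. f (xs[i := u])) \<in> linear_maps R M N"
proof (induction n arbitrary: f xs i)
  case (Suc n)
  then obtain y ys where "xs = y # ys" "y \<in> carrier M" "ys \<in> tuples M n"
      by (auto simp: tuples_Suc_iff)
  with Suc show ?case by (cases i) auto
qed simp

lemma multiI:
  assumes "\<And>xs. xs \<in> tuples M n \<Longrightarrow> f xs \<in> carrier N"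
    "\<And>xs i. xs \<in> tuples M n \<Longrightarrow> i < n \<Longrightarrow> (\<lambda>u. f (xs[i := u])) \<in> linear_maps R M N"
    "\<zero>\<^bsub>M\<^esub> \<in> carrier M"
  shows "multi R M N n f"
  using assms(1,2)
proof (induction n arbitrary: f)
  case (Suc n)
  have "multi R M N n (\<lambda>xs. f (x # xs))" if "x \<in> carrier M" for x
  proof (rule Suc.IH)
    show "f (x # xs) \<in> carrier N" if "xs \<in> tuples M n" for xs using Suc.prems(1) that \<open>x \<in> carrier
        M\<close> by simp
    show "(\<lambda>u. f (x # xs[i := u])) \<in> linear_maps R M N" if "xs \<in> tuples M n" "i < n" for xs i
      using Suc.prems(2)[of "x # xs" "Suc i"] that \<open>x \<in> carrier M\<close> by simp
  qed
  \<comment> \<open>The head slot is reached by updating place 0 of an auxiliary tuple; zero merely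
    provides an entry to be overwritten.\<close>
  moreover have "(\<lambda>x. f (x # xs)) \<in> linear_maps R M N" if "xs \<in> tuples M n" for xs
    using Suc.prems(2)[of "\<zero>\<^bsub>M\<^esub> # xs" 0] that assms(3) by simp
  ultimately show ?case by simp
qed simp

lemma multi_comp:
  assumes "T \<in> linear_maps R N N'" "multi R M N n f"
  shows "multi R M N' n (\<lambda>xs. T (f xs))"
  using assms(2)
proof (induction n arbitrary: f)
  case (Suc n)
  then show ?case by (auto intro!: lin_comp[OF assms(1)])
qed (auto intro: lin_closed[OF assms(1)])

lemma multi_ev:
  assumes "module R N" "L \<in> combs R B" "\<And>x. x \<in> B \<Longrightarrow> multi R M N n (\<lambda>xs. f xs x)"
  shows "multi R M N n (\<lambda>xs. ev N L (f xs))"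
  using assms(3)
proof (induction n arbitrary: f)
  case 0 then show ?case by (auto intro!: ev_closed[OF assms(1,2)])
next
  case (Suc n)
  then show ?case by (auto intro!: ev_lin_param[OF assms(1,2)] Suc.IH)
qed

lemma multi_smult:
  assumes "module R N" "r \<in> carrier R" "multi R M N n f"
  shows "multi R M N n (\<lambda>xs. r \<odot>\<^bsub>N\<^esub> f xs)"
  by (rule multi_comp[OF _ assms(3)])
    (use assms module.smult_r_distr[OF assms(1)] module.smult_assoc1[OF assms(1), symmetric]
      module.smult_closed[OF assms(1)] cring.cring_simprules[OF module.axioms(1)[OF assms(1)]] in
          \<open>auto intro!: linI\<close>)

definition bimulti where
  "bimulti R M M' N p q f \<longleftrightarrow>
    (\<forall>ys\<in>tuples M' q. multi R M N p (\<lambda>xs. f xs ys)) \<and>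
    (\<forall>xs\<in>tuples M p. multi R M' N q (\<lambda>ys. f xs ys))"

definition bilin where
  "bilin R M M' N f \<longleftrightarrow>
    (\<forall>y\<in>carrier M'. (\<lambda>x. f x y) \<in> linear_maps R M N) \<and>
    (\<forall>x\<in>carrier M. (\<lambda>y. f x y) \<in> linear_maps R M' N)"

lemma bilin_closed: "bilin R M M' N f \<Longrightarrow> x \<in> carrier M \<Longrightarrow> y \<in> carrier M' \<Longrightarrow> f x y \<in> carrier N"
  by (auto simp: bilin_def intro: lin_closed)

lemma bimulti_closed: "bimulti R M M' N p q f \<Longrightarrow> xs \<in> tuples M p \<Longrightarrow> ys \<in> tuples M' q
    \<Longrightarrow> f xs ys \<in> carrier N"
  by (auto simp: bimulti_def intro: multi_closed)

subsection \<open>Binary tensor products\<close>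

context
  fixes R :: "('k, 'r) ring_scheme" and M :: "('k, 'a, 'm) module_scheme" and M' ::
      "('k, 'b, 'n) module_scheme"
  assumes M: "module R M" and M': "module R M'"
begin

interpretation M: module R M by (rule M)
interpretation M': module R M' by (rule M')

lemma tensor_presentation: "presentation R (carrier M \<times> carrier M') (tensor_relations R M M')"
  unfolding presentation_def presentation_axioms_def tensor_relations_def
  by (intro conjI Un_least UN_least M.R.cring_axioms slot_relations_closed[OF M.R.cring_axioms M]
      slot_relations_closed[OF M.R.cring_axioms M']) auto

interpretation T: presentation R "carrier M \<times> carrier M'" "tensor_relations R M M'"
  by (rule tensor_presentation)

lemma tensor_module: "module R (tensor R M M')"
  unfolding tensor_def by (rule T.presented_module)

lemma pure_closed: "x \<in> carrier M \<Longrightarrow> y \<in> carrier M' \<Longrightarrow> pure R M M' x y \<in> carrier (tensor R M M')"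
  unfolding tensor_def pure_def by (rule T.generator_closed) simp

lemma pure_bilin: "bilin R M M' (tensor R M M') (pure R M M')"
  unfolding bilin_def pure_def tensor_def
proof (intro conjI ballI)
  show "(\<lambda>x. generator R (carrier M \<times> carrier M') (tensor_relations R M M') (x, y)) \<in> linear_maps R
      M
      (presented_module R (carrier M \<times> carrier M') (tensor_relations R M M'))" if
          "y \<in> carrier M'" for y
    by (rule T.generator_linear[OF _ M, where s = "\<lambda>x. (x, y)"])
        (use that in \<open>auto simp: tensor_relations_def\<close>)
  show "(\<lambda>y. generator R (carrier M \<times> carrier M') (tensor_relations R M M') (x, y)) \<in> linear_maps R
      M'
      (presented_module R (carrier M \<times> carrier M') (tensor_relations R M M'))" if
          "x \<in> carrier M" for x
    by (rule T.generator_linear[OF _ M', where s = "\<lambda>y. (x, y)"])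
        (use that in \<open>auto simp: tensor_relations_def\<close>)
qed

lemma tensor_ext:
  assumes "module R N" "bilin R M M' N (\<lambda>x y. f (x, y))"
  shows "lin_ext R N f \<in> linear_maps R (tensor R M M') N"
    and "x \<in> carrier M \<Longrightarrow> y \<in> carrier M' \<Longrightarrow> lin_ext R N f (pure R M M' x y) = f (x, y)"
proof -
  have f: "f \<in> carrier M \<times> carrier M' \<rightarrow> carrier N" using bilin_closed[OF assms(2)] by auto
  have z: "free_sum R N f q = \<zero>\<^bsub>N\<^esub>" if "q \<in> tensor_relations R M M'" for q
  proof -
    from that show ?thesis unfolding tensor_relations_def
    proof (elim UnE UN_E)
      fix y assume y: "y \<in> carrier M'" "q \<in> slot_relations R (carrier M \<times> carrier M') M
          (\<lambda>u. (u, y))"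
      show ?thesis by (rule T.free_sum_slot[OF assms(1) f M _ _ y(2)])
          (use assms(2) y(1) in \<open>simp_all add: bilin_def\<close>)
    next
      fix x assume x: "x \<in> carrier M" "q \<in> slot_relations R (carrier M \<times> carrier M') M'
          (\<lambda>v. (x, v))"
      show ?thesis by (rule T.free_sum_slot[OF assms(1) f M' _ _ x(2)])
          (use assms(2) x(1) in \<open>simp_all add: bilin_def\<close>)
    qed
  qed
  show "lin_ext R N f \<in> linear_maps R (tensor R M M') N"
    unfolding tensor_def by (rule T.lin_ext_universal(1)[OF assms(1) f z])
  show "x \<in> carrier M \<Longrightarrow> y \<in> carrier M' \<Longrightarrow> lin_ext R N f (pure R M M' x y) = f (x, y)"
    unfolding pure_def by (rule T.lin_ext_universal(2)[OF assms(1) f z]) simp_all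
qed

lemma tensor_rep:
  assumes "X \<in> carrier (tensor R M M')"
  shows "rep R X \<in> combs R (carrier M \<times> carrier M')"
    and "X = ev (tensor R M M') (rep R X) (\<lambda>(x, y). pure R M M' x y)"
proof -
  note X = assms[unfolded tensor_def]
  show "rep R X \<in> combs R (carrier M \<times> carrier M')" by (rule T.rep_combs[OF X])
  show "X = ev (tensor R M M') (rep R X) (\<lambda>(x, y). pure R M M' x y)"
    using T.rep_generator[OF X] by (simp add: tensor_def pure_def case_prod_unfold)
qed

lemma tensor_ev:
  assumes "module R N" "X \<in> carrier (tensor R M M')"
    "\<And>x y. x \<in> carrier M \<Longrightarrow> y \<in> carrier M' \<Longrightarrow> f (x, y) \<in> carrier N"
  shows "lin_ext R N f X = ev N (rep R X) f"
  by (rule T.ev_rep[OF assms(1) _ assms(2)[unfolded tensor_def]]) (use assms(3) in auto)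

end

subsection \<open>Tensor powers\<close>

context
  fixes R :: "('k, 'r) ring_scheme" and M :: "('k, 'a, 'm) module_scheme"
  assumes M: "module R M"
begin

interpretation M: module R M by (rule M)

lemma power_presentation: "presentation R (tuples M n) (power_relations R M n)"
  unfolding presentation_def presentation_axioms_def power_relations_def
  by (intro conjI UN_least M.R.cring_axioms slot_relations_closed[OF M.R.cring_axioms M])
      (rule tuples_update)

lemma tensor_power_module: "module R (tensor_power R M n)"
  unfolding tensor_power_def by (rule presentation.presented_module[OF power_presentation])

lemma pure_power_closed: "xs \<in> tuples M n \<Longrightarrow> pure_power R M xs \<in> carrier (tensor_power R M n)"
  using presentation.generator_closed[OF power_presentation, of xs n]
  by (simp add: tensor_power_def pure_power_def tuples_length)

lemma pure_power_multi: "multi R M (tensor_power R M n) n (pure_power R M)"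
proof (rule multiI)
  fix xs i assume xs: "xs \<in> tuples M n" "i < n"
  have "(\<lambda>u. generator R (tuples M n) (power_relations R M n) (xs[i := u])) \<in> linear_maps R M
      (tensor_power R M n)"
    unfolding tensor_power_def
  proof (rule presentation.generator_linear[OF power_presentation _ M, where s = "\<lambda>u. xs[i := u]"])
    show "slot_relations R (tuples M n) M (\<lambda>u. xs[i := u]) \<subseteq> power_relations R M n"
      unfolding power_relations_def using xs by blast
  qed (use xs in \<open>simp add: tuples_update\<close>)
  then show "(\<lambda>u. pure_power R M (xs[i := u])) \<in> linear_maps R M (tensor_power R M n)"
    using xs by (simp add: pure_power_def tuples_length)
qed (simp_all add: pure_power_closed)

lemma power_ext:
  assumes "module R N" "multi R M N n f"
  shows "lin_ext R N f \<in> linear_maps R (tensor_power R M n) N"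
    and "xs \<in> tuples M n \<Longrightarrow> lin_ext R N f (pure_power R M xs) = f xs"
proof -
  interpret T: presentation R "tuples M n" "power_relations R M n" by (rule power_presentation)
  have f: "f \<in> tuples M n \<rightarrow> carrier N" using multi_closed[OF assms(2)] by auto
  have z: "free_sum R N f q = \<zero>\<^bsub>N\<^esub>" if "q \<in> power_relations R M n" for q
  proof -
    from that show ?thesis unfolding power_relations_def
    proof (elim UN_E)
      fix xs i assume x: "xs \<in> tuples M n" "i \<in> {..<n}" "q \<in> slot_relations R (tuples M n) M
          (\<lambda>u. xs[i := u])"
      show ?thesis
        by (rule T.free_sum_slot[OF assms(1) f M _ _ x(3)]) (use x multi_slot[OF assms(2), of xs i]
            in \<open>simp_all add: tuples_update\<close>)
    qed
  qed
  show "lin_ext R N f \<in> linear_maps R (tensor_power R M n) N"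
    unfolding tensor_power_def by (rule T.lin_ext_universal(1)[OF assms(1) f z])
  show "xs \<in> tuples M n \<Longrightarrow> lin_ext R N f (pure_power R M xs) = f xs"
    using T.lin_ext_universal(2)[OF assms(1) f z, of xs] by (simp add: pure_power_def tuples_length)
qed

lemma power_rep:
  assumes "X \<in> carrier (tensor_power R M n)"
  shows "rep R X \<in> combs R (tuples M n)"
    and "X = ev (tensor_power R M n) (rep R X) (pure_power R M)"
proof -
  interpret T: presentation R "tuples M n" "power_relations R M n" by (rule power_presentation)
  note X = assms[unfolded tensor_power_def]
  show r: "rep R X \<in> combs R (tuples M n)" by (rule T.rep_combs[OF X])
  have "X = ev (tensor_power R M n) (rep R X) (generator R (tuples M n) (power_relations R M n))"
    using T.rep_generator[OF X] by (simp add: tensor_power_def)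
  \<comment> \<open>\<open>pure_power\<close> reads the number of factors off the length of its
    argument, so it agrees with the generator map only on \<open>tuples M n\<close>.\<close>
  also have "\<dots> = ev (tensor_power R M n) (rep R X) (pure_power R M)"
    by (rule ev_cong[OF r]) (simp add: pure_power_def tuples_length)
  finally show "X = ev (tensor_power R M n) (rep R X) (pure_power R M)" .
qed

end

subsection \<open>Mixed tensor powers\<close>

context
  fixes R :: "('k, 'r) ring_scheme" and M :: "('k, 'a, 'm) module_scheme" and M' ::
      "('k, 'b, 'n) module_scheme"
  assumes M: "module R M" and M': "module R M'"
begin

interpretation M: module R M by (rule M)
interpretation M': module R M' by (rule M')

lemma mixed_presentation: "presentation R (tuples M p \<times> tuples M' q) (mixed_relations R M M' p q)"
  unfolding presentation_def presentation_axioms_def mixed_relations_def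
  by (intro conjI Un_least UN_least M.R.cring_axioms slot_relations_closed[OF M.R.cring_axioms M]
      slot_relations_closed[OF M.R.cring_axioms M']) (auto intro: tuples_update)

lemma mixed_module: "module R (mixed_tensor R M M' p q)"
  unfolding mixed_tensor_def by (rule presentation.presented_module[OF mixed_presentation])

lemma pure_mixed_closed:
  "xs \<in> tuples M p \<Longrightarrow> ys \<in> tuples M' q \<Longrightarrow> pure_mixed R M M' xs ys \<in> carrier (mixed_tensor R M M' p q)"
  using presentation.generator_closed[OF mixed_presentation, of "(xs, ys)" p q]
  by (simp add: mixed_tensor_def pure_mixed_def tuples_length)

lemma pure_mixed_bimulti: "bimulti R M M' (mixed_tensor R M M' p q) p q (pure_mixed R M M')"
  unfolding bimulti_def
proof (intro conjI ballI multiI)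
  fix xs ys i assume a: "xs \<in> tuples M p" "ys \<in> tuples M' q" "i < p"
  have "(\<lambda>u. generator R (tuples M p \<times> tuples M' q) (mixed_relations R M M' p q) (xs[i := u], ys)) \<in>
      linear_maps R M (mixed_tensor R M M' p q)"
    unfolding mixed_tensor_def
  proof (rule presentation.generator_linear[OF mixed_presentation _ M, where s =
      "\<lambda>u. (xs[i := u], ys)"])
    show "slot_relations R (tuples M p \<times> tuples M' q) M (\<lambda>u. (xs[i := u], ys)) \<subseteq> mixed_relations R M
        M' p q"
      unfolding mixed_relations_def using a by blast
  qed (use a in \<open>simp add: tuples_update\<close>)
  then show "(\<lambda>u. pure_mixed R M M' (xs[i := u]) ys) \<in> linear_maps R M (mixed_tensor R M M' p q)"
    using a by (simp add: pure_mixed_def tuples_length)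
next
  fix xs ys i assume a: "xs \<in> tuples M p" "ys \<in> tuples M' q" "i < q"
  have "(\<lambda>u. generator R (tuples M p \<times> tuples M' q) (mixed_relations R M M' p q) (xs, ys[i := u])) \<in>
      linear_maps R M' (mixed_tensor R M M' p q)"
    unfolding mixed_tensor_def
  proof (rule presentation.generator_linear[OF mixed_presentation _ M', where s =
      "\<lambda>u. (xs, ys[i := u])"])
    show "slot_relations R (tuples M p \<times> tuples M' q) M' (\<lambda>u. (xs, ys[i := u])) \<subseteq> mixed_relations R
        M M' p q"
      unfolding mixed_relations_def using a by blast
  qed (use a in \<open>simp add: tuples_update\<close>)
  then show "(\<lambda>u. pure_mixed R M M' xs (ys[i := u])) \<in> linear_maps R M' (mixed_tensor R M M' p q)"
    using a by (simp add: pure_mixed_def tuples_length)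
qed (simp_all add: pure_mixed_closed)

lemma mixed_ext:
  assumes "module R N" "bimulti R M M' N p q (\<lambda>xs ys. f (xs, ys))"
  shows "lin_ext R N f \<in> linear_maps R (mixed_tensor R M M' p q) N"
    and "xs \<in> tuples M p \<Longrightarrow> ys \<in> tuples M' q \<Longrightarrow> lin_ext R N f (pure_mixed R M M' xs ys) = f (xs, ys)"
proof -
  interpret T: presentation R "tuples M p \<times> tuples M' q" "mixed_relations R M M' p q" by
      (rule mixed_presentation)
  have f: "f \<in> tuples M p \<times> tuples M' q \<rightarrow> carrier N" using bimulti_closed[OF assms(2)] by auto
  have z: "free_sum R N f r = \<zero>\<^bsub>N\<^esub>" if r: "r \<in> mixed_relations R M M' p q" for r
  proof -
    have m: "multi R M N p (\<lambda>xs. f (xs, ys))" "multi R M' N q (\<lambda>ys. f (xs, ys))"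
      if "xs \<in> tuples M p" "ys \<in> tuples M' q" for xs ys
      using assms(2) that unfolding bimulti_def by simp_all
    from r show ?thesis unfolding mixed_relations_def
    proof (elim UnE UN_E)
      fix xs ys i assume x: "xs \<in> tuples M p" "ys \<in> tuples M' q" "i \<in> {..<p}"
        "r \<in> slot_relations R (tuples M p \<times> tuples M' q) M (\<lambda>u. (xs[i := u], ys))"
      show ?thesis
        by (rule T.free_sum_slot[OF assms(1) f M _ _ x(4)])
          (use x multi_slot[OF m(1)[OF x(1,2)] x(1), of i] in \<open>simp_all add: tuples_update\<close>)
    next
      fix xs ys i assume x: "xs \<in> tuples M p" "ys \<in> tuples M' q" "i \<in> {..<q}"
        "r \<in> slot_relations R (tuples M p \<times> tuples M' q) M' (\<lambda>u. (xs, ys[i := u]))"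
      show ?thesis
        by (rule T.free_sum_slot[OF assms(1) f M' _ _ x(4)])
          (use x multi_slot[OF m(2)[OF x(1,2)] x(2), of i] in \<open>simp_all add: tuples_update\<close>)
    qed
  qed
  show "lin_ext R N f \<in> linear_maps R (mixed_tensor R M M' p q) N"
    unfolding mixed_tensor_def by (rule T.lin_ext_universal(1)[OF assms(1) f z])
  show "xs \<in> tuples M p \<Longrightarrow> ys \<in> tuples M' q \<Longrightarrow> lin_ext R N f (pure_mixed R M M' xs ys) = f (xs, ys)"
    using T.lin_ext_universal(2)[OF assms(1) f z, of "(xs, ys)"] by
        (simp add: pure_mixed_def tuples_length)
qed

lemma mixed_rep:
  assumes "X \<in> carrier (mixed_tensor R M M' p q)"
  shows "rep R X \<in> combs R (tuples M p \<times> tuples M' q)"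
    and "X = ev (mixed_tensor R M M' p q) (rep R X) (\<lambda>(xs, ys). pure_mixed R M M' xs ys)"
proof -
  interpret T: presentation R "tuples M p \<times> tuples M' q" "mixed_relations R M M' p q" by
      (rule mixed_presentation)
  note X = assms[unfolded mixed_tensor_def]
  show r: "rep R X \<in> combs R (tuples M p \<times> tuples M' q)" by (rule T.rep_combs[OF X])
  have "X = ev (mixed_tensor R M M' p q) (rep R X) (generator R (tuples M p \<times> tuples M' q)
      (mixed_relations R M M' p q))"
    using T.rep_generator[OF X] by (simp add: mixed_tensor_def)
  also have "\<dots> = ev (mixed_tensor R M M' p q) (rep R X) (\<lambda>(xs, ys). pure_mixed R M M' xs ys)"
    by (rule ev_cong[OF r]) (auto simp: pure_mixed_def tuples_length)
  finally show "X = ev (mixed_tensor R M M' p q) (rep R X) (\<lambda>(xs, ys). pure_mixed R M M' xs ys)" .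
qed

end

section \<open>Sweedler calculus\<close>

text \<open>\<open>sw N \<Delta>(h) f\<close> is the Sweedler sum \<open>f(h\<^sup>(\<^sup>0\<^sup>), h\<^sup>(\<^sup>1\<^sup>))\<close>.\<close>

definition sw :: "('k, 'n, 'm) module_scheme \<Rightarrow> ('k \<times> 'a \<times> 'b) list \<Rightarrow> ('a \<Rightarrow> 'b \<Rightarrow> 'n) \<Rightarrow> 'n" where
  "sw N L f = ev N L (\<lambda>(u, v). f u v)"

lemma sw_closed:
  "module R N \<Longrightarrow> L \<in> combs R (A \<times> B) \<Longrightarrow> (\<And>u v. u \<in> A \<Longrightarrow> v \<in> B \<Longrightarrow> f u v \<in> carrier N) \<Longrightarrow>
      sw N L f \<in> carrier N"
  unfolding sw_def by (rule ev_closed) auto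

lemma sw_cong:
  "L \<in> combs R (A \<times> B) \<Longrightarrow> (\<And>u v. u \<in> A \<Longrightarrow> v \<in> B \<Longrightarrow> f u v = g u v) \<Longrightarrow> sw N L f = sw N L g"
  unfolding sw_def by (rule ev_cong) auto

lemma sw_smult:
  "module R N \<Longrightarrow> L \<in> combs R (A \<times> B) \<Longrightarrow> (\<And>u v. u \<in> A \<Longrightarrow> v \<in> B \<Longrightarrow> f u v \<in> carrier N) \<Longrightarrow>
    s \<in> carrier R \<Longrightarrow> sw N L (\<lambda>u v. s \<odot>\<^bsub>N\<^esub> f u v) = s \<odot>\<^bsub>N\<^esub> sw N L f"
  unfolding sw_def by (subst ev_smult[symmetric]) (auto intro!: ev_cong)

lemma sw_map:
  assumes "module R M" "module R N" "T \<in> linear_maps R M N" "L \<in> combs R (A \<times> B)"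
    "\<And>u v. u \<in> A \<Longrightarrow> v \<in> B \<Longrightarrow> f u v \<in> carrier M"
  shows "T (sw M L f) = sw N L (\<lambda>u v. T (f u v))"
  unfolding sw_def by (subst ev_map[OF assms(1-4)]) (use assms(5) in \<open>auto intro!: ev_cong[OF
      assms(4)]\<close>)

lemma sw_lin_param:
  assumes "module R N" "L \<in> combs R (A \<times> B)" "\<And>u v. u \<in> A \<Longrightarrow> v \<in> B \<Longrightarrow> (\<lambda>x. f x u v) \<in> linear_maps R M
      N"
  shows "(\<lambda>x. sw N L (f x)) \<in> linear_maps R M N"
  unfolding sw_def by (rule ev_lin_param[OF assms(1,2)]) (use assms(3) in auto)

lemma sw_multi:
  assumes "module R N" "L \<in> combs R (A \<times> B)" "\<And>u v. u \<in> A \<Longrightarrow> v \<in> B \<Longrightarrow> multi R M N n (\<lambda>xs. f xs u v)"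
  shows "multi R M N n (\<lambda>xs. sw N L (f xs))"
  unfolding sw_def by (rule multi_ev[OF assms(1,2)]) (use assms(3) in auto)

lemma sw_sw_swap:
  assumes "module R N" "L \<in> combs R (A \<times> B)" "L' \<in> combs R (A' \<times> B')"
    "\<And>u v x y. u \<in> A \<Longrightarrow> v \<in> B \<Longrightarrow> x \<in> A' \<Longrightarrow> y \<in> B' \<Longrightarrow> f u v x y \<in> carrier N"
  shows "sw N L (\<lambda>u v. sw N L' (f u v)) = sw N L' (\<lambda>x y. sw N L (\<lambda>u v. f u v x y))"
  using ev_swap[OF assms(1-3), of "\<lambda>p q. f (fst p) (snd p) (fst q) (snd q)"] assms(4)
  by (auto simp: sw_def case_prod_unfold)

lemma sw_ev_swap:
  assumes "module R N" "L \<in> combs R (A \<times> B)" "L' \<in> combs R B'"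
    "\<And>u v x. u \<in> A \<Longrightarrow> v \<in> B \<Longrightarrow> x \<in> B' \<Longrightarrow> f u v x \<in> carrier N"
  shows "sw N L (\<lambda>u v. ev N L' (f u v)) = ev N L' (\<lambda>x. sw N L (\<lambda>u v. f u v x))"
  using ev_swap[OF assms(1-3), of "\<lambda>p q. f (fst p) (snd p) q"] assms(4)
  by (auto simp: sw_def case_prod_unfold)

text \<open>\<open>rep\<close> is not linear, so linearity in the decomposed element has to come
  from elsewhere: for bilinear \<open>f\<close> the Sweedler sum is the value at \<open>T x\<close>
  of the linear map that \<open>f\<close> induces on the tensor product.\<close>

lemma sw_arg_lin:
  assumes "module R A" "module R B" "module R N" "T \<in> linear_maps R M (tensor R A B)"
      "module R M" "bilin R A B N f"
  shows "(\<lambda>x. sw N (rep R (T x)) f) \<in> linear_maps R M N"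
proof -
  have b: "bilin R A B N (\<lambda>x y. (\<lambda>(u, v). f u v) (x, y))" using assms(6) by simp
  note e = tensor_ext[OF assms(1-3) b]
  have "sw N (rep R (T x)) f = lin_ext R N (\<lambda>(u, v). f u v) (T x)" if "x \<in> carrier M" for x
    unfolding sw_def
    by (rule tensor_ev[OF assms(1-3), symmetric]) (use that lin_closed[OF assms(4)] bilin_closed[OF
        assms(6)] in auto)
  with lin_comp[OF e(1) assms(4)] show ?thesis
    using lin_cong[OF assms(5), of "\<lambda>x. sw N (rep R (T x)) f" "\<lambda>x. lin_ext R N
        (\<lambda>(u, v). f u v) (T x)"] by auto
qed

definition trilin where
  "trilin R A B C N f \<longleftrightarrow>
    (\<forall>y\<in>carrier B. \<forall>z\<in>carrier C. (\<lambda>x. f x y z) \<in> linear_maps R A N) \<and>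
    (\<forall>x\<in>carrier A. \<forall>z\<in>carrier C. (\<lambda>y. f x y z) \<in> linear_maps R B N) \<and>
    (\<forall>x\<in>carrier A. \<forall>y\<in>carrier B. (\<lambda>z. f x y z) \<in> linear_maps R C N)"

lemma trilin_closed: "trilin R A B C N f \<Longrightarrow> x \<in> carrier A \<Longrightarrow> y \<in> carrier B \<Longrightarrow> z \<in> carrier C
    \<Longrightarrow> f x y z \<in> carrier N"
  unfolding trilin_def by (drule conjunct2, drule conjunct2) (blast dest: lin_closed)

lemma tuples_1: "xs \<in> tuples M (Suc 0) \<longleftrightarrow> (\<exists>x\<in>carrier M. xs = [x])"
  by (auto simp: tuples_Suc_iff tuples_0)

lemma tuples_2: "xs \<in> tuples M (Suc (Suc 0)) \<longleftrightarrow> (\<exists>x\<in>carrier M. \<exists>y\<in>carrier M. xs = [x, y])"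
  by (auto simp: tuples_Suc_iff tuples_0)

locale crossed = comodule_coalgebra R H C for R (structure) and H (structure) and C (structure) +
  assumes bij: "bij_betw (antipode H) (carrier H) (carrier H)"
begin

lemma modH: "module R H" by (rule H.module_axioms)
lemma modC: "module R C" by (rule module_axioms)
lemma R_cring: "cring R" by (rule module.axioms(1)[OF modC])

abbreviation \<Delta>\<^sub>H where "\<Delta>\<^sub>H h \<equiv> rep R (comult H h)"
abbreviation \<Delta>\<^sub>C where "\<Delta>\<^sub>C a \<equiv> rep R (comult C a)"
abbreviation \<rho> where "\<rho> a \<equiv> rep R (coact C a)"
abbreviation S where "S \<equiv> antipode H"
abbreviation T where "T \<equiv> antipode_inv H"
abbreviation mulH (infixl "\<cdot>" 70) where "x \<cdot> y \<equiv> x \<otimes>\<^bsub>H\<^esub> y"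

lemma comultH_closed: "h \<in> carrier H \<Longrightarrow> comult H h \<in> carrier (tensor R H H)"
  and comultC_closed: "a \<in> carrier C \<Longrightarrow> comult C a \<in> carrier (tensor R C C)"
  and coact_closed: "a \<in> carrier C \<Longrightarrow> coact C a \<in> carrier (tensor R H C)"
  by (rule lin_closed[OF H.comult_linear] lin_closed[OF comult_linear] lin_closed[OF coact_linear],
      assumption)+

lemma comultH_combs: "h \<in> carrier H \<Longrightarrow> \<Delta>\<^sub>H h \<in> combs R (carrier H \<times> carrier H)"
  and comultC_combs: "a \<in> carrier C \<Longrightarrow> \<Delta>\<^sub>C a \<in> combs R (carrier C \<times> carrier C)"
  and coact_combs: "a \<in> carrier C \<Longrightarrow> \<rho> a \<in> combs R (carrier H \<times> carrier C)"
  by (blast intro: tensor_rep(1)[OF modH modH] tensor_rep(1)[OF modC modC] tensor_rep(1)[OF modH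
      modC]
      comultH_closed comultC_closed coact_closed)+

lemma S_closed [simp]: "h \<in> carrier H \<Longrightarrow> S h \<in> carrier H"
  by (rule lin_closed[OF H.antipode_linear])

lemma T_closed [simp]: "h \<in> carrier H \<Longrightarrow> T h \<in> carrier H"
  using bij_betw_inv_into[OF bij] by (auto simp: antipode_inv_def bij_betw_def)

lemma S_T [simp]: "h \<in> carrier H \<Longrightarrow> S (T h) = h"
  unfolding antipode_inv_def by (rule bij_betw_inv_into_right[OF bij])

lemma S_inj: "x \<in> carrier H \<Longrightarrow> y \<in> carrier H \<Longrightarrow> S x = S y \<Longrightarrow> x = y"
  using bij by (auto simp: bij_betw_def inj_on_def)

text \<open>Each equation is checked after applying \<open>S\<close>, which is linear and
  injective.\<close>

lemma T_lin: "T \<in> linear_maps R H H"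
proof (rule linI)
  fix x y r assume x: "x \<in> carrier H"
  show "T x \<in> carrier H" using x by simp
  { fix y assume y: "y \<in> carrier H"
    show "T (x \<oplus>\<^bsub>H\<^esub> y) = T x \<oplus>\<^bsub>H\<^esub> T y"
      by (rule S_inj) (use x y in \<open>simp_all add: lin_add[OF H.antipode_linear]\<close>) }
  { fix r assume r: "r \<in> carrier R"
    show "T (r \<odot>\<^bsub>H\<^esub> x) = r \<odot>\<^bsub>H\<^esub> T x"
      by (rule S_inj) (use x r in \<open>simp_all add: lin_smult[OF H.antipode_linear]\<close>) }
qed

lemma epsH_closed [simp]: "h \<in> carrier H \<Longrightarrow> counit H h \<in> carrier R"
  and epsC_closed [simp]: "a \<in> carrier C \<Longrightarrow> counit C a \<in> carrier R"
  using lin_closed[OF H.counit_linear] lin_closed[OF counit_linear] by simp_all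

lemma mult_lin_left: "k \<in> carrier H \<Longrightarrow> (\<lambda>x. x \<cdot> k) \<in> linear_maps R H H"
  and mult_lin_right: "k \<in> carrier H \<Longrightarrow> (\<lambda>x. k \<cdot> x) \<in> linear_maps R H H"
  by (auto intro!: linI simp: H.smult_mult_left H.smult_mult_right H.A.l_distr H.A.r_distr)

lemma mult_lin_left_comp: "g \<in> linear_maps R M H \<Longrightarrow> k \<in> carrier H \<Longrightarrow> (\<lambda>x. g x \<cdot> k) \<in> linear_maps R M
    H"
  and mult_lin_right_comp: "g \<in> linear_maps R M H \<Longrightarrow> k \<in> carrier H \<Longrightarrow> (\<lambda>x. k \<cdot> g x) \<in> linear_maps R M
      H"
  using lin_comp[OF mult_lin_left, of k g] lin_comp[OF mult_lin_right, of k g] by blast+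

lemma id_lin: "module R M \<Longrightarrow> (\<lambda>x. x) \<in> linear_maps R M M"
  by (rule linI) auto

context
  fixes N :: "('a, 'n, 'p) module_scheme"
  assumes N: "module R N"
begin

interpretation N: module R N by (rule N)

lemma sw_comultH_lin: "bilin R H H N f \<Longrightarrow> (\<lambda>h. sw N (\<Delta>\<^sub>H h) f) \<in> linear_maps R H N"
  by (rule sw_arg_lin[OF modH modH N H.comult_linear modH])

lemma sw_comultC_lin: "bilin R C C N f \<Longrightarrow> (\<lambda>h. sw N (\<Delta>\<^sub>C h) f) \<in> linear_maps R C N"
  by (rule sw_arg_lin[OF modC modC N comult_linear modC])

lemma sw_coact_lin: "bilin R H C N f \<Longrightarrow> (\<lambda>h. sw N (\<rho> h) f) \<in> linear_maps R C N"
  by (rule sw_arg_lin[OF modH modC N coact_linear modC])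

lemma lin_ext_comultH: "h \<in> carrier H \<Longrightarrow> (\<And>x y. x \<in> carrier H \<Longrightarrow> y \<in> carrier H \<Longrightarrow> f (x, y) \<in> carrier N)
    \<Longrightarrow>
    lin_ext R N f (comult H h) = sw N (\<Delta>\<^sub>H h) (\<lambda>u v. f (u, v))"
  unfolding sw_def case_prod_unfold prod.collapse by (rule tensor_ev[OF modH modH N comultH_closed])

lemma lin_ext_comultC: "h \<in> carrier C \<Longrightarrow> (\<And>x y. x \<in> carrier C \<Longrightarrow> y \<in> carrier C \<Longrightarrow> f (x, y) \<in> carrier N)
    \<Longrightarrow>
    lin_ext R N f (comult C h) = sw N (\<Delta>\<^sub>C h) (\<lambda>u v. f (u, v))"
  unfolding sw_def case_prod_unfold prod.collapse by (rule tensor_ev[OF modC modC N comultC_closed])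

lemma lin_ext_coact: "h \<in> carrier C \<Longrightarrow> (\<And>x y. x \<in> carrier H \<Longrightarrow> y \<in> carrier C \<Longrightarrow> f (x, y) \<in> carrier N) \<Longrightarrow>
    lin_ext R N f (coact C h) = sw N (\<rho> h) (\<lambda>u v. f (u, v))"
  unfolding sw_def case_prod_unfold prod.collapse by (rule tensor_ev[OF modH modC N coact_closed])

lemma sw_comultH_closed: "h \<in> carrier H \<Longrightarrow> (\<And>u v. u \<in> carrier H \<Longrightarrow> v \<in> carrier H \<Longrightarrow> f u v \<in> carrier N)
    \<Longrightarrow> sw N (\<Delta>\<^sub>H h) f \<in> carrier N"
  and sw_comultC_closed: "a \<in> carrier C \<Longrightarrow> (\<And>u v. u \<in> carrier C \<Longrightarrow> v \<in> carrier C \<Longrightarrow> f' u v \<in> carrier N)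
      \<Longrightarrow> sw N (\<Delta>\<^sub>C a) f' \<in> carrier N"
  and sw_coact_closed: "a \<in> carrier C \<Longrightarrow> (\<And>u v. u \<in> carrier H \<Longrightarrow> v \<in> carrier C \<Longrightarrow> f'' u v \<in> carrier N)
      \<Longrightarrow> sw N (\<rho> a) f'' \<in> carrier N"
  by (rule sw_closed[OF N comultH_combs], assumption+)
    (rule sw_closed[OF N comultC_combs], assumption+, rule sw_closed[OF N coact_combs], assumption+)

end

lemma sw_comultH_cong: "h \<in> carrier H \<Longrightarrow> (\<And>u v. u \<in> carrier H \<Longrightarrow> v \<in> carrier H \<Longrightarrow> f u v = g u v) \<Longrightarrow>
    sw N (\<Delta>\<^sub>H h) f = sw N (\<Delta>\<^sub>H h) g"
  by (rule sw_cong[OF comultH_combs])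
lemma sw_comultC_cong: "a \<in> carrier C \<Longrightarrow> (\<And>u v. u \<in> carrier C \<Longrightarrow> v \<in> carrier C \<Longrightarrow> f u v = g u v) \<Longrightarrow>
    sw N (\<Delta>\<^sub>C a) f = sw N (\<Delta>\<^sub>C a) g"
  by (rule sw_cong[OF comultC_combs])
lemma sw_coact_cong: "a \<in> carrier C \<Longrightarrow> (\<And>u v. u \<in> carrier H \<Longrightarrow> v \<in> carrier C \<Longrightarrow> f u v = g u v) \<Longrightarrow>
    sw N (\<rho> a) f = sw N (\<rho> a) g"
  by (rule sw_cong[OF coact_combs])

text \<open>Membership and value are tracked together, since a nested \<^const>\<open>lin_ext\<close> can be taken apart
  only when all its values are known to lie in the target.\<close>

definition sends where "sends P L X v \<longleftrightarrow> X \<in> carrier P \<and> L X = v"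

lemma sendsI: "X \<in> carrier P \<Longrightarrow> L X = v \<Longrightarrow> sends P L X v"
  by (simp add: sends_def)

lemma sendsD: "sends P L X v \<Longrightarrow> L X = v" "sends P L X v \<Longrightarrow> X \<in> carrier P"
  by (simp_all add: sends_def)

context
  fixes P :: "('a, 'p, 'x) module_scheme" and N :: "('a, 'n, 'y) module_scheme" and L
  assumes P: "module R P" and N: "module R N" and L: "L \<in> linear_maps R P N"
begin

lemma sends_dH:
  assumes "h \<in> carrier H" "\<And>x y. x \<in> carrier H \<Longrightarrow> y \<in> carrier H \<Longrightarrow> sends P L (F (x, y)) (g x y)"
  shows "sends P L (lin_ext R P F (comult H h)) (sw N (\<Delta>\<^sub>H h) g)"
proof -
  have c: "F (x, y) \<in> carrier P" if "x \<in> carrier H" "y \<in> carrier H" for x y using assms(2)[OF that]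
      by (simp add: sends_def)
  have e: "lin_ext R P F (comult H h) = sw P (\<Delta>\<^sub>H h) (\<lambda>u v. F (u, v))"
    by (rule lin_ext_comultH[OF P assms(1)]) (rule c)
  have "L (lin_ext R P F (comult H h)) = sw N (\<Delta>\<^sub>H h) (\<lambda>u v. L (F (u, v)))"
    unfolding e by (rule sw_map[OF P N L comultH_combs[OF assms(1)], of "\<lambda>u v. F (u, v)"]) (rule c)
  also have "\<dots> = sw N (\<Delta>\<^sub>H h) g" by (rule sw_comultH_cong[OF assms(1)])
      (use assms(2) in \<open>simp add: sends_def\<close>)
  finally show ?thesis using sw_comultH_closed[OF P assms(1), of "\<lambda>u v. F (u, v)"] c by
      (simp add: sends_def e)
qed

lemma sends_dC:
  assumes "h \<in> carrier C" "\<And>x y. x \<in> carrier C \<Longrightarrow> y \<in> carrier C \<Longrightarrow> sends P L (F (x, y)) (g x y)"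
  shows "sends P L (lin_ext R P F (comult C h)) (sw N (\<Delta>\<^sub>C h) g)"
proof -
  have c: "F (x, y) \<in> carrier P" if "x \<in> carrier C" "y \<in> carrier C" for x y using assms(2)[OF that]
      by (simp add: sends_def)
  have e: "lin_ext R P F (comult C h) = sw P (\<Delta>\<^sub>C h) (\<lambda>u v. F (u, v))"
    by (rule lin_ext_comultC[OF P assms(1)]) (rule c)
  have "L (lin_ext R P F (comult C h)) = sw N (\<Delta>\<^sub>C h) (\<lambda>u v. L (F (u, v)))"
    unfolding e by (rule sw_map[OF P N L comultC_combs[OF assms(1)], of "\<lambda>u v. F (u, v)"]) (rule c)
  also have "\<dots> = sw N (\<Delta>\<^sub>C h) g" by (rule sw_comultC_cong[OF assms(1)])
      (use assms(2) in \<open>simp add: sends_def\<close>)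
  finally show ?thesis using sw_comultC_closed[OF P assms(1), of "\<lambda>u v. F (u, v)"] c by
      (simp add: sends_def e)
qed

lemma sends_co:
  assumes "h \<in> carrier C" "\<And>x y. x \<in> carrier H \<Longrightarrow> y \<in> carrier C \<Longrightarrow> sends P L (F (x, y)) (g x y)"
  shows "sends P L (lin_ext R P F (coact C h)) (sw N (\<rho> h) g)"
proof -
  have c: "F (x, y) \<in> carrier P" if "x \<in> carrier H" "y \<in> carrier C" for x y using assms(2)[OF that]
      by (simp add: sends_def)
  have e: "lin_ext R P F (coact C h) = sw P (\<rho> h) (\<lambda>u v. F (u, v))"
    by (rule lin_ext_coact[OF P assms(1)]) (rule c)
  have "L (lin_ext R P F (coact C h)) = sw N (\<rho> h) (\<lambda>u v. L (F (u, v)))"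
    unfolding e by (rule sw_map[OF P N L coact_combs[OF assms(1)], of "\<lambda>u v. F (u, v)"]) (rule c)
  also have "\<dots> = sw N (\<rho> h) g" by (rule sw_coact_cong[OF assms(1)])
      (use assms(2) in \<open>simp add: sends_def\<close>)
  finally show ?thesis using sw_coact_closed[OF P assms(1), of "\<lambda>u v. F (u, v)"] c by
      (simp add: sends_def e)
qed

end

subsection \<open>The axioms evaluated on multilinear maps\<close>

context
  fixes N :: "('a, 'n, 'p) module_scheme"
  assumes N: "module R N"
begin

interpretation N: module R N by (rule N)

text \<open>The axiom equates two elements of a triple tensor power. The linear map induced by
  \<open>f\<close> sends them to the two sides here. Such test maps transfer the remaining axioms
  below in the same way.\<close>

lemma coassocH:
  assumes h: "h \<in> carrier H" and f: "trilin R H H H N f"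
  shows "sw N (\<Delta>\<^sub>H h) (\<lambda>x y. sw N (\<Delta>\<^sub>H x) (\<lambda>u v. f u v y)) = sw N (\<Delta>\<^sub>H h) (\<lambda>x y. sw N (\<Delta>\<^sub>H y)
      (\<lambda>u v. f x u v))"
proof -
  define F where "F = (\<lambda>xs. f (xs ! 0) (xs ! 1) (xs ! 2))"
  let ?P = "tensor_power R H 3"
  have P: "module R ?P" by (rule tensor_power_module[OF modH])
  have m: "multi R H N 3 F" using f
    by (auto simp: F_def numeral_3_eq_3 tuples_0 tuples_1 tuples_2 trilin_closed[OF f]) (auto simp:
        trilin_def)
  note e = power_ext[OF modH N m]
  have p: "sends ?P (lin_ext R N F) (pure_power R H [x, y, z]) (f x y z)"
    if "x \<in> carrier H" "y \<in> carrier H" "z \<in> carrier H" for x y z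
    using that pure_power_closed[OF modH, of "[x, y, z]" 3] e(2)[of "[x, y, z]"] by
        (simp add: F_def numeral_3_eq_3 sends_def)
  have l: "sends ?P (lin_ext R N F) (lin_ext R ?P (\<lambda>(x, y). lin_ext R ?P
      (\<lambda>(u, v). pure_power R H [u, v, y]) (comult H x)) (comult H h))
     (sw N (\<Delta>\<^sub>H h) (\<lambda>x y. sw N (\<Delta>\<^sub>H x) (\<lambda>u v. f u v y)))"
    by (rule sends_dH[OF P N e(1) h], unfold prod.case, rule sends_dH[OF P N e(1)])
        (simp_all add: p)
  have r: "sends ?P (lin_ext R N F) (lin_ext R ?P (\<lambda>(x, y). lin_ext R ?P
      (\<lambda>(u, v). pure_power R H [x, u, v]) (comult H y)) (comult H h))
     (sw N (\<Delta>\<^sub>H h) (\<lambda>x y. sw N (\<Delta>\<^sub>H y) (\<lambda>u v. f x u v)))"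
    by (rule sends_dH[OF P N e(1) h], unfold prod.case, rule sends_dH[OF P N e(1)])
        (simp_all add: p)
  show ?thesis using H.coassoc[OF h] sendsD(1)[OF l] sendsD(1)[OF r] by simp
qed

lemma counitH_left:
  assumes h: "h \<in> carrier H" and f: "f \<in> linear_maps R H N"
  shows "sw N (\<Delta>\<^sub>H h) (\<lambda>x y. counit H x \<odot>\<^bsub>N\<^esub> f y) = f h"
proof -
  have "sends H f (lin_ext R H (\<lambda>(x, y). counit H x \<odot>\<^bsub>H\<^esub> y) (comult H h)) (sw N (\<Delta>\<^sub>H h)
      (\<lambda>x y. counit H x \<odot>\<^bsub>N\<^esub> f y))"
    by (rule sends_dH[OF modH N f h]) (simp add: sends_def lin_smult[OF f])
  then show ?thesis using H.counit_left[OF h] by (simp add: sends_def)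
qed

lemma counitH_right:
  assumes h: "h \<in> carrier H" and f: "f \<in> linear_maps R H N"
  shows "sw N (\<Delta>\<^sub>H h) (\<lambda>x y. counit H y \<odot>\<^bsub>N\<^esub> f x) = f h"
proof -
  have "sends H f (lin_ext R H (\<lambda>(x, y). counit H y \<odot>\<^bsub>H\<^esub> x) (comult H h)) (sw N (\<Delta>\<^sub>H h)
      (\<lambda>x y. counit H y \<odot>\<^bsub>N\<^esub> f x))"
    by (rule sends_dH[OF modH N f h]) (simp add: sends_def lin_smult[OF f])
  then show ?thesis using H.counit_right[OF h] by (simp add: sends_def)
qed

lemma antipodeH_left:
  assumes h: "h \<in> carrier H" and f: "f \<in> linear_maps R H N"
  shows "sw N (\<Delta>\<^sub>H h) (\<lambda>x y. f (S x \<cdot> y)) = counit H h \<odot>\<^bsub>N\<^esub> f \<one>\<^bsub>H\<^esub>"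
proof -
  have "sends H f (lin_ext R H (\<lambda>(x, y). S x \<cdot> y) (comult H h)) (sw N (\<Delta>\<^sub>H h) (\<lambda>x y. f (S x \<cdot> y)))"
    by (rule sends_dH[OF modH N f h]) (simp add: sends_def)
  then show ?thesis using H.antipode_left[OF h] h by (simp add: sends_def lin_smult[OF f])
qed

lemma antipodeH_right:
  assumes h: "h \<in> carrier H" and f: "f \<in> linear_maps R H N"
  shows "sw N (\<Delta>\<^sub>H h) (\<lambda>x y. f (x \<cdot> S y)) = counit H h \<odot>\<^bsub>N\<^esub> f \<one>\<^bsub>H\<^esub>"
proof -
  have "sends H f (lin_ext R H (\<lambda>(x, y). x \<cdot> S y) (comult H h)) (sw N (\<Delta>\<^sub>H h) (\<lambda>x y. f (x \<cdot> S y)))"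
    by (rule sends_dH[OF modH N f h]) (simp add: sends_def)
  then show ?thesis using H.antipode_right[OF h] h by (simp add: sends_def lin_smult[OF f])
qed

lemma comultH_mult:
  assumes g: "g \<in> carrier H" and h: "h \<in> carrier H" and f: "bilin R H H N f"
  shows "sw N (\<Delta>\<^sub>H (g \<cdot> h)) f = sw N (\<Delta>\<^sub>H g) (\<lambda>g0 g1. sw N (\<Delta>\<^sub>H h) (\<lambda>h0 h1. f (g0 \<cdot> h0) (g1 \<cdot> h1)))"
proof -
  let ?P = "tensor R H H"
  let ?L = "lin_ext R N (\<lambda>(x, y). f x y)"
  have P: "module R ?P" by (rule tensor_module[OF modH modH])
  have b: "bilin R H H N (\<lambda>x y. (\<lambda>(x, y). f x y) (x, y))" using f by simp
  note e = tensor_ext[OF modH modH N b]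
  have p: "sends ?P ?L (pure R H H x y) (f x y)" if "x \<in> carrier H" "y \<in> carrier H" for x y
    using that pure_closed[OF modH modH] e(2) by (simp add: sends_def)
  have "sends ?P ?L (lin_ext R ?P (\<lambda>(g0, g1). lin_ext R ?P (\<lambda>(h0, h1). pure R H H (g0 \<cdot> h0) (g1 \<cdot>
      h1)) (comult H h)) (comult H g))
     (sw N (\<Delta>\<^sub>H g) (\<lambda>g0 g1. sw N (\<Delta>\<^sub>H h) (\<lambda>h0 h1. f (g0 \<cdot> h0) (g1 \<cdot> h1))))"
    by (rule sends_dH[OF P N e(1) g], unfold prod.case, rule sends_dH[OF P N e(1) h]) (simp add: p)
  moreover have "?L (comult H (g \<cdot> h)) = sw N (\<Delta>\<^sub>H (g \<cdot> h)) f"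
    using g h by (subst lin_ext_comultH[OF N]) (auto simp: bilin_closed[OF f])
  ultimately show ?thesis using H.comult_mult[OF g h] by (simp add: sends_def)
qed

lemma comultH_one:
  assumes f: "bilin R H H N f"
  shows "sw N (\<Delta>\<^sub>H \<one>\<^bsub>H\<^esub>) f = f \<one>\<^bsub>H\<^esub> \<one>\<^bsub>H\<^esub>"
proof -
  let ?L = "lin_ext R N (\<lambda>(x, y). f x y)"
  have b: "bilin R H H N (\<lambda>x y. (\<lambda>(x, y). f x y) (x, y))" using f by simp
  have "?L (comult H \<one>\<^bsub>H\<^esub>) = sw N (\<Delta>\<^sub>H \<one>\<^bsub>H\<^esub>) f"
    by (subst lin_ext_comultH[OF N]) (auto simp: bilin_closed[OF f])
  then show ?thesis using tensor_ext(2)[OF modH modH N b, of "\<one>\<^bsub>H\<^esub>" "\<one>\<^bsub>H\<^esub>"] by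
      (simp add: H.comult_one)
qed

lemma co_coassoc:
  assumes a: "a \<in> carrier C" and f: "trilin R H H C N f"
  shows "sw N (\<rho> a) (\<lambda>h c. sw N (\<Delta>\<^sub>H h) (\<lambda>h0 h1. f h0 h1 c)) = sw N (\<rho> a) (\<lambda>h c. sw N (\<rho> c)
      (\<lambda>h' c'. f h h' c'))"
proof -
  define F where "F = (\<lambda>(xs, ys). f (xs ! 0) (xs ! 1) (ys ! 0))"
  let ?P = "mixed_tensor R H C 2 1"
  have P: "module R ?P" by (rule mixed_module[OF modH modC])
  have m: "bimulti R H C N 2 1 (\<lambda>xs ys. F (xs, ys))" using f
    by (auto simp: bimulti_def F_def numeral_2_eq_2 tuples_0 tuples_1 tuples_2 trilin_closed[OF f])
        (auto simp: trilin_def)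
  note e = mixed_ext[OF modH modC N m]
  have p: "sends ?P (lin_ext R N F) (pure_mixed R H C [x, y] [z]) (f x y z)"
    if "x \<in> carrier H" "y \<in> carrier H" "z \<in> carrier C" for x y z
    using that pure_mixed_closed[OF modH modC, of "[x, y]" 2 "[z]" 1] e(2)[of "[x, y]" "[z]"]
        by (simp add: F_def numeral_2_eq_2 sends_def)
  have l: "sends ?P (lin_ext R N F) (lin_ext R ?P (\<lambda>(h, c). lin_ext R ?P
      (\<lambda>(h0, h1). pure_mixed R H C [h0, h1] [c]) (comult H h)) (coact C a))
     (sw N (\<rho> a) (\<lambda>h c. sw N (\<Delta>\<^sub>H h) (\<lambda>h0 h1. f h0 h1 c)))"
    by (rule sends_co[OF P N e(1) a], unfold prod.case, rule sends_dH[OF P N e(1)])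
        (simp_all add: p del: One_nat_def)
  have r: "sends ?P (lin_ext R N F) (lin_ext R ?P (\<lambda>(h, c). lin_ext R ?P
      (\<lambda>(h', c'). pure_mixed R H C [h, h'] [c']) (coact C c)) (coact C a))
     (sw N (\<rho> a) (\<lambda>h c. sw N (\<rho> c) (\<lambda>h' c'. f h h' c')))"
    by (rule sends_co[OF P N e(1) a], unfold prod.case, rule sends_co[OF P N e(1)])
        (simp_all add: p del: One_nat_def)
  show ?thesis using coact_coassoc[OF a] sendsD(1)[OF l] sendsD(1)[OF r] by simp
qed

lemma co_counit:
  assumes a: "a \<in> carrier C" and f: "f \<in> linear_maps R C N"
  shows "sw N (\<rho> a) (\<lambda>h c. counit H h \<odot>\<^bsub>N\<^esub> f c) = f a"
proof -
  have "sends C f (lin_ext R C (\<lambda>(h, c). counit H h \<odot>\<^bsub>C\<^esub> c) (coact C a)) (sw N (\<rho> a)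
      (\<lambda>h c. counit H h \<odot>\<^bsub>N\<^esub> f c))"
    by (rule sends_co[OF modC N f a]) (simp add: sends_def lin_smult[OF f])
  then show ?thesis using coact_counit[OF a] by (simp add: sends_def)
qed

text \<open>Expresses that the comultiplication of \<open>C\<close> is colinear for the diagonal
  coaction on pairs. It lets the two copies produced by a coface act on earlier places as the
  original entry did.\<close>

lemma co_comult:
  assumes a: "a \<in> carrier C" and f: "trilin R H C C N f"
  shows "sw N (\<Delta>\<^sub>C a) (\<lambda>a0 a1. sw N (\<rho> a0) (\<lambda>h b. sw N (\<rho> a1) (\<lambda>h' b'. f (h \<cdot> h') b b'))) =
    sw N (\<rho> a) (\<lambda>h c. sw N (\<Delta>\<^sub>C c) (\<lambda>c0 c1. f h c0 c1))"
proof -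
  define F where "F = (\<lambda>(xs, ys). f (xs ! 0) (ys ! 0) (ys ! 1))"
  let ?P = "mixed_tensor R H C 1 2"
  have P: "module R ?P" by (rule mixed_module[OF modH modC])
  have m: "bimulti R H C N 1 2 (\<lambda>xs ys. F (xs, ys))" using f
    by (auto simp: bimulti_def F_def numeral_2_eq_2 tuples_0 tuples_1 tuples_2 trilin_closed[OF f])
        (auto simp: trilin_def)
  note e = mixed_ext[OF modH modC N m]
  have p: "sends ?P (lin_ext R N F) (pure_mixed R H C [x] [y, z]) (f x y z)"
    if "x \<in> carrier H" "y \<in> carrier C" "z \<in> carrier C" for x y z
    using that pure_mixed_closed[OF modH modC, of "[x]" 1 "[y, z]" 2] e(2)[of "[x]" "[y, z]"]
        by (simp add: F_def numeral_2_eq_2 sends_def)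
  have l: "sends ?P (lin_ext R N F) (lin_ext R ?P (\<lambda>(a0, a1). lin_ext R ?P
      (\<lambda>(h, b). lin_ext R ?P (\<lambda>(h', b'). pure_mixed R H C [h \<cdot> h'] [b, b']) (coact C a1)) (coact C
      a0)) (comult C a))
     (sw N (\<Delta>\<^sub>C a) (\<lambda>a0 a1. sw N (\<rho> a0) (\<lambda>h b. sw N (\<rho> a1) (\<lambda>h' b'. f (h \<cdot> h') b b'))))"
    by (rule sends_dC[OF P N e(1) a], unfold prod.case, rule sends_co[OF P N e(1)], assumption,
        unfold prod.case, rule sends_co[OF P N e(1)]) (simp_all add: p del: One_nat_def)
  have r: "sends ?P (lin_ext R N F) (lin_ext R ?P (\<lambda>(h, c). lin_ext R ?P
      (\<lambda>(c0, c1). pure_mixed R H C [h] [c0, c1]) (comult C c)) (coact C a))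
     (sw N (\<rho> a) (\<lambda>h c. sw N (\<Delta>\<^sub>C c) (\<lambda>c0 c1. f h c0 c1)))"
    by (rule sends_co[OF P N e(1) a], unfold prod.case, rule sends_dC[OF P N e(1)])
        (simp_all add: p del: One_nat_def)
  show ?thesis using coact_comult[OF a] sendsD(1)[OF l] sendsD(1)[OF r] by simp
qed

text \<open>Expresses colinearity of the counit of \<open>C\<close>: once the coacted entry is
  erased by the counit, its leg may be replaced by \<open>\<one>\<close>. Codegeneracies use this to
  discard the leg of a deleted entry.\<close>

lemma counit_co:
  assumes a: "a \<in> carrier C" and f: "f \<in> linear_maps R H N"
  shows "sw N (\<rho> a) (\<lambda>h c. counit C c \<odot>\<^bsub>N\<^esub> f h) = counit C a \<odot>\<^bsub>N\<^esub> f \<one>\<^bsub>H\<^esub>"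
proof -
  have "sends H f (lin_ext R H (\<lambda>(h, c). counit C c \<odot>\<^bsub>H\<^esub> h) (coact C a)) (sw N (\<rho> a)
      (\<lambda>h c. counit C c \<odot>\<^bsub>N\<^esub> f h))"
    by (rule sends_co[OF modH N f a]) (simp add: sends_def lin_smult[OF f])
  then show ?thesis using counit_coact[OF a] a by (simp add: sends_def lin_smult[OF f])
qed

end

subsection \<open>The antipode and its inverse\<close>

lemma sw_comultH_lin_param: "module R N \<Longrightarrow> h \<in> carrier H \<Longrightarrow>
    (\<And>u v. u \<in> carrier H \<Longrightarrow> v \<in> carrier H \<Longrightarrow> (\<lambda>x. f x u v) \<in> linear_maps R M N) \<Longrightarrow>
    (\<lambda>x. sw N (\<Delta>\<^sub>H h) (f x)) \<in> linear_maps R M N"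
  by (rule sw_lin_param[OF _ comultH_combs])
lemma sw_comultC_lin_param: "module R N \<Longrightarrow> a \<in> carrier C \<Longrightarrow>
    (\<And>u v. u \<in> carrier C \<Longrightarrow> v \<in> carrier C \<Longrightarrow> (\<lambda>x. f x u v) \<in> linear_maps R M N) \<Longrightarrow>
    (\<lambda>x. sw N (\<Delta>\<^sub>C a) (f x)) \<in> linear_maps R M N"
  by (rule sw_lin_param[OF _ comultC_combs])
lemma sw_coact_lin_param: "module R N \<Longrightarrow> a \<in> carrier C \<Longrightarrow>
    (\<And>u v. u \<in> carrier H \<Longrightarrow> v \<in> carrier C \<Longrightarrow> (\<lambda>x. f x u v) \<in> linear_maps R M N) \<Longrightarrow>
    (\<lambda>x. sw N (\<rho> a) (f x)) \<in> linear_maps R M N"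
  by (rule sw_lin_param[OF _ coact_combs])

text \<open>Both sides are contractions of \<open>S(g\<^sup>(\<^sup>0\<^sup>) h\<^sup>(\<^sup>0\<^sup>)) g\<^sup>(\<^sup>1\<^sup>) h\<^sup>(\<^sup>1\<^sup>) S(h\<^sup>(\<^sup>2\<^sup>)) S(g\<^sup>(\<^sup>2\<^sup>))\<close>,
  contracted from the right and from the left.\<close>

lemma antipode_mult:
  assumes g: "g \<in> carrier H" and h: "h \<in> carrier H"
  shows "S (g \<cdot> h) = S h \<cdot> S g"
proof -
  note [simp] = sw_comultH_closed[OF modH] g h H.A.m_assoc
  note cg = sw_comultH_cong
  note lins = mult_lin_right sw_comultH_lin_param[OF modH] mult_lin_left_comp mult_lin_right_comp
      lin_comp[OF H.antipode_linear] id_lin[OF modH]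
  let ?X = "sw H (\<Delta>\<^sub>H g) (\<lambda>g0 g'. sw H (\<Delta>\<^sub>H g') (\<lambda>g1 g2. sw H (\<Delta>\<^sub>H h) (\<lambda>h0 h'. sw H (\<Delta>\<^sub>H h')
      (\<lambda>h1 h2.
     S (g0 \<cdot> h0) \<cdot> (g1 \<cdot> (h1 \<cdot> (S h2 \<cdot> S g2)))))))"
  have "?X = sw H (\<Delta>\<^sub>H g) (\<lambda>g0 g'. sw H (\<Delta>\<^sub>H g') (\<lambda>g1 g2. sw H (\<Delta>\<^sub>H h) (\<lambda>h0 h'. counit H h' \<odot>\<^bsub>H\<^esub> (S
      (g0 \<cdot> h0) \<cdot> (g1 \<cdot> S g2)))))"
  proof (intro cg g h)
    fix g0 g' g1 g2 h0 h' assume [simp]: "g0 \<in> carrier H" "g' \<in> carrier H" "g1 \<in> carrier H"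
        "g2 \<in> carrier H" "h0 \<in> carrier H" "h' \<in> carrier H"
    have "sw H (\<Delta>\<^sub>H h') (\<lambda>h1 h2. S (g0 \<cdot> h0) \<cdot> (g1 \<cdot> ((h1 \<cdot> S h2) \<cdot> S g2))) = counit H h' \<odot>\<^bsub>H\<^esub> (S
        (g0 \<cdot> h0) \<cdot> (g1 \<cdot> (\<one>\<^bsub>H\<^esub> \<cdot> S g2)))"
      by (rule antipodeH_right[OF modH, of h' "\<lambda>x. S (g0 \<cdot> h0) \<cdot> (g1 \<cdot> (x \<cdot> S g2))"]) (simp,
          (intro lins; simp))
    moreover have "sw H (\<Delta>\<^sub>H h') (\<lambda>h1 h2. S (g0 \<cdot> h0) \<cdot> (g1 \<cdot> ((h1 \<cdot> S h2) \<cdot> S g2))) =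
        sw H (\<Delta>\<^sub>H h') (\<lambda>h1 h2. S (g0 \<cdot> h0) \<cdot> (g1 \<cdot> (h1 \<cdot> (S h2 \<cdot> S g2))))"
      by (rule cg) simp_all
    ultimately show "sw H (\<Delta>\<^sub>H h') (\<lambda>h1 h2. S (g0 \<cdot> h0) \<cdot> (g1 \<cdot> (h1 \<cdot> (S h2 \<cdot> S g2)))) = counit H h'
        \<odot>\<^bsub>H\<^esub> (S (g0 \<cdot> h0) \<cdot> (g1 \<cdot> S g2))"
      by simp
  qed
  also have "\<dots> = sw H (\<Delta>\<^sub>H g) (\<lambda>g0 g'. sw H (\<Delta>\<^sub>H g') (\<lambda>g1 g2. S (g0 \<cdot> h) \<cdot> (g1 \<cdot> S g2)))"
  proof (intro cg g)
    fix g0 g' g1 g2 assume [simp]: "g0 \<in> carrier H" "g' \<in> carrier H" "g1 \<in> carrier H"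
        "g2 \<in> carrier H"
    show "sw H (\<Delta>\<^sub>H h) (\<lambda>h0 h'. counit H h' \<odot>\<^bsub>H\<^esub> (S (g0 \<cdot> h0) \<cdot> (g1 \<cdot> S g2))) = S (g0 \<cdot> h) \<cdot> (g1 \<cdot> S
        g2)"
      by (rule counitH_right[OF modH h, of "\<lambda>h0. S (g0 \<cdot> h0) \<cdot> (g1 \<cdot> S g2)"]) (intro lins; simp)
  qed
  also have "\<dots> = sw H (\<Delta>\<^sub>H g) (\<lambda>g0 g'. counit H g' \<odot>\<^bsub>H\<^esub> (S (g0 \<cdot> h) \<cdot> \<one>\<^bsub>H\<^esub>))"
  proof (intro cg g)
    fix g0 g' assume [simp]: "g0 \<in> carrier H" "g' \<in> carrier H"
    show "sw H (\<Delta>\<^sub>H g') (\<lambda>g1 g2. S (g0 \<cdot> h) \<cdot> (g1 \<cdot> S g2)) = counit H g' \<odot>\<^bsub>H\<^esub> (S (g0 \<cdot> h) \<cdot> \<one>\<^bsub>H\<^esub>)"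
      by (rule antipodeH_right[OF modH, of g' "\<lambda>x. S (g0 \<cdot> h) \<cdot> x"]) (simp, (intro lins; simp))
  qed
  also have "\<dots> = S (g \<cdot> h) \<cdot> \<one>\<^bsub>H\<^esub>"
    by (rule counitH_right[OF modH g, of "\<lambda>g0. S (g0 \<cdot> h) \<cdot> \<one>\<^bsub>H\<^esub>"]) (intro lins; simp)
  finally have 1: "?X = S (g \<cdot> h)" by simp

  have "?X = sw H (\<Delta>\<^sub>H g) (\<lambda>g' g2. sw H (\<Delta>\<^sub>H g') (\<lambda>g0 g1. sw H (\<Delta>\<^sub>H h) (\<lambda>h0 h'. sw H (\<Delta>\<^sub>H h')
      (\<lambda>h1 h2.
     S (g0 \<cdot> h0) \<cdot> (g1 \<cdot> (h1 \<cdot> (S h2 \<cdot> S g2)))))))"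
    by (rule coassocH[OF modH g, symmetric, of "\<lambda>g0 g1 g2. sw H (\<Delta>\<^sub>H h) (\<lambda>h0 h'. sw H (\<Delta>\<^sub>H h')
        (\<lambda>h1 h2.
       S (g0 \<cdot> h0) \<cdot> (g1 \<cdot> (h1 \<cdot> (S h2 \<cdot> S g2)))))"]) (unfold trilin_def, intro conjI ballI lins;
           simp)
  also have "\<dots> = sw H (\<Delta>\<^sub>H g) (\<lambda>g' g2. sw H (\<Delta>\<^sub>H g') (\<lambda>g0 g1. sw H (\<Delta>\<^sub>H h) (\<lambda>h' h2.
      sw H (\<Delta>\<^sub>H h') (\<lambda>h0 h1.
     S (g0 \<cdot> h0) \<cdot> (g1 \<cdot> (h1 \<cdot> (S h2 \<cdot> S g2)))))))"
  proof (rule cg[OF g], rule cg)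
    fix g' g2 g0 g1 assume [simp]: "g' \<in> carrier H" "g2 \<in> carrier H" "g0 \<in> carrier H"
        "g1 \<in> carrier H"
    show "sw H (\<Delta>\<^sub>H h) (\<lambda>h0 h'. sw H (\<Delta>\<^sub>H h') (\<lambda>h1 h2. S (g0 \<cdot> h0) \<cdot> (g1 \<cdot> (h1 \<cdot> (S h2 \<cdot> S g2))))) =
      sw H (\<Delta>\<^sub>H h) (\<lambda>h' h2. sw H (\<Delta>\<^sub>H h') (\<lambda>h0 h1. S (g0 \<cdot> h0) \<cdot> (g1 \<cdot> (h1 \<cdot> (S h2 \<cdot> S g2)))))"
      by (rule coassocH[OF modH h, symmetric, of "\<lambda>h0 h1 h2. S (g0 \<cdot> h0) \<cdot> (g1 \<cdot> (h1 \<cdot> (S h2 \<cdot> S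
          g2)))"])
        (unfold trilin_def, intro conjI ballI lins; simp)
  qed simp
  also have "\<dots> = sw H (\<Delta>\<^sub>H g) (\<lambda>g' g2. sw H (\<Delta>\<^sub>H h) (\<lambda>h' h2. sw H (\<Delta>\<^sub>H g') (\<lambda>g0 g1.
      sw H (\<Delta>\<^sub>H h') (\<lambda>h0 h1.
     S (g0 \<cdot> h0) \<cdot> (g1 \<cdot> (h1 \<cdot> (S h2 \<cdot> S g2)))))))"
    by (rule cg[OF g], rule sw_sw_swap[OF modH comultH_combs comultH_combs]) simp_all
  also have "\<dots> = sw H (\<Delta>\<^sub>H g) (\<lambda>g' g2. sw H (\<Delta>\<^sub>H h) (\<lambda>h' h2. sw H (\<Delta>\<^sub>H (g' \<cdot> h'))
      (\<lambda>x y. S x \<cdot> y \<cdot> (S h2 \<cdot> S g2))))"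
  proof (intro cg g h)
    fix g' g2 h' h2 assume [simp]: "g' \<in> carrier H" "g2 \<in> carrier H" "h' \<in> carrier H"
        "h2 \<in> carrier H"
    have "sw H (\<Delta>\<^sub>H (g' \<cdot> h')) (\<lambda>x y. S x \<cdot> y \<cdot> (S h2 \<cdot> S g2)) =
      sw H (\<Delta>\<^sub>H g') (\<lambda>g0 g1. sw H (\<Delta>\<^sub>H h') (\<lambda>h0 h1. S (g0 \<cdot> h0) \<cdot> (g1 \<cdot> h1) \<cdot> (S h2 \<cdot> S g2)))"
      by (rule comultH_mult[OF modH, of g' h' "\<lambda>x y. S x \<cdot> y \<cdot> (S h2 \<cdot> S g2)"])
        (simp, simp, unfold bilin_def, (intro conjI ballI lins; simp))
    also have "\<dots> = sw H (\<Delta>\<^sub>H g') (\<lambda>g0 g1. sw H (\<Delta>\<^sub>H h') (\<lambda>h0 h1. S (g0 \<cdot> h0) \<cdot> (g1 \<cdot> (h1 \<cdot> (S h2 \<cdot> S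
        g2)))))"
      by (intro cg) simp_all
    finally show "sw H (\<Delta>\<^sub>H g') (\<lambda>g0 g1. sw H (\<Delta>\<^sub>H h') (\<lambda>h0 h1. S (g0 \<cdot> h0) \<cdot> (g1 \<cdot> (h1 \<cdot> (S h2 \<cdot> S
        g2))))) =
      sw H (\<Delta>\<^sub>H (g' \<cdot> h')) (\<lambda>x y. S x \<cdot> y \<cdot> (S h2 \<cdot> S g2))" ..
  qed
  also have "\<dots> = sw H (\<Delta>\<^sub>H g) (\<lambda>g' g2. sw H (\<Delta>\<^sub>H h) (\<lambda>h' h2. counit H g' \<odot>\<^bsub>H\<^esub> (counit H h' \<odot>\<^bsub>H\<^esub> (S
      h2 \<cdot> S g2))))"
  proof (intro cg g h)
    fix g' g2 h' h2 assume [simp]: "g' \<in> carrier H" "g2 \<in> carrier H" "h' \<in> carrier H"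
        "h2 \<in> carrier H"
    have "sw H (\<Delta>\<^sub>H (g' \<cdot> h')) (\<lambda>x y. S x \<cdot> y \<cdot> (S h2 \<cdot> S g2)) = counit H (g' \<cdot> h') \<odot>\<^bsub>H\<^esub> (\<one>\<^bsub>H\<^esub> \<cdot> (S
        h2 \<cdot> S g2))"
      by (rule antipodeH_left[OF modH, of "g' \<cdot> h'" "\<lambda>x. x \<cdot> (S h2 \<cdot> S g2)"]) (simp,
          (intro lins; simp))
    then show "sw H (\<Delta>\<^sub>H (g' \<cdot> h')) (\<lambda>x y. S x \<cdot> y \<cdot> (S h2 \<cdot> S g2)) = counit H g' \<odot>\<^bsub>H\<^esub> (counit H h'
        \<odot>\<^bsub>H\<^esub> (S h2 \<cdot> S g2))"
      by (simp add: H.counit_mult H.smult_assoc1)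
  qed
  also have "\<dots> = S h \<cdot> S g"
  proof -
    have "sw H (\<Delta>\<^sub>H h) (\<lambda>h' h2. counit H g' \<odot>\<^bsub>H\<^esub> (counit H h' \<odot>\<^bsub>H\<^esub> (S h2 \<cdot> S g2))) = counit H g'
        \<odot>\<^bsub>H\<^esub> (S h \<cdot> S g2)"
      if [simp]: "g' \<in> carrier H" "g2 \<in> carrier H" for g' g2
    proof -
      have "sw H (\<Delta>\<^sub>H h) (\<lambda>h' h2. counit H h' \<odot>\<^bsub>H\<^esub> (S h2 \<cdot> S g2)) = S h \<cdot> S g2"
        by (rule counitH_left[OF modH h, of "\<lambda>h2. S h2 \<cdot> S g2"]) (intro lins; simp)
      then show ?thesis by (subst sw_smult[OF modH comultH_combs[OF h]]) simp_all
    qed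
    then have "sw H (\<Delta>\<^sub>H g) (\<lambda>g' g2. sw H (\<Delta>\<^sub>H h) (\<lambda>h' h2. counit H g' \<odot>\<^bsub>H\<^esub> (counit H h' \<odot>\<^bsub>H\<^esub> (S h2
        \<cdot> S g2)))) =
      sw H (\<Delta>\<^sub>H g) (\<lambda>g' g2. counit H g' \<odot>\<^bsub>H\<^esub> (S h \<cdot> S g2))"
      by (intro cg g) simp_all
    also have "\<dots> = S h \<cdot> S g"
      by (rule counitH_left[OF modH g, of "\<lambda>g2. S h \<cdot> S g2"]) (intro lins; simp)
    finally show ?thesis .
  qed
  finally show ?thesis using 1 by simp
qed

lemma antipode_one [simp]: "S \<one>\<^bsub>H\<^esub> = \<one>\<^bsub>H\<^esub>"
proof -
  have b: "bilin R H H H (\<lambda>x y. S x \<cdot> y)"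
    unfolding bilin_def by (intro conjI ballI mult_lin_right mult_lin_left_comp mult_lin_right_comp
        lin_comp[OF H.antipode_linear] id_lin[OF modH]; simp)
  show ?thesis
    using antipodeH_left[OF modH H.A.one_closed id_lin[OF modH]] comultH_one[OF modH b] H.counit_one
        by simp
qed

text \<open>\<open>S\<close> reverses products and is injective, so applying it turns both claims
  into the antipode axioms. Conceptually, S^-1 is the antipode for the opposite multiplication,
  which is why the legs stand in exchanged order.\<close>

lemma antipode_inv_skew:
  assumes N: "module R N" and h: "h \<in> carrier H" and f: "f \<in> linear_maps R H N"
  shows "sw N (\<Delta>\<^sub>H h) (\<lambda>x y. f (y \<cdot> T x)) = counit H h \<odot>\<^bsub>N\<^esub> f \<one>\<^bsub>H\<^esub>"
    and "sw N (\<Delta>\<^sub>H h) (\<lambda>x y. f (T y \<cdot> x)) = counit H h \<odot>\<^bsub>N\<^esub> f \<one>\<^bsub>H\<^esub>"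
proof -
  have 1: "sw H (\<Delta>\<^sub>H h) (\<lambda>x y. y \<cdot> T x) = counit H h \<odot>\<^bsub>H\<^esub> \<one>\<^bsub>H\<^esub>"
  proof (rule S_inj)
    have "S (sw H (\<Delta>\<^sub>H h) (\<lambda>x y. y \<cdot> T x)) = sw H (\<Delta>\<^sub>H h) (\<lambda>x y. S (y \<cdot> T x))"
      by (rule sw_map[OF modH modH H.antipode_linear comultH_combs[OF h]]) simp
    also have "\<dots> = sw H (\<Delta>\<^sub>H h) (\<lambda>x y. x \<cdot> S y)" by (rule sw_comultH_cong[OF h])
        (simp add: antipode_mult)
    also have "\<dots> = counit H h \<odot>\<^bsub>H\<^esub> \<one>\<^bsub>H\<^esub>" by (rule antipodeH_right[OF modH h id_lin[OF modH]])
    finally show "S (sw H (\<Delta>\<^sub>H h) (\<lambda>x y. y \<cdot> T x)) = S (counit H h \<odot>\<^bsub>H\<^esub> \<one>\<^bsub>H\<^esub>)"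
      using h by (simp add: lin_smult[OF H.antipode_linear])
  qed (use h in \<open>simp_all add: sw_comultH_closed[OF modH]\<close>)
  have 2: "sw H (\<Delta>\<^sub>H h) (\<lambda>x y. T y \<cdot> x) = counit H h \<odot>\<^bsub>H\<^esub> \<one>\<^bsub>H\<^esub>"
  proof (rule S_inj)
    have "S (sw H (\<Delta>\<^sub>H h) (\<lambda>x y. T y \<cdot> x)) = sw H (\<Delta>\<^sub>H h) (\<lambda>x y. S (T y \<cdot> x))"
      by (rule sw_map[OF modH modH H.antipode_linear comultH_combs[OF h]]) simp
    also have "\<dots> = sw H (\<Delta>\<^sub>H h) (\<lambda>x y. S x \<cdot> y)" by (rule sw_comultH_cong[OF h])
        (simp add: antipode_mult)
    also have "\<dots> = counit H h \<odot>\<^bsub>H\<^esub> \<one>\<^bsub>H\<^esub>" by (rule antipodeH_left[OF modH h id_lin[OF modH]])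
    finally show "S (sw H (\<Delta>\<^sub>H h) (\<lambda>x y. T y \<cdot> x)) = S (counit H h \<odot>\<^bsub>H\<^esub> \<one>\<^bsub>H\<^esub>)"
      using h by (simp add: lin_smult[OF H.antipode_linear])
  qed (use h in \<open>simp_all add: sw_comultH_closed[OF modH]\<close>)
  show "sw N (\<Delta>\<^sub>H h) (\<lambda>x y. f (y \<cdot> T x)) = counit H h \<odot>\<^bsub>N\<^esub> f \<one>\<^bsub>H\<^esub>"
    using sw_map[OF modH N f comultH_combs[OF h], of "\<lambda>x y. y \<cdot> T x"] 1 h by
        (simp add: lin_smult[OF f])
  show "sw N (\<Delta>\<^sub>H h) (\<lambda>x y. f (T y \<cdot> x)) = counit H h \<odot>\<^bsub>N\<^esub> f \<one>\<^bsub>H\<^esub>"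
    using sw_map[OF modH N f comultH_combs[OF h], of "\<lambda>x y. T y \<cdot> x"] 2 h by
        (simp add: lin_smult[OF f])
qed

end

section \<open>Diagonal coactions and actions\<close>

definition ins :: "nat \<Rightarrow> 'x \<Rightarrow> 'x \<Rightarrow> 'x list \<Rightarrow> 'x list" where
  "ins i u v xs = take i xs @ [u, v] @ drop (Suc i) xs"

definition del :: "nat \<Rightarrow> 'x list \<Rightarrow> 'x list" where
  "del i xs = take i xs @ drop (Suc i) xs"

lemma ins_simps [simp]: "ins 0 u v (x # xs) = u # v # xs" "ins (Suc i) u v (x # xs) = x # ins i u v
    xs"
  by (simp_all add: ins_def)

lemma del_simps [simp]: "del 0 (x # xs) = xs" "del (Suc i) (x # xs) = x # del i xs"
  by (simp_all add: del_def)

lemma ins_tuples: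
  "xs \<in> tuples M n \<Longrightarrow> i < n \<Longrightarrow> u \<in> carrier M \<Longrightarrow> v \<in> carrier M \<Longrightarrow> ins i u v xs \<in> tuples M (Suc n)"
  by (auto simp: ins_def tuples_def dest: in_set_takeD in_set_dropD)

lemma del_tuples: "xs \<in> tuples M (Suc n) \<Longrightarrow> i \<le> n \<Longrightarrow> del i xs \<in> tuples M n"
  by (auto simp: del_def tuples_def dest: in_set_takeD in_set_dropD)

lemma tuples_nth: "xs \<in> tuples M n \<Longrightarrow> i < n \<Longrightarrow> xs ! i \<in> carrier M"
  by (auto simp: tuples_def)

lemma multi_lin:
  "multi R M N (Suc n) f \<Longrightarrow> xs \<in> tuples M n \<Longrightarrow> g \<in> linear_maps R A M \<Longrightarrow>
      (\<lambda>x. f (g x # xs)) \<in> linear_maps R A N"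
  using lin_comp[of "\<lambda>x. f (x # xs)" R M N g A] by simp

lemma multi_Cons: "multi R M N (Suc n) f \<Longrightarrow> x \<in> carrier M \<Longrightarrow> multi R M N n (\<lambda>xs. f (x # xs))"
  by simp

lemma sw_ret:
  assumes "module R N" "f a b \<in> carrier N" shows "sw N (ret R (a, b)) f = f a b"
  unfolding sw_def using ev_ret[OF assms(1), of "\<lambda>(u, v). f u v" "(a, b)"] assms(2) by simp

context crossed begin

text \<open>The diagonal coaction on tuples, that is \<^const>\<open>coact_tuple\<close> with all its factors in \<open>H\<close>
  multiplied, and the diagonal action \<^const>\<open>diag_act\<close>. The latter is extended to the empty tuple by
  the counit, so that a single recursion covers all lengths.\<close>

primrec coacts where
  "coacts [] = ret R (\<one>\<^bsub>H\<^esub>, [])"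
| "coacts (a # as) = bind R (\<rho> a) (\<lambda>(h, b). bind R (coacts as) (\<lambda>(k, bs). ret R (h \<cdot> k, b # bs)))"

primrec act where
  "act [] h = [(counit H h, [])]"
| "act (g # gs) h = bind R (\<Delta>\<^sub>H h) (\<lambda>(x, y). bind R (act gs y) (\<lambda>xs. ret R (x \<cdot> g # xs)))"

lemma coacts_combs: "as \<in> tuples C n \<Longrightarrow> coacts as \<in> combs R (carrier H \<times> tuples C n)"
proof (induction as arbitrary: n)
  case Nil then show ?case by (auto intro!: ret_combs[OF R_cring])
next
  case (Cons a as)
  then obtain m where [simp]: "n = Suc m" "a \<in> carrier C" "as \<in> tuples C m" by auto
  have "bind R (coacts as) (\<lambda>(k, bs). ret R (h \<cdot> k, b # bs)) \<in> combs R (carrier H \<times> tuples C n)"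
    if "h \<in> carrier H" "b \<in> carrier C" for h b
    by (rule bind_combs[OF R_cring Cons.IH[of m]]) (use that in \<open>auto intro!: ret_combs[OF
        R_cring]\<close>)
  then show ?case by (auto intro!: bind_combs[OF R_cring coact_combs])
qed

lemma act_combs: "h \<in> carrier H \<Longrightarrow> gs \<in> tuples H n \<Longrightarrow> act gs h \<in> combs R (tuples H n)"
proof (induction gs arbitrary: n h)
  case Nil then show ?case by (auto simp: combs_def)
next
  case (Cons g gs)
  then obtain m where [simp]: "n = Suc m" "g \<in> carrier H" "gs \<in> tuples H m" by auto
  have "bind R (act gs y) (\<lambda>xs. ret R (x \<cdot> g # xs)) \<in> combs R (tuples H n)"
    if "x \<in> carrier H" "y \<in> carrier H" for x y
    by (rule bind_combs[OF R_cring Cons.IH[of _ m]]) (use that in \<open>auto intro!: ret_combs[OF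
        R_cring]\<close>)
  then show ?case using Cons.prems by (auto intro!: bind_combs[OF R_cring comultH_combs])
qed

lemma coacts_cong: "as \<in> tuples C n \<Longrightarrow> (\<And>k bs. k \<in> carrier H \<Longrightarrow> bs \<in> tuples C n \<Longrightarrow> f k bs = g k bs)
    \<Longrightarrow> sw N (coacts as) f = sw N (coacts as) g"
  by (rule sw_cong[OF coacts_combs])
lemma act_cong: "h \<in> carrier H \<Longrightarrow> gs \<in> tuples H n \<Longrightarrow> (\<And>xs. xs \<in> tuples H n \<Longrightarrow> f xs = g xs) \<Longrightarrow>
    ev N (act gs h) f = ev N (act gs h) g"
  by (rule ev_cong[OF act_combs])

text \<open>The shape of a test map for the output of \<open>coacts\<close>: one leg in
  \<open>H\<close>, and a tuple in \<open>C\<close> that remains to be processed.\<close>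

definition lin_multi where
  "lin_multi N n F \<longleftrightarrow> (\<forall>k\<in>carrier H. multi R C N n (F k)) \<and> (\<forall>bs\<in>tuples C n.
      (\<lambda>k. F k bs) \<in> linear_maps R H N)"

lemma lin_multiI: "(\<And>k. k \<in> carrier H \<Longrightarrow> multi R C N n (F k)) \<Longrightarrow> (\<And>bs. bs \<in> tuples C n \<Longrightarrow>
    (\<lambda>k. F k bs) \<in> linear_maps R H N) \<Longrightarrow> lin_multi N n F"
  by (simp add: lin_multi_def)

lemma lin_multi_closed: "lin_multi N n F \<Longrightarrow> k \<in> carrier H \<Longrightarrow> bs \<in> tuples C n \<Longrightarrow> F k bs \<in> carrier N"
  by (auto simp: lin_multi_def intro: multi_closed)

lemma lin_multi_lin: "lin_multi N n F \<Longrightarrow> bs \<in> tuples C n \<Longrightarrow> g \<in> linear_maps R M H \<Longrightarrow>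
    (\<lambda>x. F (g x) bs) \<in> linear_maps R M N"
  using lin_comp[of "\<lambda>k. F k bs" R H N g M] by (simp add: lin_multi_def)

lemma lin_multi_multi: "lin_multi N (Suc n) F \<Longrightarrow> k \<in> carrier H \<Longrightarrow> b \<in> carrier C \<Longrightarrow> multi R C N n
    (\<lambda>bs. F k (b # bs))"
  by (simp add: lin_multi_def)

lemma lin_multi_head: "lin_multi N (Suc n) F \<Longrightarrow> k \<in> carrier H \<Longrightarrow> bs \<in> tuples C n \<Longrightarrow> g \<in> linear_maps R M
    C \<Longrightarrow> (\<lambda>x. F k (g x # bs)) \<in> linear_maps R M N"
  using multi_lin[of R C N n "F k" bs g M] by (simp add: lin_multi_def)

lemma lin_multi_head2: "lin_multi N (Suc (Suc n)) F \<Longrightarrow> k \<in> carrier H \<Longrightarrow> b \<in> carrier C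
    \<Longrightarrow> bs \<in> tuples C n \<Longrightarrow> g \<in> linear_maps R M C \<Longrightarrow> (\<lambda>x. F k (b # g x # bs)) \<in> linear_maps R M N"
  using multi_lin[of R C N n "\<lambda>bs. F k (b # bs)" bs g M] by (simp add: lin_multi_def)

text \<open>Keeps induction hypotheses applicable: after one coaction has been peeled off, its leg
  is absorbed on the left of the remaining product.\<close>

lemma lin_multi_Cons: "lin_multi N (Suc n) F \<Longrightarrow> h \<in> carrier H \<Longrightarrow> b \<in> carrier C \<Longrightarrow> lin_multi N n
    (\<lambda>k bs. F (h \<cdot> k) (b # bs))"
  by (rule lin_multiI) (auto intro: lin_multi_multi lin_multi_lin mult_lin_right)

text \<open>The shape of a test map for two successive diagonal coactions, each contributing its own
  leg.\<close>

definition bilin_multi where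
  "bilin_multi N n F \<longleftrightarrow> (\<forall>k\<in>carrier H. lin_multi N n (F k)) \<and> (\<forall>k\<in>carrier H. lin_multi N n
      (\<lambda>k'. F k' k))"

lemma bilin_multi_closed: "bilin_multi N n F \<Longrightarrow> k \<in> carrier H \<Longrightarrow> k' \<in> carrier H \<Longrightarrow> bs \<in> tuples C n
    \<Longrightarrow> F k k' bs \<in> carrier N"
  by (auto simp: bilin_multi_def intro: lin_multi_closed)

lemma bilin_multi_lin:
  assumes "bilin_multi N n F" "k \<in> carrier H" "bs \<in> tuples C n" "g \<in> linear_maps R M H"
  shows "(\<lambda>x. F (g x) k bs) \<in> linear_maps R M N" "(\<lambda>x. F k (g x) bs) \<in> linear_maps R M N"
  using lin_multi_lin[of N n "\<lambda>k'. F k' k" bs g M] lin_multi_lin[of N n "F k" bs g M] assms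
      by (simp_all add: bilin_multi_def)

lemma bilin_multi_head:
  assumes "bilin_multi N (Suc n) F" "k \<in> carrier H" "k' \<in> carrier H" "bs \<in> tuples C n"
      "g \<in> linear_maps R M C"
  shows "(\<lambda>x. F k k' (g x # bs)) \<in> linear_maps R M N"
  using lin_multi_head[of N n "F k" k' bs g M] assms by (simp add: bilin_multi_def)

lemma bilin_multi_Cons:
  assumes "bilin_multi N (Suc n) F" "h \<in> carrier H" "h' \<in> carrier H" "b \<in> carrier C"
  shows "bilin_multi N n (\<lambda>k k' bs. F (h \<cdot> k) (h' \<cdot> k') (b # bs))"
  using lin_multi_Cons[of N n "F (h \<cdot> _)" h' b] lin_multi_Cons[of N n "\<lambda>k'. F k' (h' \<cdot> _)" h b]
      assms
  unfolding bilin_multi_def by auto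

context
  fixes N :: "('a, 'n, 'p) module_scheme"
  assumes N: "module R N"
begin

interpretation N: module R N by (rule N)

lemma coacts_closed: "as \<in> tuples C n \<Longrightarrow> (\<And>k bs. k \<in> carrier H \<Longrightarrow> bs \<in> tuples C n
    \<Longrightarrow> f k bs \<in> carrier N) \<Longrightarrow> sw N (coacts as) f \<in> carrier N"
  by (rule sw_closed[OF N coacts_combs])

lemma act_closed: "h \<in> carrier H \<Longrightarrow> gs \<in> tuples H n \<Longrightarrow> (\<And>xs. xs \<in> tuples H n \<Longrightarrow> f xs \<in> carrier N) \<Longrightarrow>
    ev N (act gs h) f \<in> carrier N"
  by (rule ev_closed[OF N act_combs])

lemma coacts_lin_param: "as \<in> tuples C n \<Longrightarrow> (\<And>k bs. k \<in> carrier H \<Longrightarrow> bs \<in> tuples C n \<Longrightarrow>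
    (\<lambda>x. f x k bs) \<in> linear_maps R M N) \<Longrightarrow>
    (\<lambda>x. sw N (coacts as) (f x)) \<in> linear_maps R M N"
  by (rule sw_lin_param[OF N coacts_combs])

lemma act_lin_param: "h \<in> carrier H \<Longrightarrow> gs \<in> tuples H n \<Longrightarrow> (\<And>xs. xs \<in> tuples H n \<Longrightarrow>
    (\<lambda>x. f x xs) \<in> linear_maps R M N) \<Longrightarrow>
    (\<lambda>x. ev N (act gs h) (f x)) \<in> linear_maps R M N"
  by (rule ev_lin_param[OF N act_combs])

lemmas closed_rules = sw_comultH_closed[OF N] sw_comultC_closed[OF N] sw_coact_closed[OF N]
lemmas lin_param_rules = sw_comultH_lin_param[OF N] sw_comultC_lin_param[OF N] sw_coact_lin_param[OF
    N]

lemma coacts_Nil: "f \<one>\<^bsub>H\<^esub> [] \<in> carrier N \<Longrightarrow> sw N (coacts []) f = f \<one>\<^bsub>H\<^esub> []"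
  unfolding coacts.simps by (rule sw_ret[OF N])

text \<open>A computation with lists, valid for every \<open>f\<close> with values in
  \<open>N\<close>. It can thus be applied under other sums before any linearity of the summand is
  known.\<close>

lemma coacts_Cons:
  assumes a: "a \<in> carrier C" and as: "as \<in> tuples C n"
    and f: "\<And>k bs. k \<in> carrier H \<Longrightarrow> bs \<in> tuples C (Suc n) \<Longrightarrow> f k bs \<in> carrier N"
  shows "sw N (coacts (a # as)) f = sw N (\<rho> a) (\<lambda>h b. sw N (coacts as) (\<lambda>k bs. f (h \<cdot> k) (b # bs)))"
proof -
  let ?f = "\<lambda>(k, bs). f k bs"
  have c: "?f x \<in> carrier N" if "x \<in> carrier H \<times> tuples C (Suc n)" for x using that f by auto
  have r: "(\<lambda>(k, bs). ret R (h \<cdot> k, b # bs)) x \<in> combs R (carrier H \<times> tuples C (Suc n))"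
    if "h \<in> carrier H" "b \<in> carrier C" "x \<in> carrier H \<times> tuples C n" for h b x
    using that by (auto intro!: ret_combs[OF R_cring])
  have b: "(\<lambda>(h, b). bind R (coacts as) (\<lambda>(k, bs). ret R (h \<cdot> k, b # bs))) x \<in> combs R (carrier H \<times>
      tuples C (Suc n))"
    if "x \<in> carrier H \<times> carrier C" for x
    using that bind_combs[OF R_cring coacts_combs[OF as] r] by auto
  have "sw N (coacts (a # as)) f = ev N (\<rho> a) (\<lambda>x. ev N ((\<lambda>(h, b). bind R (coacts as)
      (\<lambda>(k, bs). ret R (h \<cdot> k, b # bs))) x) ?f)"
    unfolding sw_def coacts.simps by (rule ev_bind[OF N coact_combs[OF a] b c])
  also have "\<dots> = sw N (\<rho> a) (\<lambda>h b. ev N (bind R (coacts as) (\<lambda>(k, bs). ret R (h \<cdot> k, b # bs))) ?f)"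
    unfolding sw_def by (rule ev_cong[OF coact_combs[OF a]]) auto
  also have "\<dots> = sw N (\<rho> a) (\<lambda>h b. sw N (coacts as) (\<lambda>k bs. f (h \<cdot> k) (b # bs)))"
  proof (rule sw_coact_cong[OF a])
    fix h b assume hb: "h \<in> carrier H" "b \<in> carrier C"
    have "ev N (bind R (coacts as) (\<lambda>(k, bs). ret R (h \<cdot> k, b # bs))) ?f = ev N (coacts as) (\<lambda>x.
        ev N ((\<lambda>(k, bs). ret R (h \<cdot> k, b # bs)) x) ?f)"
      by (rule ev_bind[OF N coacts_combs[OF as] r[OF hb] c])
    also have "\<dots> = sw N (coacts as) (\<lambda>k bs. f (h \<cdot> k) (b # bs))"
      unfolding sw_def by (rule ev_cong[OF coacts_combs[OF as]]) (use hb f in \<open>auto simp: ev_ret[OF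
          N]\<close>)
    finally show "ev N (bind R (coacts as) (\<lambda>(k, bs). ret R (h \<cdot> k, b # bs))) ?f =
        sw N (coacts as) (\<lambda>k bs. f (h \<cdot> k) (b # bs))" .
  qed
  finally show ?thesis .
qed

lemma act_Nil: "ev N (act [] h) f = counit H h \<odot>\<^bsub>N\<^esub> f []" if "h \<in> carrier H" "f [] \<in> carrier N"
  using that by simp

lemma act_Cons:
  assumes h: "h \<in> carrier H" and g: "g \<in> carrier H" and gs: "gs \<in> tuples H n"
    and f: "\<And>xs. xs \<in> tuples H (Suc n) \<Longrightarrow> f xs \<in> carrier N"
  shows "ev N (act (g # gs) h) f = sw N (\<Delta>\<^sub>H h) (\<lambda>x y. ev N (act gs y) (\<lambda>xs. f (x \<cdot> g # xs)))"
proof -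
  have r: "ret R (x \<cdot> g # xs) \<in> combs R (tuples H (Suc n))"
    if "x \<in> carrier H" "xs \<in> tuples H n" for x xs
    using that g by (auto intro!: ret_combs[OF R_cring])
  have b: "(\<lambda>(x, y). bind R (act gs y) (\<lambda>xs. ret R (x \<cdot> g # xs))) p \<in> combs R (tuples H (Suc n))"
    if "p \<in> carrier H \<times> carrier H" for p
    using that bind_combs[OF R_cring act_combs[OF _ gs] r] by auto
  have "ev N (act (g # gs) h) f = ev N (\<Delta>\<^sub>H h) (\<lambda>p. ev N ((\<lambda>(x, y). bind R (act gs y)
      (\<lambda>xs. ret R (x \<cdot> g # xs))) p) f)"
    unfolding act.simps by (rule ev_bind[OF N comultH_combs[OF h] b f])
  also have "\<dots> = sw N (\<Delta>\<^sub>H h) (\<lambda>x y. ev N (bind R (act gs y) (\<lambda>xs. ret R (x \<cdot> g # xs))) f)"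
    unfolding sw_def by (rule ev_cong[OF comultH_combs[OF h]]) auto
  also have "\<dots> = sw N (\<Delta>\<^sub>H h) (\<lambda>x y. ev N (act gs y) (\<lambda>xs. f (x \<cdot> g # xs)))"
  proof (rule sw_comultH_cong[OF h])
    fix x y assume xy: "x \<in> carrier H" "y \<in> carrier H"
    have "ev N (bind R (act gs y) (\<lambda>xs. ret R (x \<cdot> g # xs))) f = ev N (act gs y) (\<lambda>xs.
        ev N (ret R (x \<cdot> g # xs)) f)"
      by (rule ev_bind[OF N act_combs[OF xy(2) gs] r[OF xy(1)] f])
    also have "\<dots> = ev N (act gs y) (\<lambda>xs. f (x \<cdot> g # xs))"
      by (rule act_cong[OF xy(2) gs], rule ev_ret[OF N]) (use xy g f in auto)
    finally show "ev N (bind R (act gs y) (\<lambda>xs. ret R (x \<cdot> g # xs))) f = ev N (act gs y)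
        (\<lambda>xs. f (x \<cdot> g # xs))" .
  qed
  finally show ?thesis .
qed

text \<open>The chosen combinations depend on the tuple in an uncontrolled way. Multilinearity is
  recovered in the head from the linearity of the coaction tested on a bilinear map, and in the tail
  by induction with the head's combination fixed.\<close>

lemma coacts_multi: "lin_multi N n F \<Longrightarrow> multi R C N n (\<lambda>as. sw N (coacts as) F)"
proof (induction n arbitrary: F)
  case 0 then show ?case by (simp add: coacts_closed[of _ 0] lin_multi_closed del: coacts.simps)
next
  case (Suc n)
  note F = Suc.prems
  have e: "sw N (coacts (a # as)) F = sw N (\<rho> a) (\<lambda>h b. sw N (coacts as)
      (\<lambda>k bs. F (h \<cdot> k) (b # bs)))"
    if "a \<in> carrier C" "as \<in> tuples C n" for a as
    by (rule coacts_Cons[OF that]) (rule lin_multi_closed[OF F])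
  have "multi R C N n (\<lambda>as. sw N (coacts (a # as)) F)" if a: "a \<in> carrier C" for a
  proof (rule multi_cong[OF modC])
    show "multi R C N n (\<lambda>as. sw N (\<rho> a) (\<lambda>h b. sw N (coacts as) (\<lambda>k bs. F (h \<cdot> k) (b # bs))))"
      by (rule sw_multi[OF N coact_combs[OF a]], rule Suc.IH, rule lin_multi_Cons[OF F])
  qed (simp add: e[OF a] del: coacts.simps)
  moreover have "(\<lambda>a. sw N (coacts (a # as)) F) \<in> linear_maps R C N" if as: "as \<in> tuples C n" for as
  proof (subst lin_cong[OF modC e[OF _ as]])
    show "(\<lambda>x. sw N (\<rho> x) (\<lambda>h b. sw N (coacts as) (\<lambda>k bs. F (h \<cdot> k) (b # bs)))) \<in> linear_maps R C N"
      by (rule sw_coact_lin[OF N], unfold bilin_def)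
        (intro conjI ballI coacts_lin_param[OF as] lin_multi_lin[OF F] lin_multi_head[OF F]
            id_lin[OF modC] mult_lin_left_comp id_lin[OF modH]; simp)
  qed
  ultimately show ?case by simp
qed

text \<open>The counit of \<open>H\<close> is multiplicative, so applied to the product of all legs
  it splits into one counit per entry, and each restores its entry.\<close>

lemma coacts_counit: "as \<in> tuples C n \<Longrightarrow> multi R C N n f \<Longrightarrow> sw N (coacts as) (\<lambda>k bs. counit H k \<odot>\<^bsub>N\<^esub> f
    bs) = f as"
proof (induction as arbitrary: n f)
  case Nil then show ?case by (subst coacts_Nil) (simp_all add: H.counit_one)
next
  case (Cons a as)
  then obtain m where n [simp]: "n = Suc m" and a [simp]: "a \<in> carrier C" and as [simp]:
      "as \<in> tuples C m" by auto
  note f = Cons.prems(2)[unfolded n]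
  have [simp]: "f xs \<in> carrier N" if "xs \<in> tuples C (Suc m)" for xs using f that by
      (rule multi_closed)
  have "sw N (coacts (a # as)) (\<lambda>k bs. counit H k \<odot>\<^bsub>N\<^esub> f bs) =
     sw N (\<rho> a) (\<lambda>h b. sw N (coacts as) (\<lambda>k bs. counit H (h \<cdot> k) \<odot>\<^bsub>N\<^esub> f (b # bs)))"
    by (rule coacts_Cons[OF a as]) simp
  also have "\<dots> = sw N (\<rho> a) (\<lambda>h b. counit H h \<odot>\<^bsub>N\<^esub> f (b # as))"
  proof (rule sw_coact_cong[OF a])
    fix h b assume [simp]: "h \<in> carrier H" "b \<in> carrier C"
    have "sw N (coacts as) (\<lambda>k bs. counit H (h \<cdot> k) \<odot>\<^bsub>N\<^esub> f (b # bs)) = sw N (coacts as)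
        (\<lambda>k bs. counit H h \<odot>\<^bsub>N\<^esub> (counit H k \<odot>\<^bsub>N\<^esub> f (b # bs)))"
      by (rule coacts_cong[OF as]) (simp add: H.counit_mult N.smult_assoc1)
    also have "\<dots> = counit H h \<odot>\<^bsub>N\<^esub> sw N (coacts as) (\<lambda>k bs. counit H k \<odot>\<^bsub>N\<^esub> f (b # bs))"
      by (rule sw_smult[OF N coacts_combs[OF as]]) simp_all
    also have "sw N (coacts as) (\<lambda>k bs. counit H k \<odot>\<^bsub>N\<^esub> f (b # bs)) = f (b # as)"
      by (rule Cons.IH[OF as]) (use f in simp)
    finally show "sw N (coacts as) (\<lambda>k bs. counit H (h \<cdot> k) \<odot>\<^bsub>N\<^esub> f (b # bs)) = counit H h \<odot>\<^bsub>N\<^esub> f (b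
        # as)" .
  qed
  also have "\<dots> = f (a # as)" by (rule co_counit[OF N a]) (use f in simp)
  finally show ?case .
qed

text \<open>Coassociativity of the product coaction on C^n. Each entry satisfies its own law, and
  the coproducts of the separate legs combine because the comultiplication of \<open>H\<close> is
  multiplicative; the empty tuple uses its value at \<open>\<one>\<close>.\<close>

lemma coacts_coassoc: "as \<in> tuples C n \<Longrightarrow> bilin_multi N n F \<Longrightarrow>
  sw N (coacts as) (\<lambda>k bs. sw N (coacts bs) (\<lambda>k' bs'. F k k' bs')) = sw N (coacts as) (\<lambda>k bs.
      sw N (\<Delta>\<^sub>H k) (\<lambda>k0 k1. F k0 k1 bs))"
proof (induction as arbitrary: n F)
  case Nil
  then have [simp]: "n = 0" by simp
  have F [simp]: "F k k' [] \<in> carrier N" if "k \<in> carrier H"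
      "k' \<in> carrier H" for k k' using bilin_multi_closed[OF Nil.prems(2) that] by simp
  have b: "bilin R H H N (\<lambda>k0 k1. F k0 k1 [])"
    unfolding bilin_def by (intro conjI ballI bilin_multi_lin[OF Nil.prems(2)] id_lin[OF modH];
        simp)
  show ?case by (simp add: coacts_Nil coacts_closed[of _ 0] closed_rules comultH_one[OF N b] del:
      coacts.simps)
next
  case (Cons a as)
  then obtain m where n [simp]: "n = Suc m" and a [simp]: "a \<in> carrier C" and as [simp]:
      "as \<in> tuples C m" by auto
  note F = Cons.prems(2)[unfolded n]
  note [simp] = bilin_multi_closed[OF F] closed_rules coacts_closed
  note lins = lin_param_rules coacts_lin_param bilin_multi_lin[OF F] bilin_multi_head[OF F]
      id_lin[OF modH] id_lin[OF modC] mult_lin_left_comp mult_lin_right_comp mult_lin_right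
  have "sw N (coacts (a # as)) (\<lambda>k bs. sw N (coacts bs) (\<lambda>k' bs'. F k k' bs')) =
     sw N (\<rho> a) (\<lambda>h b. sw N (coacts as) (\<lambda>k bs. sw N (coacts (b # bs))
         (\<lambda>k' bs'. F (h \<cdot> k) k' bs')))"
    by (rule coacts_Cons[OF a as]) simp
  also have "\<dots> = sw N (\<rho> a) (\<lambda>h b. sw N (coacts as) (\<lambda>k bs. sw N (\<rho> b) (\<lambda>h' b'.
      sw N (coacts bs) (\<lambda>k' bs'. F (h \<cdot> k) (h' \<cdot> k') (b' # bs')))))"
    by (rule sw_coact_cong[OF a], rule coacts_cong[OF as], rule coacts_Cons[of _ _ m]) simp_all
  \<comment> \<open>The second coaction of the head does not involve the tail. Moving it outward
    leaves two nested coactions of the tail, as the induction hypothesis requires.\<close>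
  also have "\<dots> = sw N (\<rho> a) (\<lambda>h b. sw N (\<rho> b) (\<lambda>h' b'. sw N (coacts as) (\<lambda>k bs.
      sw N (coacts bs) (\<lambda>k' bs'. F (h \<cdot> k) (h' \<cdot> k') (b' # bs')))))"
    by (rule sw_coact_cong[OF a], rule sw_sw_swap[OF N coacts_combs[OF as] coact_combs]) simp_all
  also have "\<dots> = sw N (\<rho> a) (\<lambda>h b. sw N (\<rho> b) (\<lambda>h' b'. sw N (coacts as) (\<lambda>k bs. sw N (\<Delta>\<^sub>H k)
      (\<lambda>k0 k1. F (h \<cdot> k0) (h' \<cdot> k1) (b' # bs)))))"
    by (rule sw_coact_cong[OF a], rule sw_coact_cong, assumption, rule Cons.IH[OF as], rule
        bilin_multi_Cons[OF F])
  also have "\<dots> = sw N (\<rho> a) (\<lambda>h b. sw N (\<Delta>\<^sub>H h) (\<lambda>h0 h1. sw N (coacts as) (\<lambda>k bs. sw N (\<Delta>\<^sub>H k)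
      (\<lambda>k0 k1. F (h0 \<cdot> k0) (h1 \<cdot> k1) (b # bs)))))"
    by (rule co_coassoc[OF N a, symmetric]) (unfold trilin_def, (intro conjI ballI lins; simp))
  also have "\<dots> = sw N (\<rho> a) (\<lambda>h b. sw N (coacts as) (\<lambda>k bs. sw N (\<Delta>\<^sub>H h) (\<lambda>h0 h1. sw N (\<Delta>\<^sub>H k)
      (\<lambda>k0 k1. F (h0 \<cdot> k0) (h1 \<cdot> k1) (b # bs)))))"
    by (rule sw_coact_cong[OF a], rule sw_sw_swap[OF N comultH_combs coacts_combs[OF as]]) simp_all
  \<comment> \<open>The coproduct of the head's leg and that of the tail's leg fuse by
    multiplicativity.\<close>
  also have "\<dots> = sw N (\<rho> a) (\<lambda>h b. sw N (coacts as) (\<lambda>k bs. sw N (\<Delta>\<^sub>H (h \<cdot> k))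
      (\<lambda>k0 k1. F k0 k1 (b # bs))))"
    by (rule sw_coact_cong[OF a], rule coacts_cong[OF as], rule comultH_mult[OF N, symmetric])
        (simp, simp, unfold bilin_def, (intro conjI ballI lins; simp))
  also have "\<dots> = sw N (coacts (a # as)) (\<lambda>k bs. sw N (\<Delta>\<^sub>H k) (\<lambda>k0 k1. F k0 k1 bs))"
    by (rule coacts_Cons[OF a as, symmetric]) simp
  finally show ?case .
qed

text \<open>The recursion strips the first entry, but cyclic operators move an entry to the end. The
  last leg stands at the right of the product, so associativity and the unit of \<open>H\<close> are
  all that is needed.\<close>

lemma coacts_snoc: "as \<in> tuples C n \<Longrightarrow> a \<in> carrier C \<Longrightarrow>
  (\<And>k bs. k \<in> carrier H \<Longrightarrow> bs \<in> tuples C (Suc n) \<Longrightarrow> F k bs \<in> carrier N) \<Longrightarrow>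
  sw N (coacts (as @ [a])) F = sw N (coacts as) (\<lambda>k bs. sw N (\<rho> a) (\<lambda>h b. F (k \<cdot> h) (bs @ [b])))"
proof (induction as arbitrary: n F)
  case Nil
  then have [simp]: "n = 0" by simp
  note [simp] = Nil.prems closed_rules
  have "sw N (coacts [a]) F = sw N (\<rho> a) (\<lambda>h b. sw N (coacts []) (\<lambda>k bs. F (h \<cdot> k) (b # bs)))"
    by (rule coacts_Cons[of _ _ 0]) simp_all
  also have "\<dots> = sw N (\<rho> a) (\<lambda>h b. F h [b])"
    by (rule sw_coact_cong) (simp_all add: coacts_Nil del: coacts.simps)
  also have "\<dots> = sw N (\<rho> a) (\<lambda>h b. F (\<one>\<^bsub>H\<^esub> \<cdot> h) ([] @ [b]))" by (rule sw_coact_cong) simp_all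
  also have "\<dots> = sw N (coacts []) (\<lambda>k bs. sw N (\<rho> a) (\<lambda>h b. F (k \<cdot> h) (bs @ [b])))"
    by (rule coacts_Nil[symmetric]) simp
  finally show ?case by simp
next
  case (Cons c as)
  then obtain m where n [simp]: "n = Suc m" and c [simp]: "c \<in> carrier C" and as [simp]:
      "as \<in> tuples C m" by auto
  have app [simp]: "xs @ [y] \<in> tuples C (Suc p)" if "xs \<in> tuples C p" "y \<in> carrier C" for xs y p
    using that by (auto simp: tuples_def)
  note [simp] = Cons.prems(2,3) closed_rules coacts_closed
  have "sw N (coacts (c # as @ [a])) F = sw N (\<rho> c) (\<lambda>h b. sw N (coacts (as @ [a]))
      (\<lambda>k bs. F (h \<cdot> k) (b # bs)))"
    by (rule coacts_Cons[of _ _ "Suc m"]) simp_all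
  also have "\<dots> = sw N (\<rho> c) (\<lambda>h b. sw N (coacts as) (\<lambda>k bs. sw N (\<rho> a) (\<lambda>h' b'. F (h \<cdot> (k \<cdot> h')) (b
      # bs @ [b']))))"
    by (rule sw_coact_cong[OF c], rule Cons.IH[OF as Cons.prems(2)]) simp
  also have "\<dots> = sw N (\<rho> c) (\<lambda>h b. sw N (coacts as) (\<lambda>k bs. sw N (\<rho> a) (\<lambda>h' b'. F ((h \<cdot> k) \<cdot> h') ((b
      # bs) @ [b']))))"
    by (rule sw_coact_cong[OF c], rule coacts_cong[OF as], rule sw_coact_cong)
        (simp_all add: H.A.m_assoc)
  also have "\<dots> = sw N (coacts (c # as)) (\<lambda>k bs. sw N (\<rho> a) (\<lambda>h b. F (k \<cdot> h) (bs @ [b])))"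
    by (rule coacts_Cons[OF c as, symmetric]) (simp del: tuples_Cons)
  finally show ?case by simp
qed

text \<open>Splitting one entry is colinear for the product coaction. The legs of the two copies are
  neighbours in the product, so the axiom for one entry applies there, and the other legs are
  unaffected.\<close>

lemma coacts_comult: "as \<in> tuples C n \<Longrightarrow> i < n \<Longrightarrow> lin_multi N (Suc n) F \<Longrightarrow>
  sw N (\<Delta>\<^sub>C (as ! i)) (\<lambda>u v. sw N (coacts (ins i u v as)) F) = sw N (coacts as) (\<lambda>k bs.
      sw N (\<Delta>\<^sub>C (bs ! i)) (\<lambda>u v. F k (ins i u v bs)))"
proof (induction as arbitrary: n i F)
  case Nil then show ?case by simp
next
  case (Cons a as)
  then obtain m where n [simp]: "n = Suc m" and a [simp]: "a \<in> carrier C" and as [simp]: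
      "as \<in> tuples C m" by auto
  note F = Cons.prems(3)[unfolded n]
  note [simp] = lin_multi_closed[OF F] closed_rules coacts_closed ins_tuples tuples_nth
  show ?case
  proof (cases i)
    case [simp]: 0
    have "sw N (\<Delta>\<^sub>C a) (\<lambda>u v. sw N (coacts (u # v # as)) F) = sw N (\<Delta>\<^sub>C a) (\<lambda>u v. sw N (\<rho> u)
        (\<lambda>h b. sw N (\<rho> v) (\<lambda>h' b'. sw N (coacts as) (\<lambda>k bs. F ((h \<cdot> h') \<cdot> k) (b # b' # bs)))))"
    proof (rule sw_comultC_cong[OF a])
      fix u v assume [simp]: "u \<in> carrier C" "v \<in> carrier C"
      have "sw N (coacts (u # v # as)) F = sw N (\<rho> u) (\<lambda>h b. sw N (coacts (v # as))
          (\<lambda>k bs. F (h \<cdot> k) (b # bs)))"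
        by (rule coacts_Cons[of _ _ "Suc m"]) simp_all
      also have "\<dots> = sw N (\<rho> u) (\<lambda>h b. sw N (\<rho> v) (\<lambda>h' b'. sw N (coacts as) (\<lambda>k bs. F (h \<cdot> (h' \<cdot> k))
          (b # b' # bs))))"
        by (rule sw_coact_cong, simp, rule coacts_Cons[of _ _ m]) simp_all
      \<comment> \<open>Reassociated so that the two legs meet as one product, the form in which the
        comodule coalgebra axiom contains them.\<close>
      also have "\<dots> = sw N (\<rho> u) (\<lambda>h b. sw N (\<rho> v) (\<lambda>h' b'. sw N (coacts as) (\<lambda>k bs. F ((h \<cdot> h') \<cdot> k)
          (b # b' # bs))))"
        by (rule sw_coact_cong, simp, rule sw_coact_cong, simp, rule coacts_cong[OF as])
            (simp add: H.A.m_assoc)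
      finally show "sw N (coacts (u # v # as)) F = \<dots>" .
    qed
    also have "\<dots> = sw N (\<rho> a) (\<lambda>h c. sw N (\<Delta>\<^sub>C c) (\<lambda>c0 c1. sw N (coacts as)
        (\<lambda>k bs. F (h \<cdot> k) (c0 # c1 # bs))))"
      by (rule co_comult[OF N a, of "\<lambda>h b b'. sw N (coacts as) (\<lambda>k bs. F (h \<cdot> k) (b # b' # bs))"])
        (unfold trilin_def, (intro conjI ballI coacts_lin_param[OF as] lin_multi_lin[OF F]
            lin_multi_head[OF F] lin_multi_head2[OF F] id_lin[OF modC] mult_lin_left_comp id_lin[OF
            modH]; simp))
    also have "\<dots> = sw N (\<rho> a) (\<lambda>h c. sw N (coacts as) (\<lambda>k bs. sw N (\<Delta>\<^sub>C c)
        (\<lambda>c0 c1. F (h \<cdot> k) (c0 # c1 # bs))))"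
      by (rule sw_coact_cong[OF a], rule sw_sw_swap[OF N comultC_combs coacts_combs[OF as]])
          simp_all
    also have "\<dots> = sw N (\<rho> a) (\<lambda>h c. sw N (coacts as) (\<lambda>k bs. sw N (\<Delta>\<^sub>C ((c # bs) ! 0))
        (\<lambda>c0 c1. F (h \<cdot> k) (ins 0 c0 c1 (c # bs)))))"
      by simp
    also have "\<dots> = sw N (coacts (a # as)) (\<lambda>k bs. sw N (\<Delta>\<^sub>C (bs ! 0)) (\<lambda>u v. F k (ins 0 u v bs)))"
      by (rule coacts_Cons[OF a as, symmetric]) simp
    finally show ?thesis by simp
  next
    case [simp]: (Suc j)
    have j [simp]: "j < m" using Cons.prems by simp
    have "sw N (\<Delta>\<^sub>C (as ! j)) (\<lambda>u v. sw N (coacts (a # ins j u v as)) F) =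
      sw N (\<Delta>\<^sub>C (as ! j)) (\<lambda>u v. sw N (\<rho> a) (\<lambda>h b. sw N (coacts (ins j u v as))
          (\<lambda>k bs. F (h \<cdot> k) (b # bs))))"
      by (rule sw_comultC_cong, simp add: tuples_nth[OF as], rule coacts_Cons[of _ _
          "Suc m"]) (simp_all add: ins_tuples[OF as])
    also have "\<dots> = sw N (\<rho> a) (\<lambda>h b. sw N (\<Delta>\<^sub>C (as ! j)) (\<lambda>u v. sw N (coacts (ins j u v as))
        (\<lambda>k bs. F (h \<cdot> k) (b # bs))))"
      by (rule sw_sw_swap[OF N comultC_combs coact_combs])
          (simp_all add: tuples_nth[OF as] coacts_closed[OF ins_tuples[OF as j]])
    also have "\<dots> = sw N (\<rho> a) (\<lambda>h b. sw N (coacts as) (\<lambda>k bs. sw N (\<Delta>\<^sub>C (bs ! j))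
        (\<lambda>u v. F (h \<cdot> k) (b # ins j u v bs))))"
      by (rule sw_coact_cong[OF a], rule Cons.IH[OF as j], rule lin_multi_Cons[OF F])
    also have "\<dots> = sw N (\<rho> a) (\<lambda>h b. sw N (coacts as) (\<lambda>k bs. sw N (\<Delta>\<^sub>C ((b # bs) ! Suc j))
        (\<lambda>u v. F (h \<cdot> k) (ins (Suc j) u v (b # bs)))))"
      by simp
    also have "\<dots> = sw N (coacts (a # as)) (\<lambda>k bs. sw N (\<Delta>\<^sub>C (bs ! Suc j))
        (\<lambda>u v. F k (ins (Suc j) u v bs)))"
      by (rule coacts_Cons[OF a as, symmetric], rule closed_rules)
          (simp_all add: tuples_nth[of _ C "Suc m"] ins_tuples[of _ C "Suc m"])
    finally show ?thesis by simp
  qed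
qed

text \<open>Erasing entry \<open>j\<close> by the counit turns its leg into \<open>\<one>\<close>,
  which drops out of the product and leaves the coaction of the shorter tuple.\<close>

lemma coacts_counit_nth: "as \<in> tuples C (Suc n) \<Longrightarrow> j \<le> n \<Longrightarrow> lin_multi N n F \<Longrightarrow>
  sw N (coacts as) (\<lambda>k bs. counit C (bs ! j) \<odot>\<^bsub>N\<^esub> F k (del j bs)) = counit C (as ! j) \<odot>\<^bsub>N\<^esub>
      sw N (coacts (del j as)) F"
proof (induction as arbitrary: n j F)
  case Nil then show ?case by simp
next
  case (Cons a as)
  then have a [simp]: "a \<in> carrier C" and as [simp]: "as \<in> tuples C n" by auto
  note F = Cons.prems(3)
  note [simp] = lin_multi_closed[OF F] closed_rules coacts_closed
  have [simp]: "bs ! j \<in> carrier C" "del j bs \<in> tuples C n" if "bs \<in> tuples C (Suc n)" for bs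
    using that Cons.prems(2) by (auto intro: tuples_nth del_tuples)
  have "sw N (coacts (a # as)) (\<lambda>k bs. counit C (bs ! j) \<odot>\<^bsub>N\<^esub> F k (del j bs)) =
    sw N (\<rho> a) (\<lambda>h b. sw N (coacts as) (\<lambda>k bs. counit C ((b # bs) ! j) \<odot>\<^bsub>N\<^esub> F (h \<cdot> k) (del j (b #
        bs))))"
    by (rule coacts_Cons[OF a as]) simp
  also have "\<dots> = counit C ((a # as) ! j) \<odot>\<^bsub>N\<^esub> sw N (coacts (del j (a # as))) F"
  proof (cases j)
    case [simp]: 0
    \<comment> \<open>The tail's coaction is moved outward, so that the counit law meets an
      innermost sum over the head alone.\<close>
    have "sw N (\<rho> a) (\<lambda>h b. sw N (coacts as) (\<lambda>k bs. counit C b \<odot>\<^bsub>N\<^esub> F (h \<cdot> k) bs)) =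
      sw N (coacts as) (\<lambda>k bs. sw N (\<rho> a) (\<lambda>h b. counit C b \<odot>\<^bsub>N\<^esub> F (h \<cdot> k) bs))"
      by (rule sw_sw_swap[OF N coact_combs coacts_combs[OF as]]) simp_all
    also have "\<dots> = sw N (coacts as) (\<lambda>k bs. counit C a \<odot>\<^bsub>N\<^esub> F (\<one>\<^bsub>H\<^esub> \<cdot> k) bs)"
      by (rule coacts_cong[OF as], rule counit_co[OF N a])
          (intro lin_multi_lin[OF F] mult_lin_left_comp id_lin[OF modH]; simp)
    also have "\<dots> = sw N (coacts as) (\<lambda>k bs. counit C a \<odot>\<^bsub>N\<^esub> F k bs)" by
        (rule coacts_cong[OF as]) simp
    also have "\<dots> = counit C a \<odot>\<^bsub>N\<^esub> sw N (coacts as) F" by (rule sw_smult[OF N coacts_combs[OF as]])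
        simp_all
    finally show ?thesis by simp
  next
    case [simp]: (Suc i)
    obtain m where [simp]: "n = Suc m" and i: "i \<le> m" using Cons.prems(2) by (cases n) auto
    note as' = as[simplified \<open>n = Suc m\<close>]
    have "sw N (\<rho> a) (\<lambda>h b. sw N (coacts as) (\<lambda>k bs. counit C (bs ! i) \<odot>\<^bsub>N\<^esub> F (h \<cdot> k) (b # del i
        bs))) =
      sw N (\<rho> a) (\<lambda>h b. counit C (as ! i) \<odot>\<^bsub>N\<^esub> sw N (coacts (del i as))
          (\<lambda>k bs. F (h \<cdot> k) (b # bs)))"
      by (rule sw_coact_cong[OF a], rule Cons.IH[OF as' i]) (rule lin_multi_Cons[OF F[simplified]])
    also have "\<dots> = counit C (as ! i) \<odot>\<^bsub>N\<^esub> sw N (\<rho> a) (\<lambda>h b. sw N (coacts (del i as))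
        (\<lambda>k bs. F (h \<cdot> k) (b # bs)))"
      by (rule sw_smult[OF N coact_combs[OF a]]) (use i as' in \<open>simp_all add: coacts_closed[OF
          del_tuples[OF as' i]] tuples_nth[OF as']\<close>)
    also have "sw N (\<rho> a) (\<lambda>h b. sw N (coacts (del i as)) (\<lambda>k bs. F (h \<cdot> k) (b # bs))) =
        sw N (coacts (a # del i as)) F"
      by (rule coacts_Cons[symmetric, OF a del_tuples[OF as' i]]) simp
    finally show ?thesis by simp
  qed
  finally show ?case .
qed

text \<open>At each split of the acting element the summand is bilinear in the two legs. The counit
  chosen for the empty tuple is linear too, which makes the induction start.\<close>

lemma act_lin: "gs \<in> tuples H n \<Longrightarrow> multi R H N n f \<Longrightarrow> (\<lambda>h. ev N (act gs h) f) \<in> linear_maps R H N"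
proof (induction gs arbitrary: n f)
  case Nil
  then have "f [] \<in> carrier N" by simp
  then have "(\<lambda>h. counit H h \<odot>\<^bsub>N\<^esub> f []) \<in> linear_maps R H N" by
      (rule lin_smult_left[OF N H.counit_linear])
  then show ?case by (subst lin_cong[OF modH act_Nil]) (use \<open>f [] \<in> carrier N\<close> in simp_all)
next
  case (Cons g gs)
  then obtain m where n [simp]: "n = Suc m" and g [simp]: "g \<in> carrier H" and gs [simp]:
      "gs \<in> tuples H m" by auto
  note f = Cons.prems(2)[unfolded n]
  show ?case
  proof (subst lin_cong[OF modH act_Cons[OF _ g gs]])
    show "f xs \<in> carrier N" if "xs \<in> tuples H (Suc m)" for xs using multi_closed[OF f that] .
    show "(\<lambda>h. sw N (\<Delta>\<^sub>H h) (\<lambda>x y. ev N (act gs y) (\<lambda>xs. f (x \<cdot> g # xs)))) \<in> linear_maps R H N"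
    proof (rule sw_comultH_lin[OF N], unfold bilin_def, intro conjI ballI)
      fix y assume [simp]: "y \<in> carrier H"
      show "(\<lambda>x. ev N (act gs y) (\<lambda>xs. f (x \<cdot> g # xs))) \<in> linear_maps R H N"
        by (rule act_lin_param[OF _ gs]) (simp, (intro multi_lin[OF f] mult_lin_left; simp))
    next
      fix x assume "x \<in> carrier H"
      then show "(\<lambda>y. ev N (act gs y) (\<lambda>xs. f (x \<cdot> g # xs))) \<in> linear_maps R H N"
        using f by (intro Cons.IH[OF gs]) simp
    qed
  qed simp
qed

lemma act_multi: "h \<in> carrier H \<Longrightarrow> multi R H N n f \<Longrightarrow> multi R H N n (\<lambda>gs. ev N (act gs h) f)"
proof (induction n arbitrary: f h)
  case 0 then show ?case by simp
next
  case (Suc n)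
  note h = Suc.prems(1) and f = Suc.prems(2)
  have c: "f xs \<in> carrier N" if "xs \<in> tuples H (Suc n)" for xs using multi_closed[OF f that] .
  note e = act_Cons[OF h _ _ c]
  have "multi R H N n (\<lambda>gs. ev N (act (g # gs) h) f)" if g: "g \<in> carrier H" for g
  proof (rule multi_cong[OF modH])
    show "multi R H N n (\<lambda>gs. sw N (\<Delta>\<^sub>H h) (\<lambda>x y. ev N (act gs y) (\<lambda>xs. f (x \<cdot> g # xs))))"
      by (rule sw_multi[OF N comultH_combs[OF h]], rule Suc.IH) (use f g in simp_all)
  qed (simp add: e[OF g] del: act.simps)
  moreover have "(\<lambda>g. ev N (act (g # gs) h) f) \<in> linear_maps R H N" if gs: "gs \<in> tuples H n" for gs
  proof (subst lin_cong[OF modH e[OF _ gs]])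
    show "(\<lambda>g. sw N (\<Delta>\<^sub>H h) (\<lambda>x y. ev N (act gs y) (\<lambda>xs. f (x \<cdot> g # xs)))) \<in> linear_maps R H N"
      by (intro lin_param_rules act_lin_param[OF _ gs] multi_lin[OF f] mult_lin_right; simp add: h)
  qed simp_all
  ultimately show ?case by simp
qed

text \<open>Multiplicativity of the comultiplication makes the diagonal formula an action: acting
  first with \<open>h'\<close> and then with \<open>h\<close> multiplies each entry by the legs of
  \<open>h \<cdot> h'\<close>.\<close>

lemma act_mult: "gs \<in> tuples H n \<Longrightarrow> multi R H N n f \<Longrightarrow> h \<in> carrier H \<Longrightarrow> h' \<in> carrier H \<Longrightarrow>
  ev N (act gs h') (\<lambda>gs'. ev N (act gs' h) f) = ev N (act gs (h \<cdot> h')) f"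
proof (induction gs arbitrary: n f h h')
  case Nil then show ?case by (simp add: H.counit_mult N.smult_assoc1[symmetric]
      comm_monoid.m_comm[OF cring.axioms(2)[OF R_cring]])
next
  case (Cons g gs)
  then obtain m where n [simp]: "n = Suc m" and g [simp]: "g \<in> carrier H" and gs [simp]:
      "gs \<in> tuples H m" by auto
  note f = Cons.prems(2)[unfolded n]
  have [simp]: "h \<in> carrier H" "h' \<in> carrier H" by fact+
  have c [simp]: "f xs \<in> carrier N" if "xs \<in> tuples H (Suc m)" for xs using multi_closed[OF f that]
      .
  note [simp] = closed_rules act_closed[of _ _ m] act_closed[of _ _ "Suc m"]
  have "ev N (act (g # gs) h') (\<lambda>gs'. ev N (act gs' h) f) = sw N (\<Delta>\<^sub>H h') (\<lambda>x' y'.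
      ev N (act gs y') (\<lambda>xs. ev N (act (x' \<cdot> g # xs) h) f))"
    by (rule act_Cons[OF _ g gs]) simp_all
  also have "\<dots> = sw N (\<Delta>\<^sub>H h') (\<lambda>x' y'. ev N (act gs y') (\<lambda>xs. sw N (\<Delta>\<^sub>H h) (\<lambda>x y.
      ev N (act xs y) (\<lambda>zs. f (x \<cdot> (x' \<cdot> g) # zs)))))"
    by (rule sw_comultH_cong, simp, rule act_cong[OF _ gs], simp, rule act_Cons[of _ _ _ m])
        simp_all
  also have "\<dots> = sw N (\<Delta>\<^sub>H h') (\<lambda>x' y'. sw N (\<Delta>\<^sub>H h) (\<lambda>x y. ev N (act gs y') (\<lambda>xs.
      ev N (act xs y) (\<lambda>zs. f (x \<cdot> (x' \<cdot> g) # zs)))))"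
    by (rule sw_comultH_cong, simp, rule sw_ev_swap[OF N comultH_combs act_combs[OF _ gs],
        symmetric]) simp_all
  also have "\<dots> = sw N (\<Delta>\<^sub>H h') (\<lambda>x' y'. sw N (\<Delta>\<^sub>H h) (\<lambda>x y. ev N (act gs (y \<cdot> y'))
      (\<lambda>zs. f (x \<cdot> (x' \<cdot> g) # zs))))"
    by (rule sw_comultH_cong, simp, rule sw_comultH_cong, simp, rule Cons.IH[OF gs multi_Cons[OF
        f]]) simp_all
  also have "\<dots> = sw N (\<Delta>\<^sub>H h) (\<lambda>x y. sw N (\<Delta>\<^sub>H h') (\<lambda>x' y'. ev N (act gs (y \<cdot> y'))
      (\<lambda>zs. f (x \<cdot> (x' \<cdot> g) # zs))))"
    by (rule sw_sw_swap[OF N comultH_combs comultH_combs]) simp_all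
  also have "\<dots> = sw N (\<Delta>\<^sub>H h) (\<lambda>x y. sw N (\<Delta>\<^sub>H h') (\<lambda>x' y'. ev N (act gs (y \<cdot> y'))
      (\<lambda>zs. f (x \<cdot> x' \<cdot> g # zs))))"
    by (rule sw_comultH_cong, simp, rule sw_comultH_cong, simp, rule act_cong[OF _ gs])
        (simp_all add: H.A.m_assoc)
  also have "\<dots> = sw N (\<Delta>\<^sub>H (h \<cdot> h')) (\<lambda>x y. ev N (act gs y) (\<lambda>zs. f (x \<cdot> g # zs)))"
  proof (rule comultH_mult[OF N, symmetric])
    show "bilin R H H N (\<lambda>x y. ev N (act gs y) (\<lambda>zs. f (x \<cdot> g # zs)))"
      unfolding bilin_def
      by (intro conjI ballI act_lin_param[OF _ gs] multi_lin[OF f] mult_lin_left act_lin[OF gs]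
          multi_Cons[OF f]; simp)
  qed simp_all
  also have "\<dots> = ev N (act (g # gs) (h \<cdot> h')) f"
    by (rule act_Cons[OF _ g gs, symmetric]) simp_all
  finally show ?case .
qed

lemma act_one: "gs \<in> tuples H n \<Longrightarrow> multi R H N n f \<Longrightarrow> ev N (act gs \<one>\<^bsub>H\<^esub>) f = f gs"
proof (induction gs arbitrary: n f)
  case Nil then show ?case by (simp add: H.counit_one)
next
  case (Cons g gs)
  then obtain m where n [simp]: "n = Suc m" and g [simp]: "g \<in> carrier H" and gs [simp]:
      "gs \<in> tuples H m" by auto
  note f = Cons.prems(2)[unfolded n]
  have c [simp]: "f xs \<in> carrier N" if "xs \<in> tuples H (Suc m)" for xs using multi_closed[OF f that]
      .
  have b: "bilin R H H N (\<lambda>x y. ev N (act gs y) (\<lambda>zs. f (x \<cdot> g # zs)))"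
    unfolding bilin_def
    by (intro conjI ballI act_lin_param[OF _ gs] multi_lin[OF f] mult_lin_left act_lin[OF gs]
        multi_Cons[OF f]; simp)
  have "ev N (act (g # gs) \<one>\<^bsub>H\<^esub>) f = sw N (\<Delta>\<^sub>H \<one>\<^bsub>H\<^esub>) (\<lambda>x y. ev N (act gs y) (\<lambda>zs. f (x \<cdot> g # zs)))"
    by (rule act_Cons[OF _ g gs]) simp_all
  also have "\<dots> = ev N (act gs \<one>\<^bsub>H\<^esub>) (\<lambda>zs. f (\<one>\<^bsub>H\<^esub> \<cdot> g # zs))" by (rule comultH_one[OF N b])
  also have "\<dots> = f (\<one>\<^bsub>H\<^esub> \<cdot> g # gs)" by (rule Cons.IH[OF gs multi_Cons[OF f]]) simp
  finally show ?case by simp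
qed

text \<open>By multiplicativity of the comultiplication, acting and then splitting the head equals
  splitting and then acting on the longer tuple. In the last coface the vertical splitting comes
  after the action of \<open>T h\<close>; this exchanges the two.\<close>

lemma act_comult:
  assumes g [simp]: "g \<in> carrier H" and gs [simp]: "gs \<in> tuples H n" and h [simp]:
      "h \<in> carrier H" and f: "multi R H N (Suc (Suc n)) f"
  shows "sw N (\<Delta>\<^sub>H g) (\<lambda>x y. ev N (act (x # y # gs) h) f) = ev N (act (g # gs) h) (\<lambda>zs.
      sw N (\<Delta>\<^sub>H (hd zs)) (\<lambda>x y. f (x # y # tl zs)))"
proof -
  have c [simp]: "f xs \<in> carrier N" if "xs \<in> tuples H (Suc (Suc n))" for xs using multi_closed[OF f
      that] .
  note [simp] = closed_rules act_closed[of _ _ n] act_closed[of _ _ "Suc n"] act_closed[of _ _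
      "Suc (Suc n)"]
  have m1: "multi R H N (Suc n) (\<lambda>xs. f (x # xs))" if "x \<in> carrier H" for x by
      (rule multi_Cons[OF f that])
  note lins = lin_param_rules act_lin_param[OF _ gs] multi_lin[OF f] multi_lin[OF m1] act_lin[OF gs]
      multi_Cons[OF m1] mult_lin_left mult_lin_right
  have "sw N (\<Delta>\<^sub>H g) (\<lambda>x y. ev N (act (x # y # gs) h) f) =
    sw N (\<Delta>\<^sub>H g) (\<lambda>x y. sw N (\<Delta>\<^sub>H h) (\<lambda>h0 h'. sw N (\<Delta>\<^sub>H h') (\<lambda>h1 h2. ev N (act gs h2)
        (\<lambda>zs. f (h0 \<cdot> x # h1 \<cdot> y # zs)))))"
  proof (rule sw_comultH_cong[OF g])
    fix x y assume [simp]: "x \<in> carrier H" "y \<in> carrier H"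
    have "ev N (act (x # y # gs) h) f = sw N (\<Delta>\<^sub>H h) (\<lambda>h0 h'. ev N (act (y # gs) h')
        (\<lambda>zs. f (h0 \<cdot> x # zs)))"
      by (rule act_Cons[of _ _ _ "Suc n"]) simp_all
    also have "\<dots> = sw N (\<Delta>\<^sub>H h) (\<lambda>h0 h'. sw N (\<Delta>\<^sub>H h') (\<lambda>h1 h2. ev N (act gs h2)
        (\<lambda>zs. f (h0 \<cdot> x # h1 \<cdot> y # zs))))"
      by (rule sw_comultH_cong, simp, rule act_Cons[of _ _ _ n]) simp_all
    finally show "ev N (act (x # y # gs) h) f = \<dots>" .
  qed
  \<comment> \<open>Rebracketed so that the legs meeting \<open>x\<close> and \<open>y\<close> come
    from one coproduct of \<open>h'\<close>, ready to be merged with the coproduct of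
    \<open>g\<close>.\<close>
  also have "\<dots> = sw N (\<Delta>\<^sub>H g) (\<lambda>x y. sw N (\<Delta>\<^sub>H h) (\<lambda>h' h2. sw N (\<Delta>\<^sub>H h') (\<lambda>h0 h1.
      ev N (act gs h2) (\<lambda>zs. f (h0 \<cdot> x # h1 \<cdot> y # zs)))))"
    by (rule sw_comultH_cong[OF g], rule coassocH[OF N h, symmetric]) (unfold trilin_def,
        (intro conjI ballI lins; simp))
  also have "\<dots> = sw N (\<Delta>\<^sub>H h) (\<lambda>h' h2. sw N (\<Delta>\<^sub>H g) (\<lambda>x y. sw N (\<Delta>\<^sub>H h') (\<lambda>h0 h1.
      ev N (act gs h2) (\<lambda>zs. f (h0 \<cdot> x # h1 \<cdot> y # zs)))))"
    by (rule sw_sw_swap[OF N comultH_combs comultH_combs]) simp_all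
  also have "\<dots> = sw N (\<Delta>\<^sub>H h) (\<lambda>h' h2. sw N (\<Delta>\<^sub>H h') (\<lambda>h0 h1. sw N (\<Delta>\<^sub>H g) (\<lambda>x y.
      ev N (act gs h2) (\<lambda>zs. f (h0 \<cdot> x # h1 \<cdot> y # zs)))))"
    by (rule sw_comultH_cong[OF h], rule sw_sw_swap[OF N comultH_combs comultH_combs]) simp_all
  also have "\<dots> = sw N (\<Delta>\<^sub>H h) (\<lambda>h' h2. sw N (\<Delta>\<^sub>H (h' \<cdot> g)) (\<lambda>x y. ev N (act gs h2)
      (\<lambda>zs. f (x # y # zs))))"
    by (rule sw_comultH_cong[OF h], rule comultH_mult[OF N, symmetric])
        (simp, simp, unfold bilin_def, (intro conjI ballI lins id_lin[OF modH]; simp))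
  also have "\<dots> = sw N (\<Delta>\<^sub>H h) (\<lambda>h' h2. ev N (act gs h2) (\<lambda>zs. sw N (\<Delta>\<^sub>H (h' \<cdot> g))
      (\<lambda>x y. f (x # y # zs))))"
    by (rule sw_comultH_cong[OF h], rule sw_ev_swap[OF N comultH_combs act_combs[OF _ gs]]) simp_all
  also have "\<dots> = sw N (\<Delta>\<^sub>H h) (\<lambda>h' h2. ev N (act gs h2) (\<lambda>zs. sw N (\<Delta>\<^sub>H (hd (h' \<cdot> g # zs)))
      (\<lambda>x y. f (x # y # tl (h' \<cdot> g # zs)))))"
    by simp
  also have "\<dots> = ev N (act (g # gs) h) (\<lambda>zs. sw N (\<Delta>\<^sub>H (hd zs)) (\<lambda>x y. f (x # y # tl zs)))"
    by (rule act_Cons[OF h g gs, symmetric]) (auto simp: tuples_Suc_iff)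
  finally show ?thesis .
qed

end

end

lemma bilin_cong:
  assumes "module R A" "module R B" "\<And>x y. x \<in> carrier A \<Longrightarrow> y \<in> carrier B \<Longrightarrow> f x y = g x y"
      "bilin R A B N g"
  shows "bilin R A B N f"
  using assms(4) lin_cong[OF assms(1), of "\<lambda>x. f x _" "\<lambda>x. g x _"] lin_cong[OF assms(2), of "f _"
      "g _"] assms(3)
  unfolding bilin_def by blast

lemma multi_snoc:
  "multi R M N (Suc n) f \<Longrightarrow> d \<in> carrier M \<Longrightarrow> multi R M N n (\<lambda>xs. f (xs @ [d]))"
proof (induction n arbitrary: f)
  case 0 then show ?case by (auto intro: multi_closed[of R M N "Suc 0"] simp: tuples_0)
next
  case (Suc n)
  have "multi R M N n (\<lambda>xs. f (x # xs @ [d]))" if "x \<in> carrier M" for x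
    using Suc.IH[of "\<lambda>xs. f (x # xs)"] Suc.prems that by simp
  moreover have "xs @ [d] \<in> tuples M (Suc n)" if "xs \<in> tuples M n" for xs
    using that Suc.prems(2) by (auto simp: tuples_def)
  ultimately show ?case using Suc.prems(1) by simp
qed

lemma tuples_snoc [simp]: "xs \<in> tuples M n \<Longrightarrow> d \<in> carrier M \<Longrightarrow> xs @ [d] \<in> tuples M (Suc n)"
  by (auto simp: tuples_def)

lemma multi_snoc_lin:
  "multi R M N (Suc n) f \<Longrightarrow> xs \<in> tuples M n \<Longrightarrow> g \<in> linear_maps R A M \<Longrightarrow>
      (\<lambda>d. f (xs @ [g d])) \<in> linear_maps R A N"
proof (induction n arbitrary: f xs)
  case 0 then show ?case using lin_comp[of "\<lambda>x. f [x]" R M N g A] by (simp add: tuples_0)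
next
  case (Suc n)
  then obtain y ys where "xs = y # ys" "y \<in> carrier M" "ys \<in> tuples M n"
      by (auto simp: tuples_Suc_iff)
  with Suc.IH[of "\<lambda>xs. f (y # xs)" ys] Suc.prems show ?case by simp
qed

lemma multi_rotate:
  assumes "multi R M N (Suc n) f" "module R M"
  shows "multi R M N (Suc n) (\<lambda>xs. f (rotate1 xs))"
proof -
  interpret module R M by fact
  have i: "(\<lambda>x. x) \<in> linear_maps R M M" by (rule linI) auto
  show ?thesis using multi_snoc[OF assms(1)] multi_snoc_lin[OF assms(1) _ i] by simp
qed

section \<open>The crossed coproduct as a coalgebra\<close>

context crossed begin

abbreviation "D \<equiv> crossed_coproduct R H C"
abbreviation "D0 \<equiv> tensor R C H"
abbreviation "pD \<equiv> pure R C H"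

lemma D_sel:
  "carrier D = carrier D0" "add D = add D0" "zero D = zero D0" "smult D = smult D0"
  by (simp_all add: crossed_coproduct_def Let_def)

lemma linear_maps_D: "linear_maps R M D = linear_maps R M D0"
    "linear_maps R D M' = linear_maps R D0 M'"
  by (simp_all add: linear_maps_def D_sel)

lemma modD0: "module R D0" by (rule tensor_module[OF modC modH])

text \<open>\<open>D\<close> is \<open>D0\<close> extended by coalgebra fields, hence a different
  record; its module laws are read off field by field through \<open>D_sel\<close>.\<close>

lemma modD: "module R D"
proof -
  interpret E: module R D0 by (rule modD0)
  show ?thesis
  proof (rule moduleI[OF R_cring])
    show "abelian_group D"
    proof (rule abelian_groupI)
      fix x assume "x \<in> carrier D"
      then show "\<exists>y\<in>carrier D. y \<oplus>\<^bsub>D\<^esub> x = \<zero>\<^bsub>D\<^esub>"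
        by (intro bexI[of _ "\<ominus>\<^bsub>D0\<^esub> x"]) (simp_all add: D_sel E.M.l_neg)
    qed (simp_all add: D_sel E.M.a_assoc, simp add: E.M.a_comm)
  qed (simp_all add: D_sel E.smult_l_distr E.smult_r_distr E.smult_assoc1)
qed

lemma pD_closed [simp]: "a \<in> carrier C \<Longrightarrow> g \<in> carrier H \<Longrightarrow> pD a g \<in> carrier D"
  unfolding D_sel by (rule pure_closed[OF modC modH])

lemma pD_lin1: "g \<in> carrier H \<Longrightarrow> f \<in> linear_maps R M C \<Longrightarrow> (\<lambda>x. pD (f x) g) \<in> linear_maps R M D"
  using lin_comp[of "\<lambda>a. pD a g" R C D0 f M] pure_bilin[OF modC modH] unfolding bilin_def
      linear_maps_D by blast

lemma pD_lin2: "a \<in> carrier C \<Longrightarrow> f \<in> linear_maps R M H \<Longrightarrow> (\<lambda>x. pD a (f x)) \<in> linear_maps R M D"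
  using lin_comp[of "pD a" R H D0 f M] pure_bilin[OF modC modH] unfolding bilin_def linear_maps_D
      by blast

text \<open>Built on \<open>D0\<close>, as in the definition of the crossed coproduct, where the
  target of the comultiplication has to be named before \<open>D\<close> is complete.
  \<open>D_sel\<close> and \<open>linear_maps_D\<close> bridge the two records.\<close>

abbreviation "DD \<equiv> tensor R D0 D0"
abbreviation "\<Delta>\<^sub>D d \<equiv> rep R (comult D d)"

lemma modDD: "module R DD" by (rule tensor_module[OF modD0 modD0])

text \<open>The function under the outermost \<open>lin_ext\<close> of the comultiplication,
  isolated so that its bilinearity can be established; without it the comultiplication would not be
  known to be well defined.\<close>

definition comultD where
  "comultD = (\<lambda>(a, g). lin_ext R DD
          (\<lambda>(a0, a1). lin_ext R DD
            (\<lambda>(h, b). lin_ext R DD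
              (\<lambda>(g0, g1). pure R D0 D0 (pD a0 (h \<cdot> g0)) (pD b g1))
              (comult H g))
            (coact C a1))
          (comult C a))"

lemma comult_D_eq: "comult D = lin_ext R DD comultD"
  by (simp add: crossed_coproduct_def comultD_def Let_def)

lemma sends_comultD:
  assumes N: "module R N" and L: "L \<in> linear_maps R DD N" and a: "a \<in> carrier C" and g:
      "g \<in> carrier H"
  shows "sends DD L (comultD (a, g)) (sw N (\<Delta>\<^sub>C a) (\<lambda>u v. sw N (\<rho> v) (\<lambda>h b. sw N (\<Delta>\<^sub>H g)
      (\<lambda>x y. L (pure R D0 D0 (pD u (h \<cdot> x)) (pD b y))))))"
  unfolding comultD_def prod.case
  by (rule sends_dC[OF modDD N L a], unfold prod.case, rule sends_co[OF modDD N L], assumption,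
      unfold prod.case,
      rule sends_dH[OF modDD N L g])
    (simp add: sends_def pure_closed[OF modD0 modD0] pD_closed[unfolded D_sel])

text \<open>Testing \<open>sends_comultD\<close> on the identity rewrites the nested
  \<open>lin_ext\<close> as Sweedler sums, for which linearity in each argument can be assembled
  from that of the pieces.\<close>

lemma comultD_bilin: "bilin R C H DD (\<lambda>a g. comultD (a, g))"
proof (rule bilin_cong[OF modC modH])
  fix a g assume "a \<in> carrier C" "g \<in> carrier H"
  then show "comultD (a, g) = sw DD (\<Delta>\<^sub>C a) (\<lambda>u v. sw DD (\<rho> v) (\<lambda>h b. sw DD (\<Delta>\<^sub>H g)
      (\<lambda>x y. pure R D0 D0 (pD u (h \<cdot> x)) (pD b y))))"
    using sendsD(1)[OF sends_comultD[OF modDD id_lin[OF modDD]]] by simp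
next
  have b: "(\<lambda>x. pure R D0 D0 (f x) d) \<in> linear_maps R M DD" "(\<lambda>x. pure R D0 D0 d (f x)) \<in>
      linear_maps R M DD"
    if "f \<in> linear_maps R M D" "d \<in> carrier D" for f d and M :: "('a, 'q, 'qq) module_scheme"
    using that lin_comp[of "\<lambda>x. pure R D0 D0 x d" R D0 DD f M] lin_comp[of
        "pure R D0 D0 d" R D0 DD f M] pure_bilin[OF modD0 modD0]
    unfolding bilin_def linear_maps_D D_sel by blast+
  note lins = sw_comultH_lin_param[OF modDD] sw_comultC_lin_param[OF modDD] sw_coact_lin_param[OF
      modDD] sw_coact_lin[OF modDD] pD_lin1 pD_lin2 mult_lin_right mult_lin_left_comp
      mult_lin_right_comp id_lin[OF modH] id_lin[OF modC]
  show "bilin R C H DD (\<lambda>a g. sw DD (\<Delta>\<^sub>C a) (\<lambda>u v. sw DD (\<rho> v) (\<lambda>h b. sw DD (\<Delta>\<^sub>H g)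
      (\<lambda>x y. pure R D0 D0 (pD u (h \<cdot> x)) (pD b y)))))"
    unfolding bilin_def
  proof (intro conjI ballI)
    fix g assume [simp]: "g \<in> carrier H"
    show "(\<lambda>a. sw DD (\<Delta>\<^sub>C a) (\<lambda>u v. sw DD (\<rho> v) (\<lambda>h b. sw DD (\<Delta>\<^sub>H g) (\<lambda>x y. pure R D0 D0 (pD u (h \<cdot>
        x)) (pD b y))))) \<in> linear_maps R C DD"
      by (rule sw_comultC_lin[OF modDD], unfold bilin_def, (intro conjI ballI lins b;
          (simp | unfold bilin_def, (intro conjI ballI lins b; simp))))
  next
    fix a assume [simp]: "a \<in> carrier C"
    show "(\<lambda>g. sw DD (\<Delta>\<^sub>C a) (\<lambda>u v. sw DD (\<rho> v) (\<lambda>h b. sw DD (\<Delta>\<^sub>H g) (\<lambda>x y. pure R D0 D0 (pD u (h \<cdot>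
        x)) (pD b y))))) \<in> linear_maps R H DD"
      by (intro sw_comultC_lin_param[OF modDD] sw_coact_lin_param[OF modDD] sw_comultH_lin[OF
          modDD]; (simp | unfold bilin_def, (intro conjI ballI lins b; simp)))
  qed
qed

lemma comultD_lin: "comult D \<in> linear_maps R D0 DD"
  unfolding comult_D_eq by (rule tensor_ext(1)[OF modC modH modDD comultD_bilin])

lemma comultD_combs: "d \<in> carrier D \<Longrightarrow> \<Delta>\<^sub>D d \<in> combs R (carrier D \<times> carrier D)"
  using tensor_rep(1)[OF modD0 modD0 lin_closed[OF comultD_lin]] by (simp add: D_sel)

text \<open>The combination chosen to represent the coproduct of \<open>pD a g\<close> has no
  visible relation to \<open>a\<close> and \<open>g\<close>. Bilinearity of \<open>f\<close> makes
  the sum independent of that choice, so the defining formula computes it.\<close>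

lemma sw_comultD_pure:
  assumes N: "module R N" and f: "bilin R D D N f" and a: "a \<in> carrier C" and g: "g \<in> carrier H"
  shows "sw N (\<Delta>\<^sub>D (pD a g)) f = sw N (\<Delta>\<^sub>C a) (\<lambda>u v. sw N (\<rho> v) (\<lambda>h b. sw N (\<Delta>\<^sub>H g)
      (\<lambda>x y. f (pD u (h \<cdot> x)) (pD b y))))"
proof -
  let ?L = "lin_ext R N (\<lambda>(p, q). f p q)"
  have f0: "bilin R D0 D0 N (\<lambda>x y. (\<lambda>(p, q). f p q) (x, y))" using f by
      (simp add: bilin_def linear_maps_D D_sel)
  note e = tensor_ext[OF modD0 modD0 N f0]
  have X: "comult D (pD a g) = comultD (a, g)"
    unfolding comult_D_eq by (rule tensor_ext(2)[OF modC modH modDD comultD_bilin a g])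
  have "comult D (pD a g) \<in> carrier DD"
    using lin_closed[OF comultD_lin] pD_closed[OF a g] by (simp add: D_sel)
  then have "sw N (\<Delta>\<^sub>D (pD a g)) f = ?L (comult D (pD a g))"
    unfolding sw_def by (rule tensor_ev[OF modD0 modD0 N, symmetric])
        (use bilin_closed[OF f0] in auto)
  also have "\<dots> = sw N (\<Delta>\<^sub>C a) (\<lambda>u v. sw N (\<rho> v) (\<lambda>h b. sw N (\<Delta>\<^sub>H g) (\<lambda>x y. ?L (pure R D0 D0 (pD u (h
      \<cdot> x)) (pD b y)))))"
    unfolding X by (rule sendsD(1)[OF sends_comultD[OF N e(1) a g]])
  also have "\<dots> = sw N (\<Delta>\<^sub>C a) (\<lambda>u v. sw N (\<rho> v) (\<lambda>h b. sw N (\<Delta>\<^sub>H g) (\<lambda>x y. f (pD u (h \<cdot> x)) (pD b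
      y))))"
    by (rule sw_comultC_cong[OF a], rule sw_coact_cong, assumption, rule sw_comultH_cong[OF g],
        subst e(2)) (simp_all add: pD_closed[unfolded D_sel])
  finally show ?thesis .
qed

lemma counitD_bilin: "bilin R C H (scalar_module R) (\<lambda>a g. counit C a \<otimes>\<^bsub>R\<^esub> counit H g)"
  unfolding bilin_def
proof (intro conjI ballI)
  fix g assume g: "g \<in> carrier H"
  show "(\<lambda>a. counit C a \<otimes>\<^bsub>R\<^esub> counit H g) \<in> linear_maps R C (scalar_module R)"
    using lin_smult_left[OF scalar_module[OF R_cring] counit_linear, of "counit H g"] g by simp
next
  fix a assume a: "a \<in> carrier C"
  show "(\<lambda>g. counit C a \<otimes>\<^bsub>R\<^esub> counit H g) \<in> linear_maps R H (scalar_module R)"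
    using lin_smult_const[OF scalar_module[OF R_cring] _ H.counit_linear, of "counit C a"] a by simp
qed

lemma counitD: "counit D \<in> linear_maps R D (scalar_module R)"
    "a \<in> carrier C \<Longrightarrow> g \<in> carrier H \<Longrightarrow> counit D (pD a g) = counit C a \<otimes>\<^bsub>R\<^esub> counit H g"
proof -
  have c: "counit D = lin_ext R (scalar_module R) (\<lambda>(a, g). counit C a \<otimes>\<^bsub>R\<^esub> counit H g)"
    by (simp add: crossed_coproduct_def Let_def)
  have b: "bilin R C H (scalar_module R) (\<lambda>a g. (\<lambda>(a, g). counit C a \<otimes>\<^bsub>R\<^esub> counit H g) (a, g))"
    using counitD_bilin by simp
  note e = tensor_ext[OF modC modH scalar_module[OF R_cring] b]
  show "counit D \<in> linear_maps R D (scalar_module R)" unfolding c linear_maps_D by (rule e(1))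
  show "a \<in> carrier C \<Longrightarrow> g \<in> carrier H \<Longrightarrow> counit D (pD a g) = counit C a \<otimes>\<^bsub>R\<^esub> counit H g"
    unfolding c using e(2) by simp
qed

lemma epsD_closed [simp]: "d \<in> carrier D \<Longrightarrow> counit D d \<in> carrier R"
  using lin_closed[OF counitD(1)] by simp

section \<open>The isomorphism and its inverse\<close>

text \<open>The recursion runs on \<open>gs\<close> alone, whence \<open>hd as\<close> and
  \<open>tl as\<close>; both tuples are meant to have the same length. At each step the tail is
  coacted as one element and the coacted tail is passed on, so an entry contributes one leg to each
  place before it.\<close>

primrec Phi where
  "Phi [] as = ret R []"
| "Phi (g # gs) as = bind R (coacts (tl as)) (\<lambda>(k, bs). bind R (Phi gs bs)
    (\<lambda>ds. ret R (pD (hd as) (k \<cdot> g) # ds)))"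

text \<open>The tail is inverted first and then coacted afresh: in a composite with
  \<open>Phi\<close>, that leg and the one multiplied on by \<open>Phi\<close> become the two legs
  of a single element of \<open>H\<close>. Only one factor \<open>T k\<close> is inserted per step,
  because the legs of the tail are already multiplied.\<close>

primrec Psi where
  "Psi [] = ret R ([], [])"
| "Psi (d # ds) = bind R (rep R d) (\<lambda>(a, g). bind R (Psi ds) (\<lambda>(gs, as). bind R (coacts as)
    (\<lambda>(k, bs). ret R (T k \<cdot> g # gs, a # bs))))"

lemma Phi_combs: "gs \<in> tuples H n \<Longrightarrow> as \<in> tuples C n \<Longrightarrow> Phi gs as \<in> combs R (tuples D n)"
proof (induction gs arbitrary: n as)
  case Nil then show ?case by (auto intro!: ret_combs[OF R_cring])
next
  case (Cons g gs)
  then obtain m a as' where [simp]: "n = Suc m" "g \<in> carrier H" "gs \<in> tuples H m" "as = a # as'"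
      "a \<in> carrier C" and as: "as' \<in> tuples C m"
    by (auto simp: tuples_Suc_iff)
  have "bind R (Phi gs bs) (\<lambda>ds. ret R (pD a (k \<cdot> g) # ds)) \<in> combs R (tuples D n)"
    if "k \<in> carrier H" "bs \<in> tuples C m" for k bs
    by (rule bind_combs[OF R_cring Cons.IH[of m]]) (use that in \<open>auto intro!: ret_combs[OF
        R_cring]\<close>)
  then show ?case by (auto intro!: bind_combs[OF R_cring coacts_combs[OF as]])
qed

lemma rep_D_combs: "d \<in> carrier D \<Longrightarrow> rep R d \<in> combs R (carrier C \<times> carrier H)"
  unfolding D_sel by (rule tensor_rep(1)[OF modC modH])

lemma Psi_combs: "ds \<in> tuples D n \<Longrightarrow> Psi ds \<in> combs R (tuples H n \<times> tuples C n)"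
proof (induction ds arbitrary: n)
  case Nil then show ?case by (auto intro!: ret_combs[OF R_cring])
next
  case (Cons d ds)
  then obtain m where [simp]: "n = Suc m" and d: "d \<in> carrier D" and ds: "ds \<in> tuples D m" by auto
  have 1: "bind R (coacts as) (\<lambda>(k, bs). ret R (T k \<cdot> g # gs, a # bs)) \<in> combs R (tuples H n \<times>
      tuples C n)"
    if "g \<in> carrier H" "a \<in> carrier C" "gs \<in> tuples H m" "as \<in> tuples C m" for a g as gs
    by (rule bind_combs[OF R_cring coacts_combs[OF that(4)]])
        (use that in \<open>auto intro!: ret_combs[OF R_cring]\<close>)
  have "bind R (Psi ds) (\<lambda>(gs, as). bind R (coacts as) (\<lambda>(k, bs). ret R (T k \<cdot> g # gs, a # bs))) \<in>
      combs R (tuples H n \<times> tuples C n)"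
    if "g \<in> carrier H" "a \<in> carrier C" for a g
    by (rule bind_combs[OF R_cring Cons.IH[OF ds]]) (use that 1 in auto)
  then show ?case by (auto intro!: bind_combs[OF R_cring rep_D_combs[OF d]])
qed

lemma Phi_cong: "gs \<in> tuples H n \<Longrightarrow> as \<in> tuples C n \<Longrightarrow> (\<And>ds. ds \<in> tuples D n \<Longrightarrow> f ds = g ds) \<Longrightarrow>
    ev N (Phi gs as) f = ev N (Phi gs as) g"
  by (rule ev_cong[OF Phi_combs])

lemma Psi_cong: "ds \<in> tuples D n \<Longrightarrow> (\<And>gs as. gs \<in> tuples H n \<Longrightarrow> as \<in> tuples C n \<Longrightarrow> f gs as = g gs as)
    \<Longrightarrow> sw N (Psi ds) f = sw N (Psi ds) g"
  by (rule sw_cong[OF Psi_combs])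

context
  fixes N :: "('a, 'n, 'p) module_scheme"
  assumes N: "module R N"
begin

interpretation N: module R N by (rule N)

lemma sw_bind:
  assumes "L \<in> combs R (A \<times> B)" "\<And>u v. u \<in> A \<Longrightarrow> v \<in> B \<Longrightarrow> g u v \<in> combs R B'" "\<And>x. x \<in> B'
      \<Longrightarrow> f x \<in> carrier N"
  shows "ev N (bind R L (\<lambda>(u, v). g u v)) f = sw N L (\<lambda>u v. ev N (g u v) f)"
proof -
  have "ev N (bind R L (\<lambda>(u, v). g u v)) f = ev N L (\<lambda>p. ev N ((\<lambda>(u, v). g u v) p) f)"
    by (rule ev_bind[OF N assms(1) _ assms(3)]) (use assms(2) in auto)
  also have "\<dots> = sw N L (\<lambda>u v. ev N (g u v) f)" unfolding sw_def by (rule ev_cong[OF assms(1)]) auto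
  finally show ?thesis .
qed

lemma Phi_closed: "gs \<in> tuples H n \<Longrightarrow> as \<in> tuples C n \<Longrightarrow> (\<And>ds. ds \<in> tuples D n \<Longrightarrow> f ds \<in> carrier N)
    \<Longrightarrow> ev N (Phi gs as) f \<in> carrier N"
  by (rule ev_closed[OF N Phi_combs])

lemma Psi_closed: "ds \<in> tuples D n \<Longrightarrow> (\<And>gs as. gs \<in> tuples H n \<Longrightarrow> as \<in> tuples C n \<Longrightarrow> f gs as \<in> carrier
    N) \<Longrightarrow> sw N (Psi ds) f \<in> carrier N"
  by (rule sw_closed[OF N Psi_combs])

lemma sw_comultD_closed: "d \<in> carrier D \<Longrightarrow> (\<And>p q. p \<in> carrier D \<Longrightarrow> q \<in> carrier D \<Longrightarrow> f p q \<in> carrier N)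
    \<Longrightarrow> sw N (\<Delta>\<^sub>D d) f \<in> carrier N"
  by (rule sw_closed[OF N comultD_combs])

lemma Phi_lin_param: "gs \<in> tuples H n \<Longrightarrow> as \<in> tuples C n \<Longrightarrow> (\<And>ds. ds \<in> tuples D n \<Longrightarrow>
    (\<lambda>x. f x ds) \<in> linear_maps R M N) \<Longrightarrow>
    (\<lambda>x. ev N (Phi gs as) (f x)) \<in> linear_maps R M N"
  by (rule ev_lin_param[OF N Phi_combs])

lemma sw_comultD_lin: "bilin R D D N f \<Longrightarrow> (\<lambda>d. sw N (\<Delta>\<^sub>D d) f) \<in> linear_maps R D N"
  unfolding linear_maps_D by (rule sw_arg_lin[OF modD0 modD0 N comultD_lin modD0])
      (simp add: bilin_def linear_maps_D D_sel)

text \<open>The case of \<open>sw_arg_lin\<close> in which the tensor to be decomposed is the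
  argument itself.\<close>

lemma rep_lin: "bilin R C H N f \<Longrightarrow> (\<lambda>d. sw N (rep R d) f) \<in> linear_maps R D N"
  unfolding linear_maps_D by (rule sw_arg_lin[OF modC modH N id_lin[OF modD0] modD0])

lemma rep_pure:
  assumes f: "bilin R C H N f" and a: "a \<in> carrier C" and g: "g \<in> carrier H"
  shows "sw N (rep R (pD a g)) f = f a g"
proof -
  have b: "bilin R C H N (\<lambda>x y. (\<lambda>(x, y). f x y) (x, y))" using f by simp
  have "sw N (rep R (pD a g)) f = lin_ext R N (\<lambda>(x, y). f x y) (pD a g)"
    unfolding sw_def by (rule tensor_ev[OF modC modH N, symmetric])
        (use a g pD_closed bilin_closed[OF f] in \<open>auto simp: D_sel\<close>)
  also have "\<dots> = f a g" using tensor_ext(2)[OF modC modH N b a g] by simp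
  finally show ?thesis .
qed

lemma rep_linear:
  assumes f: "f \<in> linear_maps R D N" and d: "d \<in> carrier D"
  shows "sw N (rep R d) (\<lambda>a g. f (pD a g)) = f d"
proof -
  have d0: "d \<in> carrier D0" using d by (simp add: D_sel)
  have "f (sw D0 (rep R d) pD) = sw N (rep R d) (\<lambda>a g. f (pD a g))"
    by (rule sw_map[OF modD0 N _ tensor_rep(1)[OF modC modH d0]])
        (use f pD_closed in \<open>auto simp: linear_maps_D D_sel\<close>)
  moreover have "sw D0 (rep R d) pD = d" unfolding sw_def by
      (rule tensor_rep(2)[OF modC modH d0, symmetric])
  ultimately show ?thesis by simp
qed

lemma Phi_Nil: "f [] \<in> carrier N \<Longrightarrow> ev N (Phi [] as) f = f []"
  by (simp add: ev_ret[OF N])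

lemma Phi_Cons:
  assumes g: "g \<in> carrier H" and gs: "gs \<in> tuples H n" and a: "a \<in> carrier C" and as:
      "as \<in> tuples C n"
    and f: "\<And>ds. ds \<in> tuples D (Suc n) \<Longrightarrow> f ds \<in> carrier N"
  shows "ev N (Phi (g # gs) (a # as)) f = sw N (coacts as) (\<lambda>k bs. ev N (Phi gs bs)
      (\<lambda>ds. f (pD a (k \<cdot> g) # ds)))"
proof -
  have r: "ret R (pD a (k \<cdot> g) # ds) \<in> combs R (tuples D (Suc n))" if "k \<in> carrier H"
      "ds \<in> tuples D n" for k ds
    using that g a by (auto intro!: ret_combs[OF R_cring])
  have "ev N (Phi (g # gs) (a # as)) f = sw N (coacts as) (\<lambda>k bs. ev N (bind R (Phi gs bs)
      (\<lambda>ds. ret R (pD a (k \<cdot> g) # ds))) f)"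
    unfolding Phi.simps list.sel
    by (rule sw_bind[OF coacts_combs[OF as] _ f]) (rule bind_combs[OF R_cring Phi_combs[OF gs]],
        assumption, rule r)
  also have "\<dots> = sw N (coacts as) (\<lambda>k bs. ev N (Phi gs bs) (\<lambda>ds. f (pD a (k \<cdot> g) # ds)))"
  proof (rule coacts_cong[OF as])
    fix k bs assume kb: "k \<in> carrier H" "bs \<in> tuples C n"
    have "ev N (bind R (Phi gs bs) (\<lambda>ds. ret R (pD a (k \<cdot> g) # ds))) f = ev N (Phi gs bs) (\<lambda>ds.
        ev N (ret R (pD a (k \<cdot> g) # ds)) f)"
      by (rule ev_bind[OF N Phi_combs[OF gs kb(2)] r[OF kb(1)] f])
    also have "\<dots> = ev N (Phi gs bs) (\<lambda>ds. f (pD a (k \<cdot> g) # ds))"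
      by (rule Phi_cong[OF gs kb(2)], rule ev_ret[OF N], rule f) (use kb g a in auto)
    finally show "ev N (bind R (Phi gs bs) (\<lambda>ds. ret R (pD a (k \<cdot> g) # ds))) f =
        ev N (Phi gs bs) (\<lambda>ds. f (pD a (k \<cdot> g) # ds))" .
  qed
  finally show ?thesis .
qed

lemma Psi_Cons:
  assumes d: "d \<in> carrier D" and ds: "ds \<in> tuples D n"
    and f: "\<And>gs as. gs \<in> tuples H (Suc n) \<Longrightarrow> as \<in> tuples C (Suc n) \<Longrightarrow> f gs as \<in> carrier N"
  shows "sw N (Psi (d # ds)) f = sw N (rep R d) (\<lambda>a g. sw N (Psi ds) (\<lambda>gs as. sw N (coacts as)
      (\<lambda>k bs. f (T k \<cdot> g # gs) (a # bs))))"
proof -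
  let ?B = "tuples H (Suc n) \<times> tuples C (Suc n)" and ?f = "\<lambda>(gs, as). f gs as"
  have f': "?f x \<in> carrier N" if "x \<in> ?B" for x using that f by auto
  have r: "ret R (T k \<cdot> g # gs, a # bs) \<in> combs R ?B"
    if "g \<in> carrier H" "a \<in> carrier C" "gs \<in> tuples H n" "k \<in> carrier H"
        "bs \<in> tuples C n" for a g gs k bs
    using that by (auto intro!: ret_combs[OF R_cring])
  have r2: "bind R (coacts as) (\<lambda>(k, bs). ret R (T k \<cdot> g # gs, a # bs)) \<in> combs R ?B"
    if "g \<in> carrier H" "a \<in> carrier C" "gs \<in> tuples H n" "as \<in> tuples C n" for a g as gs
    by (rule bind_combs[OF R_cring coacts_combs[OF that(4)]]) (use that r in auto)
  have r3: "bind R (Psi ds) (\<lambda>(gs, as). bind R (coacts as) (\<lambda>(k, bs). ret R (T k \<cdot> g # gs, a # bs)))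
      \<in> combs R ?B"
    if "g \<in> carrier H" "a \<in> carrier C" for a g
    by (rule bind_combs[OF R_cring Psi_combs[OF ds]]) (use that r2 in auto)
  have "sw N (Psi (d # ds)) f = ev N (Psi (d # ds)) ?f" by (simp add: sw_def)
  also have "\<dots> = sw N (rep R d) (\<lambda>a g. ev N (bind R (Psi ds) (\<lambda>(gs, as). bind R (coacts as)
      (\<lambda>(k, bs). ret R (T k \<cdot> g # gs, a # bs)))) ?f)"
    unfolding Psi.simps by (rule sw_bind[OF rep_D_combs[OF d] r3 f'])
  also have "\<dots> = sw N (rep R d) (\<lambda>a g. sw N (Psi ds) (\<lambda>gs as. sw N (coacts as)
      (\<lambda>k bs. f (T k \<cdot> g # gs) (a # bs))))"
  proof (rule sw_cong[OF rep_D_combs[OF d]])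
    fix a g assume ag: "a \<in> carrier C" "g \<in> carrier H"
    have "ev N (bind R (Psi ds) (\<lambda>(gs, as). bind R (coacts as) (\<lambda>(k, bs). ret R (T k \<cdot> g # gs, a #
        bs)))) ?f =
      sw N (Psi ds) (\<lambda>gs as. ev N (bind R (coacts as) (\<lambda>(k, bs). ret R (T k \<cdot> g # gs, a # bs))) ?f)"
      by (rule sw_bind[OF Psi_combs[OF ds] r2[OF ag(2,1)] f'])
    also have "\<dots> = sw N (Psi ds) (\<lambda>gs as. sw N (coacts as) (\<lambda>k bs. f (T k \<cdot> g # gs) (a # bs)))"
    proof (rule Psi_cong[OF ds])
      fix gs as assume ga: "gs \<in> tuples H n" "as \<in> tuples C n"
      have "ev N (bind R (coacts as) (\<lambda>(k, bs). ret R (T k \<cdot> g # gs, a # bs))) ?f =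
        sw N (coacts as) (\<lambda>k bs. ev N (ret R (T k \<cdot> g # gs, a # bs)) ?f)"
        by (rule sw_bind[OF coacts_combs[OF ga(2)] r[OF ag(2,1) ga(1)] f'])
      also have "\<dots> = sw N (coacts as) (\<lambda>k bs. f (T k \<cdot> g # gs) (a # bs))"
        by (rule coacts_cong[OF ga(2)], subst ev_ret[OF N]) (use ag ga f in auto)
      finally show "ev N (bind R (coacts as) (\<lambda>(k, bs). ret R (T k \<cdot> g # gs, a # bs))) ?f =
          sw N (coacts as) (\<lambda>k bs. f (T k \<cdot> g # gs) (a # bs))" .
    qed
    finally show "ev N (bind R (Psi ds) (\<lambda>(gs, as). bind R (coacts as) (\<lambda>(k, bs). ret R (T k \<cdot> g #
        gs, a # bs)))) ?f =
      sw N (Psi ds) (\<lambda>gs as. sw N (coacts as) (\<lambda>k bs. f (T k \<cdot> g # gs) (a # bs)))" .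
  qed
  finally show ?thesis .
qed

text \<open>Well-definedness of the isomorphism on the mixed tensor product. In the direction of
  \<open>as\<close> the tail passes through \<open>coacts\<close>, so the induction hypothesis has
  to be combined with linearity in the leg \<open>k\<close>.\<close>

lemma Phi_bimulti: "multi R D N n f \<Longrightarrow> bimulti R H C N n n (\<lambda>gs as. ev N (Phi gs as) f)"
proof (induction n arbitrary: f)
  case 0 then show ?case by (simp add: bimulti_def tuples_0 ev_ret[OF N])
next
  case (Suc n)
  note f = Suc.prems
  have c: "f ds \<in> carrier N" if "ds \<in> tuples D (Suc n)" for ds using multi_closed[OF f that] .
  note e = Phi_Cons[OF _ _ _ _ c]
  have IH1: "multi R H N n (\<lambda>gs. ev N (Phi gs as) f)" if "as \<in> tuples C n"
      "multi R D N n f" for as f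
    using Suc.IH[OF that(2)] that(1) by (simp add: bimulti_def)
  have IH2: "multi R C N n (\<lambda>as. ev N (Phi gs as) f)" if "gs \<in> tuples H n"
      "multi R D N n f" for gs f
    using Suc.IH[OF that(2)] that(1) by (simp add: bimulti_def)
  have fm: "multi R D N n (\<lambda>ds. f (pD a (k \<cdot> g) # ds))" if "a \<in> carrier C" "g \<in> carrier H"
      "k \<in> carrier H" for a g k
    by (rule multi_Cons[OF f]) (use that in simp)
  show ?case unfolding bimulti_def
  proof (intro conjI ballI)
    fix aas assume "aas \<in> tuples C (Suc n)"
    then obtain a as where [simp]: "aas = a # as" and a: "a \<in> carrier C" and as:
        "as \<in> tuples C n" by (auto simp: tuples_Suc_iff)
    have "multi R H N n (\<lambda>gs. ev N (Phi (g # gs) (a # as)) f)" if g: "g \<in> carrier H" for g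
    proof (rule multi_cong[OF modH])
      show "multi R H N n (\<lambda>gs. sw N (coacts as) (\<lambda>k bs. ev N (Phi gs bs)
          (\<lambda>ds. f (pD a (k \<cdot> g) # ds))))"
        by (rule sw_multi[OF N coacts_combs[OF as]], rule IH1, assumption, rule fm[OF a g])
    qed (simp add: e[OF g _ a as] del: Phi.simps)
    moreover have "(\<lambda>g. ev N (Phi (g # gs) (a # as)) f) \<in> linear_maps R H N" if gs:
        "gs \<in> tuples H n" for gs
    proof (subst lin_cong[OF modH e[OF _ gs a as]])
      show "(\<lambda>g. sw N (coacts as) (\<lambda>k bs. ev N (Phi gs bs) (\<lambda>ds. f (pD a (k \<cdot> g) # ds)))) \<in>
          linear_maps R H N"
        by (intro coacts_lin_param[OF N as] Phi_lin_param[OF gs] multi_lin[OF f] pD_lin2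
            mult_lin_right; simp add: a)
    qed simp_all
    ultimately show "multi R H N (Suc n) (\<lambda>gs. ev N (Phi gs aas) f)" by (simp del: Phi.simps)
  next
    fix ggs assume "ggs \<in> tuples H (Suc n)"
    then obtain g gs where [simp]: "ggs = g # gs" and g: "g \<in> carrier H" and gs:
        "gs \<in> tuples H n" by (auto simp: tuples_Suc_iff)
    have lin_multi: "lin_multi N n (\<lambda>k bs. ev N (Phi gs bs) (\<lambda>ds. f (pD a (k \<cdot> g) # ds)))" if a:
        "a \<in> carrier C" for a
      by (rule lin_multiI, rule IH2[OF gs fm[OF a g]], assumption, intro Phi_lin_param[OF gs]
          multi_lin[OF f] pD_lin2 mult_lin_left; simp add: a g)
    have "multi R C N n (\<lambda>as. ev N (Phi (g # gs) (a # as)) f)" if a: "a \<in> carrier C" for a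
    proof (rule multi_cong[OF modC])
      show "multi R C N n (\<lambda>as. sw N (coacts as) (\<lambda>k bs. ev N (Phi gs bs)
          (\<lambda>ds. f (pD a (k \<cdot> g) # ds))))"
        by (rule coacts_multi[OF N lin_multi[OF a]])
    qed (simp add: e[OF g gs a] del: Phi.simps)
    moreover have "(\<lambda>a. ev N (Phi (g # gs) (a # as)) f) \<in> linear_maps R C N" if as:
        "as \<in> tuples C n" for as
    proof (subst lin_cong[OF modC e[OF g gs _ as]])
      show "(\<lambda>a. sw N (coacts as) (\<lambda>k bs. ev N (Phi gs bs) (\<lambda>ds. f (pD a (k \<cdot> g) # ds)))) \<in>
          linear_maps R C N"
        by (intro coacts_lin_param[OF N as] Phi_lin_param[OF gs] multi_lin[OF f] pD_lin1 id_lin[OF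
            modC]; simp add: g)
    qed simp_all
    ultimately show "multi R C N (Suc n) (\<lambda>as. ev N (Phi ggs as) f)" by (simp del: Phi.simps)
  qed
qed

end

end

lemma tuples_ConsE:
  assumes "xs \<in> tuples M (Suc n)"
  obtains y ys where "xs = y # ys" "y \<in> carrier M" "ys \<in> tuples M n"
  using assms by (auto simp: tuples_Suc_iff)

context crossed begin

context
  fixes N :: "('a, 'n, 'p) module_scheme"
  assumes N: "module R N"
begin

interpretation N: module R N by (rule N)

lemmas tuple_closed_rules = coacts_closed[OF N] act_closed[OF N] Phi_closed[OF N] Psi_closed[OF N]
lemmas sw_closed_rules = closed_rules[OF N] sw_comultD_closed[OF N] tuple_closed_rules
lemmas all_lin_param_rules = lin_param_rules[OF N] coacts_lin_param[OF N] act_lin_param[OF N]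
    Phi_lin_param[OF N]

lemma Phi_multi_gs: "multi R D N n f \<Longrightarrow> as \<in> tuples C n \<Longrightarrow> multi R H N n (\<lambda>gs. ev N (Phi gs as) f)"
  and Phi_multi_as: "multi R D N n f \<Longrightarrow> gs \<in> tuples H n \<Longrightarrow> multi R C N n (\<lambda>as. ev N (Phi gs as) f)"
  using Phi_bimulti[OF N] by (auto simp: bimulti_def)

text \<open>Supplies the hypothesis of \<open>coacts_coassoc\<close> in the recurring situation
  where the summand under two nested coactions is a sum over \<open>Phi\<close>.\<close>

lemma Phi_bilin_multi:
  assumes gs: "gs \<in> tuples H n"
    and m: "\<And>k k'. k \<in> carrier H \<Longrightarrow> k' \<in> carrier H \<Longrightarrow> multi R D N n (f k k')"
    and l1: "\<And>k' ds. k' \<in> carrier H \<Longrightarrow> ds \<in> tuples D n \<Longrightarrow> (\<lambda>k. f k k' ds) \<in> linear_maps R H N"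
    and l2: "\<And>k ds. k \<in> carrier H \<Longrightarrow> ds \<in> tuples D n \<Longrightarrow> (\<lambda>k'. f k k' ds) \<in> linear_maps R H N"
  shows "bilin_multi N n (\<lambda>k k' bs. ev N (Phi gs bs) (f k k'))"
  unfolding bilin_multi_def
proof (intro conjI ballI lin_multiI)
  fix k k' assume "k \<in> carrier H" "k' \<in> carrier H"
  then show "multi R C N n (\<lambda>bs. ev N (Phi gs bs) (f k k'))" "multi R C N n (\<lambda>bs.
      ev N (Phi gs bs) (f k' k))"
    by (auto intro!: Phi_multi_as m gs)
qed (intro Phi_lin_param[OF N gs] l1 l2; assumption)+

text \<open>Peeling off the last instead of the first factor: the pieces of the last coaction act
  diagonally on the other \<open>g\<^sub>i\<close>.\<close>

lemma Phi_snoc: "gs \<in> tuples H n \<Longrightarrow> as \<in> tuples C n \<Longrightarrow> g \<in> carrier H \<Longrightarrow> a \<in> carrier C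
    \<Longrightarrow> multi R D N (Suc n) f \<Longrightarrow>
   ev N (Phi (gs @ [g]) (as @ [a])) f = sw N (\<rho> a) (\<lambda>h b. ev N (act gs h) (\<lambda>gs'.
       ev N (Phi gs' as) (\<lambda>ds. f (ds @ [pD b g]))))"
proof (induction gs arbitrary: n as a f)
  case Nil
  then have [simp]: "n = 0" "as = []" "g \<in> carrier H" "a \<in> carrier C" by (simp_all add: tuples_0)
  have c [simp]: "f [d] \<in> carrier N" if "d \<in> carrier D" for d using multi_closed[OF Nil.prems(5), of
      "[d]"] that by simp
  have "ev N (Phi [g] [a]) f = sw N (coacts []) (\<lambda>k bs. ev N (Phi [] bs)
      (\<lambda>ds. f (pD a (k \<cdot> g) # ds)))"
    by (rule Phi_Cons[OF N, of _ _ 0]) (auto simp: tuples_0 tuples_1)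
  also have "\<dots> = ev N (Phi [] []) (\<lambda>ds. f (pD a (\<one>\<^bsub>H\<^esub> \<cdot> g) # ds))" by (rule coacts_Nil[OF N])
      (simp add: Phi_Nil[OF N] del: Phi.simps)
  also have "\<dots> = f [pD a g]" by (subst Phi_Nil[OF N]) simp_all
  finally have 1: "ev N (Phi ([] @ [g]) (as @ [a])) f = f [pD a g]" by simp
  \<comment> \<open>On the empty tuple the action is the counit, so the surplus coaction of
    \<open>a\<close> is undone by \<open>co_counit\<close>.\<close>
  have "sw N (\<rho> a) (\<lambda>h b. ev N (act [] h) (\<lambda>gs'. ev N (Phi gs' as) (\<lambda>ds. f (ds @ [pD b g])))) =
      sw N (\<rho> a) (\<lambda>h b. counit H h \<odot>\<^bsub>N\<^esub> f [pD b g])"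
    by (rule sw_coact_cong) (simp_all add: ev_ret[OF N])
  also have "\<dots> = f [pD a g]"
    by (rule co_counit[OF N, of a "\<lambda>b. f [pD b g]"], simp, rule multi_lin[of R D N 0 f "[]"])
        (use Nil.prems(5) in \<open>simp_all add: pD_lin1[OF _ id_lin[OF modC]]\<close>)
  finally show ?case using 1 by simp
next
  case (Cons g0 gs)
  then obtain m where n [simp]: "n = Suc m" and g0 [simp]: "g0 \<in> carrier H" and gs [simp]:
      "gs \<in> tuples H m" by auto
  obtain a0 as' where as_eq: "as = a0 # as'" and a0 [simp]: "a0 \<in> carrier C" and as' [simp]:
      "as' \<in> tuples C m"
    using Cons.prems(2) by (auto elim: tuples_ConsE)
  note f = Cons.prems(5)[unfolded n]
  have [simp]: "g \<in> carrier H" "a \<in> carrier C" by fact+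
  have c [simp]: "f ds \<in> carrier N" if "ds \<in> tuples D (Suc (Suc m))" for ds using multi_closed[OF f
      that] .
  have fm: "multi R D N (Suc m) (\<lambda>ds. f (d # ds))" if "d \<in> carrier D" for d by
      (rule multi_Cons[OF f that])
  note [simp] = tuple_closed_rules[where n = m] tuple_closed_rules[where n =
      "Suc m"] sw_closed_rules
  have l: "(\<lambda>x. f (d x # ds @ [e])) \<in> linear_maps R M N" if "d \<in> linear_maps R M D"
      "ds \<in> tuples D m" "e \<in> carrier D" for d ds e and M :: "('a, 'q, 'qq) module_scheme"
    by (rule multi_lin[OF f _ that(1)]) (use that in simp)
  have l': "(\<lambda>x. f (d # ds @ [e x])) \<in> linear_maps R M N" if "e \<in> linear_maps R M D"
      "ds \<in> tuples D m" "d \<in> carrier D" for d ds e and M :: "('a, 'q, 'qq) module_scheme"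
    by (rule multi_snoc_lin[OF fm[OF that(3)] that(2,1)])
  have m': "multi R D N m (\<lambda>ds. f (d # ds @ [e]))" if "d \<in> carrier D" "e \<in> carrier D" for d e
    by (rule multi_snoc[OF fm[OF that(1)] that(2)])
  have "ev N (Phi (g0 # gs @ [g]) (a0 # as' @ [a])) f = sw N (coacts (as' @ [a])) (\<lambda>k bs.
      ev N (Phi (gs @ [g]) bs) (\<lambda>ds. f (pD a0 (k \<cdot> g0) # ds)))"
    by (rule Phi_Cons[OF N, of _ _ "Suc m"]) simp_all
  also have "\<dots> = sw N (coacts as') (\<lambda>k bs. sw N (\<rho> a) (\<lambda>h b. ev N (Phi (gs @ [g]) (bs @ [b]))
      (\<lambda>ds. f (pD a0 (k \<cdot> h \<cdot> g0) # ds))))"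
    by (rule coacts_snoc[OF N as']) simp_all
  also have "\<dots> = sw N (coacts as') (\<lambda>k bs. sw N (\<rho> a) (\<lambda>h b. sw N (\<rho> b) (\<lambda>h' b'.
      ev N (act gs h') (\<lambda>gs'. ev N (Phi gs' bs) (\<lambda>ds. f (pD a0 (k \<cdot> h \<cdot> g0) # ds @ [pD b' g]))))))"
  proof (rule coacts_cong[OF as'], rule sw_coact_cong, simp)
    fix k bs h b assume [simp]: "k \<in> carrier H" "bs \<in> tuples C m" "h \<in> carrier H" "b \<in> carrier C"
    show "ev N (Phi (gs @ [g]) (bs @ [b])) (\<lambda>ds. f (pD a0 (k \<cdot> h \<cdot> g0) # ds)) = sw N (\<rho> b)
        (\<lambda>h' b'. ev N (act gs h') (\<lambda>gs'. ev N (Phi gs' bs) (\<lambda>ds. f (pD a0 (k \<cdot> h \<cdot> g0) # ds @ [pD b'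
        g]))))"
      using Cons.IH[OF gs _ _ _ fm, of bs b "pD a0 (k \<cdot> h \<cdot> g0)"] by simp
  qed
  \<comment> \<open>One coaction of \<open>a\<close> gave the leg at \<open>g0\<close>, a second one
    the leg acting on the rest. By coassociativity they are the legs of one \<open>h\<close>, which
    is a step in the recursion of \<open>act\<close>.\<close>
  also have "\<dots> = sw N (coacts as') (\<lambda>k bs. sw N (\<rho> a) (\<lambda>h b. sw N (\<Delta>\<^sub>H h) (\<lambda>h0 h1.
      ev N (act gs h1) (\<lambda>gs'. ev N (Phi gs' bs) (\<lambda>ds. f (pD a0 (k \<cdot> h0 \<cdot> g0) # ds @ [pD b g]))))))"
  proof (rule coacts_cong[OF as'])
    fix k bs assume [simp]: "k \<in> carrier H" "bs \<in> tuples C m"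
    show "sw N (\<rho> a) (\<lambda>h b. sw N (\<rho> b) (\<lambda>h' b'. ev N (act gs h') (\<lambda>gs'. ev N (Phi gs' bs)
        (\<lambda>ds. f (pD a0 (k \<cdot> h \<cdot> g0) # ds @ [pD b' g]))))) =
      sw N (\<rho> a) (\<lambda>h b. sw N (\<Delta>\<^sub>H h) (\<lambda>h0 h1. ev N (act gs h1) (\<lambda>gs'. ev N (Phi gs' bs)
          (\<lambda>ds. f (pD a0 (k \<cdot> h0 \<cdot> g0) # ds @ [pD b g])))))"
    proof (rule co_coassoc[OF N, symmetric])
      show "trilin R H H C N (\<lambda>h h' b'. ev N (act gs h') (\<lambda>gs'. ev N (Phi gs' bs)
          (\<lambda>ds. f (pD a0 (k \<cdot> h \<cdot> g0) # ds @ [pD b' g]))))"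
        unfolding trilin_def
        by (intro conjI ballI act_lin_param[OF N _ gs] act_lin[OF N gs] Phi_multi_gs
            Phi_lin_param[OF N] l l' m' pD_lin1 pD_lin2 mult_lin_left_comp mult_lin_right id_lin[OF
            modC]; simp)
    qed simp
  qed
  \<comment> \<open>The tail's coaction is pushed inward past the splitting of \<open>h\<close> and
    the action, to rebuild the recursion of \<open>Phi\<close> on the tuple already acted
    upon.\<close>
  also have "\<dots> = sw N (\<rho> a) (\<lambda>h b. sw N (coacts as') (\<lambda>k bs. sw N (\<Delta>\<^sub>H h) (\<lambda>h0 h1.
      ev N (act gs h1) (\<lambda>gs'. ev N (Phi gs' bs) (\<lambda>ds. f (pD a0 (k \<cdot> h0 \<cdot> g0) # ds @ [pD b g]))))))"
    by (rule sw_sw_swap[OF N coacts_combs[OF as'] coact_combs]) simp_all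
  also have "\<dots> = sw N (\<rho> a) (\<lambda>h b. sw N (\<Delta>\<^sub>H h) (\<lambda>h0 h1. sw N (coacts as') (\<lambda>k bs.
      ev N (act gs h1) (\<lambda>gs'. ev N (Phi gs' bs) (\<lambda>ds. f (pD a0 (k \<cdot> h0 \<cdot> g0) # ds @ [pD b g]))))))"
    by (rule sw_coact_cong, simp, rule sw_sw_swap[OF N coacts_combs[OF as'] comultH_combs]) simp_all
  also have "\<dots> = sw N (\<rho> a) (\<lambda>h b. sw N (\<Delta>\<^sub>H h) (\<lambda>h0 h1. ev N (act gs h1) (\<lambda>gs'.
      sw N (coacts as') (\<lambda>k bs. ev N (Phi gs' bs) (\<lambda>ds. f (pD a0 (k \<cdot> h0 \<cdot> g0) # ds @ [pD b
      g]))))))"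
    by (rule sw_coact_cong, simp, rule sw_comultH_cong, simp, rule sw_ev_swap[OF N coacts_combs[OF
        as'] act_combs[OF _ gs]]) simp_all
  also have "\<dots> = sw N (\<rho> a) (\<lambda>h b. sw N (\<Delta>\<^sub>H h) (\<lambda>h0 h1. ev N (act gs h1) (\<lambda>gs'.
      ev N (Phi (h0 \<cdot> g0 # gs') (a0 # as')) (\<lambda>ds. f (ds @ [pD b g])))))"
  proof (rule sw_coact_cong, simp, rule sw_comultH_cong, simp, rule act_cong[OF _ gs], simp)
    fix h b h0 h1 gs' assume [simp]: "h \<in> carrier H" "b \<in> carrier C" "h0 \<in> carrier H"
        "h1 \<in> carrier H" "gs' \<in> tuples H m"
    have "ev N (Phi (h0 \<cdot> g0 # gs') (a0 # as')) (\<lambda>ds. f (ds @ [pD b g])) = sw N (coacts as')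
        (\<lambda>k bs. ev N (Phi gs' bs) (\<lambda>ds. f ((pD a0 (k \<cdot> (h0 \<cdot> g0)) # ds) @ [pD b g])))"
      by (rule Phi_Cons[OF N, of _ _ m]) (simp_all del: append_Cons)
    also have "\<dots> = sw N (coacts as') (\<lambda>k bs. ev N (Phi gs' bs) (\<lambda>ds. f (pD a0 (k \<cdot> h0 \<cdot> g0) # ds @
        [pD b g])))"
      by (rule coacts_cong[OF as']) (simp add: H.A.m_assoc)
    finally show "sw N (coacts as') (\<lambda>k bs. ev N (Phi gs' bs) (\<lambda>ds. f (pD a0 (k \<cdot> h0 \<cdot> g0) # ds @
        [pD b g]))) = ev N (Phi (h0 \<cdot> g0 # gs') (a0 # as')) (\<lambda>ds. f (ds @ [pD b g]))" ..
  qed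
  also have "\<dots> = sw N (\<rho> a) (\<lambda>h b. ev N (act (g0 # gs) h) (\<lambda>gs'. ev N (Phi gs' (a0 # as'))
      (\<lambda>ds. f (ds @ [pD b g]))))"
    by (rule sw_coact_cong, simp, rule act_Cons[OF N _ g0 gs, symmetric])
        (simp_all add: Phi_closed[OF N, of _ "Suc m"] del: Phi.simps)
  finally show ?case by (simp add: as_eq)
qed

text \<open>The left side is the horizontal, then the vertical cyclic operator, then
  \<open>Phi\<close>. The entry moved to the end acts on the whole tuple, and this action meets the
  action of \<open>T h\<close> made before it; the counit left over restores
  \<open>a\<close>.\<close>

lemma Phi_cyc:
  assumes gs: "gs \<in> tuples H n" and as: "as \<in> tuples C n" and g: "g \<in> carrier H" and a:
      "a \<in> carrier C"
    and f: "multi R D N (Suc n) f"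
  shows "sw N (\<rho> a) (\<lambda>h b. ev N (act (g # gs) (T h)) (\<lambda>gs'. sw N (coacts (as @ [b])) (\<lambda>k bs.
      ev N (Phi (tl gs' @ [k \<cdot> hd gs']) bs) f))) =
    ev N (Phi (g # gs) (a # as)) (\<lambda>ds. f (rotate1 ds))"
proof -
  note [simp] = gs as g a
  have gg [simp]: "g # gs \<in> tuples H (Suc n)" by simp
  have c [simp]: "f ds \<in> carrier N" if "ds \<in> tuples D (Suc n)" for ds using multi_closed[OF f that]
      .
  have ht [simp]: "hd xs \<in> carrier H" "tl xs \<in> tuples H n" if "xs \<in> tuples H (Suc n)" for xs
    using that by (auto elim: tuples_ConsE)
  have fm: "multi R D N n (\<lambda>ds. f (ds @ [d]))" if "d \<in> carrier D" for d by
      (rule multi_snoc[OF f that])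
  note [simp] = tuple_closed_rules[where n = n] tuple_closed_rules[where n =
      "Suc n"] sw_closed_rules
  \<comment> \<open>\<open>G b xs\<close> is the sum over \<open>Phi xs (b # as)\<close> of
    \<open>f\<close> on rotated tuples, unfolded once. It is multilinear in \<open>xs\<close>, as
    \<open>act_mult\<close> demands, and at \<open>a\<close> and \<open>g # gs\<close> it is the
    right side.\<close>
  define G where "G b xs = sw N (coacts as) (\<lambda>k bs. ev N (Phi (tl xs) bs)
      (\<lambda>ds. f (ds @ [pD b (k \<cdot> hd xs)])))" for b xs
  have Gc [simp]: "G b xs \<in> carrier N" if "b \<in> carrier C" "xs \<in> tuples H (Suc n)" for b xs
    using that by (simp add: G_def)
  have Gm: "multi R H N (Suc n) (G b)" if [simp]: "b \<in> carrier C" for b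
  proof -
    have "multi R H N n (\<lambda>xs. G b (x # xs))" if [simp]: "x \<in> carrier H" for x
      unfolding G_def list.sel by (rule sw_multi[OF N coacts_combs[OF as]], rule Phi_multi_gs, rule
          fm) simp_all
    moreover have "(\<lambda>x. G b (x # xs)) \<in> linear_maps R H N" if [simp]: "xs \<in> tuples H n" for xs
      unfolding G_def list.sel by (intro coacts_lin_param[OF N as] Phi_lin_param[OF N]
          multi_snoc_lin[OF f] pD_lin2 mult_lin_right; simp)
    ultimately show ?thesis by simp
  qed
  have Gl: "(\<lambda>b. G b xs) \<in> linear_maps R C N" if [simp]: "xs \<in> tuples H (Suc n)" for xs
    unfolding G_def by (intro coacts_lin_param[OF N as] Phi_lin_param[OF N] multi_snoc_lin[OF f]
        pD_lin1 id_lin[OF modC]; simp)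
  \<comment> \<open>The moved entry \<open>b\<close> is coacted twice: in
    \<open>coacts (as @ [b])\<close>, whose leg meets \<open>x\<close>, and inside
    \<open>Phi\<close>, where \<open>Phi_snoc\<close> lets it act on \<open>xs\<close>.
    Coassociativity joins both legs into the diagonal action on \<open>x # xs\<close>.\<close>
  have 1: "sw N (coacts (as @ [b])) (\<lambda>k bs. ev N (Phi (xs @ [k \<cdot> x]) bs) f) = sw N (\<rho> b) (\<lambda>h' b'.
      ev N (act (x # xs) h') (G b'))"
    if [simp]: "x \<in> carrier H" and xs [simp]: "xs \<in> tuples H n" and [simp]:
        "b \<in> carrier C" for x xs b
  proof -
    have "sw N (coacts (as @ [b])) (\<lambda>k bs. ev N (Phi (xs @ [k \<cdot> x]) bs) f) = sw N (coacts as)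
        (\<lambda>k bs. sw N (\<rho> b) (\<lambda>h' b'. ev N (Phi (xs @ [(k \<cdot> h') \<cdot> x]) (bs @ [b'])) f))"
      by (rule coacts_snoc[OF N as]) simp_all
    also have "\<dots> = sw N (coacts as) (\<lambda>k bs. sw N (\<rho> b) (\<lambda>h' b'. sw N (\<rho> b') (\<lambda>h'' b''.
        ev N (act xs h'') (\<lambda>gs'. ev N (Phi gs' bs) (\<lambda>ds. f (ds @ [pD b'' ((k \<cdot> h') \<cdot> x)]))))))"
      by (rule coacts_cong[OF as], rule sw_coact_cong, simp, rule Phi_snoc[OF _ _ _ _ f]) simp_all
    also have "\<dots> = sw N (coacts as) (\<lambda>k bs. sw N (\<rho> b) (\<lambda>h' b'. sw N (\<Delta>\<^sub>H h') (\<lambda>h0 h1.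
        ev N (act xs h1) (\<lambda>gs'. ev N (Phi gs' bs) (\<lambda>ds. f (ds @ [pD b' ((k \<cdot> h0) \<cdot> x)]))))))"
    proof (rule coacts_cong[OF as])
      fix k bs assume [simp]: "k \<in> carrier H" "bs \<in> tuples C n"
      show "sw N (\<rho> b) (\<lambda>h' b'. sw N (\<rho> b') (\<lambda>h'' b''. ev N (act xs h'') (\<lambda>gs'.
          ev N (Phi gs' bs) (\<lambda>ds. f (ds @ [pD b'' ((k \<cdot> h') \<cdot> x)]))))) =
        sw N (\<rho> b) (\<lambda>h' b'. sw N (\<Delta>\<^sub>H h') (\<lambda>h0 h1. ev N (act xs h1) (\<lambda>gs'. ev N (Phi gs' bs)
            (\<lambda>ds. f (ds @ [pD b' ((k \<cdot> h0) \<cdot> x)])))))"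
      proof (rule co_coassoc[OF N, symmetric])
        show "trilin R H H C N (\<lambda>h' h'' b''. ev N (act xs h'') (\<lambda>gs'. ev N (Phi gs' bs)
            (\<lambda>ds. f (ds @ [pD b'' ((k \<cdot> h') \<cdot> x)]))))"
          unfolding trilin_def
          by (intro conjI ballI act_lin_param[OF N _ xs] act_lin[OF N xs] Phi_multi_gs
              Phi_lin_param[OF N, where n = n] multi_snoc_lin[OF f] fm pD_lin1 pD_lin2
              mult_lin_left_comp mult_lin_right id_lin[OF modC]; simp)
      qed simp
    qed
    also have "\<dots> = sw N (coacts as) (\<lambda>k bs. sw N (\<rho> b) (\<lambda>h' b'. ev N (act (x # xs) h') (\<lambda>zs.
        ev N (Phi (tl zs) bs) (\<lambda>ds. f (ds @ [pD b' (k \<cdot> hd zs)])))))"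
      by (rule coacts_cong[OF as], rule sw_coact_cong, simp, rule trans[OF _ act_Cons[OF N, of _ _ _
          n, symmetric]],
        rule sw_comultH_cong, simp, rule act_cong[OF _ xs], simp) (simp_all add: H.A.m_assoc)
    also have "\<dots> = sw N (\<rho> b) (\<lambda>h' b'. sw N (coacts as) (\<lambda>k bs. ev N (act (x # xs) h') (\<lambda>zs.
        ev N (Phi (tl zs) bs) (\<lambda>ds. f (ds @ [pD b' (k \<cdot> hd zs)])))))"
      by (rule sw_sw_swap[OF N coacts_combs[OF as] coact_combs]) (simp_all del: act.simps)
    also have "\<dots> = sw N (\<rho> b) (\<lambda>h' b'. ev N (act (x # xs) h') (G b'))"
      unfolding G_def by (rule sw_coact_cong, simp, rule sw_ev_swap[OF N coacts_combs[OF as]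
          act_combs[of _ _ "Suc n"]]) (simp_all del: act.simps)
    finally show ?thesis .
  qed
  have "sw N (\<rho> a) (\<lambda>h b. ev N (act (g # gs) (T h)) (\<lambda>gs'. sw N (coacts (as @ [b])) (\<lambda>k bs.
      ev N (Phi (tl gs' @ [k \<cdot> hd gs']) bs) f))) =
    sw N (\<rho> a) (\<lambda>h b. ev N (act (g # gs) (T h)) (\<lambda>gs'. sw N (\<rho> b) (\<lambda>h' b'.
        ev N (act gs' h') (G b'))))"
  proof (rule sw_coact_cong, simp, rule act_cong[OF _ gg], simp)
    fix h b xs assume [simp]: "b \<in> carrier C" and xs: "xs \<in> tuples H (Suc n)"
    then show "sw N (coacts (as @ [b])) (\<lambda>k bs. ev N (Phi (tl xs @ [k \<cdot> hd xs]) bs) f) =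
        sw N (\<rho> b) (\<lambda>h' b'. ev N (act xs h') (G b'))"
      using 1[of "hd xs" "tl xs" b] by (auto elim: tuples_ConsE)
  qed
  also have "\<dots> = sw N (\<rho> a) (\<lambda>h b. sw N (\<rho> b) (\<lambda>h' b'. ev N (act (g # gs) (T h)) (\<lambda>gs'.
      ev N (act gs' h') (G b'))))"
    by (rule sw_coact_cong, simp, rule sw_ev_swap[OF N coact_combs act_combs[OF _ gg], symmetric])
        simp_all
  \<comment> \<open>The two diagonal actions compose; \<open>T h\<close> acted first and therefore
    stands on the right.\<close>
  also have "\<dots> = sw N (\<rho> a) (\<lambda>h b. sw N (\<rho> b) (\<lambda>h' b'. ev N (act (g # gs) (h' \<cdot> T h)) (G b')))"
    by (rule sw_coact_cong, simp, rule sw_coact_cong, simp, rule act_mult[OF N gg Gm]) simp_all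
  \<comment> \<open>Coassociativity makes \<open>h\<close> and \<open>h'\<close> the legs of one
    element, in the order in which the skew identity contracts them.\<close>
  also have "\<dots> = sw N (\<rho> a) (\<lambda>h b. sw N (\<Delta>\<^sub>H h) (\<lambda>h0 h1. ev N (act (g # gs) (h1 \<cdot> T h0)) (G b)))"
  proof (rule co_coassoc[OF N, symmetric])
    have l: "(\<lambda>x. ev N (act (g # gs) (p x)) (G b)) \<in> linear_maps R H N" if
        "p \<in> linear_maps R H H" "b \<in> carrier C" for p b
      by (rule lin_comp[OF act_lin[OF N gg Gm[OF that(2)]] that(1)])
    show "trilin R H H C N (\<lambda>h h' b'. ev N (act (g # gs) (h' \<cdot> T h)) (G b'))"
      unfolding trilin_def by (intro conjI ballI l act_lin_param[OF N _ gg] Gl mult_lin_right_comp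
          mult_lin_left T_lin; simp)
  qed simp
  also have "\<dots> = sw N (\<rho> a) (\<lambda>h b. counit H h \<odot>\<^bsub>N\<^esub> G b (g # gs))"
  proof (rule sw_coact_cong, simp)
    fix h b assume [simp]: "h \<in> carrier H" "b \<in> carrier C"
    have "sw N (\<Delta>\<^sub>H h) (\<lambda>h0 h1. ev N (act (g # gs) (h1 \<cdot> T h0)) (G b)) = counit H h \<odot>\<^bsub>N\<^esub>
        ev N (act (g # gs) \<one>\<^bsub>H\<^esub>) (G b)"
      by (rule antipode_inv_skew(1)[OF N _ act_lin[OF N gg Gm]]) simp_all
    then show "sw N (\<Delta>\<^sub>H h) (\<lambda>h0 h1. ev N (act (g # gs) (h1 \<cdot> T h0)) (G b)) = counit H h \<odot>\<^bsub>N\<^esub> G b (g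
        # gs)"
      using act_one[OF N gg Gm, of b] by simp
  qed
  also have "\<dots> = G a (g # gs)" by (rule co_counit[OF N a Gl]) simp
  also have "\<dots> = ev N (Phi (g # gs) (a # as)) (\<lambda>ds. f (rotate1 ds))"
    unfolding G_def list.sel by (subst Phi_Cons[OF N g gs a as]) (auto elim!: tuples_ConsE)
  finally show ?thesis .
qed

text \<open>At the split place, the second copy of the \<open>C\<close> entry is later than the
  first copy of the \<open>H\<close> entry and so supplies the leg in the crossed coproduct. At
  earlier places the two copies contribute a product of legs, handled by
  \<open>coacts_comult\<close>.\<close>

lemma Phi_coface: "gs \<in> tuples H n \<Longrightarrow> as \<in> tuples C n \<Longrightarrow> i < n \<Longrightarrow> multi R D N (Suc n) f \<Longrightarrow>
  sw N (\<Delta>\<^sub>C (as ! i)) (\<lambda>u v. sw N (\<Delta>\<^sub>H (gs ! i)) (\<lambda>x y. ev N (Phi (ins i x y gs) (ins i u v as)) f))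
      =
  ev N (Phi gs as) (\<lambda>ds. sw N (\<Delta>\<^sub>D (ds ! i)) (\<lambda>p q. f (ins i p q ds)))"
proof (induction gs arbitrary: n as i f)
  case Nil then show ?case by simp
next
  case (Cons g gs)
  then obtain m where n [simp]: "n = Suc m" and g [simp]: "g \<in> carrier H" and gs [simp]:
      "gs \<in> tuples H m" by auto
  obtain a as' where as_eq [simp]: "as = a # as'" and a [simp]: "a \<in> carrier C" and as [simp]:
      "as' \<in> tuples C m"
    using Cons.prems(2) by (auto elim: tuples_ConsE)
  note f = Cons.prems(4)[unfolded n]
  have c [simp]: "f ds \<in> carrier N" if "ds \<in> tuples D (Suc (Suc m))" for ds using multi_closed[OF f
      that] .
  have fm: "multi R D N (Suc m) (\<lambda>ds. f (d # ds))" if "d \<in> carrier D" for d by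
      (rule multi_Cons[OF f that])
  have fm2: "multi R D N m (\<lambda>ds. f (d # e # ds))" if "d \<in> carrier D" "e \<in> carrier D" for d e
      by (rule multi_Cons[OF fm[OF that(1)] that(2)])
  note [simp] = tuple_closed_rules[where n = m] tuple_closed_rules[where n =
      "Suc m"] sw_closed_rules
  note fl = multi_lin[OF f] multi_lin[OF fm]
  note lins = all_lin_param_rules fl pD_lin1 pD_lin2 mult_lin_left_comp mult_lin_right_comp
      mult_lin_right mult_lin_left id_lin[OF modH] id_lin[OF modC]
  show ?case
  proof (cases i)
    case [simp]: 0
    have 1: "ev N (Phi (x # y # gs) (u # v # as')) f = sw N (\<rho> v) (\<lambda>h b. sw N (coacts as')
        (\<lambda>k bs. sw N (\<Delta>\<^sub>H k) (\<lambda>k0 k1. ev N (Phi gs bs) (\<lambda>ds. f (pD u (h \<cdot> (k0 \<cdot> x)) # pD b (k1 \<cdot> y)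
        # ds)))))"
      if [simp]: "x \<in> carrier H" "y \<in> carrier H" "u \<in> carrier C" "v \<in> carrier C" for x y u v
    proof -
      have "ev N (Phi (x # y # gs) (u # v # as')) f = sw N (coacts (v # as')) (\<lambda>k bs.
          ev N (Phi (y # gs) bs) (\<lambda>ds. f (pD u (k \<cdot> x) # ds)))"
        by (rule Phi_Cons[OF N, of _ _ "Suc m"]) simp_all
      also have "\<dots> = sw N (\<rho> v) (\<lambda>h b. sw N (coacts as') (\<lambda>k bs. ev N (Phi (y # gs) (b # bs))
          (\<lambda>ds. f (pD u (h \<cdot> k \<cdot> x) # ds))))"
        by (rule coacts_Cons[OF N _ as]) (simp_all add: Phi_closed[OF N, of _
            "Suc m"] del: Phi.simps)
      also have "\<dots> = sw N (\<rho> v) (\<lambda>h b. sw N (coacts as') (\<lambda>k bs. sw N (coacts bs) (\<lambda>k' bs'.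
          ev N (Phi gs bs') (\<lambda>ds. f (pD u (h \<cdot> k \<cdot> x) # pD b (k' \<cdot> y) # ds)))))"
        by (rule sw_coact_cong, simp, rule coacts_cong[OF as], rule Phi_Cons[OF N, of _ _ m])
            simp_all
      \<comment> \<open>The tail is coacted once for \<open>x\<close> and once for \<open>y\<close>;
        coassociativity replaces the two legs by the coproduct of a single \<open>k\<close>.\<close>
      also have "\<dots> = sw N (\<rho> v) (\<lambda>h b. sw N (coacts as') (\<lambda>k bs. sw N (\<Delta>\<^sub>H k) (\<lambda>k0 k1.
          ev N (Phi gs bs) (\<lambda>ds. f (pD u (h \<cdot> k0 \<cdot> x) # pD b (k1 \<cdot> y) # ds)))))"
        by (rule sw_coact_cong, simp, rule coacts_coassoc[OF N as], rule Phi_bilin_multi[OF gs])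
            ((rule fm2; simp) | (intro lins; simp))+
      also have "\<dots> = sw N (\<rho> v) (\<lambda>h b. sw N (coacts as') (\<lambda>k bs. sw N (\<Delta>\<^sub>H k) (\<lambda>k0 k1.
          ev N (Phi gs bs) (\<lambda>ds. f (pD u (h \<cdot> (k0 \<cdot> x)) # pD b (k1 \<cdot> y) # ds)))))"
        by (rule sw_coact_cong, simp, rule coacts_cong[OF as], rule sw_comultH_cong)
            (simp_all add: H.A.m_assoc)
      finally show ?thesis .
    qed
    \<comment> \<open>Common form of both sides. From the left, the coproducts of \<open>k\<close>
      and \<open>g\<close> combine into that of \<open>k \<cdot> g\<close>; from the right, this
      coproduct is part of the comultiplication of \<open>pD a (k \<cdot> g)\<close>.\<close>
    let ?Q = "sw N (\<Delta>\<^sub>C a) (\<lambda>u v. sw N (\<rho> v) (\<lambda>h b. sw N (coacts as') (\<lambda>k bs. sw N (\<Delta>\<^sub>H (k \<cdot> g))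
        (\<lambda>x y. ev N (Phi gs bs) (\<lambda>ds. f (pD u (h \<cdot> x) # pD b y # ds))))))"
    have "sw N (\<Delta>\<^sub>C a) (\<lambda>u v. sw N (\<Delta>\<^sub>H g) (\<lambda>x y. ev N (Phi (x # y # gs) (u # v # as')) f)) =
      sw N (\<Delta>\<^sub>C a) (\<lambda>u v. sw N (\<Delta>\<^sub>H g) (\<lambda>x y. sw N (\<rho> v) (\<lambda>h b. sw N (coacts as') (\<lambda>k bs.
          sw N (\<Delta>\<^sub>H k) (\<lambda>k0 k1. ev N (Phi gs bs) (\<lambda>ds. f (pD u (h \<cdot> (k0 \<cdot> x)) # pD b (k1 \<cdot> y) #
          ds)))))))"
      by (rule sw_comultC_cong, simp, rule sw_comultH_cong, simp, rule 1) simp_all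
    also have "\<dots> = sw N (\<Delta>\<^sub>C a) (\<lambda>u v. sw N (\<rho> v) (\<lambda>h b. sw N (\<Delta>\<^sub>H g) (\<lambda>x y. sw N (coacts as')
        (\<lambda>k bs. sw N (\<Delta>\<^sub>H k) (\<lambda>k0 k1. ev N (Phi gs bs) (\<lambda>ds. f (pD u (h \<cdot> (k0 \<cdot> x)) # pD b (k1 \<cdot> y)
        # ds)))))))"
      by (rule sw_comultC_cong, simp, rule sw_sw_swap[OF N comultH_combs coact_combs]) simp_all
    also have "\<dots> = sw N (\<Delta>\<^sub>C a) (\<lambda>u v. sw N (\<rho> v) (\<lambda>h b. sw N (coacts as') (\<lambda>k bs. sw N (\<Delta>\<^sub>H g)
        (\<lambda>x y. sw N (\<Delta>\<^sub>H k) (\<lambda>k0 k1. ev N (Phi gs bs) (\<lambda>ds. f (pD u (h \<cdot> (k0 \<cdot> x)) # pD b (k1 \<cdot> y) #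
        ds)))))))"
      by (rule sw_comultC_cong, simp, rule sw_coact_cong, simp, rule sw_sw_swap[OF N comultH_combs
          coacts_combs[OF as]]) simp_all
    also have "\<dots> = sw N (\<Delta>\<^sub>C a) (\<lambda>u v. sw N (\<rho> v) (\<lambda>h b. sw N (coacts as') (\<lambda>k bs. sw N (\<Delta>\<^sub>H k)
        (\<lambda>k0 k1. sw N (\<Delta>\<^sub>H g) (\<lambda>x y. ev N (Phi gs bs) (\<lambda>ds. f (pD u (h \<cdot> (k0 \<cdot> x)) # pD b (k1 \<cdot> y) #
        ds)))))))"
      by (rule sw_comultC_cong, simp, rule sw_coact_cong, simp, rule coacts_cong[OF as], rule
          sw_sw_swap[OF N comultH_combs comultH_combs]) simp_all
    also have "\<dots> = ?Q"
      by (rule sw_comultC_cong, simp, rule sw_coact_cong, simp, rule coacts_cong[OF as], rule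
          comultH_mult[OF N, symmetric])
        (simp, simp, unfold bilin_def, (intro conjI ballI Phi_lin_param[OF N gs] lins; simp))
    finally have L: "sw N (\<Delta>\<^sub>C a) (\<lambda>u v. sw N (\<Delta>\<^sub>H g) (\<lambda>x y.
        ev N (Phi (x # y # gs) (u # v # as')) f)) = ?Q" .
    have "ev N (Phi (g # gs) (a # as')) (\<lambda>ds. sw N (\<Delta>\<^sub>D (ds ! 0)) (\<lambda>p q. f (ins 0 p q ds))) =
      sw N (coacts as') (\<lambda>k bs. ev N (Phi gs bs) (\<lambda>ds. sw N (\<Delta>\<^sub>D (pD a (k \<cdot> g)))
          (\<lambda>p q. f (p # q # ds))))"
      by (subst Phi_Cons[OF N g gs a as]) (auto elim!: tuples_ConsE)
    also have "\<dots> = sw N (coacts as') (\<lambda>k bs. ev N (Phi gs bs) (\<lambda>ds. sw N (\<Delta>\<^sub>C a) (\<lambda>u v.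
        sw N (\<rho> v) (\<lambda>h b. sw N (\<Delta>\<^sub>H (k \<cdot> g)) (\<lambda>x y. f (pD u (h \<cdot> x) # pD b y # ds))))))"
      by (rule coacts_cong[OF as], rule Phi_cong[OF gs], assumption, rule sw_comultD_pure[OF N])
        (unfold bilin_def, (intro conjI ballI fl id_lin[OF modD]; simp), simp_all)
    also have "\<dots> = sw N (coacts as') (\<lambda>k bs. sw N (\<Delta>\<^sub>C a) (\<lambda>u v. ev N (Phi gs bs) (\<lambda>ds.
        sw N (\<rho> v) (\<lambda>h b. sw N (\<Delta>\<^sub>H (k \<cdot> g)) (\<lambda>x y. f (pD u (h \<cdot> x) # pD b y # ds))))))"
      by (rule coacts_cong[OF as], rule sw_ev_swap[OF N comultC_combs Phi_combs[OF gs], symmetric])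
          simp_all
    also have "\<dots> = sw N (\<Delta>\<^sub>C a) (\<lambda>u v. sw N (coacts as') (\<lambda>k bs. ev N (Phi gs bs) (\<lambda>ds.
        sw N (\<rho> v) (\<lambda>h b. sw N (\<Delta>\<^sub>H (k \<cdot> g)) (\<lambda>x y. f (pD u (h \<cdot> x) # pD b y # ds))))))"
      by (rule sw_sw_swap[OF N coacts_combs[OF as] comultC_combs]) simp_all
    also have "\<dots> = sw N (\<Delta>\<^sub>C a) (\<lambda>u v. sw N (coacts as') (\<lambda>k bs. sw N (\<rho> v) (\<lambda>h b.
        ev N (Phi gs bs) (\<lambda>ds. sw N (\<Delta>\<^sub>H (k \<cdot> g)) (\<lambda>x y. f (pD u (h \<cdot> x) # pD b y # ds))))))"
      by (rule sw_comultC_cong, simp, rule coacts_cong[OF as], rule sw_ev_swap[OF N coact_combs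
          Phi_combs[OF gs], symmetric]) simp_all
    also have "\<dots> = sw N (\<Delta>\<^sub>C a) (\<lambda>u v. sw N (\<rho> v) (\<lambda>h b. sw N (coacts as') (\<lambda>k bs.
        ev N (Phi gs bs) (\<lambda>ds. sw N (\<Delta>\<^sub>H (k \<cdot> g)) (\<lambda>x y. f (pD u (h \<cdot> x) # pD b y # ds))))))"
      by (rule sw_comultC_cong, simp, rule sw_sw_swap[OF N coacts_combs[OF as] coact_combs])
          simp_all
    also have "\<dots> = ?Q"
      by (rule sw_comultC_cong, simp, rule sw_coact_cong, simp, rule coacts_cong[OF as], rule
          sw_ev_swap[OF N comultH_combs Phi_combs[OF gs], symmetric]) simp_all
    finally show ?thesis using L by (simp del: Phi.simps)
  next
    case [simp]: (Suc j)
    have j [simp]: "j < m" using Cons.prems by simp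
    have [simp]: "gs ! j \<in> carrier H" "as' ! j \<in> carrier C" by
        (rule tuples_nth[OF gs j], rule tuples_nth[OF as j])
    have [simp]: "ins j x y gs \<in> tuples H (Suc m)" if "x \<in> carrier H"
        "y \<in> carrier H" for x y using ins_tuples[OF gs j] that by simp
    have [simp]: "ins j u v bs \<in> tuples C (Suc m)" if "u \<in> carrier C" "v \<in> carrier C"
        "bs \<in> tuples C m" for u v bs using ins_tuples[OF that(3) j] that by simp
    have [simp]: "bs ! j \<in> carrier C" if "bs \<in> tuples C m" for bs using tuples_nth[OF that j] .
    have fm' : "multi R D N (Suc m) (\<lambda>ds. f (pD a (k \<cdot> g) # ds))" if "k \<in> carrier H" for k by
        (rule fm) (use that in simp)
    \<comment> \<open>The coproduct of \<open>gs ! j\<close> is placed inside the test map, so that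
      only the splitting in \<open>as'\<close> remains for \<open>coacts_comult\<close>.\<close>
    let ?F = "\<lambda>k bs. sw N (\<Delta>\<^sub>H (gs ! j)) (\<lambda>x y. ev N (Phi (ins j x y gs) bs)
        (\<lambda>ds. f (pD a (k \<cdot> g) # ds)))"
    have F: "lin_multi N (Suc m) ?F"
      by (rule lin_multiI, rule sw_multi[OF N comultH_combs], simp, rule Phi_multi_as[OF fm'], simp,
          simp)
        (intro all_lin_param_rules Phi_lin_param[OF N, of _ "Suc m"] fl pD_lin2 mult_lin_left; simp)
    have "sw N (\<Delta>\<^sub>C (as' ! j)) (\<lambda>u v. sw N (\<Delta>\<^sub>H (gs ! j)) (\<lambda>x y.
        ev N (Phi (g # ins j x y gs) (a # ins j u v as')) f)) =
      sw N (\<Delta>\<^sub>C (as' ! j)) (\<lambda>u v. sw N (\<Delta>\<^sub>H (gs ! j)) (\<lambda>x y. sw N (coacts (ins j u v as'))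
          (\<lambda>k bs. ev N (Phi (ins j x y gs) bs) (\<lambda>ds. f (pD a (k \<cdot> g) # ds)))))"
      by (rule sw_comultC_cong, simp, rule sw_comultH_cong, simp, rule Phi_Cons[OF N, of _ _
          "Suc m"]) simp_all
    also have "\<dots> = sw N (\<Delta>\<^sub>C (as' ! j)) (\<lambda>u v. sw N (coacts (ins j u v as')) ?F)"
      by (rule sw_comultC_cong, simp, rule sw_sw_swap[OF N comultH_combs coacts_combs[of _
          "Suc m"]]) simp_all
    also have "\<dots> = sw N (coacts as') (\<lambda>k bs. sw N (\<Delta>\<^sub>C (bs ! j)) (\<lambda>u v. ?F k (ins j u v bs)))"
      by (rule coacts_comult[OF N as j F])
    also have "\<dots> = sw N (coacts as') (\<lambda>k bs. ev N (Phi gs bs) (\<lambda>ds. sw N (\<Delta>\<^sub>D (ds ! j))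
        (\<lambda>p q. f (pD a (k \<cdot> g) # ins j p q ds))))"
      by (rule coacts_cong[OF as], rule Cons.IH[OF gs _ j fm']) simp_all
    also have "\<dots> = sw N (coacts as') (\<lambda>k bs. ev N (Phi gs bs) (\<lambda>ds. sw N (\<Delta>\<^sub>D ((pD a (k \<cdot> g) # ds) !
        Suc j)) (\<lambda>p q. f (ins (Suc j) p q (pD a (k \<cdot> g) # ds)))))"
      by simp
    also have "\<dots> = ev N (Phi (g # gs) (a # as')) (\<lambda>ds. sw N (\<Delta>\<^sub>D (ds ! Suc j))
        (\<lambda>p q. f (ins (Suc j) p q ds)))"
      by (rule Phi_Cons[OF N g gs a as, symmetric], rule sw_comultD_closed[OF N])
          (simp_all add: tuples_nth[of _ D "Suc m"] ins_tuples[of _ D "Suc m"])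
    finally show ?thesis by (simp del: Phi.simps)
  qed
qed

text \<open>The counit of the crossed coproduct factors through both counits. The leg multiplied
  onto the deleted \<open>H\<close> entry is absorbed by its counit, and the legs that the deleted
  \<open>C\<close> entry left on earlier places become \<open>\<one>\<close>.\<close>

lemma Phi_codegen: "gs \<in> tuples H (Suc n) \<Longrightarrow> as \<in> tuples C (Suc n) \<Longrightarrow> j \<le> n \<Longrightarrow> multi R D N n f \<Longrightarrow>
  ev N (Phi gs as) (\<lambda>ds. counit D (ds ! j) \<odot>\<^bsub>N\<^esub> f (del j ds)) =
  counit C (as ! j) \<odot>\<^bsub>N\<^esub> (counit H (gs ! j) \<odot>\<^bsub>N\<^esub> ev N (Phi (del j gs) (del j as)) f)"
proof (induction gs arbitrary: n as j f)
  case Nil then show ?case by simp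
next
  case (Cons g gs)
  then have g [simp]: "g \<in> carrier H" and gs [simp]: "gs \<in> tuples H n" by auto
  obtain a as' where as_eq [simp]: "as = a # as'" and a [simp]: "a \<in> carrier C" and as [simp]:
      "as' \<in> tuples C n"
    using Cons.prems(2) by (auto elim: tuples_ConsE)
  note f = Cons.prems(4)
  have c [simp]: "f ds \<in> carrier N" if "ds \<in> tuples D n" for ds using multi_closed[OF f that] .
  note [simp] = tuple_closed_rules[where n = n] sw_closed_rules
  have [simp]: "ds ! j \<in> carrier D" "del j ds \<in> tuples D n" if "ds \<in> tuples D (Suc n)" for ds
    using that Cons.prems(3) by (auto intro: tuples_nth del_tuples)
  have "ev N (Phi (g # gs) (a # as')) (\<lambda>ds. counit D (ds ! j) \<odot>\<^bsub>N\<^esub> f (del j ds)) =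
    sw N (coacts as') (\<lambda>k bs. ev N (Phi gs bs) (\<lambda>ds. counit D ((pD a (k \<cdot> g) # ds) ! j) \<odot>\<^bsub>N\<^esub> f (del
        j (pD a (k \<cdot> g) # ds))))"
    by (rule Phi_Cons[OF N g gs a as]) simp
  also have "\<dots> = counit C (as ! j) \<odot>\<^bsub>N\<^esub> (counit H ((g # gs) ! j) \<odot>\<^bsub>N\<^esub>
      ev N (Phi (del j (g # gs)) (del j as)) f)"
  proof (cases j)
    case [simp]: 0
    have "sw N (coacts as') (\<lambda>k bs. ev N (Phi gs bs) (\<lambda>ds. counit D (pD a (k \<cdot> g)) \<odot>\<^bsub>N\<^esub> f ds)) =
      sw N (coacts as') (\<lambda>k bs. counit H k \<odot>\<^bsub>N\<^esub> ((counit C a \<otimes>\<^bsub>R\<^esub> counit H g) \<odot>\<^bsub>N\<^esub>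
          ev N (Phi gs bs) f))"
    proof (rule coacts_cong[OF as])
      fix k bs assume [simp]: "k \<in> carrier H" "bs \<in> tuples C n"
      \<comment> \<open>\<open>counit H k\<close> is brought to the front, where
        \<open>coacts_counit\<close> consumes it; the other two scalars do not vary with the
        summation.\<close>
      have "counit D (pD a (k \<cdot> g)) = counit H k \<otimes>\<^bsub>R\<^esub> (counit C a \<otimes>\<^bsub>R\<^esub> counit H g)"
        using cring.cring_simprules[OF R_cring] by (simp add: counitD(2) H.counit_mult)
      then show "ev N (Phi gs bs) (\<lambda>ds. counit D (pD a (k \<cdot> g)) \<odot>\<^bsub>N\<^esub> f ds) = counit H k \<odot>\<^bsub>N\<^esub>
          ((counit C a \<otimes>\<^bsub>R\<^esub> counit H g) \<odot>\<^bsub>N\<^esub> ev N (Phi gs bs) f)"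
        by (subst ev_smult[OF N Phi_combs[OF gs]]) (simp_all add: N.smult_assoc1)
    qed
    also have "\<dots> = (counit C a \<otimes>\<^bsub>R\<^esub> counit H g) \<odot>\<^bsub>N\<^esub> ev N (Phi gs as') f"
      by (rule coacts_counit[OF N as], rule multi_smult[OF N _ Phi_multi_as[OF f gs]]) simp
    also have "\<dots> = counit C a \<odot>\<^bsub>N\<^esub> (counit H g \<odot>\<^bsub>N\<^esub> ev N (Phi gs as') f)" by
        (simp add: N.smult_assoc1)
    finally show ?thesis by (simp del: Phi.simps)
  next
    case [simp]: (Suc i)
    obtain m where [simp]: "n = Suc m" and i: "i \<le> m" using Cons.prems(3) by (cases n) auto
    note gs' = gs[simplified \<open>n = Suc m\<close>] and as' = as[simplified \<open>n = Suc m\<close>] and f' = f[simplified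
        \<open>n = Suc m\<close>]
    have [simp]: "del i gs \<in> tuples H m" "del i as' \<in> tuples C m" "gs ! i \<in> carrier H"
        "as' ! i \<in> carrier C"
      using del_tuples[OF gs' i] del_tuples[OF as' i] tuples_nth[OF gs', of i] tuples_nth[OF as', of
          i] i by simp_all
    have fm: "multi R D N m (\<lambda>ds. f (pD a (k \<cdot> g) # ds))" if "k \<in> carrier H" for k by
        (rule multi_Cons[OF f']) (use that in simp)
    note [simp] = tuple_closed_rules[where n = m]
    let ?F = "\<lambda>k bs. counit H (gs ! i) \<odot>\<^bsub>N\<^esub> ev N (Phi (del i gs) bs) (\<lambda>ds. f (pD a (k \<cdot> g) # ds))"
    have F: "lin_multi N m ?F"
      by (rule lin_multiI, rule multi_smult[OF N], simp, rule Phi_multi_as[OF fm], simp, simp)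
        (rule lin_smult_const[OF N], simp, (intro Phi_lin_param[OF N, of _ m] multi_lin[OF f']
            pD_lin2 mult_lin_left; simp))
    have "sw N (coacts as') (\<lambda>k bs. ev N (Phi gs bs) (\<lambda>ds. counit D (ds ! i) \<odot>\<^bsub>N\<^esub> f (pD a (k \<cdot> g) #
        del i ds))) =
      sw N (coacts as') (\<lambda>k bs. counit C (bs ! i) \<odot>\<^bsub>N\<^esub> ?F k (del i bs))"
      by (rule coacts_cong[OF as'], rule Cons.IH[OF gs' _ i fm]) simp_all
    also have "\<dots> = counit C (as' ! i) \<odot>\<^bsub>N\<^esub> sw N (coacts (del i as')) ?F" by
        (rule coacts_counit_nth[OF N as' i F])
    also have "sw N (coacts (del i as')) ?F = counit H (gs ! i) \<odot>\<^bsub>N\<^esub> sw N (coacts (del i as'))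
        (\<lambda>k bs. ev N (Phi (del i gs) bs) (\<lambda>ds. f (pD a (k \<cdot> g) # ds)))"
      by (rule sw_smult[OF N coacts_combs[of _ m]]) simp_all
    also have "sw N (coacts (del i as')) (\<lambda>k bs. ev N (Phi (del i gs) bs)
        (\<lambda>ds. f (pD a (k \<cdot> g) # ds))) = ev N (Phi (g # del i gs) (a # del i as')) f"
      by (rule Phi_Cons[OF N, of _ _ m, symmetric]) simp_all
    finally show ?thesis by (simp del: Phi.simps)
  qed
  finally show ?case by simp
qed

lemma bimulti_lin1: "bimulti R H C N (Suc n) q f \<Longrightarrow> gs \<in> tuples H n \<Longrightarrow> as \<in> tuples C q
    \<Longrightarrow> p \<in> linear_maps R M H \<Longrightarrow>
    (\<lambda>x. f (p x # gs) as) \<in> linear_maps R M N"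
  using multi_lin[of R H N n "\<lambda>gs. f gs as" gs p M] by (simp add: bimulti_def)

lemma bimulti_lin2: "bimulti R H C N q (Suc n) f \<Longrightarrow> gs \<in> tuples H q \<Longrightarrow> as \<in> tuples C n
    \<Longrightarrow> p \<in> linear_maps R M C \<Longrightarrow>
    (\<lambda>x. f gs (p x # as)) \<in> linear_maps R M N"
  using multi_lin[of R C N n "f gs" as p M] by (simp add: bimulti_def)

lemma bimulti_multi1: "bimulti R H C N (Suc n) q f \<Longrightarrow> g \<in> carrier H \<Longrightarrow> as \<in> tuples C q
    \<Longrightarrow> multi R H N n (\<lambda>gs. f (g # gs) as)"
  by (simp add: bimulti_def)

lemma bimulti_multi2: "bimulti R H C N q (Suc n) f \<Longrightarrow> gs \<in> tuples H q \<Longrightarrow> a \<in> carrier C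
    \<Longrightarrow> multi R C N n (\<lambda>as. f gs (a # as))"
  by (simp add: bimulti_def)

lemma Psi_Cons_bimulti:
  assumes f: "bimulti R H C N (Suc n) (Suc n) f" and a: "a \<in> carrier C" and g: "g \<in> carrier H"
  shows "bimulti R H C N n n (\<lambda>gs as. sw N (coacts as) (\<lambda>k bs. f (T k \<cdot> g # gs) (a # bs)))"
  unfolding bimulti_def
proof (intro conjI ballI)
  fix as assume as: "as \<in> tuples C n"
  show "multi R H N n (\<lambda>gs. sw N (coacts as) (\<lambda>k bs. f (T k \<cdot> g # gs) (a # bs)))"
    by (rule sw_multi[OF N coacts_combs[OF as]], rule bimulti_multi1[OF f]) (simp_all add: a g)
next
  fix gs assume gs: "gs \<in> tuples H n"
  have "lin_multi N n (\<lambda>k bs. f (T k \<cdot> g # gs) (a # bs))"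
    by (rule lin_multiI, rule bimulti_multi2[OF f], simp add: g gs, rule a,
        (intro bimulti_lin1[OF f gs] mult_lin_left_comp T_lin; simp add: a g))
  then show "multi R C N n (\<lambda>as. sw N (coacts as) (\<lambda>k bs. f (T k \<cdot> g # gs) (a # bs)))" by
      (rule coacts_multi[OF N])
qed

lemma Psi_Cons_bilin:
  assumes f: "bimulti R H C N (Suc n) (Suc n) f" and ds: "ds \<in> tuples D n"
  shows "bilin R C H N (\<lambda>a g. sw N (Psi ds) (\<lambda>gs as. sw N (coacts as) (\<lambda>k bs. f (T k \<cdot> g # gs) (a #
      bs))))"
  unfolding bilin_def
  by (intro conjI ballI sw_lin_param[OF N Psi_combs[OF ds]] coacts_lin_param[OF N] bimulti_lin1[OF
      f] bimulti_lin2[OF f] mult_lin_right id_lin[OF modC]; simp)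

text \<open>The head is decomposed by a chosen combination, so linearity in it needs a bilinear
  summand, which \<open>Psi_Cons_bilin\<close> provides; the tail follows by induction for each
  fixed decomposition.\<close>

lemma Psi_multi: "bimulti R H C N n n f \<Longrightarrow> multi R D N n (\<lambda>ds. sw N (Psi ds) f)"
proof (induction n arbitrary: f)
  case 0 then show ?case by (simp add: Psi_closed[OF N, of _ 0] bimulti_closed[of R H C N 0 0] del:
      Psi.simps)
next
  case (Suc n)
  note f = Suc.prems
  note e = Psi_Cons[OF N _ _ bimulti_closed[OF f]]
  have "multi R D N n (\<lambda>ds. sw N (Psi (d # ds)) f)" if d: "d \<in> carrier D" for d
  proof (rule multi_cong[OF modD])
    show "multi R D N n (\<lambda>ds. sw N (rep R d) (\<lambda>a g. sw N (Psi ds) (\<lambda>gs as. sw N (coacts as)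
        (\<lambda>k bs. f (T k \<cdot> g # gs) (a # bs)))))"
      by (rule sw_multi[OF N rep_D_combs[OF d]], rule Suc.IH, rule Psi_Cons_bimulti[OF f])
  qed (simp add: e[OF d] del: Psi.simps)
  moreover have "(\<lambda>d. sw N (Psi (d # ds)) f) \<in> linear_maps R D N" if ds: "ds \<in> tuples D n" for ds
    by (subst lin_cong[OF modD e[OF _ ds]], assumption, assumption, assumption, rule rep_lin[OF N
        Psi_Cons_bilin[OF f ds]])
  ultimately show ?case by (simp del: Psi.simps)
qed

text \<open>After the tail has been restored by induction, \<open>g\<close> carries
  \<open>T k' \<cdot> k\<close> with \<open>k\<close> from the earlier and \<open>k'\<close> from
  the later coaction. These are the left and right legs of one element, so the second skew identity
  applies.\<close>

lemma Phi_Psi: "gs \<in> tuples H n \<Longrightarrow> as \<in> tuples C n \<Longrightarrow> bimulti R H C N n n f \<Longrightarrow>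
  ev N (Phi gs as) (\<lambda>ds. sw N (Psi ds) f) = f gs as"
proof (induction gs arbitrary: n as f)
  case Nil
  then have "f [] [] \<in> carrier N" "as = []" using bimulti_closed[OF Nil.prems(3)] by
      (simp_all add: tuples_0)
  then show ?case by (simp add: ev_ret[OF N] sw_ret[OF N])
next
  case (Cons g gs)
  then obtain n' where n [simp]: "n = Suc n'" and g [simp]: "g \<in> carrier H" and gs [simp]:
      "gs \<in> tuples H n'" by auto
  obtain a as' where as_eq [simp]: "as = a # as'" and a [simp]: "a \<in> carrier C" and as [simp]:
      "as' \<in> tuples C n'"
    using Cons.prems(2) by (auto elim: tuples_ConsE)
  note f = Cons.prems(3)[unfolded n]
  note bl = bimulti_lin1[OF f] bimulti_lin2[OF f]
  have c [simp]: "f xs ys \<in> carrier N" if "xs \<in> tuples H (Suc n')"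
      "ys \<in> tuples C (Suc n')" for xs ys using bimulti_closed[OF f that] .
  note [simp] = tuple_closed_rules[where n = n'] tuple_closed_rules[where n =
      "Suc n'"] sw_closed_rules
  have "ev N (Phi (g # gs) (a # as')) (\<lambda>ds. sw N (Psi ds) f) = sw N (coacts as') (\<lambda>k bs.
      ev N (Phi gs bs) (\<lambda>ds. sw N (Psi (pD a (k \<cdot> g) # ds)) f))"
    by (rule Phi_Cons[OF N g gs a as]) (simp del: Psi.simps)
  also have "\<dots> = sw N (coacts as') (\<lambda>k bs. ev N (Phi gs bs) (\<lambda>ds. sw N (Psi ds) (\<lambda>gs as.
      sw N (coacts as) (\<lambda>k' bs. f (T k' \<cdot> (k \<cdot> g) # gs) (a # bs)))))"
  proof (rule coacts_cong[OF as], rule Phi_cong[OF gs], assumption)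
    fix k bs ds assume [simp]: "k \<in> carrier H" "bs \<in> tuples C n'" and ds: "ds \<in> tuples D n'"
    show "sw N (Psi (pD a (k \<cdot> g) # ds)) f = sw N (Psi ds) (\<lambda>gs as. sw N (coacts as)
        (\<lambda>k' bs. f (T k' \<cdot> (k \<cdot> g) # gs) (a # bs)))"
      by (subst Psi_Cons[OF N _ ds bimulti_closed[OF f]])
          (simp_all add: rep_pure[OF N Psi_Cons_bilin[OF f ds]])
  qed
  also have "\<dots> = sw N (coacts as') (\<lambda>k bs. sw N (coacts bs) (\<lambda>k' bs'. f (T k' \<cdot> (k \<cdot> g) # gs) (a #
      bs')))"
    by (rule coacts_cong[OF as], rule Cons.IH[OF gs _ Psi_Cons_bimulti[OF f]]) simp_all
  also have "\<dots> = sw N (coacts as') (\<lambda>k bs. sw N (\<Delta>\<^sub>H k) (\<lambda>k0 k1. f (T k1 \<cdot> (k0 \<cdot> g) # gs) (a #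
      bs)))"
  proof (rule coacts_coassoc[OF N as])
    show "bilin_multi N n' (\<lambda>k k' bs. f (T k' \<cdot> (k \<cdot> g) # gs) (a # bs))"
      unfolding bilin_multi_def by (intro conjI ballI lin_multiI bimulti_multi2[OF f] bl
          mult_lin_left_comp mult_lin_right_comp mult_lin_left T_lin; simp)
  qed
  also have "\<dots> = sw N (coacts as') (\<lambda>k bs. counit H k \<odot>\<^bsub>N\<^esub> f (g # gs) (a # bs))"
  proof (rule coacts_cong[OF as])
    fix k bs assume [simp]: "k \<in> carrier H" "bs \<in> tuples C n'"
    have "sw N (\<Delta>\<^sub>H k) (\<lambda>k0 k1. f (T k1 \<cdot> (k0 \<cdot> g) # gs) (a # bs)) = sw N (\<Delta>\<^sub>H k)
        (\<lambda>k0 k1. f ((T k1 \<cdot> k0) \<cdot> g # gs) (a # bs))"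
      by (rule sw_comultH_cong) (simp_all add: H.A.m_assoc)
    also have "\<dots> = counit H k \<odot>\<^bsub>N\<^esub> f (\<one>\<^bsub>H\<^esub> \<cdot> g # gs) (a # bs)"
      by (rule antipode_inv_skew(2)[OF N, of k "\<lambda>z. f (z \<cdot> g # gs) (a # bs)"]) (simp,
          (intro bl mult_lin_left; simp))
    finally show "sw N (\<Delta>\<^sub>H k) (\<lambda>k0 k1. f (T k1 \<cdot> (k0 \<cdot> g) # gs) (a # bs)) = counit H k \<odot>\<^bsub>N\<^esub> f (g #
        gs) (a # bs)" by simp
  qed
  also have "\<dots> = f (g # gs) (a # as')" by (rule coacts_counit[OF N as], rule bimulti_multi2[OF f])
      simp_all
  finally show ?case by simp
qed

text \<open>Now the coaction made by \<open>Psi\<close> comes first and the one made by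
  \<open>Phi\<close> second. The factor on \<open>g\<close> is the right leg times \<open>T\<close>
  of the left leg, and the first skew identity applies.\<close>

lemma Psi_Phi: "ds \<in> tuples D n \<Longrightarrow> multi R D N n f \<Longrightarrow> sw N (Psi ds) (\<lambda>gs as.
    ev N (Phi gs as) f) = f ds"
proof (induction ds arbitrary: n f)
  case Nil
  then have "f [] \<in> carrier N" by simp
  then show ?case by (simp add: ev_ret[OF N] sw_ret[OF N])
next
  case (Cons d ds)
  then obtain m where n [simp]: "n = Suc m" and d [simp]: "d \<in> carrier D" and ds [simp]:
      "ds \<in> tuples D m" by auto
  note f = Cons.prems(2)[unfolded n]
  have c [simp]: "f ds \<in> carrier N" if "ds \<in> tuples D (Suc m)" for ds using multi_closed[OF f that]
      .
  have fm: "multi R D N m (\<lambda>ds. f (d # ds))" if "d \<in> carrier D" for d by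
      (rule multi_Cons[OF f that])
  note [simp] = tuple_closed_rules[where n = m] tuple_closed_rules[where n =
      "Suc m"] sw_closed_rules
  have "sw N (Psi (d # ds)) (\<lambda>gs as. ev N (Phi gs as) f) = sw N (rep R d) (\<lambda>a g. sw N (Psi ds)
      (\<lambda>gs as. sw N (coacts as) (\<lambda>k bs. ev N (Phi (T k \<cdot> g # gs) (a # bs)) f)))"
    by (rule Psi_Cons[OF N d ds]) (simp del: Phi.simps)
  also have "\<dots> = sw N (rep R d) (\<lambda>a g. f (pD a g # ds))"
  proof (rule sw_cong[OF rep_D_combs[OF d]])
    fix a g assume [simp]: "a \<in> carrier C" "g \<in> carrier H"
    have "sw N (Psi ds) (\<lambda>gs as. sw N (coacts as) (\<lambda>k bs. ev N (Phi (T k \<cdot> g # gs) (a # bs)) f)) =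
        sw N (Psi ds) (\<lambda>gs as. ev N (Phi gs as) (\<lambda>ds. f (pD a g # ds)))"
    proof (rule Psi_cong[OF ds])
      fix gs as assume gs [simp]: "gs \<in> tuples H m" and as [simp]: "as \<in> tuples C m"
      have "sw N (coacts as) (\<lambda>k bs. ev N (Phi (T k \<cdot> g # gs) (a # bs)) f) = sw N (coacts as)
          (\<lambda>k bs. sw N (coacts bs) (\<lambda>k' bs'. ev N (Phi gs bs') (\<lambda>ds. f (pD a (k' \<cdot> (T k \<cdot> g)) #
          ds))))"
        by (rule coacts_cong[OF as], rule Phi_Cons[OF N, of _ _ m]) simp_all
      also have "\<dots> = sw N (coacts as) (\<lambda>k bs. sw N (\<Delta>\<^sub>H k) (\<lambda>k0 k1. ev N (Phi gs bs)
          (\<lambda>ds. f (pD a (k1 \<cdot> (T k0 \<cdot> g)) # ds))))"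
        by (rule coacts_coassoc[OF N as], rule Phi_bilin_multi[OF gs]) ((rule fm; simp) |
            (intro multi_lin[OF f] pD_lin2 mult_lin_left_comp mult_lin_right_comp mult_lin_left
            T_lin; simp))+
      also have "\<dots> = sw N (coacts as) (\<lambda>k bs. counit H k \<odot>\<^bsub>N\<^esub> ev N (Phi gs bs)
          (\<lambda>ds. f (pD a g # ds)))"
      proof (rule coacts_cong[OF as])
        fix k bs assume [simp]: "k \<in> carrier H" "bs \<in> tuples C m"
        have "sw N (\<Delta>\<^sub>H k) (\<lambda>k0 k1. ev N (Phi gs bs) (\<lambda>ds. f (pD a (k1 \<cdot> (T k0 \<cdot> g)) # ds))) =
          sw N (\<Delta>\<^sub>H k) (\<lambda>k0 k1. ev N (Phi gs bs) (\<lambda>ds. f (pD a ((k1 \<cdot> T k0) \<cdot> g) # ds)))"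
          by (rule sw_comultH_cong) (simp_all add: H.A.m_assoc)
        also have "\<dots> = counit H k \<odot>\<^bsub>N\<^esub> ev N (Phi gs bs) (\<lambda>ds. f (pD a (\<one>\<^bsub>H\<^esub> \<cdot> g) # ds))"
          by (rule antipode_inv_skew(1)[OF N, of k "\<lambda>z. ev N (Phi gs bs)
              (\<lambda>ds. f (pD a (z \<cdot> g) # ds))"])
            (simp, (intro Phi_lin_param[OF N gs] multi_lin[OF f] pD_lin2 mult_lin_left; simp))
        finally show "sw N (\<Delta>\<^sub>H k) (\<lambda>k0 k1. ev N (Phi gs bs) (\<lambda>ds. f (pD a (k1 \<cdot> (T k0 \<cdot> g)) # ds)))
            = counit H k \<odot>\<^bsub>N\<^esub> ev N (Phi gs bs) (\<lambda>ds. f (pD a g # ds))" by simp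
      qed
      also have "\<dots> = ev N (Phi gs as) (\<lambda>ds. f (pD a g # ds))" by
          (rule coacts_counit[OF N as], rule Phi_multi_as[OF fm gs]) simp
      finally show "sw N (coacts as) (\<lambda>k bs. ev N (Phi (T k \<cdot> g # gs) (a # bs)) f) =
          ev N (Phi gs as) (\<lambda>ds. f (pD a g # ds))" .
    qed
    also have "\<dots> = f (pD a g # ds)" by (rule Cons.IH[OF ds fm]) simp
    finally show "sw N (Psi ds) (\<lambda>gs as. sw N (coacts as) (\<lambda>k bs. ev N (Phi (T k \<cdot> g # gs) (a # bs))
        f)) = f (pD a g # ds)" .
  qed
  also have "\<dots> = f (d # ds)"
    by (rule rep_linear[OF N, of "\<lambda>d. f (d # ds)"], rule multi_lin[OF f ds id_lin[OF modD]]) simp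
  finally show ?case .
qed

end

end

section \<open>The operators on pure tensors\<close>

text \<open>The splitting is an abstract \<open>\<delta>\<close>, so that the comultiplications of
  \<open>H\<close>, \<open>C\<close> and the crossed coproduct are all instances. Outside the split
  place, the combination given by \<open>\<delta>\<close> is constant in the varying slot.\<close>

lemma multi_ins:
  assumes N: "module R N" and M: "module R M"
    and dc: "\<And>x. x \<in> carrier M \<Longrightarrow> \<delta> x \<in> combs R (carrier M \<times> carrier M)"
    and dl: "\<And>f. bilin R M M N f \<Longrightarrow> (\<lambda>x. sw N (\<delta> x) f) \<in> linear_maps R M N"
  shows "multi R M N (Suc n) F \<Longrightarrow> i < n \<Longrightarrow> multi R M N n (\<lambda>xs. sw N (\<delta> (xs ! i))
      (\<lambda>u v. F (ins i u v xs)))"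
proof (induction n arbitrary: i F)
  case 0 then show ?case by simp
next
  case (Suc n)
  note F = Suc.prems(1)
  have F1: "multi R M N (Suc n) (\<lambda>xs. F (x # xs))" if "x \<in> carrier M" for x by
      (rule multi_Cons[OF F that])
  interpret M: module R M by (rule M)
  have id: "(\<lambda>x. x) \<in> linear_maps R M M" by (rule linI) auto
  show ?case
  proof (cases i)
    case [simp]: 0
    have "multi R M N n (\<lambda>xs. sw N (\<delta> x) (\<lambda>u v. F (u # v # xs)))" if "x \<in> carrier M" for x
      by (rule sw_multi[OF N dc[OF that]]) (rule multi_Cons[OF F1])
    moreover have "(\<lambda>x. sw N (\<delta> x) (\<lambda>u v. F (u # v # xs))) \<in> linear_maps R M N" if
        "xs \<in> tuples M n" for xs
      by (rule dl, unfold bilin_def, (intro conjI ballI multi_lin[OF F] multi_lin[OF F1] id; simp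
          add: that))
    ultimately show ?thesis by simp
  next
    case [simp]: (Suc j)
    have j: "j < n" using Suc.prems by simp
    have "multi R M N n (\<lambda>xs. sw N (\<delta> (xs ! j)) (\<lambda>u v. F (x # ins j u v xs)))" if
        "x \<in> carrier M" for x
      by (rule Suc.IH[OF F1[OF that] j])
    moreover have "(\<lambda>x. sw N (\<delta> (xs ! j)) (\<lambda>u v. F (x # ins j u v xs))) \<in> linear_maps R M N"
        if xs: "xs \<in> tuples M n" for xs
      by (rule sw_lin_param[OF N dc[OF tuples_nth[OF xs j]]], rule multi_lin[OF F ins_tuples[OF xs
          j] id])
    ultimately show ?thesis by simp
  qed
qed

lemma multi_del:
  assumes N: "module R N" and M: "module R M" and e: "\<epsilon> \<in> linear_maps R M (scalar_module R)"
  shows "multi R M N n F \<Longrightarrow> j \<le> n \<Longrightarrow> multi R M N (Suc n) (\<lambda>xs. \<epsilon> (xs ! j) \<odot>\<^bsub>N\<^esub> F (del j xs))"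
proof (induction n arbitrary: j F)
  case 0
  then show ?case using lin_smult_left[OF N e, of "F []"] lin_closed[OF e] module.smult_closed[OF N]
      by (simp add: tuples_0)
next
  case (Suc n)
  note F = Suc.prems(1)
  interpret M: module R M by (rule M)
  have id: "(\<lambda>x. x) \<in> linear_maps R M M" by (rule linI) auto
  have ec: "\<epsilon> x \<in> carrier R" if "x \<in> carrier M" for x using lin_closed[OF e that] by simp
  show ?case
  proof (cases j)
    case [simp]: 0
    have "multi R M N (Suc n) (\<lambda>xs. \<epsilon> x \<odot>\<^bsub>N\<^esub> F xs)" if "x \<in> carrier M" for x
      by (rule multi_smult[OF N ec[OF that] F])
    moreover have "(\<lambda>x. \<epsilon> x \<odot>\<^bsub>N\<^esub> F xs) \<in> linear_maps R M N" if "xs \<in> tuples M (Suc n)" for xs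
      by (rule lin_smult_left[OF N e multi_closed[OF F that]])
    ultimately show ?thesis unfolding multi.simps(2)[of _ _ _ "Suc n"] by (simp del: multi.simps)
  next
    case [simp]: (Suc i)
    have i: "i \<le> n" using Suc.prems by simp
    have "multi R M N (Suc n) (\<lambda>xs. \<epsilon> (xs ! i) \<odot>\<^bsub>N\<^esub> F (x # del i xs))" if "x \<in> carrier M" for x
      by (rule Suc.IH[OF multi_Cons[OF F that] i])
    moreover have "(\<lambda>x. \<epsilon> (xs ! i) \<odot>\<^bsub>N\<^esub> F (x # del i xs)) \<in> linear_maps R M N" if
        "xs \<in> tuples M (Suc n)" for xs
      by (rule lin_smult_const[OF N ec[OF tuples_nth[OF that]] multi_lin[OF F del_tuples[OF that i]
          id]]) (use i in simp)
    ultimately show ?thesis unfolding multi.simps(2)[of _ _ _ "Suc n"] by (simp del: multi.simps)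
  qed
qed

text \<open>Uniqueness half of the universal property: every element is a combination of generators,
  and linear maps commute with evaluating it. With \<open>mixed_unique\<close> it reduces all final
  identities to pure tensors.\<close>

lemma power_unique:
  assumes M: "module R M" and N: "module R N" and S: "S \<in> linear_maps R (tensor_power R M n) N"
      "S' \<in> linear_maps R (tensor_power R M n) N"
    and eq: "\<And>xs. xs \<in> tuples M n \<Longrightarrow> S (pure_power R M xs) = S' (pure_power R M xs)" and X:
        "X \<in> carrier (tensor_power R M n)"
  shows "S X = S' X"
proof -
  note P = tensor_power_module[OF M, of n] and r = power_rep[OF M X]
  have "S X = S (ev (tensor_power R M n) (rep R X) (pure_power R M))" using r(2) by simp
  also have "\<dots> = ev N (rep R X) (\<lambda>xs. S (pure_power R M xs))" by
      (rule ev_map[OF P N S(1) r(1)]) (rule pure_power_closed[OF M])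
  also have "\<dots> = ev N (rep R X) (\<lambda>xs. S' (pure_power R M xs))" by (rule ev_cong[OF r(1) eq])
  also have "\<dots> = S' (ev (tensor_power R M n) (rep R X) (pure_power R M))" by
      (rule ev_map[OF P N S(2) r(1), symmetric]) (rule pure_power_closed[OF M])
  finally show ?thesis using r(2) by simp
qed

lemma mixed_unique:
  assumes M: "module R M" and M': "module R M'" and N: "module R N"
    and S: "S \<in> linear_maps R (mixed_tensor R M M' p q) N" "S' \<in> linear_maps R (mixed_tensor R M M'
        p q) N"
    and eq: "\<And>xs ys. xs \<in> tuples M p \<Longrightarrow> ys \<in> tuples M' q \<Longrightarrow> S (pure_mixed R M M' xs ys) = S'
        (pure_mixed R M M' xs ys)"
    and X: "X \<in> carrier (mixed_tensor R M M' p q)"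
  shows "S X = S' X"
proof -
  let ?P = "mixed_tensor R M M' p q"
  note P = mixed_module[OF M M', of p q] and r = mixed_rep[OF M M' X]
  have X': "sw ?P (rep R X) (pure_mixed R M M') = X" using r(2) by (simp add: sw_def)
  have "S (sw ?P (rep R X) (pure_mixed R M M')) = sw N (rep R X) (\<lambda>xs ys. S (pure_mixed R M M' xs
      ys))" by (rule sw_map[OF P N S(1) r(1)]) (rule pure_mixed_closed[OF M M'])
  also have "\<dots> = sw N (rep R X) (\<lambda>xs ys. S' (pure_mixed R M M' xs ys))" by
      (rule sw_cong[OF r(1) eq])
  also have "\<dots> = S' (sw ?P (rep R X) (pure_mixed R M M'))" by
      (rule sw_map[OF P N S(2) r(1), symmetric]) (rule pure_mixed_closed[OF M M'])
  finally show ?thesis unfolding X' .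
qed

lemma bimulti_cong:
  assumes "module R M" "module R M'" "\<And>xs ys. xs \<in> tuples M p \<Longrightarrow> ys \<in> tuples M' q
      \<Longrightarrow> f xs ys = g xs ys" "bimulti R M M' N p q g"
  shows "bimulti R M M' N p q f"
  unfolding bimulti_def
proof (intro conjI ballI)
  fix ys assume "ys \<in> tuples M' q"
  then show "multi R M N p (\<lambda>xs. f xs ys)"
    using assms(3,4) by (intro multi_cong[OF assms(1), of p "\<lambda>xs. g xs ys"
        "\<lambda>xs. f xs ys"]) (simp_all add: bimulti_def)
next
  fix xs assume "xs \<in> tuples M p"
  then show "multi R M' N q (\<lambda>ys. f xs ys)"
    using assms(3,4) by (intro multi_cong[OF assms(2), of q "\<lambda>ys. g xs ys"
        "\<lambda>ys. f xs ys"]) (simp_all add: bimulti_def)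
qed

lemma list_update_simps': "take i xs @ [u, v] @ drop (i + 1) xs = ins i u v xs"
    "take i xs @ drop (Suc i) xs = del i xs"
  by (simp_all add: ins_def del_def)

context crossed begin

abbreviation "MT p q \<equiv> mixed_tensor R H C p q"
abbreviation "TP n \<equiv> tensor_power R D n"
abbreviation "pm \<equiv> pure_mixed R H C"
abbreviation "pp \<equiv> pure_power R D"

lemma modMT: "module R (MT p q)" by (rule mixed_module[OF modH modC])
lemma modTP: "module R (TP n)" by (rule tensor_power_module[OF modD])
lemma pm_bimulti: "bimulti R H C (MT p q) p q pm" by (rule pure_mixed_bimulti[OF modH modC])
lemma pp_multi: "multi R D (TP n) n pp" by (rule pure_power_multi[OF modD])

lemma list_mult_Cons [simp]: "list_mult H (h # hs) = h \<cdot> list_mult H hs" and list_mult_Nil [simp]: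
    "list_mult H [] = \<one>\<^bsub>H\<^esub>"
  by (simp_all add: list_mult_def)

lemma list_mult_multi: "multi R H H n (list_mult H)"
proof (induction n)
  case (Suc n)
  have "multi R H H n (\<lambda>hs. h \<cdot> list_mult H hs)" if "h \<in> carrier H" for h by
      (rule multi_comp[OF mult_lin_right[OF that] Suc])
  moreover have "(\<lambda>h. h \<cdot> list_mult H hs) \<in> linear_maps R H H" if "hs \<in> tuples H n" for hs
    by (rule mult_lin_left[OF multi_closed[OF Suc that]])
  ultimately show ?case by simp
qed simp

subsection \<open>Iterated comultiplication and factorwise coaction\<close>

context
  fixes N :: "('a, 'n, 'p) module_scheme"
  assumes N: "module R N"
begin

interpretation N: module R N by (rule N)

lemma lin_multi_list_mult: "lin_multi N n f \<Longrightarrow> bimulti R H C N n n (\<lambda>hs bs. f (list_mult H hs) bs)"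
  unfolding bimulti_def lin_multi_def
  by (auto intro!: multi_comp[OF _ list_mult_multi] multi_closed[OF list_mult_multi])

text \<open>\<open>coact_tuple\<close> keeps all legs apart whereas \<open>coacts\<close> multiplies
  them, so the two are compared on test maps that see the legs only through
  \<open>list_mult\<close>. Membership belongs to the induction, since the next recursive step
  applies a linear map to this element.\<close>

lemma coact_tuple: "as \<in> tuples C n \<Longrightarrow> coact_tuple R H C as \<in> carrier (MT n n) \<and>
    (\<forall>f. lin_multi N n f \<longrightarrow> lin_ext R N (\<lambda>(hs, bs). f (list_mult H hs) bs) (coact_tuple R H C as) =
        sw N (coacts as) f)"
proof (induction as arbitrary: n)
  case Nil
  then have [simp]: "n = 0" by simp
  have "lin_ext R N (\<lambda>(hs, bs). f (list_mult H hs) bs) (pm [] []) = sw N (coacts []) f"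
      if f: "lin_multi N 0 f" for f
  proof -
    have b: "bimulti R H C N 0 0 (\<lambda>hs bs. (\<lambda>(hs, bs). f (list_mult H hs) bs) (hs, bs))" using
        lin_multi_list_mult[OF f] by simp
    have "f \<one>\<^bsub>H\<^esub> [] \<in> carrier N" using lin_multi_closed[OF f] by simp
    then show ?thesis using mixed_ext(2)[OF modH modC N b, of "[]" "[]"] by (simp add: sw_ret[OF N])
  qed
  then show ?case using pure_mixed_closed[OF modH modC, of "[]" 0 "[]" 0] by simp
next
  case (Cons a as)
  then obtain m where n [simp]: "n = Suc m" and a [simp]: "a \<in> carrier C" and as [simp]:
      "as \<in> tuples C m" by auto
  let ?T = "MT (Suc m) (Suc m)"
  have X: "coact_tuple R H C as \<in> carrier (MT m m)"
    and IH: "\<And>f. lin_multi N m f \<Longrightarrow> lin_ext R N (\<lambda>(hs, bs). f (list_mult H hs) bs) (coact_tuple R H C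
        as) = sw N (coacts as) f"
    using Cons.IH[OF as] by auto
  let ?G = "\<lambda>h b. lin_ext R ?T (\<lambda>(hs, bs). pm (h # hs) (b # bs))"
  have c: "coact_tuple R H C (a # as) = lin_ext R ?T (\<lambda>(h, b). ?G h b (coact_tuple R H C as)) (coact
      C a)"
    by (simp add: tuples_length[OF as] Let_def)
  have b: "bimulti R H C ?T m m (\<lambda>hs bs. (\<lambda>(hs, bs). pm (h # hs) (b # bs)) (hs, bs))" if
      "h \<in> carrier H" "b \<in> carrier C" for h b
    using pm_bimulti[of "Suc m" "Suc m"] that by (simp add: bimulti_def)
  note G = mixed_ext[OF modH modC modMT b]
  have closed_rules: "?G h b (coact_tuple R H C as) \<in> carrier ?T" if "h \<in> carrier H"
      "b \<in> carrier C" for h b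
    by (rule lin_closed[OF G(1)[OF that] X])
  have 1: "coact_tuple R H C (a # as) \<in> carrier ?T"
    unfolding c by (subst lin_ext_coact[OF modMT a]) (auto intro!: closed_rules sw_coact_closed[OF
        modMT])
  have 2: "lin_ext R N (\<lambda>(hs, bs). f (list_mult H hs) bs) (coact_tuple R H C (a # as)) =
      sw N (coacts (a # as)) f" if f: "lin_multi N (Suc m) f" for f
  proof -
    have bf: "bimulti R H C N (Suc m) (Suc m) (\<lambda>hs bs. (\<lambda>(hs, bs). f (list_mult H hs) bs) (hs, bs))"
        using lin_multi_list_mult[OF f] by simp
    let ?L = "lin_ext R N (\<lambda>(hs, bs). f (list_mult H hs) bs)"
    note L = mixed_ext[OF modH modC N bf]
    have "sends ?T ?L (?G h b (coact_tuple R H C as)) (sw N (coacts as)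
        (\<lambda>k bs. f (h \<cdot> k) (b # bs)))" if hb [simp]: "h \<in> carrier H" "b \<in> carrier C" for h b
    proof (rule sendsI[OF closed_rules[OF hb]])
      note f' = lin_multi_Cons[OF f hb]
      have bf': "bimulti R H C N m m (\<lambda>hs bs. (\<lambda>(hs, bs). f (h \<cdot> list_mult H hs) (b # bs)) (hs,
          bs))" using lin_multi_list_mult[OF f'] by simp
      note L' = mixed_ext[OF modH modC N bf']
      have "?L (?G h b (coact_tuple R H C as)) = lin_ext R N (\<lambda>(hs, bs). f (h \<cdot> list_mult H hs) (b #
          bs)) (coact_tuple R H C as)"
        by (rule mixed_unique[OF modH modC N lin_comp[OF L(1) G(1)[OF hb]] L'(1) _ X])
            (simp add: G(2) L(2) L'(2))
      also have "\<dots> = sw N (coacts as) (\<lambda>k bs. f (h \<cdot> k) (b # bs))" by (rule IH[OF f'])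
      finally show "?L (?G h b (coact_tuple R H C as)) = sw N (coacts as)
          (\<lambda>k bs. f (h \<cdot> k) (b # bs))" .
    qed
    then have "sends ?T ?L (coact_tuple R H C (a # as)) (sw N (\<rho> a) (\<lambda>h b. sw N (coacts as)
        (\<lambda>k bs. f (h \<cdot> k) (b # bs))))"
      unfolding c by (intro sends_co[OF modMT N L(1) a]) simp
    moreover have "sw N (coacts (a # as)) f = sw N (\<rho> a) (\<lambda>h b. sw N (coacts as)
        (\<lambda>k bs. f (h \<cdot> k) (b # bs)))"
      by (rule coacts_Cons[OF N a as lin_multi_closed[OF f]])
    ultimately show ?thesis by (simp add: sends_def del: coacts.simps)
  qed
  show ?case using 1 2 by (simp del: coacts.simps coact_tuple.simps)
qed

text \<open>Acting on units yields the bare legs of \<open>h\<close>, and multiplying them entrywise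
  onto \<open>gs\<close> is what \<open>act\<close> does with \<open>gs\<close> itself.\<close>

lemma act_ones: "gs \<in> tuples H n \<Longrightarrow> h \<in> carrier H \<Longrightarrow> (\<And>xs. xs \<in> tuples H n \<Longrightarrow> f xs \<in> carrier N) \<Longrightarrow>
   ev N (act (replicate n \<one>\<^bsub>H\<^esub>) h) (\<lambda>hs. f (map2 (mult H) hs gs)) = ev N (act gs h) f"
proof (induction gs arbitrary: n h f)
  case Nil then show ?case by simp
next
  case (Cons g gs)
  then obtain m where n [simp]: "n = Suc m" and g [simp]: "g \<in> carrier H" and gs [simp]:
      "gs \<in> tuples H m" by auto
  have [simp]: "h \<in> carrier H" by fact
  note c [simp] = Cons.prems(3)[unfolded n]
  have ones [simp]: "replicate m \<one>\<^bsub>H\<^esub> \<in> tuples H m" by (auto simp: tuples_def)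
  have m2 [simp]: "map2 (mult H) hs zs \<in> tuples H p" if "hs \<in> tuples H p"
      "zs \<in> tuples H p" for hs zs p
    using that by (auto simp: tuples_def set_zip subset_iff)
  have "ev N (act (\<one>\<^bsub>H\<^esub> # replicate m \<one>\<^bsub>H\<^esub>) h) (\<lambda>hs. f (map2 (mult H) hs (g # gs))) =
    sw N (\<Delta>\<^sub>H h) (\<lambda>x y. ev N (act (replicate m \<one>\<^bsub>H\<^esub>) y) (\<lambda>hs. f (map2 (mult H) (x \<cdot> \<one>\<^bsub>H\<^esub> # hs) (g #
        gs))))"
    by (rule act_Cons[OF N _ _ ones]) (simp_all add: m2[of _ "Suc m"])
  also have "\<dots> = sw N (\<Delta>\<^sub>H h) (\<lambda>x y. ev N (act gs y) (\<lambda>zs. f (x \<cdot> g # zs)))"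
    by (rule sw_comultH_cong, simp, simp, rule Cons.IH[OF gs]) simp_all
  also have "\<dots> = ev N (act (g # gs) h) f" by (rule act_Cons[OF N _ g gs, symmetric]) simp_all
  finally show ?case by simp
qed

end

text \<open>Acting on a tuple of units multiplies every leg by \<open>\<one>\<close>, so it returns
  the legs themselves. In this form the iterated coproduct is covered by the calculus of
  \<open>act\<close>.\<close>

lemma iter_comult: "h \<in> carrier H \<Longrightarrow> iter_comult R H p h =
    ev (tensor_power R H (Suc p)) (act (replicate (Suc p) \<one>\<^bsub>H\<^esub>) h) (pure_power R H)"
proof (induction p arbitrary: h)
  case 0
  note P = tensor_power_module[OF modH]
  let ?P = "tensor_power R H (Suc 0)"
  have pc: "pure_power R H xs \<in> carrier ?P" if "xs \<in> tuples H (Suc 0)" for xs by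
      (rule pure_power_closed[OF modH that])
  have "ev ?P (act [\<one>\<^bsub>H\<^esub>] h) (pure_power R H) = sw ?P (\<Delta>\<^sub>H h) (\<lambda>x y. ev ?P (act [] y)
      (\<lambda>xs. pure_power R H (x \<cdot> \<one>\<^bsub>H\<^esub> # xs)))"
    by (rule act_Cons[OF P 0 _ _ pc]) simp_all
  \<comment> \<open>\<open>act\<close> splits \<open>h\<close> once more than
    \<open>iter_comult\<close>, down to the empty tuple; the counit law removes the surplus
    leg.\<close>
  also have "\<dots> = sw ?P (\<Delta>\<^sub>H h) (\<lambda>x y. counit H y \<odot>\<^bsub>?P\<^esub> pure_power R H [x \<cdot> \<one>\<^bsub>H\<^esub>])"
    by (rule sw_comultH_cong[OF 0], rule act_Nil[OF P]) (simp_all add: pc)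
  also have "\<dots> = pure_power R H [h \<cdot> \<one>\<^bsub>H\<^esub>]"
    by (rule counitH_right[OF P 0], rule multi_lin[OF pure_power_multi[OF modH], of "[]"])
        (simp_all add: mult_lin_left)
  finally show ?case using 0 by simp
next
  case (Suc p)
  note h [simp] = Suc.prems
  let ?P = "tensor_power R H (Suc (Suc p))" and ?P' = "tensor_power R H (Suc p)"
  note P = tensor_power_module[OF modH, of "Suc (Suc p)"] and P' = tensor_power_module[OF modH, of
      "Suc p"]
  have ones [simp]: "replicate q \<one>\<^bsub>H\<^esub> \<in> tuples H q" for q by (auto simp: tuples_def)
  have pc: "pure_power R H xs \<in> carrier ?P" if "xs \<in> tuples H (Suc (Suc p))" for xs by
      (rule pure_power_closed[OF modH that])
  have m: "multi R H ?P (Suc p) (\<lambda>hs. pure_power R H (h0 # hs))" if "h0 \<in> carrier H" for h0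
    by (rule multi_Cons[OF pure_power_multi[OF modH] that])
  have i: "lin_ext R ?P (\<lambda>hs. pure_power R H (h0 # hs)) (iter_comult R H p h1) =
      ev ?P (act (replicate (Suc p) \<one>\<^bsub>H\<^esub>) h1) (\<lambda>hs. pure_power R H (h0 # hs))"
    if [simp]: "h0 \<in> carrier H" "h1 \<in> carrier H" for h0 h1
  proof -
    note e = power_ext[OF modH P m[OF that(1)]]
    have "lin_ext R ?P (\<lambda>hs. pure_power R H (h0 # hs)) (iter_comult R H p h1) =
        ev ?P (act (replicate (Suc p) \<one>\<^bsub>H\<^esub>) h1) (\<lambda>hs. lin_ext R ?P (\<lambda>hs. pure_power R H (h0 # hs))
        (pure_power R H hs))"
      unfolding Suc.IH[OF that(2)] by (rule ev_map[OF P' P e(1) act_combs[OF that(2) ones]])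
          (rule pure_power_closed[OF modH])
    also have "\<dots> = ev ?P (act (replicate (Suc p) \<one>\<^bsub>H\<^esub>) h1) (\<lambda>hs. pure_power R H (h0 # hs))"
      by (rule act_cong[OF that(2) ones], rule e(2))
    finally show ?thesis .
  qed
  have closed_rules: "ev ?P (act (replicate (Suc p) \<one>\<^bsub>H\<^esub>) h1) (\<lambda>hs. pure_power R H (h0 # hs)) \<in>
      carrier ?P" if "h0 \<in> carrier H" "h1 \<in> carrier H" for h0 h1
    by (rule act_closed[OF P that(2) ones], rule pc) (use that in simp)
  have "iter_comult R H (Suc p) h = sw ?P (\<Delta>\<^sub>H h) (\<lambda>h0 h1. lin_ext R ?P
      (\<lambda>hs. pure_power R H (h0 # hs)) (iter_comult R H p h1))"
    unfolding iter_comult.simps by (simp add: lin_ext_comultH[OF P h] i closed_rules del: act.simps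
        replicate_Suc)
  also have "\<dots> = sw ?P (\<Delta>\<^sub>H h) (\<lambda>h0 h1. ev ?P (act (replicate (Suc p) \<one>\<^bsub>H\<^esub>) h1)
      (\<lambda>hs. pure_power R H (h0 \<cdot> \<one>\<^bsub>H\<^esub> # hs)))"
    by (rule sw_comultH_cong[OF h]) (simp add: i del: act.simps replicate_Suc)
  also have "\<dots> = ev ?P (act (\<one>\<^bsub>H\<^esub> # replicate (Suc p) \<one>\<^bsub>H\<^esub>) h) (pure_power R H)"
    by (rule act_Cons[OF P h _ ones pc, symmetric]) simp_all
  finally show ?case by simp
qed

text \<open>Combines \<open>iter_comult\<close> with \<open>act_ones\<close>. The tuple has at least
  one entry because \<open>diag_act\<close> obtains the number of iterations as its length minus
  one.\<close>

lemma diag_act: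
  assumes N: "module R N" and h: "h \<in> carrier H" and gs: "gs \<in> tuples H (Suc p)" and f:
      "multi R H N (Suc p) f"
  shows "lin_ext R N f (diag_act R H h gs) = ev N (act gs h) f"
proof -
  let ?P = "tensor_power R H (Suc p)"
  note P = tensor_power_module[OF modH, of "Suc p"]
  have ones: "replicate (Suc p) \<one>\<^bsub>H\<^esub> \<in> tuples H (Suc p)" by (auto simp: tuples_def)
  have pc: "pure_power R H xs \<in> carrier ?P" if "xs \<in> tuples H (Suc p)" for xs by
      (rule pure_power_closed[OF modH that])
  \<comment> \<open>Entrywise multiplication by a fixed tuple preserves multilinearity; the length,
    tuple and test map are left general for the induction.\<close>
  have m2: "multi R H K n (\<lambda>hs. k (map2 (mult H) hs zs))" if "multi R H K n k"
      "zs \<in> tuples H n" "module R K" for k K n zs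
    using that(1,2)
  proof (induction n arbitrary: k zs)
    case 0 then show ?case by simp
  next
    case (Suc n)
    then obtain y ys where [simp]: "zs = y # ys" and y: "y \<in> carrier H" and ys: "ys \<in> tuples H n"
        by (auto elim: tuples_ConsE)
    have "map2 (mult H) hs ys \<in> tuples H n" if "hs \<in> tuples H n" for hs
      using that ys by (auto simp: tuples_def set_zip subset_iff)
    then have "(\<lambda>x. k (x \<cdot> y # map2 (mult H) hs ys)) \<in> linear_maps R H K" if
        "hs \<in> tuples H n" for hs
      using multi_lin[OF Suc.prems(1) _ mult_lin_left[OF y]] that by blast
    moreover have "multi R H K n (\<lambda>hs. k (x \<cdot> y # map2 (mult H) hs ys))" if "x \<in> carrier H" for x
      by (rule Suc.IH[OF multi_Cons[OF Suc.prems(1)] ys]) (use that y in simp)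
    ultimately show ?case by simp
  qed
  have m: "multi R H ?P (Suc p) (\<lambda>hs. pure_power R H (map2 (mult H) hs gs))"
    by (rule m2[OF pure_power_multi[OF modH] gs P])
  note e = power_ext[OF modH P m] and ef = power_ext[OF modH N f]
  have "diag_act R H h gs = ev ?P (act (replicate (Suc p) \<one>\<^bsub>H\<^esub>) h) (\<lambda>hs. lin_ext R ?P
      (\<lambda>hs. pure_power R H (map2 (mult H) hs gs)) (pure_power R H hs))"
    unfolding diag_act_def tuples_length[OF gs] diff_Suc_1 iter_comult[OF h]
    by (rule ev_map[OF P P e(1) act_combs[OF h ones]]) (rule pc)
  also have "\<dots> = ev ?P (act (replicate (Suc p) \<one>\<^bsub>H\<^esub>) h) (\<lambda>hs. pure_power R H (map2 (mult H) hs gs))"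
    by (rule act_cong[OF h ones], rule e(2))
  also have "\<dots> = ev ?P (act gs h) (pure_power R H)" by (rule act_ones[OF P gs h pc])
  finally have "lin_ext R N f (diag_act R H h gs) = lin_ext R N f (ev ?P (act gs h) (pure_power R
      H))" by simp
  also have "\<dots> = ev N (act gs h) (\<lambda>hs. lin_ext R N f (pure_power R H hs))"
    by (rule ev_map[OF P N ef(1) act_combs[OF h gs]]) (rule pc)
  also have "\<dots> = ev N (act gs h) f" by (rule act_cong[OF h gs], rule ef(2))
  finally show ?thesis .
qed

section \<open>Multilinearity of the horizontal and vertical operators\<close>

context
  fixes N :: "('a, 'n, 'p) module_scheme"
  assumes N: "module R N"
begin

interpretation N: module R N by (rule N)

text \<open>The entry moved to the end is the delicate slot: linearity there passes through the
  coaction, through \<open>T\<close>, and through the action in its acting element.\<close>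

lemma horizontal_cyc_bimulti:
  assumes F: "bimulti R H C N p (Suc q) F"
  shows "bimulti R H C N p (Suc q) (\<lambda>gs as. sw N (\<rho> (hd as)) (\<lambda>h b. ev N (act gs (T h))
      (\<lambda>gs'. F gs' (tl as @ [b]))))"
proof -
  have F1: "multi R H N p (\<lambda>gs. F gs as)" if "as \<in> tuples C (Suc q)" for as using F that by
      (simp add: bimulti_def)
  have F2: "multi R C N (Suc q) (F gs)" if "gs \<in> tuples H p" for gs using F that by
      (simp add: bimulti_def)
  show ?thesis unfolding bimulti_def
  proof (intro conjI ballI)
    fix as assume "as \<in> tuples C (Suc q)"
    then have [simp]: "hd as \<in> carrier C" "tl as \<in> tuples C q" by (auto elim: tuples_ConsE)
    show "multi R H N p (\<lambda>gs. sw N (\<rho> (hd as)) (\<lambda>h b. ev N (act gs (T h))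
        (\<lambda>gs'. F gs' (tl as @ [b]))))"
      by (rule sw_multi[OF N coact_combs], simp, rule act_multi[OF N], simp, rule F1) simp
  next
    fix gs assume gs: "gs \<in> tuples H p"
    have "multi R C N q (\<lambda>as. sw N (\<rho> a) (\<lambda>h b. ev N (act gs (T h)) (\<lambda>gs'. F gs' (as @ [b]))))"
        if a: "a \<in> carrier C" for a
      by (rule sw_multi[OF N coact_combs[OF a]], rule multi_ev[OF N act_combs[OF _ gs]], simp, rule
          multi_snoc[OF F2]) simp_all
    moreover have "(\<lambda>a. sw N (\<rho> a) (\<lambda>h b. ev N (act gs (T h)) (\<lambda>gs'. F gs' (as @ [b])))) \<in>
        linear_maps R C N" if as: "as \<in> tuples C q" for as
    proof (rule sw_coact_lin[OF N], unfold bilin_def, intro conjI ballI)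
      fix b assume b: "b \<in> carrier C"
      show "(\<lambda>h. ev N (act gs (T h)) (\<lambda>gs'. F gs' (as @ [b]))) \<in> linear_maps R H N"
        by (rule lin_comp[OF act_lin[OF N gs F1] T_lin]) (use as b in simp)
    next
      fix h assume h: "h \<in> carrier H"
      show "(\<lambda>b. ev N (act gs (T h)) (\<lambda>gs'. F gs' (as @ [b]))) \<in> linear_maps R C N"
        by (rule act_lin_param[OF N _ gs], simp add: h, rule multi_snoc_lin[OF F2 as id_lin[OF
            modC]])
    qed
    ultimately show "multi R C N (Suc q) (\<lambda>as. sw N (\<rho> (hd as)) (\<lambda>h b. ev N (act gs (T h))
        (\<lambda>gs'. F gs' (tl as @ [b]))))" by simp
  qed
qed

lemma vertical_cyc_lin_multi:
  assumes F: "bimulti R H C N (Suc p) q F" and gs: "gs \<in> tuples H p" and g: "g \<in> carrier H"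
  shows "lin_multi N q (\<lambda>k bs. F (gs @ [k \<cdot> g]) bs)"
proof (rule lin_multiI)
  show "multi R C N q (F (gs @ [k \<cdot> g]))" if "k \<in> carrier H" for k using F gs g that by
      (simp add: bimulti_def)
  show "(\<lambda>k. F (gs @ [k \<cdot> g]) bs) \<in> linear_maps R H N" if "bs \<in> tuples C q" for bs
    by (rule multi_snoc_lin[of R H N p "\<lambda>gs. F gs bs", OF _ gs mult_lin_left[OF g]])
        (use F that in \<open>simp add: bimulti_def\<close>)
qed

lemma vertical_cyc_bimulti:
  assumes F: "bimulti R H C N (Suc p) q F"
  shows "bimulti R H C N (Suc p) q (\<lambda>gs as. sw N (coacts as) (\<lambda>k bs. F (tl gs @ [k \<cdot> hd gs]) bs))"
proof -
  have F1: "multi R H N (Suc p) (\<lambda>gs. F gs as)" if "as \<in> tuples C q" for as using F that by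
      (simp add: bimulti_def)
  show ?thesis unfolding bimulti_def
  proof (intro conjI ballI)
    fix as assume as: "as \<in> tuples C q"
    have "multi R H N p (\<lambda>gs. sw N (coacts as) (\<lambda>k bs. F (gs @ [k \<cdot> g]) bs))" if g:
        "g \<in> carrier H" for g
      by (rule sw_multi[OF N coacts_combs[OF as]], rule multi_snoc[OF F1], assumption) (simp add: g)
    moreover have "(\<lambda>g. sw N (coacts as) (\<lambda>k bs. F (gs @ [k \<cdot> g]) bs)) \<in> linear_maps R H N"
        if gs: "gs \<in> tuples H p" for gs
      by (rule coacts_lin_param[OF N as], rule multi_snoc_lin[OF F1 gs mult_lin_right])
    ultimately show "multi R H N (Suc p) (\<lambda>gs. sw N (coacts as) (\<lambda>k bs. F (tl gs @ [k \<cdot> hd gs])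
        bs))" by simp
  next
    fix gs assume "gs \<in> tuples H (Suc p)"
    then show "multi R C N q (\<lambda>as. sw N (coacts as) (\<lambda>k bs. F (tl gs @ [k \<cdot> hd gs]) bs))"
      by (intro coacts_multi[OF N] vertical_cyc_lin_multi[OF F]) (auto elim: tuples_ConsE)
  qed
qed

lemma comultC_nth_bimulti:
  assumes F: "bimulti R H C N p (Suc q) F" and i: "i < q"
  shows "bimulti R H C N p q (\<lambda>gs as. sw N (\<Delta>\<^sub>C (as ! i)) (\<lambda>u v. F gs (ins i u v as)))"
  unfolding bimulti_def
proof (intro conjI ballI)
  fix as assume as: "as \<in> tuples C q"
  show "multi R H N p (\<lambda>gs. sw N (\<Delta>\<^sub>C (as ! i)) (\<lambda>u v. F gs (ins i u v as)))"
    by (rule sw_multi[OF N comultC_combs[OF tuples_nth[OF as i]]])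
        (use F ins_tuples[OF as i] in \<open>simp add: bimulti_def\<close>)
next
  fix gs assume "gs \<in> tuples H p"
  then show "multi R C N q (\<lambda>as. sw N (\<Delta>\<^sub>C (as ! i)) (\<lambda>u v. F gs (ins i u v as)))"
    using F by (intro multi_ins[OF N modC comultC_combs sw_comultC_lin[OF N] _ i])
        (simp_all add: bimulti_def)
qed

lemma comultH_nth_bimulti:
  assumes F: "bimulti R H C N (Suc p) q F" and i: "i < p"
  shows "bimulti R H C N p q (\<lambda>gs as. sw N (\<Delta>\<^sub>H (gs ! i)) (\<lambda>u v. F (ins i u v gs) as))"
  unfolding bimulti_def
proof (intro conjI ballI)
  fix gs assume gs: "gs \<in> tuples H p"
  show "multi R C N q (\<lambda>as. sw N (\<Delta>\<^sub>H (gs ! i)) (\<lambda>u v. F (ins i u v gs) as))"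
    by (rule sw_multi[OF N comultH_combs[OF tuples_nth[OF gs i]]])
        (use F ins_tuples[OF gs i] in \<open>simp add: bimulti_def\<close>)
next
  fix as assume "as \<in> tuples C q"
  then show "multi R H N p (\<lambda>gs. sw N (\<Delta>\<^sub>H (gs ! i)) (\<lambda>u v. F (ins i u v gs) as))"
    using F by (intro multi_ins[OF N modH comultH_combs sw_comultH_lin[OF N] _ i, of
        "\<lambda>gs. F gs as"]) (simp_all add: bimulti_def)
qed

lemma counitC_nth_bimulti:
  assumes F: "bimulti R H C N p q F" and j: "j \<le> q"
  shows "bimulti R H C N p (Suc q) (\<lambda>gs as. counit C (as ! j) \<odot>\<^bsub>N\<^esub> F gs (del j as))"
  unfolding bimulti_def
proof (intro conjI ballI)
  fix as assume as: "as \<in> tuples C (Suc q)"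
  show "multi R H N p (\<lambda>gs. counit C (as ! j) \<odot>\<^bsub>N\<^esub> F gs (del j as))"
    by (rule multi_smult[OF N]) (use F j del_tuples[OF as j] tuples_nth[OF as] in \<open>simp_all add:
        bimulti_def\<close>)
next
  fix gs assume "gs \<in> tuples H p"
  then show "multi R C N (Suc q) (\<lambda>as. counit C (as ! j) \<odot>\<^bsub>N\<^esub> F gs (del j as))"
    using F by (intro multi_del[OF N modC counit_linear _ j]) (simp add: bimulti_def)
qed

lemma counitH_nth_bimulti:
  assumes F: "bimulti R H C N p q F" and j: "j \<le> p"
  shows "bimulti R H C N (Suc p) q (\<lambda>gs as. counit H (gs ! j) \<odot>\<^bsub>N\<^esub> F (del j gs) as)"
  unfolding bimulti_def
proof (intro conjI ballI)
  fix gs assume gs: "gs \<in> tuples H (Suc p)"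
  show "multi R C N q (\<lambda>as. counit H (gs ! j) \<odot>\<^bsub>N\<^esub> F (del j gs) as)"
    by (rule multi_smult[OF N]) (use F j del_tuples[OF gs j] tuples_nth[OF gs] in \<open>simp_all add:
        bimulti_def\<close>)
next
  fix as assume "as \<in> tuples C q"
  then show "multi R H N (Suc p) (\<lambda>gs. counit H (gs ! j) \<odot>\<^bsub>N\<^esub> F (del j gs) as)"
    using F by (intro multi_del[OF N modH H.counit_linear _ j, of "\<lambda>gs. F gs as"])
        (simp add: bimulti_def)
qed

text \<open>In both directions the last coface is coface 0 followed by the cyclic operator. Once
  \<open>act_comult\<close> has moved the vertical splitting before the action,
  \<open>Phi_cyc\<close> applies one degree higher, and \<open>Phi_coface\<close> at place 0
  finishes.\<close>

lemma Phi_coface_last: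
  assumes gs: "gs \<in> tuples H (Suc n)" and as: "as \<in> tuples C (Suc n)" and f:
      "multi R D N (Suc (Suc n)) f"
  shows "sw N (\<Delta>\<^sub>C (hd as)) (\<lambda>u v. sw N (\<rho> u) (\<lambda>h b. ev N (act gs (T h)) (\<lambda>gs'.
      sw N (\<Delta>\<^sub>H (hd gs')) (\<lambda>x y. sw N (coacts (v # tl as @ [b])) (\<lambda>k bs.
          ev N (Phi (y # tl gs' @ [k \<cdot> x]) bs) f))))) =
    ev N (Phi gs as) (\<lambda>ds. sw N (\<Delta>\<^sub>D (ds ! 0)) (\<lambda>p q. f (rotate1 (ins 0 p q ds))))"
proof -
  obtain g gs0 where gs_eq [simp]: "gs = g # gs0" and g [simp]: "g \<in> carrier H" and gs0 [simp]:
      "gs0 \<in> tuples H n"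
    using gs by (auto elim: tuples_ConsE)
  obtain a as0 where as_eq [simp]: "as = a # as0" and a [simp]: "a \<in> carrier C" and as0 [simp]:
      "as0 \<in> tuples C n"
    using as by (auto elim: tuples_ConsE)
  \<comment> \<open>The vertical cyclic operator followed by the sum over \<open>Phi\<close>, kept
    folded while the coproduct of the head is exchanged with the action.\<close>
  define F where "F vs zs = sw N (coacts vs) (\<lambda>k bs. ev N (Phi (tl zs @ [k \<cdot> hd zs]) bs) f)" for vs
      zs
  have Fm: "multi R H N (Suc (Suc n)) (F vs)" if "vs \<in> tuples C (Suc (Suc n))" for vs
    using vertical_cyc_bimulti[OF Phi_bimulti[OF N f]] that unfolding bimulti_def F_def by blast
  have Fc: "F vs zs \<in> carrier N" if "vs \<in> tuples C (Suc (Suc n))"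
      "zs \<in> tuples H (Suc (Suc n))" for vs zs
    by (rule multi_closed[OF Fm[OF that(1)] that(2)])
  have vs [simp]: "v # as0 @ [b] \<in> tuples C (Suc (Suc n))" if "v \<in> carrier C"
      "b \<in> carrier C" for v b
    using that by simp
  note fr = multi_rotate[OF f modD]
  have "sw N (\<Delta>\<^sub>C a) (\<lambda>u v. sw N (\<rho> u) (\<lambda>h b. ev N (act (g # gs0) (T h)) (\<lambda>gs'.
      sw N (\<Delta>\<^sub>H (hd gs')) (\<lambda>x y. F (v # as0 @ [b]) (x # y # tl gs'))))) =
    sw N (\<Delta>\<^sub>C a) (\<lambda>u v. sw N (\<rho> u) (\<lambda>h b. sw N (\<Delta>\<^sub>H g) (\<lambda>x y.
        ev N (act (x # y # gs0) (T h)) (F (v # as0 @ [b])))))"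
    by (rule sw_comultC_cong[OF a], rule sw_coact_cong, assumption, rule act_comult[OF N g gs0 _ Fm,
        symmetric]) simp_all
  also have "\<dots> = sw N (\<Delta>\<^sub>C a) (\<lambda>u v. sw N (\<Delta>\<^sub>H g) (\<lambda>x y. sw N (\<rho> u) (\<lambda>h b.
      ev N (act (x # y # gs0) (T h)) (F (v # as0 @ [b])))))"
    by (rule sw_comultC_cong[OF a], rule sw_sw_swap[OF N coact_combs comultH_combs[OF g]],
        assumption, rule act_closed[OF N, of _ _ "Suc (Suc n)"]) (simp_all add: Fc)
  also have "\<dots> = sw N (\<Delta>\<^sub>C a) (\<lambda>u v. sw N (\<Delta>\<^sub>H g) (\<lambda>x y.
      ev N (Phi (x # y # gs0) (u # v # as0)) (\<lambda>ds. f (rotate1 ds))))"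
    unfolding F_def append_Cons[symmetric]
    by (rule sw_comultC_cong[OF a], rule sw_comultH_cong[OF g], rule Phi_cyc[OF N, of _
        "Suc n"]) (simp_all add: f del: multi.simps)
  also have "\<dots> = ev N (Phi (g # gs0) (a # as0)) (\<lambda>ds. sw N (\<Delta>\<^sub>D (ds ! 0))
      (\<lambda>p q. f (rotate1 (ins 0 p q ds))))"
    using Phi_coface[OF N, of "g # gs0" "Suc n" "a # as0" 0 "\<lambda>ds. f (rotate1 ds)"] fr by simp
  finally show ?thesis unfolding F_def by (simp del: coacts.simps Phi.simps act.simps)
qed

end

end

section \<open>The operators on generators\<close>

context crossed begin

abbreviation "X \<equiv> natural_bicocyclic R H C"
abbreviation "Y \<equiv> coalgebra_cocyclic R D"

lemmas pm_closed = pure_mixed_closed[OF modH modC]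
lemmas pp_closed = pure_power_closed[OF modD]

text \<open>\<open>f\<close> is the nested \<open>lin_ext\<close> of a definition and
  \<open>W\<close> its Sweedler form. Agreement on tuples suffices to transfer multilinearity from
  \<open>W\<close>, which makes the operator well defined and computes it on generators.\<close>

lemma operator_on_pure:
  assumes W: "bimulti R H C (MT p' q') p q W"
    and eq: "\<And>gs as. gs \<in> tuples H p \<Longrightarrow> as \<in> tuples C q \<Longrightarrow> f (gs, as) = W gs as"
  shows "lin_ext R (MT p' q') f \<in> linear_maps R (MT p q) (MT p' q')"
    and "gs \<in> tuples H p \<Longrightarrow> as \<in> tuples C q \<Longrightarrow> lin_ext R (MT p' q') f (pm gs as) = W gs as"
proof -
  have b: "bimulti R H C (MT p' q') p q (\<lambda>gs as. f (gs, as))"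
    by (rule bimulti_cong[OF modH modC eq W])
  show "lin_ext R (MT p' q') f \<in> linear_maps R (MT p q) (MT p' q')"
    by (rule mixed_ext(1)[OF modH modC modMT b])
  show "gs \<in> tuples H p \<Longrightarrow> as \<in> tuples C q \<Longrightarrow> lin_ext R (MT p' q') f (pm gs as) = W gs as"
    using mixed_ext(2)[OF modH modC modMT b] eq by simp
qed

lemma power_operator_on_pure:
  assumes W: "multi R D (TP m) n W" and eq: "\<And>ds. ds \<in> tuples D n \<Longrightarrow> f ds = W ds"
  shows "lin_ext R (TP m) f \<in> linear_maps R (TP n) (TP m)"
    and "ds \<in> tuples D n \<Longrightarrow> lin_ext R (TP m) f (pp ds) = W ds"
proof -
  have b: "multi R D (TP m) n f" by (rule multi_cong[OF modD _ W]) (simp add: eq)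
  show "lin_ext R (TP m) f \<in> linear_maps R (TP n) (TP m)" by (rule power_ext(1)[OF modD modTP b])
  show "ds \<in> tuples D n \<Longrightarrow> lin_ext R (TP m) f (pp ds) = W ds"
    using power_ext(2)[OF modD modTP b] eq by simp
qed

lemma hcoface_inner:
  assumes i: "i \<le> q"
  shows "hcoface X p q i \<in> linear_maps R (MT (Suc p) (Suc q)) (MT (Suc p) (Suc (Suc q)))"
    and "gs \<in> tuples H (Suc p) \<Longrightarrow> as \<in> tuples C (Suc q) \<Longrightarrow>
      hcoface X p q i (pm gs as) = sw (MT (Suc p) (Suc (Suc q))) (\<Delta>\<^sub>C (as ! i))
          (\<lambda>u v. pm gs (ins i u v as))"
proof -
  let ?T = "MT (Suc p) (Suc (Suc q))"
  have i': "i < Suc q" using i by simp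
  have e: "(\<lambda>(gs, as). lin_ext R ?T (\<lambda>(u, v). pm gs (ins i u v as)) (comult C (as ! i))) (gs, as) =
      sw ?T (\<Delta>\<^sub>C (as ! i)) (\<lambda>u v. pm gs (ins i u v as))" if "gs \<in> tuples H (Suc p)"
          "as \<in> tuples C (Suc q)" for gs as
    unfolding prod.case by (subst lin_ext_comultC[OF modMT tuples_nth[OF that(2) i']]) (auto intro!:
        pm_closed ins_tuples that i')
  have h: "hcoface X p q i = lin_ext R ?T (\<lambda>(gs, as). lin_ext R ?T (\<lambda>(u, v). pm gs (ins i u v as))
      (comult C (as ! i)))"
    using i by (simp add: natural_bicocyclic_def Let_def list_update_simps' ins_def)
  note o = operator_on_pure[OF comultC_nth_bimulti[OF modMT pm_bimulti i'] e]
  show "hcoface X p q i \<in> linear_maps R (MT (Suc p) (Suc q)) ?T" unfolding h by (rule o(1))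
  show "gs \<in> tuples H (Suc p) \<Longrightarrow> as \<in> tuples C (Suc q) \<Longrightarrow>
      hcoface X p q i (pm gs as) = sw ?T (\<Delta>\<^sub>C (as ! i)) (\<lambda>u v. pm gs (ins i u v as))" unfolding h
          by (rule o(2))
qed

lemma hcoface_last:
  shows "hcoface X p q (Suc q) \<in> linear_maps R (MT (Suc p) (Suc q)) (MT (Suc p) (Suc (Suc q)))"
    and "gs \<in> tuples H (Suc p) \<Longrightarrow> as \<in> tuples C (Suc q) \<Longrightarrow>
      hcoface X p q (Suc q) (pm gs as) = sw (MT (Suc p) (Suc (Suc q))) (\<Delta>\<^sub>C (hd as)) (\<lambda>u v.
          sw (MT (Suc p) (Suc (Suc q))) (\<rho> u) (\<lambda>h b.
        ev (MT (Suc p) (Suc (Suc q))) (act gs (T h)) (\<lambda>gs'. pm gs' (v # tl as @ [b]))))"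
proof -
  let ?T = "MT (Suc p) (Suc (Suc q))"
  let ?W = "\<lambda>gs as. sw ?T (\<Delta>\<^sub>C (hd as)) (\<lambda>u v. sw ?T (\<rho> u) (\<lambda>h b. ev ?T (act gs (T h))
      (\<lambda>gs'. pm gs' (v # tl as @ [b]))))"
  let ?f = "\<lambda>(gs, as). lin_ext R ?T (\<lambda>(u, v). lin_ext R ?T (\<lambda>(h, b). lin_ext R ?T
      (\<lambda>gs'. pm gs' (v # tl as @ [b])) (diag_act R H (T h) gs)) (coact C u)) (comult C (hd as))"
  note [simp del] = coacts.simps act.simps
  have hl: "hd as \<in> carrier C" "tl as \<in> tuples C q" if "as \<in> tuples C (Suc q)" for as using that
      by (auto elim: tuples_ConsE)
  have e: "?f (gs, as) = ?W gs as" if gs: "gs \<in> tuples H (Suc p)" and as: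
      "as \<in> tuples C (Suc q)" for gs as
  proof -
    have m: "multi R H ?T (Suc p) (\<lambda>gs'. pm gs' vs)" if "vs \<in> tuples C (Suc (Suc q))" for vs
      using pm_bimulti[of "Suc p" "Suc (Suc q)"] that unfolding bimulti_def by blast
    have "sends ?T (\<lambda>x. x) (?f (gs, as)) (?W gs as)"
      unfolding prod.case
    proof (rule sends_dC[OF modMT modMT id_lin[OF modMT] hl(1)[OF as]], unfold prod.case, rule
        sends_co[OF modMT modMT id_lin[OF modMT]], assumption, unfold prod.case)
      fix u v h b assume a: "u \<in> carrier C" "v \<in> carrier C" "h \<in> carrier H" "b \<in> carrier C"
      then have vs: "v # tl as @ [b] \<in> tuples C (Suc (Suc q))" using hl[OF as] by simp
      have "ev ?T (act gs (T h)) (\<lambda>gs'. pm gs' (v # tl as @ [b])) \<in> carrier ?T"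
        by (rule act_closed[OF modMT _ gs], simp add: a, rule pm_closed[OF _ vs])
      then show "sends ?T (\<lambda>x. x) (lin_ext R ?T (\<lambda>gs'. pm gs' (v # tl as @ [b])) (diag_act R H (T h)
          gs)) (ev ?T (act gs (T h)) (\<lambda>gs'. pm gs' (v # tl as @ [b])))"
        using diag_act[OF modMT _ gs m[OF vs], of "T h"] a by (simp add: sends_def)
    qed
    then show ?thesis by (simp add: sends_def)
  qed
  \<comment> \<open>Multilinearity is inherited from a composite: the horizontal cyclic operator
    preceded by the splitting at place 0.\<close>
  have W: "bimulti R H C ?T (Suc p) (Suc q) ?W"
    by (rule bimulti_cong[OF modH modC _ comultC_nth_bimulti[OF modMT horizontal_cyc_bimulti[OF
        modMT pm_bimulti], of 0]]) (auto elim!: tuples_ConsE)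
  have h: "hcoface X p q (Suc q) = lin_ext R ?T ?f"
    by (simp add: natural_bicocyclic_def Let_def)
  note o = operator_on_pure[OF W e]
  show "hcoface X p q (Suc q) \<in> linear_maps R (MT (Suc p) (Suc q)) ?T" unfolding h by (rule o(1))
  show "gs \<in> tuples H (Suc p) \<Longrightarrow> as \<in> tuples C (Suc q) \<Longrightarrow> hcoface X p q (Suc q) (pm gs as) = ?W gs as"
    unfolding h by (rule o(2))
qed

lemma hcodegen:
  assumes i: "i \<le> q"
  shows "hcodegen X p q i \<in> linear_maps R (MT (Suc p) (Suc (Suc q))) (MT (Suc p) (Suc q))"
    and "gs \<in> tuples H (Suc p) \<Longrightarrow> as \<in> tuples C (Suc (Suc q)) \<Longrightarrow>
      hcodegen X p q i (pm gs as) = counit C (as ! Suc i) \<odot>\<^bsub>MT (Suc p) (Suc q)\<^esub> pm gs (del (Suc i)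
          as)"
proof -
  have h: "hcodegen X p q i = lin_ext R (MT (Suc p) (Suc q)) (\<lambda>(gs, as). counit C (as ! Suc i) \<odot>\<^bsub>MT
      (Suc p) (Suc q)\<^esub> pm gs (del (Suc i) as))"
    by (simp add: natural_bicocyclic_def Let_def del_def)
  have i': "Suc i \<le> Suc q" using i by simp
  note o = operator_on_pure[OF counitC_nth_bimulti[OF modMT pm_bimulti i'], where f =
      "\<lambda>(gs, as). counit C (as ! Suc i) \<odot>\<^bsub>MT (Suc p) (Suc q)\<^esub> pm gs (del (Suc i) as)"]
  show "hcodegen X p q i \<in> linear_maps R (MT (Suc p) (Suc (Suc q))) (MT (Suc p) (Suc q))" unfolding
      h by (rule o(1)) simp
  show "gs \<in> tuples H (Suc p) \<Longrightarrow> as \<in> tuples C (Suc (Suc q)) \<Longrightarrow>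
      hcodegen X p q i (pm gs as) = counit C (as ! Suc i) \<odot>\<^bsub>MT (Suc p) (Suc q)\<^esub> pm gs (del (Suc i)
          as)" unfolding h by (rule o(2)) simp_all
qed

lemma hcyc:
  shows "hcyc X p q \<in> linear_maps R (MT (Suc p) (Suc q)) (MT (Suc p) (Suc q))"
    and "gs \<in> tuples H (Suc p) \<Longrightarrow> as \<in> tuples C (Suc q) \<Longrightarrow>
      hcyc X p q (pm gs as) = sw (MT (Suc p) (Suc q)) (\<rho> (hd as)) (\<lambda>h b.
          ev (MT (Suc p) (Suc q)) (act gs (T h)) (\<lambda>gs'. pm gs' (tl as @ [b])))"
proof -
  let ?T = "MT (Suc p) (Suc q)"
  let ?W = "\<lambda>gs as. sw ?T (\<rho> (hd as)) (\<lambda>h b. ev ?T (act gs (T h)) (\<lambda>gs'. pm gs' (tl as @ [b])))"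
  let ?f = "\<lambda>(gs, as). lin_ext R ?T (\<lambda>(h, b). lin_ext R ?T (\<lambda>gs'. pm gs' (tl as @ [b])) (diag_act R
      H (T h) gs)) (coact C (hd as))"
  have hl: "hd as \<in> carrier C" "tl as \<in> tuples C q" if "as \<in> tuples C (Suc q)" for as using that
      by (auto elim: tuples_ConsE)
  have e: "?f (gs, as) = ?W gs as" if gs: "gs \<in> tuples H (Suc p)" and as:
      "as \<in> tuples C (Suc q)" for gs as
  proof -
    have m: "multi R H ?T (Suc p) (\<lambda>gs'. pm gs' vs)" if "vs \<in> tuples C (Suc q)" for vs
      using pm_bimulti[of "Suc p" "Suc q"] that unfolding bimulti_def by blast
    have "sends ?T (\<lambda>x. x) (?f (gs, as)) (?W gs as)"
      unfolding prod.case
    proof (rule sends_co[OF modMT modMT id_lin[OF modMT] hl(1)[OF as]], unfold prod.case)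
      fix h b assume a: "h \<in> carrier H" "b \<in> carrier C"
      then have vs: "tl as @ [b] \<in> tuples C (Suc q)" using hl[OF as] by simp
      have "ev ?T (act gs (T h)) (\<lambda>gs'. pm gs' (tl as @ [b])) \<in> carrier ?T"
        by (rule act_closed[OF modMT _ gs], simp add: a, rule pm_closed[OF _ vs])
      then show "sends ?T (\<lambda>x. x) (lin_ext R ?T (\<lambda>gs'. pm gs' (tl as @ [b])) (diag_act R H (T h)
          gs)) (ev ?T (act gs (T h)) (\<lambda>gs'. pm gs' (tl as @ [b])))"
        using diag_act[OF modMT _ gs m[OF vs], of "T h"] a by (simp add: sends_def)
    qed
    then show ?thesis by (simp add: sends_def)
  qed
  have h: "hcyc X p q = lin_ext R ?T ?f"
    by (simp add: natural_bicocyclic_def Let_def)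
  note o = operator_on_pure[OF horizontal_cyc_bimulti[OF modMT pm_bimulti] e]
  show "hcyc X p q \<in> linear_maps R ?T ?T" unfolding h by (rule o(1))
  show "gs \<in> tuples H (Suc p) \<Longrightarrow> as \<in> tuples C (Suc q) \<Longrightarrow> hcyc X p q (pm gs as) = ?W gs as"
    unfolding h by (rule o(2))
qed

lemma vcoface_inner:
  assumes i: "i \<le> p"
  shows "vcoface X p q i \<in> linear_maps R (MT (Suc p) (Suc q)) (MT (Suc (Suc p)) (Suc q))"
    and "gs \<in> tuples H (Suc p) \<Longrightarrow> as \<in> tuples C (Suc q) \<Longrightarrow>
      vcoface X p q i (pm gs as) = sw (MT (Suc (Suc p)) (Suc q)) (\<Delta>\<^sub>H (gs ! i))
          (\<lambda>u v. pm (ins i u v gs) as)"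
proof -
  let ?T = "MT (Suc (Suc p)) (Suc q)"
  have i': "i < Suc p" using i by simp
  have e: "(\<lambda>(gs, as). lin_ext R ?T (\<lambda>(u, v). pm (ins i u v gs) as) (comult H (gs ! i))) (gs, as) =
      sw ?T (\<Delta>\<^sub>H (gs ! i)) (\<lambda>u v. pm (ins i u v gs) as)" if "gs \<in> tuples H (Suc p)"
          "as \<in> tuples C (Suc q)" for gs as
    unfolding prod.case by (subst lin_ext_comultH[OF modMT tuples_nth[OF that(1) i']]) (auto intro!:
        pm_closed ins_tuples that i')
  have h: "vcoface X p q i = lin_ext R ?T (\<lambda>(gs, as). lin_ext R ?T (\<lambda>(u, v). pm (ins i u v gs) as)
      (comult H (gs ! i)))"
    using i by (simp add: natural_bicocyclic_def Let_def ins_def)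
  note o = operator_on_pure[OF comultH_nth_bimulti[OF modMT pm_bimulti i'] e]
  show "vcoface X p q i \<in> linear_maps R (MT (Suc p) (Suc q)) ?T" unfolding h by (rule o(1))
  show "gs \<in> tuples H (Suc p) \<Longrightarrow> as \<in> tuples C (Suc q) \<Longrightarrow>
      vcoface X p q i (pm gs as) = sw ?T (\<Delta>\<^sub>H (gs ! i)) (\<lambda>u v. pm (ins i u v gs) as)" unfolding h
          by (rule o(2))
qed

lemma vcoface_last:
  shows "vcoface X p q (Suc p) \<in> linear_maps R (MT (Suc p) (Suc q)) (MT (Suc (Suc p)) (Suc q))"
    and "gs \<in> tuples H (Suc p) \<Longrightarrow> as \<in> tuples C (Suc q) \<Longrightarrow>
      vcoface X p q (Suc p) (pm gs as) = sw (MT (Suc (Suc p)) (Suc q)) (\<Delta>\<^sub>H (hd gs)) (\<lambda>u v.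
        sw (MT (Suc (Suc p)) (Suc q)) (coacts as) (\<lambda>k bs. pm (v # tl gs @ [k \<cdot> u]) bs))"
proof -
  let ?T = "MT (Suc (Suc p)) (Suc q)"
  let ?W = "\<lambda>gs as. sw ?T (\<Delta>\<^sub>H (hd gs)) (\<lambda>u v. sw ?T (coacts as) (\<lambda>k bs. pm (v # tl gs @ [k \<cdot> u])
      bs))"
  let ?f = "\<lambda>(gs, as). lin_ext R ?T (\<lambda>(u, v). lin_ext R ?T (\<lambda>(hs, bs). pm (v # tl gs @ [list_mult H
      hs \<cdot> u]) bs) (coact_tuple R H C as)) (comult H (hd gs))"
  have hl: "hd gs \<in> carrier H" "tl gs \<in> tuples H p" if "gs \<in> tuples H (Suc p)" for gs using that
      by (auto elim: tuples_ConsE)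
  have e: "?f (gs, as) = ?W gs as" if gs: "gs \<in> tuples H (Suc p)" and as:
      "as \<in> tuples C (Suc q)" for gs as
  proof -
    have "sends ?T (\<lambda>x. x) (?f (gs, as)) (?W gs as)"
      unfolding prod.case
    proof (rule sends_dH[OF modMT modMT id_lin[OF modMT] hl(1)[OF gs]], unfold prod.case)
      fix u v assume a: "u \<in> carrier H" "v \<in> carrier H"
      have vt: "v # tl gs \<in> tuples H (Suc p)" using a hl[OF gs] by simp
      have lin_multi: "lin_multi ?T (Suc q) (\<lambda>k bs. pm (v # tl gs @ [k \<cdot> u]) bs)"
        using vertical_cyc_lin_multi[OF modMT pm_bimulti vt a(1)] by simp
      have "sw ?T (coacts as) (\<lambda>k bs. pm (v # tl gs @ [k \<cdot> u]) bs) \<in> carrier ?T"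
        by (rule coacts_closed[OF modMT as]) (rule lin_multi_closed[OF lin_multi])
      then show "sends ?T (\<lambda>x. x) (lin_ext R ?T (\<lambda>(hs, bs). pm (v # tl gs @ [list_mult H hs \<cdot> u])
          bs) (coact_tuple R H C as)) (sw ?T (coacts as) (\<lambda>k bs. pm (v # tl gs @ [k \<cdot> u]) bs))"
        using coact_tuple[OF modMT as, THEN conjunct2, rule_format, OF lin_multi] by
            (simp add: sends_def)
    qed
    then show ?thesis by (simp add: sends_def)
  qed
  \<comment> \<open>As in the horizontal direction: a splitting at place 0 followed by the vertical
    cyclic operator.\<close>
  have W: "bimulti R H C ?T (Suc p) (Suc q) ?W"
    by (rule bimulti_cong[OF modH modC _ comultH_nth_bimulti[OF modMT vertical_cyc_bimulti[OF modMT
        pm_bimulti], of 0]]) (auto elim!: tuples_ConsE)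
  have h: "vcoface X p q (Suc p) = lin_ext R ?T ?f"
    by (simp add: natural_bicocyclic_def Let_def)
  note o = operator_on_pure[OF W e]
  show "vcoface X p q (Suc p) \<in> linear_maps R (MT (Suc p) (Suc q)) ?T" unfolding h by (rule o(1))
  show "gs \<in> tuples H (Suc p) \<Longrightarrow> as \<in> tuples C (Suc q) \<Longrightarrow> vcoface X p q (Suc p) (pm gs as) = ?W gs as"
    unfolding h by (rule o(2))
qed

lemma vcodegen:
  assumes i: "i \<le> p"
  shows "vcodegen X p q i \<in> linear_maps R (MT (Suc (Suc p)) (Suc q)) (MT (Suc p) (Suc q))"
    and "gs \<in> tuples H (Suc (Suc p)) \<Longrightarrow> as \<in> tuples C (Suc q) \<Longrightarrow>
      vcodegen X p q i (pm gs as) = counit H (gs ! Suc i) \<odot>\<^bsub>MT (Suc p) (Suc q)\<^esub> pm (del (Suc i) gs)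
          as"
proof -
  have h: "vcodegen X p q i = lin_ext R (MT (Suc p) (Suc q)) (\<lambda>(gs, as). counit H (gs ! Suc i) \<odot>\<^bsub>MT
      (Suc p) (Suc q)\<^esub> pm (del (Suc i) gs) as)"
    by (simp add: natural_bicocyclic_def Let_def del_def)
  have i': "Suc i \<le> Suc p" using i by simp
  note o = operator_on_pure[OF counitH_nth_bimulti[OF modMT pm_bimulti i'], where f =
      "\<lambda>(gs, as). counit H (gs ! Suc i) \<odot>\<^bsub>MT (Suc p) (Suc q)\<^esub> pm (del (Suc i) gs) as"]
  show "vcodegen X p q i \<in> linear_maps R (MT (Suc (Suc p)) (Suc q)) (MT (Suc p) (Suc q))" unfolding
      h by (rule o(1)) simp
  show "gs \<in> tuples H (Suc (Suc p)) \<Longrightarrow> as \<in> tuples C (Suc q) \<Longrightarrow>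
      vcodegen X p q i (pm gs as) = counit H (gs ! Suc i) \<odot>\<^bsub>MT (Suc p) (Suc q)\<^esub> pm (del (Suc i) gs)
          as" unfolding h by (rule o(2)) simp_all
qed

lemma vcyc:
  shows "vcyc X p q \<in> linear_maps R (MT (Suc p) (Suc q)) (MT (Suc p) (Suc q))"
    and "gs \<in> tuples H (Suc p) \<Longrightarrow> as \<in> tuples C (Suc q) \<Longrightarrow>
      vcyc X p q (pm gs as) = sw (MT (Suc p) (Suc q)) (coacts as) (\<lambda>k bs. pm (tl gs @ [k \<cdot> hd gs])
          bs)"
proof -
  let ?T = "MT (Suc p) (Suc q)"
  let ?W = "\<lambda>gs as. sw ?T (coacts as) (\<lambda>k bs. pm (tl gs @ [k \<cdot> hd gs]) bs)"
  let ?f = "\<lambda>(gs, as). lin_ext R ?T (\<lambda>(hs, bs). pm (tl gs @ [list_mult H hs \<cdot> hd gs]) bs)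
      (coact_tuple R H C as)"
  have hl: "hd gs \<in> carrier H" "tl gs \<in> tuples H p" if "gs \<in> tuples H (Suc p)" for gs using that
      by (auto elim: tuples_ConsE)
  have e: "?f (gs, as) = ?W gs as" if gs: "gs \<in> tuples H (Suc p)" and as:
      "as \<in> tuples C (Suc q)" for gs as
    using coact_tuple[OF modMT as, THEN conjunct2, rule_format, OF vertical_cyc_lin_multi[OF modMT
        pm_bimulti hl(2)[OF gs] hl(1)[OF gs]]] by simp
  have h: "vcyc X p q = lin_ext R ?T ?f"
    by (simp add: natural_bicocyclic_def Let_def)
  note o = operator_on_pure[OF vertical_cyc_bimulti[OF modMT pm_bimulti] e]
  show "vcyc X p q \<in> linear_maps R ?T ?T" unfolding h by (rule o(1))
  show "gs \<in> tuples H (Suc p) \<Longrightarrow> as \<in> tuples C (Suc q) \<Longrightarrow> vcyc X p q (pm gs as) = ?W gs as"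
    unfolding h by (rule o(2))
qed

lemma lin_ext_comultD:
  assumes N: "module R N" and d: "d \<in> carrier D" and f: "\<And>x y. x \<in> carrier D \<Longrightarrow> y \<in> carrier D
      \<Longrightarrow> f (x, y) \<in> carrier N"
  shows "lin_ext R N f (comult D d) = sw N (\<Delta>\<^sub>D d) (\<lambda>u v. f (u, v))"
  unfolding sw_def case_prod_unfold prod.collapse
  by (rule tensor_ev[OF modD0 modD0 N]) (use d f lin_closed[OF comultD_lin] in \<open>simp_all add:
      D_sel\<close>)

lemma coface_inner:
  assumes i: "i \<le> n"
  shows "coface Y n i \<in> linear_maps R (TP (Suc n)) (TP (Suc (Suc n)))"
    and "ds \<in> tuples D (Suc n) \<Longrightarrow> coface Y n i (pp ds) = sw (TP (Suc (Suc n))) (\<Delta>\<^sub>D (ds ! i))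
        (\<lambda>u v. pp (ins i u v ds))"
proof -
  let ?T = "TP (Suc (Suc n))"
  have i': "i < Suc n" using i by simp
  let ?f = "\<lambda>ds. lin_ext R ?T (\<lambda>(u, v). pp (ins i u v ds)) (comult D (ds ! i))"
  have e: "?f ds = sw ?T (\<Delta>\<^sub>D (ds ! i)) (\<lambda>u v. pp (ins i u v ds))" if "ds \<in> tuples D (Suc n)" for ds
    by (subst lin_ext_comultD[OF modTP tuples_nth[OF that i']]) (auto intro!: pp_closed ins_tuples
        that i')
  have h: "coface Y n i = lin_ext R ?T ?f"
    using i by (simp add: coalgebra_cocyclic_def ins_def)
  note o = power_operator_on_pure[OF multi_ins[OF modTP modD comultD_combs sw_comultD_lin[OF modTP]
      pp_multi i'] e]
  show "coface Y n i \<in> linear_maps R (TP (Suc n)) ?T" unfolding h by (rule o(1))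
  show "ds \<in> tuples D (Suc n) \<Longrightarrow> coface Y n i (pp ds) = sw ?T (\<Delta>\<^sub>D (ds ! i))
      (\<lambda>u v. pp (ins i u v ds))" unfolding h by (rule o(2))
qed

lemma coface_last:
  shows "coface Y n (Suc n) \<in> linear_maps R (TP (Suc n)) (TP (Suc (Suc n)))"
    and "ds \<in> tuples D (Suc n) \<Longrightarrow> coface Y n (Suc n) (pp ds) = sw (TP (Suc (Suc n))) (\<Delta>\<^sub>D (ds ! 0))
        (\<lambda>u v. pp (rotate1 (ins 0 u v ds)))"
proof -
  let ?T = "TP (Suc (Suc n))"
  let ?f = "\<lambda>ds. lin_ext R ?T (\<lambda>(u, v). pp (v # tl ds @ [u])) (comult D (hd ds))"
  have e: "?f ds = sw ?T (\<Delta>\<^sub>D (ds ! 0)) (\<lambda>u v. pp (rotate1 (ins 0 u v ds)))" if ds: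
      "ds \<in> tuples D (Suc n)" for ds
  proof -
    obtain d ds' where [simp]: "ds = d # ds'" "d \<in> carrier D" "ds' \<in> tuples D n" using ds
        by (auto elim: tuples_ConsE)
    show ?thesis by (subst lin_ext_comultD[OF modTP]) (auto intro!: pp_closed)
  qed
  have h: "coface Y n (Suc n) = lin_ext R ?T ?f"
    by (simp add: coalgebra_cocyclic_def)
  \<comment> \<open>The last coface splits the head and then rotates, so \<open>multi_ins\<close> at
    place 0 is applied to a rotated pure tensor.\<close>
  note o = power_operator_on_pure[OF multi_ins[OF modTP modD comultD_combs sw_comultD_lin[OF modTP]
      multi_rotate[OF pp_multi modD] zero_less_Suc] e]
  show "coface Y n (Suc n) \<in> linear_maps R (TP (Suc n)) ?T" unfolding h by (rule o(1))
  show "ds \<in> tuples D (Suc n) \<Longrightarrow> coface Y n (Suc n) (pp ds) = sw ?T (\<Delta>\<^sub>D (ds ! 0))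
      (\<lambda>u v. pp (rotate1 (ins 0 u v ds)))" unfolding h by (rule o(2))
qed

lemma codegen:
  assumes i: "i \<le> n"
  shows "codegen Y n i \<in> linear_maps R (TP (Suc (Suc n))) (TP (Suc n))"
    and "ds \<in> tuples D (Suc (Suc n)) \<Longrightarrow> codegen Y n i (pp ds) = counit D (ds ! Suc i) \<odot>\<^bsub>TP (Suc n)\<^esub>
        pp (del (Suc i) ds)"
proof -
  have h: "codegen Y n i = lin_ext R (TP (Suc n)) (\<lambda>ds. counit D (ds ! Suc i) \<odot>\<^bsub>TP (Suc n)\<^esub> pp (del
      (Suc i) ds))"
    by (simp add: coalgebra_cocyclic_def del_def)
  have i': "Suc i \<le> Suc n" using i by simp
  note o = power_operator_on_pure[OF multi_del[OF modTP modD counitD(1) pp_multi i'] refl]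
  show "codegen Y n i \<in> linear_maps R (TP (Suc (Suc n))) (TP (Suc n))" unfolding h by (rule o(1))
  show "ds \<in> tuples D (Suc (Suc n)) \<Longrightarrow> codegen Y n i (pp ds) = counit D (ds ! Suc i) \<odot>\<^bsub>TP (Suc n)\<^esub> pp
      (del (Suc i) ds)" unfolding h by (rule o(2))
qed

lemma cyc:
  shows "cyc Y n \<in> linear_maps R (TP (Suc n)) (TP (Suc n))"
    and "ds \<in> tuples D (Suc n) \<Longrightarrow> cyc Y n (pp ds) = pp (rotate1 ds)"
proof -
  have h: "cyc Y n = lin_ext R (TP (Suc n)) (\<lambda>ds. pp (rotate1 ds))"
    by (simp add: coalgebra_cocyclic_def)
  note o = power_operator_on_pure[OF multi_rotate[OF pp_multi modD] refl]
  show "cyc Y n \<in> linear_maps R (TP (Suc n)) (TP (Suc n))" unfolding h by (rule o(1))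
  show "ds \<in> tuples D (Suc n) \<Longrightarrow> cyc Y n (pp ds) = pp (rotate1 ds)" unfolding h by (rule o(2))
qed

section \<open>The isomorphism of tensor modules and its compatibility with the operators\<close>

definition phi where
  "phi n = lin_ext R (TP n) (\<lambda>(gs, as). ev (TP n) (Phi gs as) pp)"

definition psi where
  "psi n = lin_ext R (MT n n) (\<lambda>ds. sw (MT n n) (Psi ds) pm)"

lemma phi_on_pure: "phi n \<in> linear_maps R (MT n n) (TP n)"
  "gs \<in> tuples H n \<Longrightarrow> as \<in> tuples C n \<Longrightarrow> phi n (pm gs as) = ev (TP n) (Phi gs as) pp"
proof -
  have b: "bimulti R H C (TP n) n n (\<lambda>gs as. (\<lambda>(gs, as). ev (TP n) (Phi gs as) pp) (gs, as))"
    using Phi_bimulti[OF modTP pp_multi] by simp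
  show "phi n \<in> linear_maps R (MT n n) (TP n)" unfolding phi_def by
      (rule mixed_ext(1)[OF modH modC modTP b])
  show "gs \<in> tuples H n \<Longrightarrow> as \<in> tuples C n \<Longrightarrow> phi n (pm gs as) = ev (TP n) (Phi gs as) pp"
    unfolding phi_def using mixed_ext(2)[OF modH modC modTP b] by simp
qed

lemma psi_on_pure: "psi n \<in> linear_maps R (TP n) (MT n n)"
  "ds \<in> tuples D n \<Longrightarrow> psi n (pp ds) = sw (MT n n) (Psi ds) pm"
  unfolding psi_def using power_ext[OF modD modMT Psi_multi[OF modMT pm_bimulti]] by simp_all

text \<open>On generators this is \<open>Phi_Psi\<close> with the pure tensor itself as test map;
  uniqueness extends it to all elements.\<close>

lemma psi_phi: "x \<in> carrier (MT n n) \<Longrightarrow> psi n (phi n x) = x"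
proof (rule mixed_unique[OF modH modC modMT lin_comp[OF psi_on_pure(1) phi_on_pure(1)] id_lin[OF
    modMT]])
  fix gs as assume ga: "gs \<in> tuples H n" "as \<in> tuples C n"
  have "psi n (phi n (pm gs as)) = ev (MT n n) (Phi gs as) (\<lambda>ds. psi n (pp ds))"
    unfolding phi_on_pure(2)[OF ga] by (rule ev_map[OF modTP modMT psi_on_pure(1) Phi_combs[OF ga]])
        (rule pp_closed)
  also have "\<dots> = ev (MT n n) (Phi gs as) (\<lambda>ds. sw (MT n n) (Psi ds) pm)" by
      (rule Phi_cong[OF ga psi_on_pure(2)])
  also have "\<dots> = pm gs as" by (rule Phi_Psi[OF modMT ga pm_bimulti])
  finally show "psi n (phi n (pm gs as)) = pm gs as" .
qed

lemma phi_psi: "x \<in> carrier (TP n) \<Longrightarrow> phi n (psi n x) = x"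
proof (rule power_unique[OF modD modTP lin_comp[OF phi_on_pure(1) psi_on_pure(1)] id_lin[OF modTP]])
  fix ds assume ds: "ds \<in> tuples D n"
  have "phi n (psi n (pp ds)) = sw (TP n) (Psi ds) (\<lambda>gs as. phi n (pm gs as))"
    unfolding psi_on_pure(2)[OF ds] by (rule sw_map[OF modMT modTP phi_on_pure(1) Psi_combs[OF ds]])
        (rule pm_closed)
  also have "\<dots> = sw (TP n) (Psi ds) (\<lambda>gs as. ev (TP n) (Phi gs as) pp)" by
      (rule Psi_cong[OF ds phi_on_pure(2)])
  also have "\<dots> = pp ds" by (rule Psi_Phi[OF modTP ds pp_multi])
  finally show "phi n (psi n (pp ds)) = pp ds" .
qed

lemma phi_bij: "bij_betw (phi n) (carrier (MT n n)) (carrier (TP n))"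
  by (rule bij_betw_byWitness[where f' = "psi n"])
    (use psi_phi phi_psi lin_closed[OF phi_on_pure(1)] lin_closed[OF psi_on_pure(1)] in auto)

text \<open>The case distinction is the one in the definition of the cofaces. The horizontal coface
  is applied first, so the vertical one starts in bidegree \<open>(n, Suc n)\<close>.\<close>

lemma phi_coface:
  assumes i: "i \<le> Suc n" and x: "x \<in> carrier (MT (Suc n) (Suc n))"
  shows "phi (Suc (Suc n)) (vcoface X n (Suc n) i (hcoface X n n i x)) = coface Y n i (phi (Suc n)
      x)"
proof (cases "i \<le> n")
  case i: True
  note h = hcoface_inner[OF i, where p = n] and v = vcoface_inner[OF i, where q =
      "Suc n"] and c = coface_inner[OF i]
  let ?N = "TP (Suc (Suc n))"
  have i': "i < Suc n" using i by simp
  note pv = lin_comp[OF phi_on_pure(1) v(1)]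
  show ?thesis
  proof (rule mixed_unique[OF modH modC modTP lin_comp[OF pv h(1)] lin_comp[OF c(1) phi_on_pure(1)]
      _ x])
    fix gs as assume gs: "gs \<in> tuples H (Suc n)" and as: "as \<in> tuples C (Suc n)"
    have 1: "phi (Suc (Suc n)) (vcoface X n (Suc n) i (pm gs as')) = sw ?N (\<Delta>\<^sub>H (gs ! i)) (\<lambda>x y.
        ev ?N (Phi (ins i x y gs) as') pp)"
      if as': "as' \<in> tuples C (Suc (Suc n))" for as'
      unfolding v(2)[OF gs as']
      by (subst sw_map[OF modMT modTP phi_on_pure(1) comultH_combs[OF tuples_nth[OF gs i']]])
        (auto intro!: pm_closed ins_tuples gs as' i' sw_cong[OF comultH_combs[OF tuples_nth[OF gs
            i']]] phi_on_pure(2))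
    have "phi (Suc (Suc n)) (vcoface X n (Suc n) i (hcoface X n n i (pm gs as))) =
      sw ?N (\<Delta>\<^sub>C (as ! i)) (\<lambda>u v. phi (Suc (Suc n)) (vcoface X n (Suc n) i (pm gs (ins i u v as))))"
      unfolding h(2)[OF gs as] by (rule sw_map[OF modMT modTP pv comultC_combs[OF tuples_nth[OF as
          i']]]) (intro pm_closed ins_tuples gs as i')
    also have "\<dots> = sw ?N (\<Delta>\<^sub>C (as ! i)) (\<lambda>u v. sw ?N (\<Delta>\<^sub>H (gs ! i)) (\<lambda>x y.
        ev ?N (Phi (ins i x y gs) (ins i u v as)) pp))"
      by (rule sw_cong[OF comultC_combs[OF tuples_nth[OF as i']]], rule 1, rule ins_tuples[OF as
          i'])
    also have "\<dots> = ev ?N (Phi gs as) (\<lambda>ds. sw ?N (\<Delta>\<^sub>D (ds ! i)) (\<lambda>p q. pp (ins i p q ds)))"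
      by (rule Phi_coface[OF modTP gs as i' pp_multi])
    also have "\<dots> = ev ?N (Phi gs as) (\<lambda>ds. coface Y n i (pp ds))" by
        (rule Phi_cong[OF gs as c(2)[symmetric]])
    also have "\<dots> = coface Y n i (phi (Suc n) (pm gs as))"
      unfolding phi_on_pure(2)[OF gs as] by (rule ev_map[OF modTP modTP c(1) Phi_combs[OF gs as],
          symmetric]) (rule pp_closed)
    finally show "phi (Suc (Suc n)) (vcoface X n (Suc n) i (hcoface X n n i (pm gs as))) = coface Y
        n i (phi (Suc n) (pm gs as))" .
  qed
next
  case False
  then have [simp]: "i = Suc n" using i by simp
  note h = hcoface_last[where p = n and q = n] and v = vcoface_last[where p = n and q =
      "Suc n"] and c = coface_last[where n = n]
  let ?N = "TP (Suc (Suc n))"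
  note pv = lin_comp[OF phi_on_pure(1) v(1)]
  note [simp del] = coacts.simps act.simps Phi.simps
  show ?thesis unfolding \<open>i = Suc n\<close>
  proof (rule mixed_unique[OF modH modC modTP lin_comp[OF pv h(1)] lin_comp[OF c(1) phi_on_pure(1)]
      _ x])
    fix gs as assume gs: "gs \<in> tuples H (Suc n)" and as: "as \<in> tuples C (Suc n)"
    have a: "hd as \<in> carrier C" "tl as \<in> tuples C n" using as by (auto elim: tuples_ConsE)
    \<comment> \<open>Stated for every tuple \<open>gs\<close>: by the time the vertical coface is
      applied, the action of \<open>T h\<close> has replaced the original tuple.\<close>
    have 1: "phi (Suc (Suc n)) (vcoface X n (Suc n) (Suc n) (pm gs as')) =
        sw ?N (\<Delta>\<^sub>H (hd gs)) (\<lambda>x y. sw ?N (coacts as') (\<lambda>k bs. ev ?N (Phi (y # tl gs @ [k \<cdot> x]) bs)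
            pp))"
      if as': "as' \<in> tuples C (Suc (Suc n))" and gs: "gs \<in> tuples H (Suc n)" for as' gs
    proof -
      have g [simp]: "hd gs \<in> carrier H" "tl gs \<in> tuples H n" using gs by (auto elim: tuples_ConsE)
      have t: "y # tl gs @ [k \<cdot> x] \<in> tuples H (Suc (Suc n))" if "x \<in> carrier H" "y \<in> carrier H"
          "k \<in> carrier H" for x y k
        using that by simp
      have "phi (Suc (Suc n)) (vcoface X n (Suc n) (Suc n) (pm gs as')) =
        sw ?N (\<Delta>\<^sub>H (hd gs)) (\<lambda>x y. phi (Suc (Suc n)) (sw (MT (Suc (Suc n)) (Suc (Suc n))) (coacts
            as') (\<lambda>k bs. pm (y # tl gs @ [k \<cdot> x]) bs)))"
        unfolding v(2)[OF gs as']
        by (rule sw_map[OF modMT modTP phi_on_pure(1) comultH_combs[OF g(1)]])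
            (rule coacts_closed[OF modMT as'], intro pm_closed t)
      also have "\<dots> = sw ?N (\<Delta>\<^sub>H (hd gs)) (\<lambda>x y. sw ?N (coacts as') (\<lambda>k bs. phi (Suc (Suc n)) (pm (y
          # tl gs @ [k \<cdot> x]) bs)))"
        by (rule sw_comultH_cong[OF g(1)], rule sw_map[OF modMT modTP phi_on_pure(1) coacts_combs[OF
            as']]) (intro pm_closed t)
      also have "\<dots> = sw ?N (\<Delta>\<^sub>H (hd gs)) (\<lambda>x y. sw ?N (coacts as') (\<lambda>k bs.
          ev ?N (Phi (y # tl gs @ [k \<cdot> x]) bs) pp))"
        by (rule sw_comultH_cong[OF g(1)], rule coacts_cong[OF as'], rule phi_on_pure(2)[OF t])
      finally show ?thesis .
    qed
    let ?M = "MT (Suc n) (Suc (Suc n))"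
    have t: "v # tl as @ [b] \<in> tuples C (Suc (Suc n))" if "v \<in> carrier C"
        "b \<in> carrier C" for v b using that a by simp
    have "phi (Suc (Suc n)) (vcoface X n (Suc n) (Suc n) (hcoface X n n (Suc n) (pm gs as))) =
      sw ?N (\<Delta>\<^sub>C (hd as)) (\<lambda>u v. phi (Suc (Suc n)) (vcoface X n (Suc n) (Suc n) (sw ?M (\<rho> u)
          (\<lambda>h b. ev ?M (act gs (T h)) (\<lambda>gs'. pm gs' (v # tl as @ [b]))))))"
      unfolding h(2)[OF gs as] by (rule sw_map[OF modMT modTP pv comultC_combs[OF a(1)]])
          (rule sw_coact_closed[OF modMT], assumption, rule act_closed[OF modMT _ gs], simp, intro
          pm_closed t)
    also have "\<dots> = sw ?N (\<Delta>\<^sub>C (hd as)) (\<lambda>u v. sw ?N (\<rho> u) (\<lambda>h b. phi (Suc (Suc n)) (vcoface X n (Suc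
        n) (Suc n) (ev ?M (act gs (T h)) (\<lambda>gs'. pm gs' (v # tl as @ [b]))))))"
      by (rule sw_comultC_cong[OF a(1)], rule sw_map[OF modMT modTP pv coact_combs], assumption)
          (rule act_closed[OF modMT _ gs], simp, intro pm_closed t)
    also have "\<dots> = sw ?N (\<Delta>\<^sub>C (hd as)) (\<lambda>u v. sw ?N (\<rho> u) (\<lambda>h b. ev ?N (act gs (T h))
        (\<lambda>gs'. phi (Suc (Suc n)) (vcoface X n (Suc n) (Suc n) (pm gs' (v # tl as @ [b]))))))"
      by (rule sw_comultC_cong[OF a(1)], rule sw_coact_cong, assumption, rule ev_map[OF modMT modTP
          pv act_combs[OF _ gs]]) (simp, intro pm_closed t)
    also have "\<dots> = sw ?N (\<Delta>\<^sub>C (hd as)) (\<lambda>u v. sw ?N (\<rho> u) (\<lambda>h b. ev ?N (act gs (T h)) (\<lambda>gs'.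
      sw ?N (\<Delta>\<^sub>H (hd gs')) (\<lambda>x y. sw ?N (coacts (v # tl as @ [b])) (\<lambda>k bs.
          ev ?N (Phi (y # tl gs' @ [k \<cdot> x]) bs) pp)))))"
      by (rule sw_comultC_cong[OF a(1)], rule sw_coact_cong, assumption, rule act_cong[OF _ gs],
          simp, rule 1[OF t])
    also have "\<dots> = ev ?N (Phi gs as) (\<lambda>ds. sw ?N (\<Delta>\<^sub>D (ds ! 0))
        (\<lambda>p q. pp (rotate1 (ins 0 p q ds))))"
      by (rule Phi_coface_last[OF modTP gs as pp_multi])
    also have "\<dots> = ev ?N (Phi gs as) (\<lambda>ds. coface Y n (Suc n) (pp ds))" by
        (rule Phi_cong[OF gs as c(2)[symmetric]])
    also have "\<dots> = coface Y n (Suc n) (phi (Suc n) (pm gs as))"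
      unfolding phi_on_pure(2)[OF gs as] by (rule ev_map[OF modTP modTP c(1) Phi_combs[OF gs as],
          symmetric]) (rule pp_closed)
    finally show "phi (Suc (Suc n)) (vcoface X n (Suc n) (Suc n) (hcoface X n n (Suc n) (pm gs as)))
        = coface Y n (Suc n) (phi (Suc n) (pm gs as))" .
  qed
qed

text \<open>On pure tensors both operators delete entry \<open>Suc i\<close>, and
  \<open>Phi_codegen\<close> compares the scalars. The horizontal codegeneracy is indexed by target
  bidegree \<open>(Suc n, n)\<close>, as the first degree has not yet been lowered.\<close>

lemma phi_codegen:
  assumes i: "i \<le> n" and x: "x \<in> carrier (MT (Suc (Suc n)) (Suc (Suc n)))"
  shows "phi (Suc n) (vcodegen X n n i (hcodegen X (Suc n) n i x)) = codegen Y n i (phi (Suc (Suc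
      n)) x)"
proof -
  note h = hcodegen[OF i, where p = "Suc n"] and v = vcodegen[OF i, where q = n] and c = codegen[OF
      i]
  let ?N = "TP (Suc n)"
  have i': "Suc i \<le> Suc n" "Suc i < Suc (Suc n)" using i by simp_all
  note pv = lin_comp[OF phi_on_pure(1) v(1)]
  show ?thesis
  proof (rule mixed_unique[OF modH modC modTP lin_comp[OF pv h(1)] lin_comp[OF c(1) phi_on_pure(1)]
      _ x])
    fix gs as assume gs: "gs \<in> tuples H (Suc (Suc n))" and as: "as \<in> tuples C (Suc (Suc n))"
    note dg = del_tuples[OF gs i'(1)] and da = del_tuples[OF as i'(1)] and ng = tuples_nth[OF gs
        i'(2)] and na = tuples_nth[OF as i'(2)]
    have "phi (Suc n) (vcodegen X n n i (hcodegen X (Suc n) n i (pm gs as))) =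
      counit C (as ! Suc i) \<odot>\<^bsub>?N\<^esub> phi (Suc n) (vcodegen X n n i (pm gs (del (Suc i) as)))"
      unfolding h(2)[OF gs as] by (rule lin_smult[OF pv]) (simp add: na, rule pm_closed[OF gs da])
    also have "phi (Suc n) (vcodegen X n n i (pm gs (del (Suc i) as))) = counit H (gs ! Suc i) \<odot>\<^bsub>?N\<^esub>
        phi (Suc n) (pm (del (Suc i) gs) (del (Suc i) as))"
      unfolding v(2)[OF gs da] by (rule lin_smult[OF phi_on_pure(1)])
          (simp add: ng, rule pm_closed[OF dg da])
    also have "phi (Suc n) (pm (del (Suc i) gs) (del (Suc i) as)) =
        ev ?N (Phi (del (Suc i) gs) (del (Suc i) as)) pp"
      by (rule phi_on_pure(2)[OF dg da])
    also have "counit C (as ! Suc i) \<odot>\<^bsub>?N\<^esub> (counit H (gs ! Suc i) \<odot>\<^bsub>?N\<^esub>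
        ev ?N (Phi (del (Suc i) gs) (del (Suc i) as)) pp) =
      ev ?N (Phi gs as) (\<lambda>ds. counit D (ds ! Suc i) \<odot>\<^bsub>?N\<^esub> pp (del (Suc i) ds))"
      by (rule Phi_codegen[OF modTP gs as i'(1) pp_multi, symmetric])
    also have "\<dots> = ev ?N (Phi gs as) (\<lambda>ds. codegen Y n i (pp ds))" by
        (rule Phi_cong[OF gs as c(2)[symmetric]])
    also have "\<dots> = codegen Y n i (phi (Suc (Suc n)) (pm gs as))"
      unfolding phi_on_pure(2)[OF gs as] by (rule ev_map[OF modTP modTP c(1) Phi_combs[OF gs as],
          symmetric]) (rule pp_closed)
    finally show "phi (Suc n) (vcodegen X n n i (hcodegen X (Suc n) n i (pm gs as))) = codegen Y n i
        (phi (Suc (Suc n)) (pm gs as))" .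
  qed
qed

lemma phi_cyc:
  assumes x: "x \<in> carrier (MT (Suc n) (Suc n))"
  shows "phi (Suc n) (vcyc X n n (hcyc X n n x)) = cyc Y n (phi (Suc n) x)"
proof -
  note h = hcyc[where p = n and q = n] and v = vcyc[where p = n and q = n] and c = cyc[where n = n]
  let ?N = "TP (Suc n)" and ?M = "MT (Suc n) (Suc n)"
  note pv = lin_comp[OF phi_on_pure(1) v(1)]
  note [simp del] = coacts.simps act.simps Phi.simps
  show ?thesis
  proof (rule mixed_unique[OF modH modC modTP lin_comp[OF pv h(1)] lin_comp[OF c(1) phi_on_pure(1)]
      _ x])
    fix gs as assume gs: "gs \<in> tuples H (Suc n)" and as: "as \<in> tuples C (Suc n)"
    obtain g gs0 where gs_eq [simp]: "gs = g # gs0" and g [simp]: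
        "g \<in> carrier H" and gs0 [simp]: "gs0 \<in> tuples H n"
      using gs by (auto elim: tuples_ConsE)
    obtain a as0 where as_eq [simp]: "as = a # as0" and a [simp]:
        "a \<in> carrier C" and as0 [simp]: "as0 \<in> tuples C n"
      using as by (auto elim: tuples_ConsE)
    have 1: "phi (Suc n) (vcyc X n n (pm gs as')) = sw ?N (coacts as') (\<lambda>k bs.
        ev ?N (Phi (tl gs @ [k \<cdot> hd gs]) bs) pp)"
      if as': "as' \<in> tuples C (Suc n)" and gs: "gs \<in> tuples H (Suc n)" for as' gs
    proof -
      have t: "tl gs @ [k \<cdot> hd gs] \<in> tuples H (Suc n)" if "k \<in> carrier H" for k
        using that gs by (auto elim: tuples_ConsE)
      have "phi (Suc n) (vcyc X n n (pm gs as')) = sw ?N (coacts as')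
          (\<lambda>k bs. phi (Suc n) (pm (tl gs @ [k \<cdot> hd gs]) bs))"
        unfolding v(2)[OF gs as'] by (rule sw_map[OF modMT modTP phi_on_pure(1) coacts_combs[OF
            as']]) (intro pm_closed t)
      also have "\<dots> = sw ?N (coacts as') (\<lambda>k bs. ev ?N (Phi (tl gs @ [k \<cdot> hd gs]) bs) pp)"
        by (rule coacts_cong[OF as'], rule phi_on_pure(2)[OF t])
      finally show ?thesis .
    qed
    have t: "as0 @ [b] \<in> tuples C (Suc n)" if "b \<in> carrier C" for b using that by simp
    have "phi (Suc n) (vcyc X n n (hcyc X n n (pm gs as))) =
      sw ?N (\<rho> a) (\<lambda>h b. phi (Suc n) (vcyc X n n (ev ?M (act gs (T h))
          (\<lambda>gs'. pm gs' (as0 @ [b])))))"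
      unfolding h(2)[OF gs as] unfolding as_eq list.sel
      by (rule sw_map[OF modMT modTP pv coact_combs[OF a]])
          (rule act_closed[OF modMT _ gs], simp, intro pm_closed t)
    also have "\<dots> = sw ?N (\<rho> a) (\<lambda>h b. ev ?N (act gs (T h)) (\<lambda>gs'. phi (Suc n) (vcyc X n n (pm gs'
        (as0 @ [b])))))"
      by (rule sw_coact_cong[OF a], rule ev_map[OF modMT modTP pv act_combs[OF _ gs]])
          (simp, intro pm_closed t)
    also have "\<dots> = sw ?N (\<rho> a) (\<lambda>h b. ev ?N (act gs (T h)) (\<lambda>gs'. sw ?N (coacts (as0 @ [b]))
        (\<lambda>k bs. ev ?N (Phi (tl gs' @ [k \<cdot> hd gs']) bs) pp)))"
      by (rule sw_coact_cong[OF a], rule act_cong[OF _ gs], simp, rule 1[OF t])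
    also have "\<dots> = ev ?N (Phi gs as) (\<lambda>ds. pp (rotate1 ds))"
      unfolding gs_eq as_eq by (rule Phi_cyc[OF modTP gs0 as0 g a pp_multi])
    also have "\<dots> = ev ?N (Phi gs as) (\<lambda>ds. cyc Y n (pp ds))" by
        (rule Phi_cong[OF gs as c(2)[symmetric]])
    also have "\<dots> = cyc Y n (phi (Suc n) (pm gs as))"
      unfolding phi_on_pure(2)[OF gs as] by (rule ev_map[OF modTP modTP c(1) Phi_combs[OF gs as],
          symmetric]) (rule pp_closed)
    finally show "phi (Suc n) (vcyc X n n (hcyc X n n (pm gs as))) = cyc Y n (phi (Suc n) (pm gs
        as))" .
  qed
qed

text \<open>The index shift reflects that degree n of a cocyclic module has n+1 tensor factors,
  while \<open>phi\<close> is indexed by the number of factors.\<close>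

lemma cocyclic_iso_phi: "cocyclic_iso R (diagonal X) Y (\<lambda>n. phi (Suc n))"
proof -
  have o: "obj (diagonal X) n = MT (Suc n) (Suc n)" "obj Y n = TP (Suc n)" for n
    by (simp_all add: diagonal_def natural_bicocyclic_def coalgebra_cocyclic_def Let_def)
  have d: "coface (diagonal X) n i x = vcoface X n (Suc n) i (hcoface X n n i x)"
    "codegen (diagonal X) n i x = vcodegen X n n i (hcodegen X (Suc n) n i x)"
    "cyc (diagonal X) n x = vcyc X n n (hcyc X n n x)" for n i x
    by (simp_all add: diagonal_def)
  show ?thesis unfolding cocyclic_iso_def o d
    using phi_on_pure(1) phi_bij phi_coface phi_codegen phi_cyc by blast
qed

end

theorem theorem4p2:
  fixes R :: "('k, 'r) ring_scheme"
    and H :: "('k, 'h, 'z) hopf_algebra_scheme"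
    and C :: "('k, 'c, 'h, 'y) comodule_coalgebra_scheme"
  assumes "cring R"
    and "hopf_algebra R H"
    and "bij_betw (antipode H) (carrier H) (carrier H)"
    and "comodule_coalgebra R H C"
  shows "\<exists>\<phi>. cocyclic_iso R (diagonal (natural_bicocyclic R H C))
                (coalgebra_cocyclic R (crossed_coproduct R H C)) \<phi>"
proof -
  interpret crossed R H C
    by (rule crossed.intro[OF assms(4)]) (simp add: crossed_axioms_def assms(3))
  show ?thesis using cocyclic_iso_phi by blast
qed

end
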